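(* Let $K\subset\mathbb{R}^d$ be a compact convex set whose interior contains the origin. Let $Z$ be the zero cell of the Poisson hyperplane tessellation associated with $K$ (defined in the context), and let $f_0(Z)$ be the number of vertices of the (almost sure) polytope $Z$. Then $$\mathbf{E} f_0(Z)=\frac1d\int_{\mathbb{S}^{d-1}} \big(h(\mathfrak{p}K,x)\big)^{-d}J(x)\,\mathrm{d}x,$$ where $$h(\mathfrak{p}K,x)=\frac12\int_{\mathbb{S}^{d-1}}|\langle x,u\rangle|\,S_{d-1}(K,\mathrm{d}u)$$ is the support function of the projection body $\mathfrak{p}K$ of $K$, and $$J(x)=\int_{(\mathbb{S}^{d-1})^d}[v_1,\dots,v_d]\,\mathbf{1}_{\{\langle v_1,x\rangle\ge0,\dots,\langle v_d,x\rangle\ge0\}}\,S_{d-1}(K,\mathrm{d}v_1)\cdots S_{d-1}(K,\mathrm{d}v_d),\quad x\in\mathbb{S}^{d-1}.$$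
   Context: $S_{d-1}(K,\cdot)$ is the surface area measure of $K$ on the unit sphere $\mathbb{S}^{d-1}$; it is not assumed to be even. $[v_1,\dots,v_d]$ is the volume of the parallelepiped spanned by $v_1,\dots,v_d$; $\mathrm{d}x$ on $\mathbb{S}^{d-1}$ is $(d-1)$-dimensional Hausdorff (surface) measure; $V_d$ is Lebesgue measure on $\mathbb{R}^d$. Zero cell: let $\mathcal{P}_K=\{(t_i,u_i): i\ge 1\}$ be a Poisson process on $(0,\infty)\times\mathbb{S}^{d-1}$ with intensity measure equal to the product of $V_d(K)^{-1}$ times Lebesgue measure on $(0,\infty)$ and $S_{d-1}(K,\cdot)$. The tessellation is induced by the hyperplanes $H_{u_i}(t_i)=\{x:\langle x,u_i\rangle= t_i\}$, and the zero cell is $Z:=\bigcap_{i\ge1}\{x:\langle x,u_i\rangle\le t_i\}$, almost surely a polytope with the origin in its interior. *)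

theory Defs
  imports "HOL-Probability.Probability"
begin

section \<open>Hausdorff measure and surface measure on the unit sphere\<close>

text \<open>Size-\<open>\<delta>\<close> approximation of the unnormalised \<open>k\<close>-dimensional Hausdorff outer measure.
  Empty covering sets cost nothing; nonempty ones cost \<open>1\<close> if \<open>k = 0\<close> (as \<open>0 ^ 0 = 1\<close>), so
  that \<open>k = 0\<close> yields the counting measure. Boundedness is required since
  \<^const>\<open>diameter\<close> is unspecified on unbounded sets.\<close>

definition hausdorff_pre :: "nat \<Rightarrow> real \<Rightarrow> 'a::metric_space set \<Rightarrow> ennreal" where
  "hausdorff_pre k \<delta> A =
     (INF U \<in> {U :: nat \<Rightarrow> 'a set. A \<subseteq> (\<Union>i. U i) \<and> (\<forall>i. bounded (U i) \<and> diameter (U i) \<le> \<delta>)}.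
        \<Sum>i. if U i = {} then 0 else ennreal (diameter (U i) ^ k))"

definition hausdorff_raw :: "nat \<Rightarrow> 'a::metric_space set \<Rightarrow> ennreal" where
  "hausdorff_raw k A = (SUP \<delta> \<in> {0<..}. hausdorff_pre k \<delta> A)"

definition unit_cube :: "nat \<Rightarrow> 'a::euclidean_space set" where
  "unit_cube k = (let B = SOME B. B \<subseteq> Basis \<and> card B = k in
     {x. \<forall>b\<in>Basis. if b \<in> B then 0 \<le> x \<bullet> b \<and> x \<bullet> b \<le> 1 else x \<bullet> b = 0})"

text \<open>The usual normalisation: \<open>k\<close>-dimensional Hausdorff measure agrees with
  \<open>k\<close>-dimensional Lebesgue measure on \<open>k\<close>-dimensional flats, i.e. a \<open>k\<close>-dimensional unit cube
  has measure \<open>1\<close> (for \<open>k \<le> DIM('a)\<close>).\<close>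

definition hausdorff :: "nat \<Rightarrow> 'a::euclidean_space set \<Rightarrow> ennreal" where
  "hausdorff k A = hausdorff_raw k A / hausdorff_raw k (unit_cube k :: 'a set)"

definition sphere_measure :: "(real ^ 'n) measure" where
  "sphere_measure = measure_of (sphere 0 1) (sets (restrict_space borel (sphere 0 1)))
     (hausdorff (CARD('n) - 1))"

section \<open>The surface area measure\<close>

text \<open>The local parallel set: points \<open>x\<close> with \<open>0 < d(K,x) \<le> \<epsilon>\<close> for which the unit vector
  pointing from the nearest point of \<open>K\<close> to \<open>x\<close> (an outer normal vector of \<open>K\<close>) lies in \<open>\<omega>\<close>.\<close>

definition local_parallel_set :: "'a::euclidean_space set \<Rightarrow> real \<Rightarrow> 'a set \<Rightarrow> 'a set" where
  "local_parallel_set K \<epsilon> \<omega> =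
     {x. 0 < infdist x K \<and> infdist x K \<le> \<epsilon> \<and> (x - closest_point K x) /\<^sub>R infdist x K \<in> \<omega>}"

text \<open>The area measures \<open>S\<^sub>0(K,\<cdot>), \<dots>, S\<^sub>d\<^sub>-\<^sub>1(K,\<cdot>)\<close> of a convex body \<open>K\<close> are defined by the local
  Steiner formula: the volume of \<open>local_parallel_set K \<epsilon> \<omega>\<close> is
  \<open>(1/d) (\<Sum>m<d. \<epsilon>^(d-m) (d choose m) S\<^sub>m(K,\<omega>))\<close>.
  The surface area measure is the one of order \<open>d - 1\<close>, the coefficient of \<open>\<epsilon>\<close>,
  that is, the right derivative at \<open>0\<close> of the local parallel volume. It is a measure on the
  Borel sets of the unit sphere.\<close>

definition surface_area_measure :: "'a::euclidean_space set \<Rightarrow> 'a measure" where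
  "surface_area_measure K = measure_of (sphere 0 1) (sets (restrict_space borel (sphere 0 1)))
     (\<lambda>\<omega>. Lim (at_right 0) (\<lambda>\<epsilon>. emeasure lborel (local_parallel_set K \<epsilon> \<omega>) / ennreal \<epsilon>))"

section \<open>Poisson processes\<close>

definition point_count :: "(nat \<Rightarrow> 'w \<Rightarrow> 'b) \<Rightarrow> 'b set \<Rightarrow> 'w \<Rightarrow> ennreal" where
  "point_count X A \<omega> = emeasure (count_space UNIV) {i. X i \<omega> \<in> A}"

text \<open>A Poisson process with intensity measure \<open>\<Lambda>\<close> of infinite total mass, given through an
  enumeration \<open>X\<close> of its points.\<close>

definition poisson_process :: "'w measure \<Rightarrow> 'b measure \<Rightarrow> (nat \<Rightarrow> 'w \<Rightarrow> 'b) \<Rightarrow> bool" where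
  "poisson_process M \<Lambda> X \<longleftrightarrow>
     prob_space M \<and>
     (\<forall>i. X i \<in> M \<rightarrow>\<^sub>M \<Lambda>) \<and>
     (\<forall>A\<in>sets \<Lambda>. emeasure \<Lambda> A < \<infinity> \<longrightarrow>
        (\<forall>k::nat. measure M {\<omega> \<in> space M. point_count X A \<omega> = of_nat k} =
           exp (- measure \<Lambda> A) * measure \<Lambda> A ^ k / fact k)) \<and>
     (\<forall>(A :: nat \<Rightarrow> 'b set) I. finite I \<longrightarrow> A ` I \<subseteq> sets \<Lambda> \<longrightarrow> disjoint_family_on A I \<longrightarrow>
        prob_space.indep_vars M (\<lambda>_. borel) (\<lambda>j. point_count X (A j)) I)"

section \<open>The zero cell\<close>

definition tessellation_intensity :: "'a::euclidean_space set \<Rightarrow> (real \<times> 'a) measure" where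
  "tessellation_intensity K =
     scale_measure (ennreal (inverse (measure lborel K))) (restrict_space lborel {0<..})
       \<Otimes>\<^sub>M surface_area_measure K"

definition zero_cell :: "(nat \<Rightarrow> real \<times> 'a::real_inner) \<Rightarrow> 'a set" where
  "zero_cell p = (\<Inter>i. {x. x \<bullet> snd (p i) \<le> fst (p i)})"

definition num_vertices :: "'a::real_vector set \<Rightarrow> ennreal" where
  "num_vertices Z = emeasure (count_space UNIV) {v. v extreme_point_of Z}"

section \<open>The integrands\<close>

definition proj_body_support :: "'a::euclidean_space set \<Rightarrow> 'a \<Rightarrow> real" where
  "proj_body_support K x = 1/2 * (\<integral>u. \<bar>x \<bullet> u\<bar> \<partial>surface_area_measure K)"

definition parallelepiped_volume :: "('n::finite \<Rightarrow> real ^ 'n) \<Rightarrow> real" where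
  "parallelepiped_volume v =
     measure lborel {\<Sum>i\<in>UNIV. a i *\<^sub>R v i | a :: 'n \<Rightarrow> real. \<forall>i. 0 \<le> a i \<and> a i \<le> 1}"

definition J :: "(real ^ 'n) set \<Rightarrow> real ^ 'n \<Rightarrow> real" where
  "J K x = (\<integral>v. parallelepiped_volume v * indicator {v. \<forall>i. v i \<bullet> x \<ge> 0} v
     \<partial>(\<Pi>\<^sub>M i\<in>(UNIV :: 'n set). surface_area_measure K))"

end

theory Submission
  imports Defs
begin

text \<open>
  A vertex of the zero cell is the common point of \<open>d\<close> of the hyperplanes that no further
  hyperplane separates from the origin. In general position exactly \<open>d\<close> hyperplanes pass through
  it, so that it belongs to \<open>d!\<close> tuples of indices (\<open>card_vertex_tuples\<close>). The multivariate Mecke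
  formula (\<open>mecke_avoiding\<close>) expresses the expected number of such tuples as an integral, with
  respect to the \<open>d\<close>-th power of the intensity measure, of the probability that the process
  contains no hyperplane separating the common point \<open>p\<close> from the origin.

  The hyperplanes that separate \<open>p\<close> from the origin have intensity
  \<open>V\<^sup>-\<^sup>1 \<integral> max 0 \<langle>p, u\<rangle> S(du)\<close>, where \<open>V\<close> is the volume of \<open>K\<close> and \<open>S\<close> its surface area measure.
  The centroid of \<open>S\<close> is the origin (\<open>integral_surface_area_inner\<close>), even if \<open>S\<close> is not
  symmetric, and so this intensity equals \<open>h(p) / V\<close> with the support function \<open>h\<close> of the
  projection body. Replacing the distances of the \<open>d\<close> hyperplanes by their common point, with the
  volume spanned by the normals as Jacobian determinant (\<open>nn_integral_distances\<close>), gives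
  \<open>d! E f\<^sub>0 = V\<^sup>-\<^sup>d \<integral> J(p) exp (- h(p) / V) dp\<close>.
  Since \<open>J\<close> is homogeneous of degree \<open>0\<close> and \<open>h\<close> of degree \<open>1\<close>, integrating over the radius
  (\<open>nn_integral_homogeneous_exp\<close>) leaves an integral over the unit sphere.

  Two measures have to be brought into a usable form first. The surface area measure is a limit of
  quotients of parallel volumes; the quotients are monotone because the metric projection
  onto a convex set is a contraction (\<open>measure_shell_ratio_mono\<close>), and the limit is countably
  additive. The surface measure of the sphere is a normalised Hausdorff measure; it is
  \<open>d\<close> times the volume of cones (\<open>hausdorff_sphere\<close>), since small caps are nearly isometric to
  pieces of a hyperplane, on which Hausdorff measure is a multiple of Lebesgue measure.
\<close>

section \<open>Volume under Lipschitz and linear maps\<close>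

lemma emeasure_UN_le_nn_integral_count_space:
  assumes C: "countable C" and A: "\<And>i. i \<in> C \<Longrightarrow> A i \<in> sets M"
  shows "emeasure M (\<Union>i\<in>C. A i) \<le> (\<integral>\<^sup>+i. emeasure M (A i) \<partial>count_space C)"
proof -
  have "emeasure M (\<Union>i\<in>C. A i) = (\<integral>\<^sup>+x. indicator (\<Union>i\<in>C. A i) x \<partial>M)"
    using assms by (intro nn_integral_indicator[symmetric] sets.countable_UN') auto
  also have "\<dots> \<le> (\<integral>\<^sup>+x. (\<integral>\<^sup>+i. indicator (A i) x \<partial>count_space C) \<partial>M)"
  proof (intro nn_integral_mono)
    fix x
    show "indicator (\<Union>i\<in>C. A i) x \<le> (\<integral>\<^sup>+i. indicator (A i) x \<partial>count_space C)"
    proof (cases "x \<in> (\<Union>i\<in>C. A i)")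
      case True
      then obtain i where i: "i \<in> C" "x \<in> A i" by auto
      then have "1 = (indicator (A i) x :: ennreal)" by simp
      also have "\<dots> \<le> (\<integral>\<^sup>+i. indicator (A i) x \<partial>count_space C)" using i by (intro nn_integral_ge_point)
      finally show ?thesis using True by simp
    qed simp
  qed
  also have "\<dots> = (\<integral>\<^sup>+i. (\<integral>\<^sup>+x. indicator (A i) x \<partial>M) \<partial>count_space C)"
    using assms by (intro nn_integral_count_space_nn_integral) auto
  also have "\<dots> = (\<integral>\<^sup>+i. emeasure M (A i) \<partial>count_space C)"
    using A by (intro nn_integral_cong) auto
  finally show ?thesis .
qed

text \<open>By Vitali's covering theorem disjoint small balls exhaust \<open>S\<close> up to a null set inside an
  open set of almost the same volume. A Lipschitz map sends each of them into a ball of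
  \<open>L\<close> times the radius and the rest to a null set. The set \<open>T\<close> stands for the image, which may
  fail to be Borel.\<close>

lemma emeasure_lborel_Lipschitz_image_le:
  fixes f :: "'a::euclidean_space \<Rightarrow> 'b::euclidean_space"
  assumes dim: "DIM('a) = DIM('b)"
    and S: "S \<in> sets borel" and T: "T \<in> sets borel" "T \<subseteq> f ` S"
    and L: "0 < L" and lip: "\<And>x y. x \<in> S \<Longrightarrow> y \<in> S \<Longrightarrow> dist (f x) (f y) \<le> L * dist x y"
  shows "emeasure lborel T \<le> ennreal (L ^ DIM('a)) * emeasure lborel S"
proof (rule ennreal_le_epsilon)
  define d where "d = DIM('a)"
  fix e :: real assume "e > 0"
  define e' where "e' = e / L ^ d"
  have Lp: "L ^ d > 0" using L by simp
  have "e' > 0" using \<open>e > 0\<close> Lp by (simp add: e'_def)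
  obtain U where U: "open U" "S \<subseteq> U" "emeasure lborel (U - S) < e'"
    using outer_regular_lborel[OF S \<open>e' > 0\<close>] by blast
  have mU: "emeasure lborel U \<le> emeasure lborel S + e'"
  proof -
    have "emeasure lborel U = emeasure lborel (S \<union> (U - S))" using U by (simp add: Un_absorb1)
    also have "\<dots> = emeasure lborel S + emeasure lborel (U - S)"
      using S U by (intro plus_emeasure[symmetric]) auto
    finally show ?thesis using U(3) by (simp add: add_left_mono less_imp_le)
  qed
  define I where "I = {(a, r). a \<in> S \<and> 0 < r \<and> ball a r \<subseteq> U}"
  have vit: "\<exists>i. i \<in> I \<and> x \<in> ball (fst i) (snd i) \<and> snd i < c" if "x \<in> S" "0 < c" for x c
  proof -
    obtain r where "r > 0" "ball x r \<subseteq> U" using U \<open>x \<in> S\<close> openE by blast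
    then have "(x, min r (c/2)) \<in> I" using that by (auto simp: I_def)
    then show ?thesis using that \<open>r > 0\<close> by (intro exI[of _ "(x, min r (c/2))"]) auto
  qed
  obtain C where C: "countable C" "C \<subseteq> I"
     "pairwise (\<lambda>i j. disjnt (ball (fst i) (snd i)) (ball (fst j) (snd j))) C"
     "negligible (S - (\<Union>i \<in> C. ball (fst i) (snd i)))"
    by (rule Vitali_covering_theorem_balls[of S I fst snd]) (use vit in auto)
  have ballU: "ball (fst i) (snd i) \<subseteq> U" if "i \<in> C" for i
  proof -
    have "i \<in> I" using that C(2) by blast
    then show ?thesis by (cases i) (simp add: I_def)
  qed
  define N where "N = S - (\<Union>i \<in> C. ball (fst i) (snd i))"
  have negN: "negligible (f ` N)"
  proof (rule negligible_locally_Lipschitz_image)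
    show "DIM('a) \<le> DIM('b)" using dim by simp
    show "negligible N" using C by (simp add: N_def)
    show "\<exists>T B. open T \<and> x \<in> T \<and> (\<forall>y\<in>N \<inter> T. norm (f y - f x) \<le> B * norm (y - x))" if "x \<in> N" for x
      using lip that by (intro exI[of _ UNIV] exI[of _ L]) (auto simp: N_def dist_norm)
  qed
  define W where "W = (\<Union>i \<in> C. cball (f (fst i)) (L * snd i))"
  have Wb: "W \<in> sets borel" unfolding W_def using C(1) by (intro sets.countable_UN') auto
  have sub: "T - W \<subseteq> f ` N"
  proof
    fix y assume y: "y \<in> T - W"
    then obtain x where x: "x \<in> S" "y = f x" using T by auto
    have "x \<notin> ball (fst i) (snd i)" if "i \<in> C" for i
    proof
      assume "x \<in> ball (fst i) (snd i)"
      moreover have "fst i \<in> S" using that C(2) by (auto simp: I_def)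
      ultimately have "dist (f (fst i)) (f x) \<le> L * snd i"
        using lip[of "fst i" x] x L by (meson less_imp_le mem_ball mult_left_mono order_trans)
      then show False using y x that by (auto simp: W_def)
    qed
    then show "y \<in> f ` N" using x by (auto simp: N_def)
  qed
  have "negligible (T - W)" using negN sub by (rule negligible_subset)
  then have null: "T - W \<in> null_sets lborel"
    using T Wb by (auto simp: negligible_iff_null_sets null_sets_completion_iff)
  have "emeasure lborel T \<le> emeasure lborel ((T - W) \<union> W)"
    using T Wb by (intro emeasure_mono) auto
  also have "\<dots> = emeasure lborel W" using null Wb by (subst emeasure_Un_null_set[of W, unfolded Un_commute[of W]]) (auto simp: Un_commute)
  also have "\<dots> \<le> (\<integral>\<^sup>+i. emeasure lborel (cball (f (fst i)) (L * snd i)) \<partial>count_space C)"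
    unfolding W_def using C(1) by (intro emeasure_UN_le_nn_integral_count_space) auto
  also have "\<dots> = (\<integral>\<^sup>+i. ennreal (L ^ d) * emeasure lborel (ball (fst i) (snd i)) \<partial>count_space C)"
  proof (intro nn_integral_cong)
    fix i assume "i \<in> space (count_space C)"
    then have "snd i > 0" using C(2) by (auto simp: I_def)
    then show "emeasure lborel (cball (f (fst i)) (L * snd i)) = ennreal (L ^ d) * emeasure lborel (ball (fst i) (snd i))"
      using L dim by (simp add: emeasure_cball emeasure_ball d_def power_mult_distrib ennreal_mult'[symmetric] mult_ac unit_ball_vol_def)
  qed
  also have "\<dots> = ennreal (L ^ d) * (\<integral>\<^sup>+i. emeasure lborel (ball (fst i) (snd i)) \<partial>count_space C)"
    by (intro nn_integral_cmult) auto
  also have "(\<integral>\<^sup>+i. emeasure lborel (ball (fst i) (snd i)) \<partial>count_space C) = emeasure lborel (\<Union>i\<in>C. ball (fst i) (snd i))"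
    using C(1,3) by (intro emeasure_UN_countable[symmetric])
       (auto simp: disjoint_family_on_def pairwise_def disjnt_def)
  also have "\<dots> \<le> emeasure lborel U" using U(1) ballU by (intro emeasure_mono UN_least) auto
  also have "ennreal (L ^ d) * emeasure lborel U \<le> ennreal (L ^ d) * (emeasure lborel S + e')"
    using mU by (intro mult_left_mono) auto
  also have "\<dots> = ennreal (L ^ d) * emeasure lborel S + e"
  proof -
    have "ennreal (L ^ d) * ennreal e' = ennreal e"
      using L \<open>e > 0\<close> by (subst ennreal_mult[symmetric]) (auto simp: e'_def)
    then show ?thesis by (simp add: distrib_left)
  qed
  finally show "emeasure lborel T \<le> ennreal (L ^ DIM('a)) * emeasure lborel S + e"
    by (simp add: d_def mult_left_mono)
qed

text \<open>The Lipschitz bound with constant \<open>1\<close>, for the map and for its inverse.\<close>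

lemma emeasure_lborel_isometry_vimage:
  fixes f :: "'a::euclidean_space \<Rightarrow> 'b::euclidean_space"
  assumes dim: "DIM('a) = DIM('b)" and iso: "\<And>x y. dist (f x) (f y) = dist x y" and surj: "surj f"
    and B: "B \<in> sets borel"
  shows "emeasure lborel (f -` B) = emeasure lborel B"
proof (rule antisym)
  have cont: "continuous_on UNIV f"
    unfolding continuous_on_iff by (auto simp: iso)
  have meas: "f -` B \<in> sets borel"
    using measurable_sets[OF borel_measurable_continuous_onI[OF cont] B] by simp
  have inj: "inj f" using iso by (metis dist_eq_0_iff injI)
  show "emeasure lborel (f -` B) \<le> emeasure lborel B"
    using emeasure_lborel_Lipschitz_image_le[of B "f -` B" "inv f" 1] dim meas B inj surj iso
    by (force simp: image_iff inv_f_f surj_f_inv_f[OF surj] iso[symmetric])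
  show "emeasure lborel B \<le> emeasure lborel (f -` B)"
    using emeasure_lborel_Lipschitz_image_le[of "f -` B" B f 1] dim meas B surj iso by auto
qed

abbreviation shear_matrix :: "'n \<Rightarrow> 'n \<Rightarrow> real \<Rightarrow> real ^ 'n ^ 'n" where
  "shear_matrix m n c \<equiv> (\<chi> i j. if i = m \<and> j = n then c else of_bool (i = j))"

abbreviation stretch_matrix :: "'n \<Rightarrow> real \<Rightarrow> real ^ 'n ^ 'n" where
  "stretch_matrix m c \<equiv> (\<chi> i j. if i = j then (if i = m then c else 1) else 0)"

lemma norm_axis_real: "norm (axis m r :: real ^ 'n) = \<bar>r\<bar>"
proof -
  have "axis m r = r *\<^sub>R (axis m 1 :: real ^ 'n)" by (auto simp: vec_eq_iff axis_def)
  then show ?thesis by simp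
qed

lemma shear_matrix_mult_vec:
  assumes "m \<noteq> n"
  shows "shear_matrix m n c *v x = x + axis m (c * x $ n)"
proof -
  have "(\<Sum>j\<in>UNIV. (if i = m \<and> j = n then c else of_bool (i = j)) * x $ j) =
      (\<Sum>j\<in>UNIV. (if j = i then x $ j else 0) + (if j = n then (if i = m then c * x $ j else 0) else 0))" for i
    using assms by (intro sum.cong) auto
  then show ?thesis
    by (auto simp: matrix_vector_mult_def vec_eq_iff axis_def sum.distrib)
qed

lemma stretch_matrix_mult_vec:
  "stretch_matrix m c *v x = (\<chi> i. (if i = m then c else 1) * x $ i)"
proof -
  have "(\<Sum>j\<in>UNIV. (if i = j then (if i = m then c else 1) else 0) * x $ j) =
      (\<Sum>j\<in>UNIV. (if j = i then (if i = m then c else 1) * x $ j else 0))" for i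
    by (intro sum.cong) auto
  then show ?thesis
    by (auto simp: matrix_vector_mult_def vec_eq_iff)
qed

lemma borel_vimage_matrix [measurable]: "B \<in> sets borel \<Longrightarrow> (*v) (A::real^'n^'n) -` B \<in> sets borel"
proof -
  assume "B \<in> sets borel"
  moreover have "(*v) A \<in> borel_measurable borel"
    by (intro borel_measurable_continuous_onI matrix_vector_mult_linear_continuous_on)
  ultimately show ?thesis using measurable_sets[of "(*v) A" borel borel B] by simp
qed

lemma emeasure_lborel_vimage_diagonal:
  fixes A :: "real ^ 'n ^ 'n"
  assumes diag: "\<And>i j. i \<noteq> j \<Longrightarrow> A $ i $ j = 0" and det: "det A \<noteq> 0" and B: "B \<in> sets borel"
  shows "ennreal \<bar>det A\<bar> * emeasure lborel ((*v) A -` B) = emeasure lborel B"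
proof -
  define c :: "real ^ 'n \<Rightarrow> real" where "c = (\<lambda>b. (A *v b) \<bullet> b)"
  have dA: "det A = (\<Prod>i\<in>UNIV. A $ i $ i)" using diag by (rule det_diagonal)
  have A0: "A $ i $ i \<noteq> 0" for i using det dA by auto
  have mv: "A *v x = (\<chi> i. A $ i $ i * x $ i)" for x
  proof -
    have "(\<Sum>j\<in>UNIV. A $ i $ j * x $ j) = (\<Sum>j\<in>UNIV. if j = i then A $ i $ j * x $ j else 0)" for i
      using diag by (intro sum.cong) auto
    then show ?thesis by (auto simp: matrix_vector_mult_def vec_eq_iff)
  qed
  have c: "c (axis i 1) = A $ i $ i" for i
    unfolding c_def by (simp add: inner_axis mv)
  have T: "(\<lambda>x. 0 + (\<Sum>j\<in>Basis. (c j * (x \<bullet> j)) *\<^sub>R j)) = (*v) A"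
  proof (rule ext)
    fix x :: "real ^ 'n"
    have "(\<Sum>j\<in>Basis. (c j * (x \<bullet> j)) *\<^sub>R j) = (\<Sum>i\<in>UNIV. (c (axis i 1) * x $ i) *\<^sub>R axis i 1)"
      by (subst sum.reindex_bij_betw[OF bij_betw_imageI[of "\<lambda>i. axis i (1::real)" UNIV Basis], symmetric])
         (auto simp: inj_on_def axis_eq_axis Basis_vec_def inner_axis)
    also have "\<dots> = A *v x"
      unfolding c mv
      by (auto simp: vec_eq_iff axis_def sum.delta if_distrib[of "\<lambda>x. _ * x"] cong: if_cong)
    finally show "0 + (\<Sum>j\<in>Basis. (c j * (x \<bullet> j)) *\<^sub>R j) = A *v x" by simp
  qed
  have pc: "(\<Prod>j\<in>Basis. \<bar>c j\<bar>) = \<bar>det A\<bar>"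
    unfolding dA abs_prod
    by (subst prod.reindex_bij_betw[OF bij_betw_imageI[of "\<lambda>i. axis i (1::real)" UNIV Basis], symmetric])
       (auto simp: inj_on_def axis_eq_axis Basis_vec_def c)
  have "lborel = density (distr lborel borel ((*v) A)) (\<lambda>_. ennreal \<bar>det A\<bar>)"
  proof (rule lborel_affine_euclidean[of c 0, unfolded T pc])
    show "c j \<noteq> 0" if "j \<in> Basis" for j using that A0 c by (auto simp: Basis_vec_def)
  qed
  then have "emeasure lborel B = emeasure (density (distr lborel borel ((*v) A)) (\<lambda>_. ennreal \<bar>det A\<bar>)) B"
    by simp
  also have "\<dots> = ennreal \<bar>det A\<bar> * emeasure (distr lborel borel ((*v) A)) B"
    using B by (simp add: emeasure_density nn_integral_cmult)
  also have "emeasure (distr lborel borel ((*v) A)) B = emeasure lborel ((*v) A -` B)"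
    using B borel_measurable_continuous_onI[OF matrix_vector_mult_linear_continuous_on[of UNIV A]] by (subst emeasure_distr) auto
  finally show ?thesis by simp
qed

text \<open>Conjugation with a stretching of the coordinate \<open>m\<close> by \<open>s\<close> replaces the parameter \<open>c\<close> of the
  shear by \<open>s * c\<close>. The Lipschitz constant \<open>1 + \<bar>s * c\<bar>\<close> of that shear tends to \<open>1\<close> with \<open>s\<close>.\<close>

lemma emeasure_lborel_vimage_shear_le:
  assumes mn: "m \<noteq> (n::'n::finite)" and B: "B \<in> sets borel"
  shows "emeasure lborel ((*v) (shear_matrix m n c) -` B) \<le> emeasure lborel B"
proof -
  have step: "emeasure lborel ((*v) (shear_matrix m n c) -` B) \<le>
      ennreal ((1 + \<bar>s * c\<bar>) ^ CARD('n)) * emeasure lborel B" if s: "s > 0" for s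
  proof -
    define B' where "B' = (*v) (stretch_matrix m (1/s)) -` B"
    define C where "C = (*v) (shear_matrix m n (s * c)) -` B'"
    have [measurable]: "B' \<in> sets borel" "C \<in> sets borel" using B by (auto simp: B'_def C_def)
    have det: "det (stretch_matrix m r) = r" for r :: real
      by (subst det_diagonal) (auto simp: prod.delta)
    have stretch: "ennreal \<bar>r\<bar> * emeasure lborel ((*v) (stretch_matrix m r) -` X) = emeasure lborel X"
      if "r \<noteq> 0" "X \<in> sets borel" for r :: real and X
      using emeasure_lborel_vimage_diagonal[of "stretch_matrix m r" X] that by (simp add: det)
    have eq: "(*v) (shear_matrix m n c) -` B = (*v) (stretch_matrix m s) -` C"
    proof -
      have "stretch_matrix m (1/s) *v (shear_matrix m n (s * c) *v (stretch_matrix m s *v x)) = shear_matrix m n c *v x" for x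
        using s mn unfolding shear_matrix_mult_vec[OF mn] stretch_matrix_mult_vec
        by (auto simp: vec_eq_iff axis_def field_simps)
      then show ?thesis by (auto simp: C_def B'_def)
    qed
    have "C \<subseteq> (*v) (shear_matrix m n (- (s * c))) ` B'"
    proof
      fix x assume "x \<in> C"
      moreover have "x = shear_matrix m n (- (s * c)) *v (shear_matrix m n (s * c) *v x)"
        using mn unfolding shear_matrix_mult_vec[OF mn] by (auto simp: vec_eq_iff axis_def)
      ultimately show "x \<in> (*v) (shear_matrix m n (- (s * c))) ` B'" by (auto simp: C_def)
    qed
    moreover have "dist (shear_matrix m n (- (s * c)) *v x) (shear_matrix m n (- (s * c)) *v y) \<le> (1 + \<bar>s * c\<bar>) * dist x y" for x y
    proof -
      have "dist (shear_matrix m n (- (s * c)) *v x) (shear_matrix m n (- (s * c)) *v y) = norm ((x - y) + axis m (- (s * c) * (x - y) $ n))"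
        unfolding shear_matrix_mult_vec[OF mn] dist_norm
        by (rule arg_cong[of _ _ norm]) (auto simp: vec_eq_iff axis_def algebra_simps)
      also have "\<dots> \<le> norm (x - y) + \<bar>s * c\<bar> * \<bar>(x - y) $ n\<bar>"
        by (rule order_trans[OF norm_triangle_ineq]) (simp add: abs_mult norm_axis_real)
      also have "\<dots> \<le> norm (x - y) + \<bar>s * c\<bar> * norm (x - y)"
        by (intro add_left_mono mult_left_mono component_le_norm_cart) auto
      finally show ?thesis by (simp add: dist_norm algebra_simps)
    qed
    ultimately have le: "emeasure lborel C \<le> ennreal ((1 + \<bar>s * c\<bar>) ^ CARD('n)) * emeasure lborel B'"
      using emeasure_lborel_Lipschitz_image_le[of B' C "(*v) (shear_matrix m n (- (s * c)))" "1 + \<bar>s * c\<bar>"]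
      by (auto simp: add_pos_nonneg)
    have "ennreal s * emeasure lborel ((*v) (shear_matrix m n c) -` B) = emeasure lborel C"
      unfolding eq using stretch[of s C] s by simp
    also have "\<dots> \<le> ennreal ((1 + \<bar>s * c\<bar>) ^ CARD('n)) * (ennreal s * (ennreal (1/s) * emeasure lborel B'))"
      using le s by (simp add: mult.assoc[symmetric] ennreal_mult'[symmetric])
    also have "ennreal (1/s) * emeasure lborel B' = emeasure lborel B"
      unfolding B'_def using stretch[of "1/s" B] s B by simp
    finally have "ennreal s * emeasure lborel ((*v) (shear_matrix m n c) -` B) \<le>
        ennreal s * (ennreal ((1 + \<bar>s * c\<bar>) ^ CARD('n)) * emeasure lborel B)" by (simp add: mult_ac)
    then show ?thesis
      using s by (simp add: ennreal_mult_le_mult_iff)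
  qed
  show ?thesis
  proof (rule tendsto_lowerbound)
    have "((\<lambda>s. ennreal ((1 + \<bar>s * c\<bar>) ^ CARD('n))) \<longlongrightarrow> ennreal ((1 + \<bar>0 * c\<bar>) ^ CARD('n))) (at_right 0)"
      by (intro tendsto_ennrealI tendsto_intros)
    then have "((\<lambda>s. ennreal ((1 + \<bar>s * c\<bar>) ^ CARD('n)) * emeasure lborel B) \<longlongrightarrow> 1 * emeasure lborel B) (at_right 0)"
      by (intro tendsto_mult_ennreal) auto
    then show "((\<lambda>s. ennreal ((1 + \<bar>s * c\<bar>) ^ CARD('n)) * emeasure lborel B) \<longlongrightarrow> emeasure lborel B) (at_right 0)"
      by simp
    show "\<forall>\<^sub>F s in at_right 0. emeasure lborel ((*v) (shear_matrix m n c) -` B) \<le> ennreal ((1 + \<bar>s * c\<bar>) ^ CARD('n)) * emeasure lborel B"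
      using eventually_at_right_less[of "0::real"] by eventually_elim (rule step)
  qed auto
qed

text \<open>A matrix is a product of elementary ones. Diagonal matrices scale the coordinates and
  transpositions are isometries. The bound for shears is applied to a shear and to its inverse.\<close>

lemma emeasure_lborel_vimage_matrix:
  fixes A :: "real ^ 'n ^ 'n"
  assumes "det A \<noteq> 0" and "B \<in> sets borel"
  shows "ennreal \<bar>det A\<bar> * emeasure lborel ((*v) A -` B) = emeasure lborel B"
  using assms
proof (induction A arbitrary: B rule: induct_matrix_elementary)
  case (1 A A')
  have "(*v) (A ** A') -` B = (*v) A' -` ((*v) A -` B)"
    by (auto simp: matrix_vector_mul_assoc)
  then show ?case using "1.IH"(1)[of B] "1.IH"(2)[of "(*v) A -` B"] "1.prems"
    by (auto simp: det_mul abs_mult ennreal_mult mult.assoc)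
next
  case (2 A i)
  then show ?case using det_zero_row(2)[of i A] by (auto simp: row_def vec_eq_iff)
next
  case (3 A)
  then show ?case by (intro emeasure_lborel_vimage_diagonal)
next
  case (4 m n)
  let ?A = "(\<chi> i j. mat 1 $ i $ Transposition.transpose m n j) :: real^'n^'n"
  have mv: "?A *v x = (\<chi> i. x $ Transposition.transpose m n i)" for x
  proof -
    have "(\<Sum>j\<in>UNIV. (mat 1 :: real^'n^'n) $ i $ Transposition.transpose m n j * x $ j) =
       (\<Sum>j\<in>UNIV. if j = Transposition.transpose m n i then x $ j else 0)" for i
      by (intro sum.cong) (auto simp: mat_def transpose_eq_iff)
    then show ?thesis by (auto simp: matrix_vector_mult_def vec_eq_iff)
  qed
  have nrm: "norm (?A *v x) = norm x" for x
    unfolding mv norm_vec_def L2_set_def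
    using sum.reindex_bij_betw[of "Transposition.transpose m n" UNIV UNIV "\<lambda>i. (x $ i)\<^sup>2"] by simp
  have lin: "orthogonal_transformation ((*v) ?A)"
    unfolding orthogonal_transformation using nrm matrix_vector_mul_linear by blast
  have "\<bar>det ?A\<bar> = 1"
    using lin det_orthogonal_matrix[of ?A] by (auto simp: orthogonal_transformation_matrix)
  moreover have "emeasure lborel ((*v) ?A -` B) = emeasure lborel B"
    using nrm[of "x - y" for x y] orthogonal_transformation_surj[OF lin] "4.prems"
    by (intro emeasure_lborel_isometry_vimage) (auto simp: dist_norm matrix_vector_mult_diff_distrib)
  ultimately show ?case by simp
next
  case (5 m n c)
  have "shear_matrix m n c = (\<chi> k. if k = m then row m (mat 1) + c *s row n (mat 1) else row k (mat 1))"
    using "5.hyps" by (auto simp: vec_eq_iff row_def mat_def)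
  then have det: "det (shear_matrix m n c) = 1"
    using det_row_operation[OF "5.hyps", of "mat 1" c] by (simp add: det_I)
  have "B = (*v) (shear_matrix m n (-c)) -` ((*v) (shear_matrix m n c) -` B)"
  proof (rule set_eqI)
    fix x
    have "shear_matrix m n c *v (shear_matrix m n (-c) *v x) = x"
      using "5.hyps" unfolding shear_matrix_mult_vec[OF "5.hyps"] by (auto simp: vec_eq_iff axis_def)
    then show "x \<in> B \<longleftrightarrow> x \<in> (*v) (shear_matrix m n (-c)) -` ((*v) (shear_matrix m n c) -` B)"
      by simp
  qed
  then have "emeasure lborel B = emeasure lborel ((*v) (shear_matrix m n (-c)) -` ((*v) (shear_matrix m n c) -` B))"
    by (rule arg_cong)
  also have "\<dots> \<le> emeasure lborel ((*v) (shear_matrix m n c) -` B)"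
    using "5.prems" by (intro emeasure_lborel_vimage_shear_le[OF "5.hyps"] borel_vimage_matrix) auto
  finally have "emeasure lborel B \<le> emeasure lborel ((*v) (shear_matrix m n c) -` B)" .
  then show ?case unfolding det
    using emeasure_lborel_vimage_shear_le[OF "5.hyps", of B c] "5.prems" by simp
qed

section \<open>The surface area measure of a convex body\<close>

locale convex_body =
  fixes K :: "'a::euclidean_space set"
  assumes compact: "compact K" and convex: "convex K" and nonempty: "K \<noteq> {}"
begin

lemma closed: "closed K"
  using compact by (rule compact_imp_closed)

definition nearest :: "'a \<Rightarrow> 'a" where
  "nearest x = closest_point K x"

definition unit_normal :: "'a \<Rightarrow> 'a" where
  "unit_normal x = (x - nearest x) /\<^sub>R infdist x K"

text \<open>The local parallel sets are the shells with \<open>a = 0\<close>; shells with \<open>a > 0\<close> arise as their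
  differences.\<close>

definition shell :: "real \<Rightarrow> real \<Rightarrow> 'a set \<Rightarrow> 'a set" where
  "shell a b \<omega> = {x. a < infdist x K \<and> infdist x K \<le> b \<and> unit_normal x \<in> \<omega>}"

lemma local_parallel_set_eq_shell: "local_parallel_set K \<epsilon> \<omega> = shell 0 \<epsilon> \<omega>"
  by (simp add: local_parallel_set_def shell_def unit_normal_def nearest_def)

lemma nearest_in: "nearest x \<in> K"
  unfolding nearest_def using closed nonempty by (rule closest_point_in_set)

lemma infdist_eq_norm: "infdist x K = norm (x - nearest x)"
  using setdist_closest_point[OF closed nonempty, of x]
  by (simp add: infdist_eq_setdist nearest_def dist_norm)

lemma infdist_pos_iff: "0 < infdist x K \<longleftrightarrow> x \<notin> K"
  using closed nonempty by (metis in_closed_iff_infdist_zero infdist_nonneg less_le)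

lemma nearest_eqI:
  assumes "p \<in> K" and "\<And>z. z \<in> K \<Longrightarrow> (y - p) \<bullet> (z - p) \<le> 0"
  shows "nearest y = p"
  unfolding nearest_def
proof (rule closest_point_unique[symmetric, OF convex closed assms(1)], rule ballI)
  fix z assume "z \<in> K"
  have "(norm (y - p))\<^sup>2 \<le> (norm (y - z))\<^sup>2"
  proof -
    have "(norm (y - z))\<^sup>2 = (norm (y - p))\<^sup>2 - 2 * ((y - p) \<bullet> (z - p)) + (norm (z - p))\<^sup>2"
      by (simp add: power2_norm_eq_inner inner_diff inner_commute algebra_simps)
    then show ?thesis using assms(2)[OF \<open>z \<in> K\<close>] by (smt (verit) zero_le_power2)
  qed
  then show "dist y p \<le> dist y z" by (simp add: dist_norm)
qed

lemma nearest_add_eq: "0 < infdist x K \<Longrightarrow> x = nearest x + infdist x K *\<^sub>R unit_normal x"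
  by (simp add: unit_normal_def)

lemma norm_unit_normal: "0 < infdist x K \<Longrightarrow> norm (unit_normal x) = 1"
  by (simp add: unit_normal_def infdist_eq_norm)

lemma unit_normal_inner_le:
  assumes "0 < infdist x K" "z \<in> K"
  shows "unit_normal x \<bullet> (z - nearest x) \<le> 0"
proof -
  have "(x - nearest x) \<bullet> (z - nearest x) \<le> 0"
    unfolding nearest_def using convex closed assms(2) by (rule closest_point_dot)
  then show ?thesis using assms(1)
    by (simp add: unit_normal_def mult_nonneg_nonpos)
qed

lemma nearest_ray:
  assumes x: "0 < infdist x K" and s: "0 < s"
  defines "y \<equiv> nearest x + s *\<^sub>R unit_normal x"
  shows "nearest y = nearest x" and "infdist y K = s" and "unit_normal y = unit_normal x"
proof -
  show n: "nearest y = nearest x"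
    using s unit_normal_inner_le[OF x] nearest_in
    by (intro nearest_eqI) (auto simp: y_def mult_nonneg_nonpos)
  show d: "infdist y K = s"
    using s norm_unit_normal[OF x] unfolding infdist_eq_norm[of y] n by (simp add: y_def)
  show "unit_normal y = unit_normal x"
    unfolding unit_normal_def[of y] n d using s by (simp add: y_def)
qed

text \<open>Each of the two nearest points lies in the supporting half-space at the other one; the sum
  of these two inequalities is the claim.\<close>

lemma unit_normal_monotone:
  assumes x: "0 < infdist x K" and y: "0 < infdist y K"
  shows "0 \<le> (unit_normal x - unit_normal y) \<bullet> (x - y)"
proof -
  define n m p q r s where defs: "n = unit_normal x" "m = unit_normal y" "p = nearest x" "q = nearest y"
    "r = infdist x K" "s = infdist y K"
  have eq: "x = p + r *\<^sub>R n" "y = q + s *\<^sub>R m"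
    using nearest_add_eq[OF x] nearest_add_eq[OF y] by (simp_all add: defs)
  have nm: "n \<bullet> n = 1" "m \<bullet> m = 1"
    using norm_unit_normal[OF x] norm_unit_normal[OF y] by (simp_all add: defs norm_eq_1)
  have le: "n \<bullet> m \<le> 1" using norm_cauchy_schwarz[of n m] norm_unit_normal[OF x] norm_unit_normal[OF y]
    by (simp add: defs)
  have 1: "n \<bullet> (q - p) \<le> 0" "m \<bullet> (p - q) \<le> 0"
    unfolding defs using nearest_in by (auto intro!: unit_normal_inner_le x y)
  have "(n - m) \<bullet> (x - y) = - (n \<bullet> (q - p)) - m \<bullet> (p - q) + (r + s) * (1 - n \<bullet> m)"
    unfolding eq by (simp add: inner_diff inner_add nm inner_commute algebra_simps)
  moreover have "0 \<le> (r + s) * (1 - n \<bullet> m)" using le x y by (simp add: defs)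
  ultimately have "0 \<le> (n - m) \<bullet> (x - y)" using 1 by linarith
  then show ?thesis by (simp add: defs)
qed

text \<open>Monotonicity of the normal field makes pushing points outwards an expanding map. Its inverse
  is a contraction between shells.\<close>

lemma dist_le_dist_push:
  assumes x: "0 < infdist x K" and y: "0 < infdist y K" and h: "0 \<le> h"
  shows "dist x y \<le> dist (x + h *\<^sub>R unit_normal x) (y + h *\<^sub>R unit_normal y)"
proof -
  define v w where "v = x - y" and "w = unit_normal x - unit_normal y"
  have "0 \<le> w \<bullet> v" using unit_normal_monotone[OF x y] by (simp add: v_def w_def)
  then have "(norm v)\<^sup>2 \<le> (norm (v + h *\<^sub>R w))\<^sup>2"
    using h by (simp add: power2_norm_eq_inner inner_add inner_commute)
  then have "norm v \<le> norm (v + h *\<^sub>R w)" by simp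
  also have "v + h *\<^sub>R w = (x + h *\<^sub>R unit_normal x) - (y + h *\<^sub>R unit_normal y)"
    by (simp add: v_def w_def algebra_simps)
  finally show ?thesis by (simp add: dist_norm v_def)
qed

lemma nearest_measurable [measurable]: "nearest \<in> borel_measurable borel"
  unfolding nearest_def[abs_def]
  by (intro borel_measurable_continuous_onI continuous_on_closest_point convex closed nonempty)

lemma infdist_measurable [measurable]: "(\<lambda>x. infdist x K) \<in> borel_measurable borel"
  by (intro borel_measurable_continuous_onI continuous_intros)

lemma unit_normal_measurable [measurable]: "unit_normal \<in> borel_measurable borel"
  unfolding unit_normal_def[abs_def] by measurable

lemma shell_measurable [measurable]:
  assumes [measurable]: "\<omega> \<in> sets borel"
  shows "shell a b \<omega> \<in> sets borel"
  unfolding shell_def by measurable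

text \<open>Moving the outer shell inwards along the normals maps it onto the inner shell, by a
  contraction.\<close>

lemma emeasure_shell_shift_le:
  assumes a: "0 \<le> a" and h: "0 \<le> h" and w: "\<omega> \<in> sets borel"
  shows "emeasure lborel (shell a b \<omega>) \<le> emeasure lborel (shell (a + h) (b + h) \<omega>)"
proof -
  define f where "f z = z - h *\<^sub>R unit_normal z" for z
  have "shell a b \<omega> \<subseteq> f ` shell (a + h) (b + h) \<omega>"
  proof
    fix x assume x: "x \<in> shell a b \<omega>"
    define z where "z = nearest x + (infdist x K + h) *\<^sub>R unit_normal x"
    have pos: "0 < infdist x K" using x a by (auto simp: shell_def)
    then have pos': "0 < infdist x K + h" using h by simp
    note ray = nearest_ray[OF pos pos', folded z_def]
    have "z \<in> shell (a + h) (b + h) \<omega>" using x ray by (auto simp: shell_def)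
    moreover have "f z = x"
      using nearest_add_eq[OF pos] ray unfolding f_def z_def by (simp add: algebra_simps)
    ultimately show "x \<in> f ` shell (a + h) (b + h) \<omega>" by force
  qed
  moreover have "dist (f x) (f y) \<le> 1 * dist x y"
    if "x \<in> shell (a + h) (b + h) \<omega>" "y \<in> shell (a + h) (b + h) \<omega>" for x y
  proof -
    have *: "0 < infdist (f z) K \<and> f z + h *\<^sub>R unit_normal (f z) = z"
      if "z \<in> shell (a + h) (b + h) \<omega>" for z
    proof -
      have pos: "0 < infdist z K" and pos': "0 < infdist z K - h" using that a h by (auto simp: shell_def)
      have fz: "f z = nearest z + (infdist z K - h) *\<^sub>R unit_normal z"
        using nearest_add_eq[OF pos] by (simp add: f_def algebra_simps)
      have "f z + h *\<^sub>R unit_normal z = z" by (simp add: f_def)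
      then show ?thesis using nearest_ray(2,3)[OF pos pos', folded fz] pos' by simp
    qed
    show ?thesis
      using dist_le_dist_push[of "f x" "f y" h] *[OF that(1)] *[OF that(2)] h by simp
  qed
  ultimately show ?thesis
    using emeasure_lborel_Lipschitz_image_le[of "shell (a + h) (b + h) \<omega>" "shell a b \<omega>" f 1] w by simp
qed

lemma bounded_infdist_le: "bounded {x. infdist x K \<le> b}"
proof -
  obtain B where B: "\<And>z. z \<in> K \<Longrightarrow> norm z \<le> B" using compact_imp_bounded[OF compact] by (auto simp: bounded_iff)
  have "norm x \<le> B + b" if "infdist x K \<le> b" for x
    using norm_triangle_ineq[of "nearest x" "x - nearest x"] B[OF nearest_in[of x]] that
    by (simp add: infdist_eq_norm)
  then show ?thesis by (auto simp: bounded_iff)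
qed

lemma emeasure_shell_finite: "emeasure lborel (shell a b \<omega>) < \<infinity>"
proof -
  have "bounded (shell a b \<omega>)" by (rule bounded_subset[OF bounded_infdist_le[of b]]) (auto simp: shell_def)
  then show ?thesis by (rule emeasure_bounded_finite)
qed

lemma emeasure_shell_split:
  assumes "0 \<le> a" "a \<le> b" and w: "\<omega> \<in> sets borel"
  shows "measure lborel (shell 0 b \<omega>) = measure lborel (shell 0 a \<omega>) + measure lborel (shell a b \<omega>)"
proof -
  have "shell 0 b \<omega> = shell 0 a \<omega> \<union> shell a b \<omega>" using assms by (auto simp: shell_def)
  moreover have "shell 0 a \<omega> \<inter> shell a b \<omega> = {}" by (auto simp: shell_def)
  moreover have "shell a b \<omega> \<in> fmeasurable lborel" "shell 0 a \<omega> \<in> fmeasurable lborel"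
    using w emeasure_shell_finite by (auto simp: fmeasurable_def)
  ultimately show ?thesis by (simp add: measure_Un2 fmeasurable_def disjoint_iff Diff_triv Int_commute)
qed

text \<open>When \<open>[0, t]\<close> is cut into steps of equal length, the volumes of the successive shells
  increase, so that the mean of the first \<open>k\<close> of them is at most the mean of all \<open>N\<close>. The ratio
  \<open>s / t\<close> is then approximated by \<open>k / N\<close>.\<close>

lemma measure_shell_ratio_mono:
  assumes st: "0 < s" "s \<le> t" and w: "\<omega> \<in> sets borel"
  shows "measure lborel (shell 0 s \<omega>) / s \<le> measure lborel (shell 0 t \<omega>) / t"
proof -
  define F where "F r = measure lborel (shell 0 r \<omega>)" for r
  have F_mono: "F a \<le> F b" if "a \<le> b" for a b
    unfolding F_def using that w emeasure_shell_finite
    by (intro measure_mono_fmeasurable) (auto simp: shell_def fmeasurable_def intro!: shell_measurable[unfolded shell_def])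
  have F0: "F 0 = 0"
  proof -
    have "shell 0 0 \<omega> = {}" by (auto simp: shell_def)
    then show ?thesis by (simp add: F_def)
  qed
  have F_nonneg: "0 \<le> F r" for r by (simp add: F_def)
  have ratio: "real (Suc k) * F (real k * \<delta>) \<le> real k * F (real (Suc k) * \<delta>)" if "\<delta> > 0" for \<delta> k
  proof -
    define a where "a j = F (real (Suc j) * \<delta>) - F (real j * \<delta>)" for j
    have aj: "a j = measure lborel (shell (real j * \<delta>) (real (Suc j) * \<delta>) \<omega>)" for j
      unfolding a_def F_def using \<open>\<delta> > 0\<close> w by (subst emeasure_shell_split[of "real j * \<delta>"]) (auto simp: algebra_simps)
    have amono: "a j \<le> a k" if "j \<le> k" for j
    proof -
      have "emeasure lborel (shell (real j * \<delta>) (real (Suc j) * \<delta>) \<omega>) \<le>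
        emeasure lborel (shell (real j * \<delta> + real (k - j) * \<delta>) (real (Suc j) * \<delta> + real (k - j) * \<delta>) \<omega>)"
        using \<open>\<delta> > 0\<close> w by (intro emeasure_shell_shift_le) auto
      also have "real j * \<delta> + real (k - j) * \<delta> = real k * \<delta>" using that by (simp add: of_nat_diff algebra_simps)
      also have "real (Suc j) * \<delta> + real (k - j) * \<delta> = real (Suc k) * \<delta>" using that by (simp add: of_nat_diff algebra_simps)
      finally show ?thesis unfolding aj measure_def
        using emeasure_shell_finite by (intro enn2real_mono) auto
    qed
    have "F (real k * \<delta>) = (\<Sum>j<k. a j)"
      unfolding a_def by (subst sum_lessThan_telescope[of "\<lambda>j. F (real j * \<delta>)"]) (simp add: F0)
    also have "\<dots> \<le> (\<Sum>j<k. a k)" by (intro sum_mono amono) auto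
    finally have "F (real k * \<delta>) \<le> real k * a k" by simp
    then show ?thesis by (simp add: a_def algebra_simps)
  qed
  have ratio': "F (real k * \<delta>) * real N \<le> F (real N * \<delta>) * real k" if "\<delta> > 0" "k \<le> N" for \<delta> k N
    using that(2)
  proof (induction rule: dec_induct)
    case (step n)
    show ?case
    proof (cases "n = 0")
      case True
      then have "k = 0" using step by simp
      then show ?thesis by (simp add: F0)
    next
      case False
      have "real n * (F (real k * \<delta>) * real (Suc n)) = real (Suc n) * (F (real k * \<delta>) * real n)"
        by (simp del: of_nat_Suc)
      also have "\<dots> \<le> real (Suc n) * (F (real n * \<delta>) * real k)"
        using step.IH by (intro mult_left_mono) auto
      also have "\<dots> \<le> real n * F (real (Suc n) * \<delta>) * real k"
        using mult_right_mono[OF ratio[OF \<open>\<delta> > 0\<close>, of n], of "real k"] by (simp add: mult_ac del: of_nat_Suc)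
      finally have "real n * (F (real k * \<delta>) * real (Suc n)) \<le> real n * (F (real (Suc n) * \<delta>) * real k)"
        by (simp add: mult_ac)
      then show ?thesis using False by (simp del: of_nat_Suc)
    qed
  qed simp
  have bound: "F s \<le> (s / t + 1 / real N) * F t" if N: "N > 0" for N
  proof -
    define \<delta> where "\<delta> = t / real N"
    \<comment> \<open>The least number of steps that covers \<open>[0, s]\<close>.\<close>
    define k where "k = min N (nat \<lceil>s * real N / t\<rceil>)"
    have d: "\<delta> > 0" using st N by (simp add: \<delta>_def)
    have N\<delta>: "real N * \<delta> = t" using N by (simp add: \<delta>_def)
    have "s \<le> real k * \<delta>"
    proof (cases "N \<le> nat \<lceil>s * real N / t\<rceil>")
      case True then show ?thesis using N\<delta> st by (simp add: k_def)
    next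
      case False
      then have "s * real N / t \<le> real k" by (simp add: k_def real_nat_ceiling_ge)
      then show ?thesis using st N by (simp add: \<delta>_def field_simps)
    qed
    then have "F s * real N \<le> F (real k * \<delta>) * real N" by (intro mult_right_mono F_mono) auto
    also have "\<dots> \<le> F t * real k" using ratio'[OF d, of k N] N\<delta> by (simp add: k_def)
    also have "\<dots> \<le> F t * (s * real N / t + 1)"
    proof (intro mult_left_mono F_nonneg)
      have "real k \<le> real (nat \<lceil>s * real N / t\<rceil>)" by (simp add: k_def)
      also have "\<dots> \<le> s * real N / t + 1" using st by (simp add: of_nat_nat)
      finally show "real k \<le> s * real N / t + 1" .
    qed
    finally show ?thesis using N by (simp add: field_simps)
  qed
  have "F s \<le> (s / t + 0) * F t"
  proof (rule LIMSEQ_le_const)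
    show "(\<lambda>N. (s / t + 1 / real N) * F t) \<longlonglongrightarrow> (s / t + 0) * F t"
      by (intro tendsto_intros lim_1_over_n)
    show "\<exists>N. \<forall>n\<ge>N. F s \<le> (s / t + 1 / real n) * F t" using bound by (intro exI[of _ 1]) auto
  qed
  then show ?thesis using st by (simp add: F_def field_simps)
qed

definition area_approx :: "real \<Rightarrow> 'a set \<Rightarrow> ennreal" where
  "area_approx \<epsilon> \<omega> = emeasure lborel (local_parallel_set K \<epsilon> \<omega>) / ennreal \<epsilon>"

lemma area_approx_eq:
  "0 < \<epsilon> \<Longrightarrow> area_approx \<epsilon> \<omega> = ennreal (measure lborel (shell 0 \<epsilon> \<omega>) / \<epsilon>)"
  using emeasure_shell_finite[of 0 \<epsilon> \<omega>]
  by (simp add: area_approx_def local_parallel_set_eq_shell emeasure_eq_ennreal_measure divide_ennreal)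

lemma area_approx_mono:
  assumes "0 < s" "s \<le> t" "\<omega> \<in> sets borel"
  shows "area_approx s \<omega> \<le> area_approx t \<omega>"
  using assms measure_shell_ratio_mono[OF assms] by (simp add: area_approx_eq)

text \<open>The quotients decrease as \<open>\<epsilon>\<close> tends to \<open>0\<close>, so their limit is an infimum. It is written as
  such because upper bounds by single quotients are then immediate.\<close>

definition area :: "'a set \<Rightarrow> ennreal" where
  "area \<omega> = (INF \<epsilon>\<in>{0<..}. area_approx \<epsilon> \<omega>)"

lemma area_le_approx: "0 < \<epsilon> \<Longrightarrow> area \<omega> \<le> area_approx \<epsilon> \<omega>"
  unfolding area_def by (rule INF_lower) auto

lemma area_approx_tendsto:
  assumes w: "\<omega> \<in> sets borel"
  shows "((\<lambda>\<epsilon>. area_approx \<epsilon> \<omega>) \<longlongrightarrow> area \<omega>) (at_right 0)"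
proof (rule order_tendstoI)
  fix a assume "a < area \<omega>"
  then show "\<forall>\<^sub>F \<epsilon> in at_right 0. a < area_approx \<epsilon> \<omega>"
    using eventually_at_right_less[of "0::real"]
    by (auto elim!: eventually_mono intro: less_le_trans area_le_approx)
next
  fix a assume "area \<omega> < a"
  then obtain t where t: "t > 0" "area_approx t \<omega> < a" by (auto simp: area_def INF_less_iff)
  then show "\<forall>\<^sub>F \<epsilon> in at_right 0. area_approx \<epsilon> \<omega> < a"
    unfolding eventually_at_right_field
    using area_approx_mono[OF _ _ w, of _ t] by (meson le_less_trans less_imp_le)
qed

lemma area_finite: "area \<omega> < \<infinity>"
  using area_le_approx[of 1 \<omega>] area_approx_eq[of 1 \<omega>] by (auto simp: less_top[symmetric] top_unique)

abbreviation sphere_algebra :: "'a set set" where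
  "sphere_algebra \<equiv> sets (restrict_space borel (sphere 0 1))"

lemma sphere_algebraD: "\<omega> \<in> sphere_algebra \<Longrightarrow> \<omega> \<in> sets borel" "\<omega> \<in> sphere_algebra \<Longrightarrow> \<omega> \<subseteq> sphere 0 1"
  by (auto simp: sets_restrict_space)

lemma shell_Un: "shell a b (\<omega> \<union> \<omega>') = shell a b \<omega> \<union> shell a b \<omega>'"
  by (auto simp: shell_def)

lemma area_additive:
  assumes w: "\<omega> \<in> sets borel" "\<omega>' \<in> sets borel" and disj: "\<omega> \<inter> \<omega>' = {}"
  shows "area (\<omega> \<union> \<omega>') = area \<omega> + area \<omega>'"
proof (rule tendsto_unique)
  show "((\<lambda>\<epsilon>. area_approx \<epsilon> (\<omega> \<union> \<omega>')) \<longlongrightarrow> area (\<omega> \<union> \<omega>')) (at_right 0)"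
    using w by (intro area_approx_tendsto) auto
  have "area_approx \<epsilon> (\<omega> \<union> \<omega>') = area_approx \<epsilon> \<omega> + area_approx \<epsilon> \<omega>'" for \<epsilon>
  proof -
    have "shell 0 \<epsilon> \<omega> \<inter> shell 0 \<epsilon> \<omega>' = {}" using disj by (auto simp: shell_def)
    then show ?thesis using w
      by (simp add: area_approx_def local_parallel_set_eq_shell shell_Un plus_emeasure[symmetric] add_divide_distrib_ennreal)
  qed
  moreover have "((\<lambda>\<epsilon>. area_approx \<epsilon> \<omega> + area_approx \<epsilon> \<omega>') \<longlongrightarrow> area \<omega> + area \<omega>') (at_right 0)"
    using w by (intro tendsto_add area_approx_tendsto) auto
  ultimately show "((\<lambda>\<epsilon>. area_approx \<epsilon> (\<omega> \<union> \<omega>')) \<longlongrightarrow> area \<omega> + area \<omega>') (at_right 0)" by simp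
qed simp

text \<open>Finite additivity passes to the limit. Continuity at the empty set holds because \<open>area\<close> is
  bounded by the volume of the shell of width \<open>1\<close>, which is continuous there.\<close>

lemma countably_additive_area: "countably_additive sphere_algebra area"
proof -
  interpret S: sigma_algebra "sphere 0 1 :: 'a set" sphere_algebra
    using sets.sigma_algebra_axioms[of "restrict_space borel (sphere 0 1 :: 'a set)"] by (simp add: space_restrict_space)
  show ?thesis
  proof (rule S.empty_continuous_imp_countably_additive)
    have "shell 0 1 {} = {}" by (auto simp: shell_def)
    then have "area {} = 0" using area_le_approx[of 1 "{}"] by (simp add: area_approx_eq)
    then show "positive sphere_algebra area" by (simp add: positive_def)
    show "additive sphere_algebra area"
      unfolding additive_def using area_additive sphere_algebraD(1) by simp
    show "\<forall>A\<in>sphere_algebra. area A \<noteq> \<infinity>" using area_finite by (simp add: less_top)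
    fix A :: "nat \<Rightarrow> 'a set"
    assume A: "range A \<subseteq> sphere_algebra" "decseq A" "(\<Inter>i. A i) = {}"
    have "(\<lambda>i. emeasure lborel (shell 0 1 (A i))) \<longlonglongrightarrow> emeasure lborel (\<Inter>i. shell 0 1 (A i))"
    proof (rule Lim_emeasure_decseq)
      show "range (\<lambda>i. shell 0 1 (A i)) \<subseteq> sets lborel"
      proof
        fix B assume "B \<in> range (\<lambda>i. shell 0 1 (A i))"
        then obtain i where "B = shell 0 1 (A i)" by auto
        moreover have "A i \<in> sphere_algebra" using A(1) by auto
        ultimately show "B \<in> sets lborel" using shell_measurable[OF sphere_algebraD(1)] by simp
      qed
      show "decseq (\<lambda>i. shell 0 1 (A i))" using A(2) by (auto simp: decseq_def shell_def)
      show "emeasure lborel (shell 0 1 (A i)) \<noteq> \<infinity>" for i using emeasure_shell_finite[of 0 1 "A i"] by auto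
    qed
    also have "(\<Inter>i. shell 0 1 (A i)) = {}" using A(3) by (auto simp: shell_def)
    finally have "(\<lambda>i. emeasure lborel (shell 0 1 (A i))) \<longlonglongrightarrow> 0" by simp
    then show "(\<lambda>i. area (A i)) \<longlonglongrightarrow> 0"
    proof (rule tendsto_sandwich[OF _ _ tendsto_const, rotated -1])
      show "\<forall>\<^sub>F i in sequentially. area (A i) \<le> emeasure lborel (shell 0 1 (A i))"
        using area_le_approx[of 1] by (simp add: area_approx_def local_parallel_set_eq_shell divide_ennreal_def)
    qed auto
  qed
qed

lemma sets_surface_area_measure: "sets (surface_area_measure K) = sphere_algebra"
  unfolding surface_area_measure_def
  using sets.sets_measure_of_eq[of "restrict_space borel (sphere 0 1 :: 'a set)"] by (simp add: space_restrict_space)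

lemma space_surface_area_measure: "space (surface_area_measure K) = sphere 0 1"
  unfolding surface_area_measure_def
  using sets.space_measure_of_eq[of "restrict_space borel (sphere 0 1 :: 'a set)"] by (simp add: space_restrict_space)

lemma emeasure_surface_area_measure:
  assumes "\<omega> \<in> sphere_algebra"
  shows "emeasure (surface_area_measure K) \<omega> = area \<omega>"
proof -
  interpret S: sigma_algebra "sphere 0 1 :: 'a set" sphere_algebra
    using sets.sigma_algebra_axioms[of "restrict_space borel (sphere 0 1 :: 'a set)"] by (simp add: space_restrict_space)
  let ?f = "\<lambda>\<omega>. Lim (at_right 0) (\<lambda>\<epsilon>. emeasure lborel (local_parallel_set K \<epsilon> \<omega>) / ennreal \<epsilon>)"
  have eq: "?f \<omega> = area \<omega>" if "\<omega> \<in> sphere_algebra" for \<omega>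
    using area_approx_tendsto[OF sphere_algebraD(1)[OF that]] unfolding area_approx_def
    by (intro tendsto_Lim) auto
  have ca: "countably_additive sphere_algebra ?f"
    using countably_additive_area unfolding countably_additive_def
    by (auto simp: eq subset_eq image_subset_iff S.countable_UN)
  moreover have "positive sphere_algebra ?f"
  proof -
    have "shell 0 1 {} = {}" by (auto simp: shell_def)
    then have "area {} = 0" using area_le_approx[of 1 "{}"] by (simp add: area_approx_eq)
    then show ?thesis using eq[of "{}"] by (simp add: positive_def)
  qed
  ultimately show ?thesis
    unfolding surface_area_measure_def using assms S.sigma_algebra_axioms eq
    by (subst emeasure_measure_of_sigma) auto
qed

lemma finite_surface_area_measure: "finite_measure (surface_area_measure K)"
proof
  have "sphere 0 1 \<in> sphere_algebra" by (auto simp: sets_restrict_space)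
  then show "emeasure (surface_area_measure K) (space (surface_area_measure K)) \<noteq> \<infinity>"
    using area_finite[of "sphere 0 1"] by (simp add: space_surface_area_measure emeasure_surface_area_measure)
qed

end

section \<open>The centroid of the surface area measure\<close>

context convex_body
begin

text \<open>The hyperplane supporting \<open>K\<close> at the point nearest to \<open>x\<close> bounds the distance of \<open>y\<close> from
  below.\<close>

lemma infdist_subgradient:
  assumes x: "0 < infdist x K"
  shows "infdist x K + unit_normal x \<bullet> (y - x) \<le> infdist y K"
proof -
  have "unit_normal x \<bullet> (y - nearest y) \<le> norm (unit_normal x) * norm (y - nearest y)"
    by (rule norm_cauchy_schwarz)
  then have "unit_normal x \<bullet> (y - nearest y) \<le> infdist y K"
    using norm_unit_normal[OF x] by (simp add: infdist_eq_norm)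
  moreover have "unit_normal x \<bullet> (x - nearest x) = infdist x K"
  proof -
    have "x - nearest x = infdist x K *\<^sub>R unit_normal x" using x by (simp add: unit_normal_def)
    moreover have "unit_normal x \<bullet> unit_normal x = 1" using norm_unit_normal[OF x] by (simp add: norm_eq_1)
    ultimately show ?thesis by simp
  qed
  moreover have "unit_normal x \<bullet> (y - nearest y) = unit_normal x \<bullet> (y - x) +
      unit_normal x \<bullet> (x - nearest x) - unit_normal x \<bullet> (nearest y - nearest x)"
    by (simp add: inner_diff_right)
  ultimately show ?thesis
    using unit_normal_inner_le[OF x nearest_in[of y]] by linarith
qed

lemma unit_normal_continuous:
  assumes x: "0 < infdist x K"
  shows "isCont unit_normal x"
  unfolding unit_normal_def[abs_def] nearest_def[abs_def]
  using x by (intro continuous_intros continuous_at_closest_point convex closed nonempty) auto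

text \<open>The subgradient inequalities at \<open>x\<close> and at the neighbouring point enclose the quotient
  between two values of the continuous normal field.\<close>

lemma infdist_quotient_tendsto:
  assumes x: "0 < infdist x K"
  shows "(\<lambda>k. real (Suc k) * (infdist (x + (1 / real (Suc k)) *\<^sub>R e) K - infdist x K)) \<longlonglongrightarrow> unit_normal x \<bullet> e"
proof -
  define y where "y k = x + (1 / real (Suc k)) *\<^sub>R e" for k
  have y: "y \<longlonglongrightarrow> x"
  proof -
    have "(\<lambda>k. x + (1 / real (Suc k)) *\<^sub>R e) \<longlonglongrightarrow> x + 0 *\<^sub>R e"
      by (intro tendsto_intros LIMSEQ_Suc[OF lim_1_over_n])
    then show ?thesis by (simp add: y_def[abs_def])
  qed
  have ev: "\<forall>\<^sub>F k in sequentially. 0 < infdist (y k) K"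
    using tendsto_infdist[OF y] x by (rule order_tendstoD)
  have "(\<lambda>k. real (Suc k) * (infdist (y k) K - infdist x K) - unit_normal x \<bullet> e) \<longlonglongrightarrow> 0"
  proof (rule Lim_null_comparison)
    show "(\<lambda>k. norm (unit_normal (y k) - unit_normal x) * norm e) \<longlonglongrightarrow> 0"
      using isCont_tendsto_compose[OF unit_normal_continuous[OF x] y]
      by (intro tendsto_mult_left_zero tendsto_norm_zero) (simp add: LIM_zero_iff)
    show "\<forall>\<^sub>F k in sequentially. norm (real (Suc k) * (infdist (y k) K - infdist x K) - unit_normal x \<bullet> e)
        \<le> norm (unit_normal (y k) - unit_normal x) * norm e"
      using ev
    proof eventually_elim
      fix k assume yk: "0 < infdist (y k) K"
      define D where "D = infdist (y k) K - infdist x K"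
      have d: "y k - x = (1 / real (Suc k)) *\<^sub>R e" by (simp add: y_def)
      have "unit_normal x \<bullet> (y k - x) \<le> D" using infdist_subgradient[OF x, of "y k"] by (simp add: D_def)
      then have 1: "unit_normal x \<bullet> e \<le> real (Suc k) * D"
        unfolding d by (simp add: field_simps del: of_nat_Suc)
      have "D \<le> unit_normal (y k) \<bullet> (y k - x)" using infdist_subgradient[OF yk, of x] by (simp add: D_def inner_diff)
      then have 2: "real (Suc k) * D \<le> unit_normal (y k) \<bullet> e"
        unfolding d by (simp add: field_simps del: of_nat_Suc)
      have 3: "unit_normal (y k) \<bullet> e - unit_normal x \<bullet> e \<le> norm (unit_normal (y k) - unit_normal x) * norm e"
        using norm_cauchy_schwarz[of "unit_normal (y k) - unit_normal x" e] by (simp add: inner_diff_left)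
      show "norm (real (Suc k) * (infdist (y k) K - infdist x K) - unit_normal x \<bullet> e)
        \<le> norm (unit_normal (y k) - unit_normal x) * norm e"
        using 1 2 3 by (simp add: D_def[symmetric])
    qed
  qed
  then show ?thesis by (simp add: LIM_zero_iff y_def)
qed

lemma convex_infdist_le: "convex {x. infdist x K \<le> c}"
proof (rule convexI, safe)
  fix x y :: 'a and u v :: real
  assume uv: "0 \<le> u" "0 \<le> v" "u + v = 1" and xy: "infdist x K \<le> c" "infdist y K \<le> c"
  have "infdist (u *\<^sub>R x + v *\<^sub>R y) K \<le> dist (u *\<^sub>R x + v *\<^sub>R y) (u *\<^sub>R nearest x + v *\<^sub>R nearest y)"
    using convexD[OF convex nearest_in nearest_in uv] by (rule infdist_le)
  also have "\<dots> = norm (u *\<^sub>R (x - nearest x) + v *\<^sub>R (y - nearest y))"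
    by (simp add: dist_norm algebra_simps)
  also have "\<dots> \<le> u * infdist x K + v * infdist y K"
    using uv by (intro order_trans[OF norm_triangle_ineq]) (simp add: infdist_eq_norm)
  also have "\<dots> \<le> u * c + v * c" using uv xy by (intro add_mono mult_left_mono) auto
  also have "\<dots> = c" using uv by (simp add: distrib_right[symmetric])
  finally show "infdist (u *\<^sub>R x + v *\<^sub>R y) K \<le> c" .
qed

lemma infdist_le_borel: "{x. infdist x K \<le> c} \<in> sets borel"
  by measurable

text \<open>A level set of the distance lies in the frontier of a convex set.\<close>

lemma AE_infdist_neq:
  assumes "0 < c"
  shows "AE x in lborel. infdist x K \<noteq> c"
proof -
  have "{x. infdist x K = c} \<subseteq> frontier {x. infdist x K \<le> c}"
  proof
    fix x assume "x \<in> {x. infdist x K = c}"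
    then have x: "infdist x K = c" by simp
    have "x \<notin> interior {y. infdist y K \<le> c}"
    proof
      assume "x \<in> interior {y. infdist y K \<le> c}"
      then obtain r where r: "r > 0" "ball x r \<subseteq> {y. infdist y K \<le> c}"
        by (auto simp: mem_interior)
      define y where "y = nearest x + (infdist x K + r / 2) *\<^sub>R unit_normal x"
      have pos: "0 < infdist x K" "0 < infdist x K + r / 2" using x assms r by auto
      have "y = x + (r / 2) *\<^sub>R unit_normal x"
      proof -
        have "nearest x + infdist x K *\<^sub>R unit_normal x = x"
          by (rule nearest_add_eq[OF pos(1), symmetric])
        then show ?thesis unfolding y_def by (simp add: scaleR_left_distrib flip: add.assoc)
      qed
      then have "y \<in> ball x r" using r norm_unit_normal[OF pos(1)] by (simp add: dist_norm)
      then show False using r x nearest_ray(2)[OF pos, folded y_def] by auto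
    qed
    moreover have "x \<in> closure {y. infdist y K \<le> c}"
      using x closure_subset[of "{y. infdist y K \<le> c}"] by auto
    ultimately show "x \<in> frontier {x. infdist x K \<le> c}" by (simp add: frontier_def)
  qed
  then have "negligible {x. infdist x K = c}"
    using negligible_convex_frontier[OF convex_infdist_le] by (rule negligible_subset[rotated])
  moreover have "{x. infdist x K = c} \<in> sets borel" by measurable
  ultimately have "{x. infdist x K = c} \<in> null_sets lborel"
    by (simp add: negligible_iff_null_sets null_sets_completion_iff)
  then show ?thesis by (intro AE_I'[of "{x. infdist x K = c}"]) auto
qed

lemma AE_not_frontier: "AE x in lborel. x \<in> interior K \<or> 0 < infdist x K"
proof -
  have "negligible (frontier K)" using convex by (rule negligible_convex_frontier)
  then have "frontier K \<in> null_sets lborel"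
    by (simp add: negligible_iff_null_sets null_sets_completion_iff)
  then show ?thesis
    by (rule AE_I') (use closed in \<open>auto simp: frontier_def infdist_pos_iff\<close>)
qed

text \<open>Up to sign the integrand is the derivative, in direction \<open>e\<close>, of the compactly supported
  Lipschitz function \<open>\<epsilon> - min (infdist x K) \<epsilon>\<close>. The integrals of its difference quotients vanish
  by translation invariance and converge by dominated convergence.\<close>

lemma integral_unit_normal_shell:
  assumes \<epsilon>: "0 < \<epsilon>"
  shows "(\<integral>x. indicator (shell 0 \<epsilon> UNIV) x * (unit_normal x \<bullet> e) \<partial>lborel) = 0"
proof -
  define g where "g x = \<epsilon> - min (infdist x K) \<epsilon>" for x
  define D where "D k x = real (Suc k) * (g (x + (1 / real (Suc k)) *\<^sub>R e) - g x)" for k x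
  define F where "F x = - (indicator (shell 0 \<epsilon> UNIV) x * (unit_normal x \<bullet> e))" for x
  \<comment> \<open>The dominating function: the difference quotients vanish further away than \<open>\<epsilon> + norm e\<close>.\<close>
  define w where "w x = norm e * indicator {x. infdist x K \<le> \<epsilon> + norm e} x" for x
  have g_meas [measurable]: "g \<in> borel_measurable borel" unfolding g_def by measurable
  have F_meas [measurable]: "F \<in> borel_measurable borel"
  proof -
    have [measurable]: "shell 0 \<epsilon> UNIV \<in> sets borel" by simp
    show ?thesis unfolding F_def by measurable
  qed
  have B: "emeasure lborel {x. infdist x K \<le> c} < \<infinity>" for c
    by (rule emeasure_bounded_finite[OF bounded_infdist_le])
  have g_int: "integrable lborel g"
  proof (rule Bochner_Integration.integrable_bound)
    show "integrable lborel (\<lambda>x. \<epsilon> * indicator {x. infdist x K \<le> \<epsilon>} x :: real)"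
      using B[of \<epsilon>] infdist_le_borel by (intro integrable_mult_right integrable_real_indicator) auto
    show "AE x in lborel. norm (g x) \<le> norm (\<epsilon> * indicator {x. infdist x K \<le> \<epsilon>} x :: real)"
      using \<epsilon> infdist_nonneg[of _ K] by (intro AE_I2) (auto simp: g_def indicator_def)
  qed simp
  have D0: "(\<integral>x. D k x \<partial>lborel) = 0" for k
  proof -
    have *: "lborel = distr lborel borel ((+) ((1 / real (Suc k)) *\<^sub>R e))" by (rule lborel_distr_plus[symmetric])
    have int': "integrable lborel (\<lambda>x. g (x + (1 / real (Suc k)) *\<^sub>R e))"
      using g_int by (subst (asm) *) (simp add: integrable_distr_eq add.commute)
    have "(\<integral>x. g x \<partial>lborel) = (\<integral>x. g (x + (1 / real (Suc k)) *\<^sub>R e) \<partial>lborel)"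
      by (subst *) (simp add: integral_distr add.commute)
    then show ?thesis unfolding D_def using g_int int' by (simp add: Bochner_Integration.integral_diff)
  qed
  have lip: "\<bar>g x - g y\<bar> \<le> norm (x - y)" for x y
    using infdist_triangle_abs[of x K y] by (auto simp: g_def dist_norm min_def)
  have "(\<lambda>k. \<integral>x. D k x \<partial>lborel) \<longlonglongrightarrow> (\<integral>x. F x \<partial>lborel)"
  proof (rule integral_dominated_convergence[where w = w])
    show "integrable lborel w"
      unfolding w_def using B infdist_le_borel by (intro integrable_mult_right integrable_real_indicator) auto
    show "AE x in lborel. norm (D k x) \<le> w x" for k
    proof (intro AE_I2)
      fix x
      have "\<bar>D k x\<bar> \<le> real (Suc k) * norm ((1 / real (Suc k)) *\<^sub>R e)"
        unfolding D_def abs_mult using lip[of "x + (1 / real (Suc k)) *\<^sub>R e" x]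
        by (intro mult_mono) auto
      then have 1: "\<bar>D k x\<bar> \<le> norm e" by (simp del: of_nat_Suc)
      have "D k x = 0" if "\<not> infdist x K \<le> \<epsilon> + norm e"
      proof -
        have "norm ((1 / real (Suc k)) *\<^sub>R e) \<le> norm e"
          using mult_left_mono[of 1 "1 + real k" "norm e"] by (simp add: divide_le_eq)
        moreover have "\<bar>infdist (x + (1 / real (Suc k)) *\<^sub>R e) K - infdist x K\<bar> \<le> norm ((1 / real (Suc k)) *\<^sub>R e)"
          using infdist_triangle_abs[of "x + (1 / real (Suc k)) *\<^sub>R e" K x] by (simp add: dist_norm)
        ultimately have "infdist (x + (1 / real (Suc k)) *\<^sub>R e) K \<ge> \<epsilon>" using that by linarith
        then show ?thesis using that norm_ge_zero[of e] unfolding D_def g_def by (simp del: norm_ge_zero)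
      qed
      then show "norm (D k x) \<le> w x" using 1 by (cases "infdist x K \<le> \<epsilon> + norm e") (auto simp: w_def)
    qed
    show "AE x in lborel. (\<lambda>k. D k x) \<longlonglongrightarrow> F x"
      using AE_infdist_neq[OF \<epsilon>] AE_not_frontier
    proof eventually_elim
      fix x assume neq: "infdist x K \<noteq> \<epsilon>" and fr: "x \<in> interior K \<or> 0 < infdist x K"
      have y: "(\<lambda>k. x + (1 / real (Suc k)) *\<^sub>R e) \<longlonglongrightarrow> x"
      proof -
        have "(\<lambda>k. x + (1 / real (Suc k)) *\<^sub>R e) \<longlonglongrightarrow> x + 0 *\<^sub>R e"
          by (intro tendsto_intros LIMSEQ_Suc[OF lim_1_over_n])
        then show ?thesis by simp
      qed
      consider "x \<in> interior K" | "0 < infdist x K" "infdist x K < \<epsilon>" | "\<epsilon> < infdist x K"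
        using fr neq by fastforce
      then show "(\<lambda>k. D k x) \<longlonglongrightarrow> F x"
      proof cases
        case 1
        have x0: "infdist z K = 0" if "z \<in> interior K" for z
          using that interior_subset[of K] infdist_pos_iff[of z] infdist_nonneg[of z K] by fastforce
        have "\<forall>\<^sub>F k in sequentially. x + (1 / real (Suc k)) *\<^sub>R e \<in> interior K"
          by (rule topological_tendstoD[OF y open_interior 1])
        then have "\<forall>\<^sub>F k in sequentially. D k x = F x"
          by eventually_elim (use x0[OF 1] x0 in \<open>simp add: D_def F_def g_def shell_def\<close>)
        then show ?thesis by (rule tendsto_eventually)
      next
        case 2
        have "\<forall>\<^sub>F k in sequentially. infdist (x + (1 / real (Suc k)) *\<^sub>R e) K < \<epsilon>"
          using tendsto_infdist[OF y] 2(2) by (rule order_tendstoD)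
        then have "\<forall>\<^sub>F k in sequentially. - (real (Suc k) * (infdist (x + (1 / real (Suc k)) *\<^sub>R e) K - infdist x K)) = D k x"
          by eventually_elim (use 2 in \<open>simp add: D_def g_def min_def algebra_simps\<close>)
        moreover have "F x = - (unit_normal x \<bullet> e)" using 2 by (simp add: F_def shell_def)
        ultimately show ?thesis
          using Lim_transform_eventually[OF tendsto_minus[OF infdist_quotient_tendsto[OF 2(1), of e]]] by simp
      next
        case 3
        have "\<forall>\<^sub>F k in sequentially. \<epsilon> < infdist (x + (1 / real (Suc k)) *\<^sub>R e) K"
          using tendsto_infdist[OF y] 3 by (rule order_tendstoD)
        then have "\<forall>\<^sub>F k in sequentially. D k x = F x"
          by eventually_elim (use 3 in \<open>simp add: D_def F_def g_def shell_def\<close>)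
        then show ?thesis by (rule tendsto_eventually)
      qed
    qed
  qed (simp_all add: D_def)
  then have "(\<integral>x. F x \<partial>lborel) = 0" using D0 by (simp add: LIMSEQ_const_iff)
  then show ?thesis by (simp add: F_def)
qed

lemma integrable_bounded_surface_area:
  assumes [measurable]: "f \<in> borel_measurable borel" and "\<And>u. norm u = 1 \<Longrightarrow> \<bar>f u\<bar> \<le> (B::real)"
  shows "integrable (surface_area_measure K) f"
proof -
  interpret S: finite_measure "surface_area_measure K" by (rule finite_surface_area_measure)
  have "f \<in> borel_measurable (surface_area_measure K)"
    by (simp add: measurable_cong_sets[OF sets_surface_area_measure refl] measurable_restrict_space1)
  then show ?thesis
    using assms(2) by (intro S.integrable_const_bound[of _ B]) (auto simp: space_surface_area_measure)
qed

lemma sphere_in_algebra: "sphere 0 1 \<in> sphere_algebra"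
  by (auto simp: sets_restrict_space)

text \<open>For each \<open>\<epsilon>\<close> the surface area measure is bounded by the image, under the normal map, of
  the normalised volume of the shell of width \<open>\<epsilon>\<close>. The function \<open>1 + \<langle>u, e\<rangle>\<close> is nonnegative, and
  its linear part has integral \<open>0\<close> over the shell.\<close>

lemma integral_surface_area_le:
  assumes e: "norm e \<le> 1" and \<epsilon>: "0 < \<epsilon>"
  shows "(\<integral>u. u \<bullet> e \<partial>surface_area_measure K) + enn2real (area (sphere 0 1)) \<le> measure lborel (shell 0 \<epsilon> UNIV) / \<epsilon>"
proof -
  let ?S = "surface_area_measure K"
  interpret S: finite_measure ?S by (rule finite_surface_area_measure)
  have [measurable]: "id \<in> ?S \<rightarrow>\<^sub>M borel"
    by (simp add: measurable_cong_sets[OF sets_surface_area_measure refl] measurable_restrict_space1)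
  have sh [measurable]: "shell 0 \<epsilon> UNIV \<in> sets borel" by simp
  define S' where "S' = distr ?S borel id"
  define \<mu> where "\<mu> = distr (density lborel (\<lambda>x. ennreal (1 / \<epsilon>) * indicator (shell 0 \<epsilon> UNIV) x)) borel unit_normal"
  have "S' \<le> \<mu>"
  proof (subst le_measure)
    show "sets S' = sets \<mu>" by (simp add: S'_def \<mu>_def)
    have "emeasure S' A \<le> emeasure \<mu> A" if "A \<in> sets S'" for A
    proof -
      have A [measurable]: "A \<in> sets borel" using that by (simp add: S'_def)
      have "emeasure S' A = emeasure ?S (A \<inter> sphere 0 1)"
        using A unfolding S'_def by (subst emeasure_distr) (auto simp: space_surface_area_measure)
      also have "\<dots> \<le> area_approx \<epsilon> (A \<inter> sphere 0 1)"
        using \<epsilon> A by (subst emeasure_surface_area_measure) (auto intro!: area_le_approx simp: sets_restrict_space)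
      also have "\<dots> = ennreal (1 / \<epsilon>) * emeasure lborel (shell 0 \<epsilon> (A \<inter> sphere 0 1))"
        using \<epsilon> by (simp add: area_approx_def local_parallel_set_eq_shell divide_ennreal_def inverse_ennreal mult.commute inverse_eq_divide)
      also have "shell 0 \<epsilon> (A \<inter> sphere 0 1) = shell 0 \<epsilon> UNIV \<inter> unit_normal -` A"
        by (auto simp: shell_def norm_unit_normal)
      also have "ennreal (1 / \<epsilon>) * emeasure lborel \<dots> = emeasure \<mu> A"
        using A sh measurable_sets[OF unit_normal_measurable A] unfolding \<mu>_def
        by (subst emeasure_distr) (auto simp: emeasure_density nn_integral_cmult mult.assoc indicator_inter_arith[symmetric])
      finally show ?thesis .
    qed
    then show "\<forall>A\<in>sets S'. emeasure S' A \<le> emeasure \<mu> A" by blast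
  qed
  then have "(\<integral>\<^sup>+u. ennreal (1 + u \<bullet> e) \<partial>S') \<le> (\<integral>\<^sup>+u. ennreal (1 + u \<bullet> e) \<partial>\<mu>)"
    by (intro nn_integral_mono_measure) (auto simp: S'_def \<mu>_def)
  also have "(\<integral>\<^sup>+u. ennreal (1 + u \<bullet> e) \<partial>S') = (\<integral>\<^sup>+u. ennreal (1 + u \<bullet> e) \<partial>?S)"
    unfolding S'_def by (subst nn_integral_distr) auto
  also have "\<dots> = ennreal (\<integral>u. 1 + u \<bullet> e \<partial>?S)"
  proof (rule nn_integral_eq_integral)
    show "integrable ?S (\<lambda>u. 1 + u \<bullet> e)"
    proof (rule integrable_bounded_surface_area[of _ "1 + 1"])
      show "\<bar>1 + u \<bullet> e\<bar> \<le> 1 + 1" if "norm u = 1" for u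
        using Cauchy_Schwarz_ineq2[of u e] that e by simp
    qed simp
    show "AE u in ?S. 0 \<le> 1 + u \<bullet> e"
    proof (rule AE_I2)
      fix u assume "u \<in> space ?S"
      then show "0 \<le> 1 + u \<bullet> e"
        using Cauchy_Schwarz_ineq2[of u e] e by (auto simp: space_surface_area_measure)
    qed
  qed
  also have "(\<integral>u. 1 + u \<bullet> e \<partial>?S) = enn2real (area (sphere 0 1)) + (\<integral>u. u \<bullet> e \<partial>?S)"
  proof -
    have "integrable ?S (\<lambda>u. u \<bullet> e)"
    proof (rule integrable_bounded_surface_area[of _ 1])
      show "\<bar>u \<bullet> e\<bar> \<le> 1" if "norm u = 1" for u
        using Cauchy_Schwarz_ineq2[of u e] that e by simp
    qed simp
    moreover have "measure ?S (space ?S) = enn2real (area (sphere 0 1))"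
      unfolding measure_def space_surface_area_measure emeasure_surface_area_measure[OF sphere_in_algebra] ..
    ultimately show ?thesis by simp
  qed
  also have "(\<integral>\<^sup>+u. ennreal (1 + u \<bullet> e) \<partial>\<mu>) = (\<integral>\<^sup>+x. ennreal (1 / \<epsilon> * (indicator (shell 0 \<epsilon> UNIV) x * (1 + unit_normal x \<bullet> e))) \<partial>lborel)"
    unfolding \<mu>_def using \<epsilon>
    by (subst nn_integral_distr, measurable, subst nn_integral_density, measurable)
       (auto intro!: nn_integral_cong simp: ennreal_mult'' indicator_def ennreal_mult'[symmetric])
  also have "\<dots> = ennreal (\<integral>x. 1 / \<epsilon> * (indicator (shell 0 \<epsilon> UNIV) x * (1 + unit_normal x \<bullet> e)) \<partial>lborel)"
  proof (rule nn_integral_eq_integral)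
    have 1: "\<bar>unit_normal x \<bullet> e\<bar> \<le> 1" if "x \<in> shell 0 \<epsilon> UNIV" for x
      using Cauchy_Schwarz_ineq2[of "unit_normal x" e] norm_unit_normal[of x] that e by (auto simp: shell_def)
    show "integrable lborel (\<lambda>x. 1 / \<epsilon> * (indicator (shell 0 \<epsilon> UNIV) x * (1 + unit_normal x \<bullet> e)))"
    proof (rule Bochner_Integration.integrable_bound)
      show "integrable lborel (\<lambda>x. 2 / \<epsilon> * indicator (shell 0 \<epsilon> UNIV) x :: real)"
        using emeasure_shell_finite[of 0 \<epsilon> UNIV] by (intro integrable_mult_right integrable_real_indicator) auto
      show "AE x in lborel. norm (1 / \<epsilon> * (indicator (shell 0 \<epsilon> UNIV) x * (1 + unit_normal x \<bullet> e)))
          \<le> norm (2 / \<epsilon> * indicator (shell 0 \<epsilon> UNIV) x :: real)"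
      proof (rule AE_I2)
        fix x
        show "norm (1 / \<epsilon> * (indicator (shell 0 \<epsilon> UNIV) x * (1 + unit_normal x \<bullet> e)))
          \<le> norm (2 / \<epsilon> * indicator (shell 0 \<epsilon> UNIV) x :: real)"
          using 1[of x] \<epsilon> by (cases "x \<in> shell 0 \<epsilon> UNIV") (auto simp: divide_right_mono)
      qed
    qed measurable
    show "AE x in lborel. 0 \<le> 1 / \<epsilon> * (indicator (shell 0 \<epsilon> UNIV) x * (1 + unit_normal x \<bullet> e))"
    proof (rule AE_I2)
      fix x
      show "0 \<le> 1 / \<epsilon> * (indicator (shell 0 \<epsilon> UNIV) x * (1 + unit_normal x \<bullet> e))"
        using 1[of x] \<epsilon> by (cases "x \<in> shell 0 \<epsilon> UNIV") auto
    qed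
  qed
  also have "(\<integral>x. 1 / \<epsilon> * (indicator (shell 0 \<epsilon> UNIV) x * (1 + unit_normal x \<bullet> e)) \<partial>lborel) = measure lborel (shell 0 \<epsilon> UNIV) / \<epsilon>"
  proof -
    have 1: "integrable lborel (indicator (shell 0 \<epsilon> UNIV) :: 'a \<Rightarrow> real)"
      using emeasure_shell_finite[of 0 \<epsilon> UNIV] by (intro integrable_real_indicator) auto
    have 2: "integrable lborel (\<lambda>x. indicator (shell 0 \<epsilon> UNIV) x * (unit_normal x \<bullet> e))"
    proof (rule Bochner_Integration.integrable_bound[OF 1])
      show "AE x in lborel. norm (indicator (shell 0 \<epsilon> UNIV) x * (unit_normal x \<bullet> e)) \<le> norm (indicator (shell 0 \<epsilon> UNIV) x :: real)"
      proof (rule AE_I2)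
        fix x
        show "norm (indicator (shell 0 \<epsilon> UNIV) x * (unit_normal x \<bullet> e)) \<le> norm (indicator (shell 0 \<epsilon> UNIV) x :: real)"
          using Cauchy_Schwarz_ineq2[of "unit_normal x" e] norm_unit_normal[of x] e
          by (cases "x \<in> shell 0 \<epsilon> UNIV") (auto simp: shell_def)
      qed
    qed measurable
    have "(\<integral>x. 1 / \<epsilon> * (indicator (shell 0 \<epsilon> UNIV) x * (1 + unit_normal x \<bullet> e)) \<partial>lborel) =
        1 / \<epsilon> * (\<integral>x. indicator (shell 0 \<epsilon> UNIV) x + indicator (shell 0 \<epsilon> UNIV) x * (unit_normal x \<bullet> e) \<partial>lborel)"
      by (subst integral_mult_right_zero[symmetric]) (intro Bochner_Integration.integral_cong refl, simp add: algebra_simps)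
    also have "\<dots> = 1 / \<epsilon> * (measure lborel (shell 0 \<epsilon> UNIV) + 0)"
      by (subst Bochner_Integration.integral_add[OF 1 2]) (simp add: integral_unit_normal_shell[OF \<epsilon>])
    finally show ?thesis by simp
  qed
  finally show ?thesis using \<epsilon> by (subst (asm) ennreal_le_iff) (auto simp: add.commute)
qed

text \<open>As \<open>\<epsilon>\<close> tends to \<open>0\<close> the bound becomes \<open>\<integral> \<langle>u, e\<rangle> S(du) \<le> 0\<close>, for \<open>e\<close> as well as for \<open>- e\<close>.\<close>

lemma integral_surface_area_inner: "(\<integral>u. u \<bullet> e \<partial>surface_area_measure K) = 0"
proof -
  have le: "(\<integral>u. u \<bullet> e \<partial>surface_area_measure K) \<le> 0" if e: "norm e \<le> 1" for e
  proof -
    have "((\<lambda>\<epsilon>. area_approx \<epsilon> (sphere 0 1)) \<longlongrightarrow> ennreal (enn2real (area (sphere 0 1)))) (at_right 0)"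
      using area_finite[of "sphere 0 1"] area_approx_tendsto[OF sphere_algebraD(1)[OF sphere_in_algebra]]
      by (simp add: less_top)
    then have "((\<lambda>\<epsilon>. enn2real (area_approx \<epsilon> (sphere 0 1))) \<longlongrightarrow> enn2real (area (sphere 0 1))) (at_right 0)"
      by (rule tendsto_enn2real) simp
    moreover have "\<forall>\<^sub>F \<epsilon> in at_right 0. (\<integral>u. u \<bullet> e \<partial>surface_area_measure K) + enn2real (area (sphere 0 1))
        \<le> enn2real (area_approx \<epsilon> (sphere 0 1))"
      using eventually_at_right_less[of "0::real"]
    proof eventually_elim
      fix \<epsilon> :: real assume "0 < \<epsilon>"
      moreover have "shell 0 \<epsilon> (sphere 0 1) = shell 0 \<epsilon> UNIV" by (auto simp: shell_def norm_unit_normal)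
      ultimately show "(\<integral>u. u \<bullet> e \<partial>surface_area_measure K) + enn2real (area (sphere 0 1))
        \<le> enn2real (area_approx \<epsilon> (sphere 0 1))"
        using integral_surface_area_le[OF e] by (simp add: area_approx_eq)
    qed
    ultimately have "(\<integral>u. u \<bullet> e \<partial>surface_area_measure K) + enn2real (area (sphere 0 1)) \<le> enn2real (area (sphere 0 1))"
      by (intro tendsto_lowerbound) auto
    then show ?thesis by simp
  qed
  \<comment> \<open>The bound holds for vectors of length at most \<open>1\<close>; the general case is a matter of scaling.\<close>
  define e' where "e' = sgn e"
  have "(\<integral>u. u \<bullet> e' \<partial>surface_area_measure K) = 0"
  proof -
    have n: "norm e' \<le> 1" by (simp add: e'_def norm_sgn)
    then have "norm (- e') \<le> 1" by simp
    then show ?thesis using le[OF n] le[of "- e'"] by simp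
  qed
  moreover have "e = norm e *\<^sub>R e'" by (cases "e = 0") (simp_all add: e'_def sgn_div_norm)
  then have "(\<integral>u. u \<bullet> e \<partial>surface_area_measure K) = norm e * (\<integral>u. u \<bullet> e' \<partial>surface_area_measure K)"
    by (metis (mono_tags, lifting) Bochner_Integration.integral_cong inner_scaleR_right integral_mult_right_zero)
  ultimately show ?thesis by simp
qed

end

section \<open>Hausdorff outer measure\<close>

abbreviation cover_cost :: "nat \<Rightarrow> 'a::metric_space set \<Rightarrow> ennreal" where
  "cover_cost k U \<equiv> (if U = {} then 0 else ennreal (diameter U ^ k))"

abbreviation fine_covers :: "real \<Rightarrow> 'a::metric_space set \<Rightarrow> (nat \<Rightarrow> 'a set) set" where
  "fine_covers \<delta> A \<equiv> {U :: nat \<Rightarrow> 'a set. A \<subseteq> (\<Union>i. U i) \<and> (\<forall>i. bounded (U i) \<and> diameter (U i) \<le> \<delta>)}"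

lemma hausdorff_pre_le:
  "U \<in> fine_covers \<delta> A \<Longrightarrow> hausdorff_pre k \<delta> A \<le> (\<Sum>i. cover_cost k (U i))"
  unfolding hausdorff_pre_def by (rule INF_lower)

lemma hausdorff_pre_geI:
  "(\<And>U. U \<in> fine_covers \<delta> A \<Longrightarrow> x \<le> (\<Sum>i. cover_cost k (U i))) \<Longrightarrow> x \<le> hausdorff_pre k \<delta> A"
  unfolding hausdorff_pre_def by (rule INF_greatest)

lemma hausdorff_pre_lessD:
  "hausdorff_pre k \<delta> A < x \<Longrightarrow> \<exists>U\<in>fine_covers \<delta> A. (\<Sum>i. cover_cost k (U i)) < x"
  unfolding hausdorff_pre_def INF_less_iff by blast

lemma hausdorff_pre_mono: "A \<subseteq> B \<Longrightarrow> hausdorff_pre k \<delta> A \<le> hausdorff_pre k \<delta> B"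
  by (rule hausdorff_pre_geI, rule hausdorff_pre_le) auto

lemma hausdorff_pre_antimono: "\<delta> \<le> \<delta>' \<Longrightarrow> hausdorff_pre k \<delta>' A \<le> hausdorff_pre k \<delta> A"
  by (rule hausdorff_pre_geI, rule hausdorff_pre_le) (auto intro: order_trans)

lemma hausdorff_pre_le_raw: "0 < \<delta> \<Longrightarrow> hausdorff_pre k \<delta> A \<le> hausdorff_raw k A"
  unfolding hausdorff_raw_def by (rule SUP_upper) auto

lemma hausdorff_raw_leI: "(\<And>\<delta>. 0 < \<delta> \<Longrightarrow> hausdorff_pre k \<delta> A \<le> x) \<Longrightarrow> hausdorff_raw k A \<le> x"
  unfolding hausdorff_raw_def by (rule SUP_least) auto

lemma hausdorff_raw_mono: "A \<subseteq> B \<Longrightarrow> hausdorff_raw k A \<le> hausdorff_raw k B"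
  by (rule hausdorff_raw_leI) (meson hausdorff_pre_le_raw hausdorff_pre_mono order_trans)

lemma hausdorff_raw_empty [simp]: "hausdorff_raw k {} = 0"
proof -
  have "hausdorff_pre k \<delta> ({} :: 'a set) \<le> 0" if "0 < \<delta>" for \<delta>
    using hausdorff_pre_le[where U = "\<lambda>_. {}" and \<delta> = \<delta> and A = "{} :: 'a set" and k = k] that by (simp add: diameter_def)
  then have "hausdorff_raw k ({} :: 'a set) \<le> 0" by (rule hausdorff_raw_leI)
  then show ?thesis by simp
qed

lemma hausdorff_pre_le_sum:
  assumes I: "finite I" "A \<subseteq> (\<Union>i\<in>I. U i)" and \<delta>: "0 \<le> \<delta>"
    and U: "\<And>i. i \<in> I \<Longrightarrow> bounded (U i) \<and> diameter (U i) \<le> \<delta>"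
  shows "hausdorff_pre k \<delta> A \<le> (\<Sum>i\<in>I. cover_cost k (U i))"
proof -
  obtain e where e: "bij_betw e {..<card I} I"
    using ex_bij_betw_nat_finite[OF I(1)] by (auto simp: atLeast0LessThan)
  define V where "V n = (if n < card I then U (e n) else {})" for n
  have eI: "n < card I \<Longrightarrow> e n \<in> I" for n using e by (auto simp: bij_betw_def)
  have "V \<in> fine_covers \<delta> A"
  proof -
    have "\<exists>n. x \<in> V n" if "x \<in> A" for x
    proof -
      obtain i where i: "i \<in> I" "x \<in> U i" using I(2) \<open>x \<in> A\<close> by blast
      then have "i \<in> e ` {..<card I}" using bij_betw_imp_surj_on[OF e] by simp
      then obtain n where "n < card I" "e n = i" by auto
      then show ?thesis using i(2) by (intro exI[of _ n]) (simp add: V_def)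
    qed
    moreover have "bounded (V n) \<and> diameter (V n) \<le> \<delta>" for n
      using U eI \<delta> by (simp add: V_def)
    ultimately show ?thesis by blast
  qed
  then have "hausdorff_pre k \<delta> A \<le> (\<Sum>n. cover_cost k (V n))" by (rule hausdorff_pre_le)
  also have "\<dots> = (\<Sum>n<card I. cover_cost k (V n))"
    by (rule suminf_finite) (auto simp: V_def)
  also have "\<dots> = (\<Sum>n<card I. cover_cost k (U (e n)))"
    by (rule sum.cong) (auto simp: V_def)
  also have "\<dots> = (\<Sum>i\<in>I. cover_cost k (U i))"
    by (rule sum.reindex_bij_betw[OF e])
  finally show ?thesis .
qed

lemma hausdorff_pre_subadditive:
  fixes A :: "nat \<Rightarrow> 'a::metric_space set"
  shows "hausdorff_pre k \<delta> (\<Union>n. A n) \<le> (\<Sum>n. hausdorff_pre k \<delta> (A n))"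
proof (cases "\<exists>n. hausdorff_pre k \<delta> (A n) = \<infinity>")
  case True
  then obtain n where "hausdorff_pre k \<delta> (A n) = \<infinity>" by auto
  then have "(\<Sum>n. hausdorff_pre k \<delta> (A n)) = \<infinity>"
    using sum_le_suminf[of "\<lambda>n. hausdorff_pre k \<delta> (A n)" "{n}"] by (simp add: top_unique)
  then show ?thesis by simp
next
  case False
  show ?thesis
  proof (rule ennreal_le_epsilon)
    fix e :: real assume "0 < e"
    have "\<exists>U. U \<in> fine_covers \<delta> (A n) \<and> (\<Sum>i. cover_cost k (U i)) \<le> hausdorff_pre k \<delta> (A n) + ennreal (e * (1/2) ^ Suc n)" for n
    proof -
      have "hausdorff_pre k \<delta> (A n) < hausdorff_pre k \<delta> (A n) + ennreal (e * (1/2) ^ Suc n)"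
        using ennreal_add_left_cancel_less[of "hausdorff_pre k \<delta> (A n)" 0 "ennreal (e * (1/2) ^ Suc n)"]
          \<open>0 < e\<close> False by simp
      from hausdorff_pre_lessD[OF this] obtain U where "U \<in> fine_covers \<delta> (A n)"
        "(\<Sum>i. cover_cost k (U i)) < hausdorff_pre k \<delta> (A n) + ennreal (e * (1/2) ^ Suc n)"
        by (rule bexE)
      then show ?thesis by (intro exI[of _ U] conjI less_imp_le)
    qed
    then have "\<exists>U. \<forall>n. U n \<in> fine_covers \<delta> (A n) \<and>
        (\<Sum>i. cover_cost k (U n i)) \<le> hausdorff_pre k \<delta> (A n) + ennreal (e * (1/2) ^ Suc n)"
      by (rule choice[OF allI])
    then obtain U where UU: "\<forall>n. U n \<in> fine_covers \<delta> (A n) \<and>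
        (\<Sum>i. cover_cost k (U n i)) \<le> hausdorff_pre k \<delta> (A n) + ennreal (e * (1/2) ^ Suc n)"
      by (rule exE)
    have U: "U n \<in> fine_covers \<delta> (A n)" for n
      by (rule conjunct1[OF UU[THEN spec]])
    have Us: "(\<Sum>i. cover_cost k (U n i)) \<le> hausdorff_pre k \<delta> (A n) + ennreal (e * (1/2) ^ Suc n)" for n
      by (rule conjunct2[OF UU[THEN spec]])
    define V where "V m = (case prod_decode m of (n, i) \<Rightarrow> U n i)" for m
    have "V \<in> fine_covers \<delta> (\<Union>n. A n)"
    proof -
      have "\<exists>m. x \<in> V m" if "x \<in> A n" for x n
      proof -
        obtain i where "x \<in> U n i" using U[of n] \<open>x \<in> A n\<close> by blast
        then show ?thesis by (intro exI[of _ "prod_encode (n, i)"]) (simp add: V_def)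
      qed
      moreover have "bounded (V m) \<and> diameter (V m) \<le> \<delta>" for m
        using U[of "fst (prod_decode m)"] unfolding V_def case_prod_beta by simp
      ultimately show ?thesis by auto
    qed
    then have "hausdorff_pre k \<delta> (\<Union>n. A n) \<le> (\<Sum>m. cover_cost k (V m))" by (rule hausdorff_pre_le)
    also have "\<dots> = (\<Sum>m. (\<lambda>(n, i). cover_cost k (U n i)) (prod_decode m))"
      unfolding V_def case_prod_beta ..
    also have "\<dots> = (\<Sum>n. \<Sum>i. cover_cost k (U n i))"
      by (rule suminf_ennreal_2dimen[unfolded o_def]) (simp only: prod.case)
    also have "\<dots> \<le> (\<Sum>n. hausdorff_pre k \<delta> (A n) + ennreal (e * (1/2) ^ Suc n))"
      by (rule suminf_le[OF Us]) simp_all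
    also have "\<dots> = (\<Sum>n. hausdorff_pre k \<delta> (A n)) + (\<Sum>n. ennreal (e * (1/2) ^ Suc n))"
      by (subst suminf_add) auto
    also have "(\<Sum>n. ennreal (e * (1/2) ^ Suc n)) = ennreal e"
    proof -
      have "(\<lambda>n. e * (1/2) ^ Suc n) sums (e * 1)" by (intro sums_mult power_half_series)
      then have "(\<Sum>n. e * (1/2) ^ Suc n) = e" "summable (\<lambda>n. e * (1/2) ^ Suc n)"
        by (simp_all only: sums_iff mult_1_right)
      then show ?thesis using \<open>0 < e\<close> by (subst suminf_ennreal2) (simp_all only: zero_le_mult_iff, simp_all)
    qed
    finally show "hausdorff_pre k \<delta> (\<Union>n. A n) \<le> (\<Sum>n. hausdorff_pre k \<delta> (A n)) + ennreal e" .
  qed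
qed

lemma hausdorff_raw_subadditive:
  fixes A :: "nat \<Rightarrow> 'a::metric_space set"
  shows "hausdorff_raw k (\<Union>n. A n) \<le> (\<Sum>n. hausdorff_raw k (A n))"
proof (rule hausdorff_raw_leI)
  fix \<delta> :: real assume "0 < \<delta>"
  have "hausdorff_pre k \<delta> (\<Union>n. A n) \<le> (\<Sum>n. hausdorff_pre k \<delta> (A n))" by (rule hausdorff_pre_subadditive)
  also have "\<dots> \<le> (\<Sum>n. hausdorff_raw k (A n))"
    using \<open>0 < \<delta>\<close> by (intro suminf_le hausdorff_pre_le_raw) auto
  finally show "hausdorff_pre k \<delta> (\<Union>n. A n) \<le> (\<Sum>n. hausdorff_raw k (A n))" .
qed

lemma hausdorff_raw_countable_subadditive:
  fixes A :: "'i \<Rightarrow> 'a::metric_space set"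
  assumes "countable I"
  shows "hausdorff_raw k (\<Union>i\<in>I. A i) \<le> (\<integral>\<^sup>+i. hausdorff_raw k (A i) \<partial>count_space I)"
proof -
  define B where "B n = (if n \<in> to_nat_on I ` I then A (from_nat_into I n) else {})" for n
  have "(\<Union>i\<in>I. A i) \<subseteq> (\<Union>n. B n)"
  proof
    fix x assume "x \<in> (\<Union>i\<in>I. A i)"
    then obtain i where "i \<in> I" "x \<in> A i" by auto
    then show "x \<in> (\<Union>n. B n)" using assms by (intro UN_I[of "to_nat_on I i"]) (auto simp: B_def)
  qed
  then have "hausdorff_raw k (\<Union>i\<in>I. A i) \<le> hausdorff_raw k (\<Union>n. B n)" by (rule hausdorff_raw_mono)
  also have "\<dots> \<le> (\<Sum>n. hausdorff_raw k (B n))" by (rule hausdorff_raw_subadditive)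
  also have "\<dots> = (\<integral>\<^sup>+n. hausdorff_raw k (B n) \<partial>count_space UNIV)" by (simp add: nn_integral_count_space_nat)
  also have "\<dots> = (\<integral>\<^sup>+n. hausdorff_raw k (B n) \<partial>count_space (to_nat_on I ` I))"
    by (rule nn_integral_count_space_eq) (auto simp: B_def)
  also have "\<dots> = (\<integral>\<^sup>+i. hausdorff_raw k (B (to_nat_on I i)) \<partial>count_space I)"
    using assms by (subst nn_integral_bij_count_space[symmetric, where g = "to_nat_on I" and A = I])
      (auto simp: bij_betw_def inj_on_to_nat_on)
  also have "\<dots> = (\<integral>\<^sup>+i. hausdorff_raw k (A i) \<partial>count_space I)"
    using assms by (intro nn_integral_cong) (auto simp: B_def)
  finally show ?thesis .
qed

lemma hausdorff_raw_Un_le: "hausdorff_raw k (A \<union> B) \<le> hausdorff_raw k A + hausdorff_raw k B"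
proof -
  have "hausdorff_raw k (\<Union>b\<in>UNIV. if b then A else B) \<le> (\<integral>\<^sup>+b. hausdorff_raw k (if b then A else B) \<partial>count_space UNIV)"
    by (rule hausdorff_raw_countable_subadditive) auto
  also have "\<dots> = hausdorff_raw k A + hausdorff_raw k B"
    by (subst nn_integral_count_space_finite) (auto simp: UNIV_bool add.commute)
  also have "(\<Union>b\<in>UNIV. if b then A else B) = A \<union> B" by (auto split: if_splits)
  finally show ?thesis .
qed

lemma diameter_Lipschitz_image_le:
  assumes b: "bounded U" and L: "0 \<le> L" and lip: "\<And>x y. x \<in> U \<Longrightarrow> y \<in> U \<Longrightarrow> dist (f x) (f y) \<le> L * dist x y"
  shows "bounded (f ` U)" "diameter (f ` U) \<le> L * diameter U"
proof -
  have le: "dist (f x) (f y) \<le> L * diameter U" if "x \<in> U" "y \<in> U" for x y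
    using lip[OF that] mult_left_mono[OF diameter_bounded_bound[OF b that] L] by linarith
  show "bounded (f ` U)"
  proof (cases "U = {}")
    case False
    then obtain x where "x \<in> U" by auto
    then show ?thesis using le unfolding bounded_def by auto
  qed simp
  show "diameter (f ` U) \<le> L * diameter U"
  proof (cases "U = {}")
    case False
    then show ?thesis unfolding diameter_def[of "f ` U"] using le by (auto intro!: cSUP_least)
  qed (simp add: diameter_def)
qed

lemma hausdorff_raw_Lipschitz_image_le:
  fixes f :: "'a::metric_space \<Rightarrow> 'b::metric_space"
  assumes L: "0 < L" and lip: "\<And>x y. x \<in> A \<Longrightarrow> y \<in> A \<Longrightarrow> dist (f x) (f y) \<le> L * dist x y"
  shows "hausdorff_raw k (f ` A) \<le> ennreal (L ^ k) * hausdorff_raw k A"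
proof (rule hausdorff_raw_leI)
  fix \<epsilon> :: real assume "0 < \<epsilon>"
  define \<delta> where "\<delta> = \<epsilon> / L"
  have \<delta>: "0 < \<delta>" "L * \<delta> = \<epsilon>" using L \<open>0 < \<epsilon>\<close> by (auto simp: \<delta>_def)
  have scale: "hausdorff_pre k \<epsilon> (f ` A) \<le> ennreal (L ^ k) * (\<Sum>i. cover_cost k (U i))" if U: "U \<in> fine_covers \<delta> A" for U
  proof -
    have Ub: "bounded (U i)" "diameter (U i) \<le> \<delta>" for i using U by auto
    have b: "bounded (U i \<inter> A)" for i using Ub by (auto intro: bounded_subset)
    have d: "diameter (f ` (U i \<inter> A)) \<le> L * diameter (U i)" "bounded (f ` (U i \<inter> A))" for i
    proof -
      have "diameter (f ` (U i \<inter> A)) \<le> L * diameter (U i \<inter> A)"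
        using L lip by (intro diameter_Lipschitz_image_le(2)[OF b, where f = f and L = L]) auto
      also have "\<dots> \<le> L * diameter (U i)"
        using L Ub by (intro mult_left_mono diameter_subset) auto
      finally show "diameter (f ` (U i \<inter> A)) \<le> L * diameter (U i)" .
      show "bounded (f ` (U i \<inter> A))" using L lip by (intro diameter_Lipschitz_image_le(1)[OF b, where f = f and L = L]) auto
    qed
    have "L * diameter (U i) \<le> \<epsilon>" for i using Ub(2)[of i] L \<delta>(2) by (metis mult_left_mono less_imp_le)
    then have "bounded (f ` (U i \<inter> A)) \<and> diameter (f ` (U i \<inter> A)) \<le> \<epsilon>" for i
      using d order_trans by blast
    moreover have "f ` A \<subseteq> (\<Union>i. f ` (U i \<inter> A))"
    proof
      fix y assume "y \<in> f ` A"
      then obtain x where x: "x \<in> A" "y = f x" by auto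
      moreover obtain i where "x \<in> U i" using U x(1) by blast
      ultimately show "y \<in> (\<Union>i. f ` (U i \<inter> A))" by auto
    qed
    ultimately have "(\<lambda>i. f ` (U i \<inter> A)) \<in> fine_covers \<epsilon> (f ` A)" by simp
    then have "hausdorff_pre k \<epsilon> (f ` A) \<le> (\<Sum>i. cover_cost k (f ` (U i \<inter> A)))" by (rule hausdorff_pre_le)
    also have "\<dots> \<le> (\<Sum>i. ennreal (L ^ k) * cover_cost k (U i))"
    proof (intro suminf_le allI)
      fix i
      show "cover_cost k (f ` (U i \<inter> A)) \<le> ennreal (L ^ k) * cover_cost k (U i)"
        using power_mono[OF d(1)[of i] diameter_ge_0[OF d(2)], of k] L
        by (auto simp: ennreal_mult'[symmetric] power_mult_distrib intro!: ennreal_leI)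
    qed auto
    also have "\<dots> = ennreal (L ^ k) * (\<Sum>i. cover_cost k (U i))" by (rule ennreal_suminf_cmult)
    finally show ?thesis .
  qed
  have le: "ennreal (1 / L ^ k) * hausdorff_pre k \<epsilon> (f ` A) \<le> (\<Sum>i. cover_cost k (U i))" if "U \<in> fine_covers \<delta> A" for U
  proof -
    have "ennreal (1 / L ^ k) * hausdorff_pre k \<epsilon> (f ` A) \<le> ennreal (1 / L ^ k) * (ennreal (L ^ k) * (\<Sum>i. cover_cost k (U i)))"
      using scale[OF that] by (rule mult_left_mono) simp
    also have "\<dots> = (\<Sum>i. cover_cost k (U i))"
      using L by (simp add: mult.assoc[symmetric] ennreal_mult'[symmetric] del: ennreal_suminf_cmult)
    finally show ?thesis .
  qed
  have "hausdorff_pre k \<epsilon> (f ` A) = ennreal (L ^ k) * (ennreal (1 / L ^ k) * hausdorff_pre k \<epsilon> (f ` A))"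
    using L by (simp add: mult.assoc[symmetric] ennreal_mult'[symmetric])
  also have "\<dots> \<le> ennreal (L ^ k) * hausdorff_pre k \<delta> A"
    by (intro mult_left_mono hausdorff_pre_geI le) auto
  also have "\<dots> \<le> ennreal (L ^ k) * hausdorff_raw k A"
    using \<delta> by (intro mult_left_mono hausdorff_pre_le_raw) auto
  finally show "hausdorff_pre k \<epsilon> (f ` A) \<le> ennreal (L ^ k) * hausdorff_raw k A" .
qed

lemma hausdorff_raw_isometry_image:
  fixes f :: "'a::metric_space \<Rightarrow> 'b::metric_space"
  assumes iso: "\<And>x y. dist (f x) (f y) = dist x y"
  shows "hausdorff_raw k (f ` A) = hausdorff_raw k A"
proof (rule antisym)
  show "hausdorff_raw k (f ` A) \<le> hausdorff_raw k A"
    using hausdorff_raw_Lipschitz_image_le[of 1 A f k] iso by simp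
  have inj: "inj f" using iso by (metis dist_eq_0_iff injI)
  then have "hausdorff_raw k A = hausdorff_raw k (inv f ` f ` A)" by (simp add: image_comp)
  also have "\<dots> \<le> hausdorff_raw k (f ` A)"
  proof -
    have "dist (inv f x) (inv f y) \<le> 1 * dist x y" if "x \<in> f ` A" "y \<in> f ` A" for x y
      using that iso inj by (auto simp: inv_f_f)
    then show ?thesis using hausdorff_raw_Lipschitz_image_le[of 1 "f ` A" "inv f" k] by simp
  qed
  finally show "hausdorff_raw k A \<le> hausdorff_raw k (f ` A)" .
qed

text \<open>A covering set of diameter smaller than the distance of \<open>A\<close> and \<open>B\<close> meets only one of them,
  so that a fine cover of the union splits.\<close>

lemma hausdorff_raw_separated:
  assumes r: "0 < r" and sep: "\<And>x y. x \<in> A \<Longrightarrow> y \<in> B \<Longrightarrow> r \<le> dist x y"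
  shows "hausdorff_raw k A + hausdorff_raw k B \<le> hausdorff_raw k (A \<union> B)"
proof -
  have le: "hausdorff_pre k \<delta> A + hausdorff_pre k \<delta> B \<le> hausdorff_pre k \<delta> (A \<union> B)" if \<delta>: "0 < \<delta>" "\<delta> < r" for \<delta>
  proof (rule hausdorff_pre_geI)
    fix U assume U: "U \<in> fine_covers \<delta> (A \<union> B)"
    define V where "V C i = (if U i \<inter> C = {} then {} else U i)" for C i
    have cov: "V C \<in> fine_covers \<delta> C" if "C \<subseteq> A \<union> B" for C
    proof -
      have "\<exists>i. x \<in> V C i" if "x \<in> C" for x
      proof -
        have "x \<in> (\<Union>i. U i)" using U \<open>x \<in> C\<close> \<open>C \<subseteq> A \<union> B\<close> by blast
        then obtain i where "x \<in> U i" by auto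
        then show ?thesis using \<open>x \<in> C\<close> by (intro exI[of _ i]) (auto simp: V_def)
      qed
      moreover have "bounded (V C i) \<and> diameter (V C i) \<le> \<delta>" for i
        using U \<delta> by (simp add: V_def)
      ultimately show ?thesis by blast
    qed
    have one: "U i \<inter> A = {} \<or> U i \<inter> B = {}" for i
    proof (rule ccontr)
      assume "\<not> ?thesis"
      then obtain x y where "x \<in> U i" "y \<in> U i" "x \<in> A" "y \<in> B" by auto
      moreover have "bounded (U i)" "diameter (U i) \<le> \<delta>" using U by auto
      ultimately have "dist x y \<le> \<delta>" by (meson diameter_bounded_bound order_trans)
      then show False using sep[OF \<open>x \<in> A\<close> \<open>y \<in> B\<close>] \<delta> by simp
    qed
    have "hausdorff_pre k \<delta> A + hausdorff_pre k \<delta> B \<le> (\<Sum>i. cover_cost k (V A i)) + (\<Sum>i. cover_cost k (V B i))"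
      by (intro add_mono hausdorff_pre_le cov) auto
    also have "\<dots> = (\<Sum>i. cover_cost k (V A i) + cover_cost k (V B i))" by (subst suminf_add) auto
    also have "\<dots> \<le> (\<Sum>i. cover_cost k (U i))"
    proof (intro suminf_le allI)
      fix i show "cover_cost k (V A i) + cover_cost k (V B i) \<le> cover_cost k (U i)"
        using one[of i] by (auto simp: V_def)
    qed auto
    finally show "hausdorff_pre k \<delta> A + hausdorff_pre k \<delta> B \<le> (\<Sum>i. cover_cost k (U i))" .
  qed
  have conv: "((\<lambda>\<delta>. hausdorff_pre k \<delta> C) \<longlongrightarrow> hausdorff_raw k C) (at_right 0)" for C :: "'a set"
  proof (rule order_tendstoI)
    fix a assume "a < hausdorff_raw k C"
    then obtain t where t: "t > 0" "a < hausdorff_pre k t C" by (auto simp: hausdorff_raw_def less_SUP_iff)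
    then show "\<forall>\<^sub>F \<delta> in at_right 0. a < hausdorff_pre k \<delta> C"
      unfolding eventually_at_right_field
      by (intro exI[of _ t]) (meson hausdorff_pre_antimono less_imp_le less_le_trans)
  next
    fix a assume "hausdorff_raw k C < a"
    then show "\<forall>\<^sub>F \<delta> in at_right 0. hausdorff_pre k \<delta> C < a"
      using eventually_at_right_less[of "0::real"]
      by (auto elim!: eventually_mono intro: le_less_trans hausdorff_pre_le_raw)
  qed
  show ?thesis
  proof (rule tendsto_le[OF _ conv tendsto_add[OF conv conv]])
    show "\<forall>\<^sub>F \<delta> in at_right 0. hausdorff_pre k \<delta> A + hausdorff_pre k \<delta> B \<le> hausdorff_pre k \<delta> (A \<union> B)"
      unfolding eventually_at_right_field using r le by (intro exI[of _ r]) auto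
  qed simp
qed

text \<open>Disjoint compact sets have positive distance. Together with inner regularity of finite
  Borel measures this gives lower bounds for the Hausdorff measure of Borel sets without a proof
  that they are measurable in the sense of Caratheodory.\<close>

lemma hausdorff_raw_sum_compact_le:
  fixes C :: "'i \<Rightarrow> 'a::heine_borel set"
  assumes "finite I" and "\<And>i. i \<in> I \<Longrightarrow> compact (C i)" and "disjoint_family_on C I"
  shows "(\<Sum>i\<in>I. hausdorff_raw k (C i)) \<le> hausdorff_raw k (\<Union>i\<in>I. C i)"
  using assms
proof (induction I rule: finite_induct)
  case (insert j I)
  define D where "D = (\<Union>i\<in>I. C i)"
  have D: "compact D" unfolding D_def using insert by (intro compact_UN) auto
  have Cj: "compact (C j)" "C j \<inter> D = {}"
    using insert.prems insert.hyps by (auto simp: D_def disjoint_family_on_def)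
  have "\<exists>r>0. \<forall>x\<in>C j. \<forall>y\<in>D. r \<le> dist x y"
    using separate_compact_closed[OF Cj(1) compact_imp_closed[OF D]] Cj(2) by blast
  then obtain r where r: "r > 0" "\<And>x y. x \<in> C j \<Longrightarrow> y \<in> D \<Longrightarrow> r \<le> dist x y" by blast
  have "(\<Sum>i\<in>insert j I. hausdorff_raw k (C i)) = hausdorff_raw k (C j) + (\<Sum>i\<in>I. hausdorff_raw k (C i))"
    using insert.hyps by simp
  also have "\<dots> \<le> hausdorff_raw k (C j) + hausdorff_raw k D"
    unfolding D_def using insert.prems by (intro add_left_mono insert.IH) (auto simp: disjoint_family_on_def)
  also have "\<dots> \<le> hausdorff_raw k (C j \<union> D)" using r by (rule hausdorff_raw_separated)
  finally show ?case by (simp add: D_def)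
qed simp

section \<open>Hausdorff measure on a hyperplane\<close>

text \<open>The normalisation of Hausdorff measure uses a cube spanned by \<open>d - 1\<close> chosen basis vectors;
  \<open>e\<close> is the one that is left out, so that the cube lies in the hyperplane orthogonal to \<open>e\<close>.\<close>

locale unit_hyperplane =
  fixes e :: "'a::euclidean_space"
  assumes e_Basis: "e \<in> Basis" and cube: "(SOME B. B \<subseteq> Basis \<and> card B = DIM('a) - 1) = Basis - {e}"
begin

definition codim1 :: nat where "codim1 = card (Basis - {e})"

lemma codim1_eq: "codim1 = DIM('a) - 1"
  using e_Basis by (simp add: codim1_def card_Diff_singleton)

lemma e_norm: "e \<bullet> e = 1" "norm e = 1"
  using e_Basis by auto

definition flat :: "'a \<Rightarrow> 'a" where
  "flat x = x - (x \<bullet> e) *\<^sub>R e"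

abbreviation hyperplane :: "'a set" where "hyperplane \<equiv> {x. x \<bullet> e = 0}"

lemma flat_in: "flat x \<bullet> e = 0"
  by (simp add: flat_def inner_diff e_norm)

lemma flat_inner: "b \<in> Basis \<Longrightarrow> b \<noteq> e \<Longrightarrow> flat x \<bullet> b = x \<bullet> b"
  using e_Basis by (simp add: flat_def inner_diff inner_Basis)

lemma norm_flat_le: "norm (flat x) \<le> norm x"
proof -
  have "(norm (flat x))\<^sup>2 \<le> (norm x)\<^sup>2"
    unfolding power2_norm_eq_inner flat_def by (simp add: inner_diff inner_commute e_norm power2_eq_square[symmetric])
  then show ?thesis by simp
qed

lemma continuous_on_flat: "continuous_on UNIV flat"
  unfolding flat_def[abs_def] by (intro continuous_intros)

lemma flat_measurable [measurable]: "flat \<in> borel_measurable borel"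
  by (rule borel_measurable_continuous_onI[OF continuous_on_flat])

definition slab :: "real \<Rightarrow> 'a set \<Rightarrow> 'a set" where
  "slab s A = {x. flat x \<in> A \<and> 0 \<le> x \<bullet> e \<and> x \<bullet> e \<le> s}"

text \<open>\<open>(d-1)\<close>-dimensional Lebesgue measure on the hyperplane, as volume of a slab of height \<open>1\<close>.\<close>

definition flat_measure :: "'a measure" where
  "flat_measure = distr (density lborel (indicator {x. 0 \<le> x \<bullet> e \<and> x \<bullet> e \<le> 1})) borel flat"

lemma sets_flat_measure [simp, measurable_cong]: "sets flat_measure = sets borel"
  by (simp add: flat_measure_def)

lemma space_flat_measure [simp]: "space flat_measure = UNIV"
  by (simp add: flat_measure_def)

lemma slab_measurable [measurable]:
  assumes [measurable]: "A \<in> sets borel"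
  shows "slab s A \<in> sets borel"
  unfolding slab_def by measurable

lemma emeasure_flat_measure:
  assumes [measurable]: "A \<in> sets borel"
  shows "emeasure flat_measure A = emeasure lborel (slab 1 A)"
proof -
  have "emeasure flat_measure A = (\<integral>\<^sup>+x. indicator {x. 0 \<le> x \<bullet> e \<and> x \<bullet> e \<le> 1} x * indicator (flat -` A) x \<partial>lborel)"
    unfolding flat_measure_def
    using measurable_sets[OF flat_measurable, of A]
    by (subst emeasure_distr) (auto simp: emeasure_density)
  also have "\<dots> = (\<integral>\<^sup>+x. indicator (slab 1 A) x \<partial>lborel)"
    by (intro nn_integral_cong) (auto simp: slab_def indicator_def)
  also have "\<dots> = emeasure lborel (slab 1 A)"
    by (intro nn_integral_indicator) simp
  finally show ?thesis .
qed

text \<open>Only the coordinates of \<open>x\<close> within the hyperplane matter; the cube always lies in the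
  hyperplane.\<close>

definition flat_cube :: "'a \<Rightarrow> real \<Rightarrow> 'a set" where
  "flat_cube x s = {y. y \<bullet> e = 0 \<and> (\<forall>b\<in>Basis - {e}. x \<bullet> b \<le> y \<bullet> b \<and> y \<bullet> b \<le> x \<bullet> b + s)}"

lemma unit_cube_eq: "unit_cube codim1 = flat_cube 0 1"
  unfolding unit_cube_def cube[folded codim1_eq] Let_def flat_cube_def using e_Basis by auto

lemma flat_cube_image:
  assumes "0 < s" "x \<bullet> e = 0"
  shows "flat_cube x s = (\<lambda>y. x + s *\<^sub>R y) ` flat_cube 0 1"
proof (intro equalityI subsetI)
  fix y assume y: "y \<in> flat_cube x s"
  have "(1/s) *\<^sub>R (y - x) \<in> flat_cube 0 1"
    using y assms by (auto simp: flat_cube_def inner_diff divide_simps diff_le_eq add.commute)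
  moreover have "y = x + s *\<^sub>R ((1/s) *\<^sub>R (y - x))" using assms by simp
  ultimately show "y \<in> (\<lambda>y. x + s *\<^sub>R y) ` flat_cube 0 1" by blast
next
  fix y assume "y \<in> (\<lambda>y. x + s *\<^sub>R y) ` flat_cube 0 1"
  then show "y \<in> flat_cube x s" using assms by (auto simp: flat_cube_def inner_add)
qed

abbreviation H :: "'a set \<Rightarrow> ennreal" where "H \<equiv> hausdorff_raw codim1"

text \<open>The constant by which \<open>hausdorff\<close> divides; it only has to be positive and finite.\<close>

definition kappa :: ennreal where "kappa = H (unit_cube codim1)"

lemma H_flat_cube:
  assumes "0 < s" "x \<bullet> e = 0"
  shows "H (flat_cube x s) = ennreal (s ^ codim1) * kappa"
proof (rule antisym)
  have "dist (x + s *\<^sub>R y) (x + s *\<^sub>R z) = s * dist y z" for y z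
    using assms by (simp add: dist_norm scaleR_diff_right[symmetric])
  then show "H (flat_cube x s) \<le> ennreal (s ^ codim1) * kappa"
    unfolding flat_cube_image[OF assms] kappa_def unit_cube_eq using assms
    by (intro hausdorff_raw_Lipschitz_image_le) auto
  have eq: "flat_cube 0 1 = (\<lambda>y. (1/s) *\<^sub>R (y - x)) ` flat_cube x s"
    unfolding flat_cube_image[OF assms] image_image using assms by simp
  have "dist ((1/s) *\<^sub>R (y - x)) ((1/s) *\<^sub>R (z - x)) = (1/s) * dist y z" for y z
    using assms by (simp add: dist_norm scaleR_diff_right[symmetric])
  then have "kappa \<le> ennreal ((1/s) ^ codim1) * H (flat_cube x s)"
    unfolding kappa_def unit_cube_eq unfolding eq using assms
    by (intro hausdorff_raw_Lipschitz_image_le) auto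
  then have "ennreal (s ^ codim1) * kappa \<le> ennreal (s ^ codim1) * (ennreal ((1/s) ^ codim1) * H (flat_cube x s))"
    by (rule mult_left_mono) simp
  also have "\<dots> = H (flat_cube x s)"
    using assms by (simp add: mult.assoc[symmetric] ennreal_mult'[symmetric] power_mult_distrib[symmetric] del: power_one_over)
  finally show "ennreal (s ^ codim1) * kappa \<le> H (flat_cube x s)" .
qed

lemma prod_Basis_split: "(\<Prod>b\<in>Basis. f b) = (f e :: real) * (\<Prod>b\<in>Basis - {e}. f b)"
  using e_Basis by (simp add: prod.remove)

lemma card_Basis_minus: "card (Basis - {e}) = codim1"
  by (simp add: codim1_def)

lemma emeasure_flat_measure_cube:
  assumes "0 \<le> s"
  shows "emeasure flat_measure (flat_cube x s) = ennreal (s ^ codim1)"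
proof -
  have eq: "slab 1 (flat_cube x s) = cbox (flat x) (flat x + s *\<^sub>R (\<Sum>b\<in>Basis - {e}. b) + e)" (is "_ = cbox ?l ?u")
  proof -
    have 1: "(\<Sum>b\<in>Basis - {e}. b) \<bullet> b = (if b = e then 0 else 1)" if "b \<in> Basis" for b
      using that e_Basis by (auto simp: inner_sum_left inner_Basis sum.If_cases sum.delta)
    have "?u \<bullet> b = (if b = e then 1 else x \<bullet> b + s)" if "b \<in> Basis" for b
      using that 1[OF that] e_Basis flat_inner[OF that, of x] flat_in[of x] by (auto simp: inner_add inner_Basis e_norm)
    moreover have "?l \<bullet> b = (if b = e then 0 else x \<bullet> b)" if "b \<in> Basis" for b
      using flat_inner[OF that, of x] flat_in[of x] by auto
    moreover have "y \<in> slab 1 (flat_cube x s) \<longleftrightarrow> (\<forall>b\<in>Basis. (if b = e then 0 else x \<bullet> b) \<le> y \<bullet> b \<and> y \<bullet> b \<le> (if b = e then 1 else x \<bullet> b + s))" for y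
      using e_Basis flat_inner[of _ y] flat_in[of y] by (auto simp: slab_def flat_cube_def)
    ultimately show ?thesis by (auto simp: mem_box)
  qed
  have bm: "flat_cube x s \<in> sets borel"
    unfolding flat_cube_def by measurable
  have "emeasure flat_measure (flat_cube x s) = emeasure lborel (cbox ?l ?u)"
    using emeasure_flat_measure[OF bm] eq by simp
  also have "\<dots> = ennreal (\<Prod>b\<in>Basis. (?u - ?l) \<bullet> b)"
  proof -
    have "?l \<bullet> b \<le> ?u \<bullet> b" if "b \<in> Basis" for b
      using that assms e_Basis by (auto simp: inner_add inner_sum_left inner_Basis sum.If_cases sum_nonneg)
    then show ?thesis by (simp add: emeasure_lborel_cbox_eq)
  qed
  also have "(\<Prod>b\<in>Basis. (?u - ?l) \<bullet> b) = (\<Prod>b\<in>Basis. if b = e then 1 else s)"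
    using e_Basis by (intro prod.cong) (auto simp: inner_add inner_sum_left inner_Basis e_norm sum.delta)
  also have "\<dots> = s ^ codim1"
    using card_Basis_minus by (subst prod_Basis_split) (simp add: prod_constant[symmetric] cong: prod.cong_simp)
  finally show ?thesis .
qed

lemma flat_cube_borel [measurable]: "flat_cube x s \<in> sets borel"
  unfolding flat_cube_def by measurable

lemma norm_le_sum_flat:
  assumes "z \<bullet> e = 0" and "\<And>b. b \<in> Basis - {e} \<Longrightarrow> \<bar>z \<bullet> b\<bar> \<le> c"
  shows "norm z \<le> real codim1 * c"
proof -
  have "norm z \<le> (\<Sum>b\<in>Basis. \<bar>z \<bullet> b\<bar>)" by (rule norm_le_l1)
  also have "\<dots> = (\<Sum>b\<in>Basis - {e}. \<bar>z \<bullet> b\<bar>)" using assms(1) e_Basis by (simp add: sum.remove)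
  also have "\<dots> \<le> (\<Sum>b\<in>Basis - {e}. c)" by (intro sum_mono assms)
  finally show ?thesis by (simp add: card_Basis_minus)
qed

lemma diameter_flat_cube_le:
  assumes "0 \<le> s"
  shows "bounded (flat_cube x s)" "diameter (flat_cube x s) \<le> real codim1 * s"
proof -
  have le: "dist y z \<le> real codim1 * s" if "y \<in> flat_cube x s" "z \<in> flat_cube x s" for y z
    unfolding dist_norm
  proof (rule norm_le_sum_flat)
    show "(y - z) \<bullet> e = 0" using that by (simp add: flat_cube_def inner_diff)
    fix b assume b: "b \<in> Basis - {e}"
    have "x \<bullet> b \<le> y \<bullet> b" "y \<bullet> b \<le> x \<bullet> b + s" "x \<bullet> b \<le> z \<bullet> b" "z \<bullet> b \<le> x \<bullet> b + s"
      using that b unfolding flat_cube_def by blast+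
    then show "\<bar>(y - z) \<bullet> b\<bar> \<le> s" by (simp add: inner_diff abs_le_iff)
  qed
  show "bounded (flat_cube x s)"
  proof (cases "flat_cube x s = {}")
    case False
    then obtain y where "y \<in> flat_cube x s" by auto
    then show ?thesis using le unfolding bounded_def by blast
  qed simp
  show "diameter (flat_cube x s) \<le> real codim1 * s"
  proof (cases "flat_cube x s = {}")
    case False
    then show ?thesis unfolding diameter_def using le by (auto intro!: cSUP_least)
  qed (use assms in \<open>simp add: diameter_def\<close>)
qed

text \<open>Cut the cube into \<open>N\<^sup>d\<^sup>-\<^sup>1\<close> cubes of side \<open>1 / N\<close>.\<close>

lemma kappa_finite: "kappa < \<infinity>"
proof -
  have "kappa \<le> ennreal (real codim1 ^ codim1)"
    unfolding kappa_def unit_cube_eq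
  proof (rule hausdorff_raw_leI)
    fix \<delta> :: real assume "0 < \<delta>"
    obtain N :: nat where N: "N > 0" "real codim1 / \<delta> < real N"
      using reals_Archimedean2[of "max 1 (real codim1 / \<delta>)"] by (metis gr0I less_max_iff_disj max.strict_boundedE not_one_less_zero of_nat_0 max_less_iff_conj)
    define G where "G = (\<Pi>\<^sub>E b\<in>Basis - {e}. {..<N})"
    define x where "x g = (\<Sum>b\<in>Basis - {e}. (real (g b) / real N) *\<^sub>R b)" for g :: "'a \<Rightarrow> nat"
    have xb: "x g \<bullet> b = real (g b) / real N" if "b \<in> Basis - {e}" for g b
      using that unfolding x_def by (auto simp: inner_sum_left inner_Basis if_distrib[of "\<lambda>t. _ * t"] sum.delta cong: if_cong)
    define U where "U g = flat_cube (x g) (1 / real N)" for g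
    have finG: "finite G" unfolding G_def by (intro finite_PiE) auto
    have "flat_cube 0 1 \<subseteq> (\<Union>g\<in>G. U g)"
    proof
      fix y assume y: "y \<in> flat_cube 0 1"
      define g where "g = restrict (\<lambda>b. min (N - 1) (nat \<lfloor>real N * (y \<bullet> b)\<rfloor>)) (Basis - {e})"
      have "g \<in> G" using N by (auto simp: G_def g_def)
      moreover have "y \<in> U g"
      proof -
        have "x g \<bullet> b \<le> y \<bullet> b \<and> y \<bullet> b \<le> x g \<bullet> b + 1 / real N" if b: "b \<in> Basis - {e}" for b
        proof -
          have y01: "0 \<le> y \<bullet> b" "y \<bullet> b \<le> 1" using y b by (auto simp: flat_cube_def)
          define m where "m = nat \<lfloor>real N * (y \<bullet> b)\<rfloor>"
          have m: "real m \<le> real N * (y \<bullet> b)" "real N * (y \<bullet> b) < real m + 1"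
            using y01 unfolding m_def by (auto simp: of_nat_floor)
          have g: "g b = min (N - 1) m" using b by (simp add: g_def m_def)
          have "real (g b) \<le> real N * (y \<bullet> b)" using m g by (simp add: min_def of_nat_diff split: if_splits)
          moreover have "real N * (y \<bullet> b) \<le> real (g b) + 1"
          proof (cases "m \<le> N - 1")
            case True then show ?thesis using m g by simp
          next
            case False
            then have "real (g b) + 1 = real N" using g N by (simp add: of_nat_diff)
            then show ?thesis using y01 by (simp add: mult_left_le)
          qed
          ultimately show ?thesis unfolding xb[OF b] using N by (simp add: field_simps)
        qed
        then show ?thesis using y by (auto simp: U_def flat_cube_def)
      qed
      ultimately show "y \<in> (\<Union>g\<in>G. U g)" by auto
    qed
    moreover have dU: "bounded (U g) \<and> diameter (U g) \<le> real codim1 * (1 / real N)" for g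
      unfolding U_def using N by (intro conjI diameter_flat_cube_le) auto
    moreover have "real codim1 * (1 / real N) \<le> \<delta>" using N \<open>0 < \<delta>\<close> by (simp add: field_simps)
    ultimately have "hausdorff_pre codim1 \<delta> (flat_cube 0 1) \<le> (\<Sum>g\<in>G. cover_cost codim1 (U g))"
      using finG \<open>0 < \<delta>\<close> by (intro hausdorff_pre_le_sum) (auto intro: order_trans)
    also have "\<dots> \<le> (\<Sum>g\<in>G. ennreal ((real codim1 * (1 / real N)) ^ codim1))"
      using dU by (intro sum_mono) (auto intro!: ennreal_leI power_mono diameter_ge_0)
    also have "\<dots> = ennreal (real (card G) * (real codim1 * (1 / real N)) ^ codim1)"
      by (simp add: ennreal_of_nat_eq_real_of_nat ennreal_mult')
    also have "card G = N ^ codim1" by (simp add: G_def card_PiE card_Basis_minus)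
    also have "real (N ^ codim1) * (real codim1 * (1 / real N)) ^ codim1 = real codim1 ^ codim1"
      using N by (simp add: power_divide)
    finally show "hausdorff_pre codim1 \<delta> (flat_cube 0 1) \<le> ennreal (real codim1 ^ codim1)" .
  qed
  then show ?thesis by (rule le_less_trans) simp
qed

text \<open>A covering set of diameter \<open>r\<close> meets the hyperplane inside a cube of side \<open>2 r\<close>, whose
  volume is \<open>2\<^sup>d\<^sup>-\<^sup>1\<close> times the cost of the set.\<close>

lemma kappa_pos: "0 < kappa"
proof -
  have "1 \<le> ennreal (2 ^ codim1) * kappa"
  proof -
    have "1 / ennreal (2 ^ codim1) \<le> hausdorff_pre codim1 1 (flat_cube 0 1)"
    proof (rule hausdorff_pre_geI)
      fix U :: "nat \<Rightarrow> 'a set" assume U: "U \<in> fine_covers 1 (flat_cube 0 1)"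
      have Ub: "bounded (U i)" for i using U by auto
      \<comment> \<open>A cube centred at a point of \<open>U i\<close>, with half the side equal to the diameter of \<open>U i\<close>.\<close>
      define W where "W i = (if U i = {} then {} else
         flat_cube ((SOME x. x \<in> U i) - diameter (U i) *\<^sub>R (\<Sum>b\<in>Basis - {e}. b)) (2 * diameter (U i)))" for i
      have sub: "U i \<inter> hyperplane \<subseteq> W i" for i
      proof
        fix y assume y: "y \<in> U i \<inter> hyperplane"
        define x where "x = (SOME x. x \<in> U i)"
        have x: "x \<in> U i" unfolding x_def using y by (intro someI[of "\<lambda>x. x \<in> U i" y]) auto
        have "\<bar>(y - x) \<bullet> b\<bar> \<le> diameter (U i)" if "b \<in> Basis" for b
          using Basis_le_norm[OF that, of "y - x"] diameter_bounded_bound[OF Ub, of y i x] x y by (simp add: dist_norm)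
        moreover have "(\<Sum>b\<in>Basis - {e}. b) \<bullet> b = 1" if "b \<in> Basis - {e}" for b
          using that by (auto simp: inner_sum_left inner_Basis sum.delta)
        ultimately show "y \<in> W i" using y by (fastforce simp: W_def flat_cube_def x_def[symmetric] inner_diff abs_le_iff)
      qed
      have "flat_cube 0 1 \<subseteq> (\<Union>i. W i)"
      proof
        fix y assume y: "y \<in> flat_cube 0 1"
        then have "y \<in> (\<Union>i. U i)" using U by blast
        then show "y \<in> (\<Union>i. W i)" using sub y by (auto simp: flat_cube_def)
      qed
      have Wm: "W i \<in> sets borel" for i by (simp add: W_def)
      have "1 = emeasure flat_measure (flat_cube 0 1)" using emeasure_flat_measure_cube[of 1 0] by simp
      also have "\<dots> \<le> emeasure flat_measure (\<Union>i. W i)"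
        using \<open>flat_cube 0 1 \<subseteq> (\<Union>i. W i)\<close> Wm by (intro emeasure_mono) auto
      also have "\<dots> \<le> (\<Sum>i. emeasure flat_measure (W i))"
        using Wm by (intro emeasure_subadditive_countably) auto
      also have "\<dots> \<le> (\<Sum>i. ennreal (2 ^ codim1) * cover_cost codim1 (U i))"
      proof (intro suminf_le allI)
        fix i show "emeasure flat_measure (W i) \<le> ennreal (2 ^ codim1) * cover_cost codim1 (U i)"
          using diameter_ge_0[OF Ub[of i]]
          by (auto simp: W_def emeasure_flat_measure_cube power_mult_distrib ennreal_mult')
      qed auto
      also have "\<dots> = ennreal (2 ^ codim1) * (\<Sum>i. cover_cost codim1 (U i))" by (rule ennreal_suminf_cmult)
      finally have "1 / ennreal (2 ^ codim1) \<le> (ennreal (2 ^ codim1) * (\<Sum>i. cover_cost codim1 (U i))) / ennreal (2 ^ codim1)"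
        by (rule divide_right_mono_ennreal)
      then show "1 / ennreal (2 ^ codim1) \<le> (\<Sum>i. cover_cost codim1 (U i))"
        by (simp add: mult.commute[of "ennreal (2 ^ codim1)"] ennreal_mult_divide_eq del: ennreal_suminf_multc)
    qed
    also have "\<dots> \<le> kappa" unfolding kappa_def unit_cube_eq by (rule hausdorff_pre_le_raw) simp
    finally have "ennreal (2 ^ codim1) * (1 / ennreal (2 ^ codim1)) \<le> ennreal (2 ^ codim1) * kappa"
      by (rule mult_left_mono) simp
    then show ?thesis by (simp add: ennreal_times_divide mult_divide_eq_ennreal)
  qed
  then show ?thesis by (metis mult_zero_right not_gr_zero not_one_le_zero)
qed

text \<open>The index of the half-open dyadic cube of side \<open>1 / 2\<^sup>n\<close> that contains \<open>x\<close>. Such cubes of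
  different sizes are either nested or disjoint.\<close>

definition grid :: "nat \<Rightarrow> 'a \<Rightarrow> 'a \<Rightarrow> int" where
  "grid n x = restrict (\<lambda>b. \<lfloor>2 ^ n * (x \<bullet> b)\<rfloor>) (Basis - {e})"

definition cell :: "nat \<Rightarrow> ('a \<Rightarrow> int) \<Rightarrow> 'a set" where
  "cell n g = {y. y \<bullet> e = 0 \<and> grid n y = g}"

lemma cell_iff:
  "y \<in> cell n (grid n x) \<longleftrightarrow> y \<bullet> e = 0 \<and> (\<forall>b\<in>Basis - {e}. \<lfloor>2 ^ n * (y \<bullet> b)\<rfloor> = \<lfloor>2 ^ n * (x \<bullet> b)\<rfloor>)"
  unfolding cell_def grid_def by (auto simp: fun_eq_iff restrict_def)

lemma cell_borel: "cell n (grid n x) \<in> sets borel"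
proof -
  have "cell n (grid n x) = {y. y \<bullet> e = 0 \<and> (\<forall>b\<in>Basis - {e}. \<lfloor>2 ^ n * (y \<bullet> b)\<rfloor> = \<lfloor>2 ^ n * (x \<bullet> b)\<rfloor>)}"
    using cell_iff by auto
  also have "\<dots> \<in> sets borel" by measurable
  finally show ?thesis .
qed

definition corner :: "nat \<Rightarrow> 'a \<Rightarrow> 'a" where
  "corner n x = (\<Sum>b\<in>Basis - {e}. (of_int \<lfloor>2 ^ n * (x \<bullet> b)\<rfloor> / 2 ^ n) *\<^sub>R b)"

lemma corner_inner: "b \<in> Basis - {e} \<Longrightarrow> corner n x \<bullet> b = of_int \<lfloor>2 ^ n * (x \<bullet> b)\<rfloor> / 2 ^ n"
  unfolding corner_def
  by (auto simp: inner_sum_left inner_Basis if_distrib[of "\<lambda>t. _ * t"] sum.delta cong: if_cong)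

lemma corner_e: "corner n x \<bullet> e = 0"
  unfolding corner_def using e_Basis by (simp add: inner_sum_left inner_Basis)

lemma cell_subset_cube: "cell n (grid n x) \<subseteq> flat_cube (corner n x) (1 / 2 ^ n)"
proof
  fix y assume y: "y \<in> cell n (grid n x)"
  have "corner n x \<bullet> b \<le> y \<bullet> b \<and> y \<bullet> b \<le> corner n x \<bullet> b + 1 / 2 ^ n" if b: "b \<in> Basis - {e}" for b
  proof -
    have "\<lfloor>2 ^ n * (y \<bullet> b)\<rfloor> = \<lfloor>2 ^ n * (x \<bullet> b)\<rfloor>" using y b cell_iff by blast
    then have "of_int \<lfloor>2 ^ n * (x \<bullet> b)\<rfloor> \<le> 2 ^ n * (y \<bullet> b)" "2 ^ n * (y \<bullet> b) \<le> of_int \<lfloor>2 ^ n * (x \<bullet> b)\<rfloor> + 1"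
      by linarith+
    then show ?thesis unfolding corner_inner[OF b] by (simp add: field_simps)
  qed
  then show "y \<in> flat_cube (corner n x) (1 / 2 ^ n)" using y cell_iff by (auto simp: flat_cube_def)
qed

lemma cube_subset_cell:
  assumes "0 \<le> t" "t < 1 / 2 ^ n"
  shows "flat_cube (corner n x) t \<subseteq> cell n (grid n x)"
proof
  fix y assume y: "y \<in> flat_cube (corner n x) t"
  have "\<lfloor>2 ^ n * (y \<bullet> b)\<rfloor> = \<lfloor>2 ^ n * (x \<bullet> b)\<rfloor>" if b: "b \<in> Basis - {e}" for b
  proof -
    have "corner n x \<bullet> b \<le> y \<bullet> b" "y \<bullet> b \<le> corner n x \<bullet> b + t" using y b by (auto simp: flat_cube_def)
    then have "of_int \<lfloor>2 ^ n * (x \<bullet> b)\<rfloor> \<le> 2 ^ n * (y \<bullet> b)" "2 ^ n * (y \<bullet> b) < of_int \<lfloor>2 ^ n * (x \<bullet> b)\<rfloor> + 1"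
      unfolding corner_inner[OF b] using assms by (auto simp: field_simps)
    then show ?thesis by linarith
  qed
  then show "y \<in> cell n (grid n x)" using y unfolding cell_iff by (auto simp: flat_cube_def)
qed

text \<open>The half-open cell lies in the closed cube of the same side, and contains all smaller cubes
  with the same corner.\<close>

lemma H_cell_le: "H (cell n (grid n x)) \<le> kappa * emeasure flat_measure (cell n (grid n x))"
proof -
  have "H (cell n (grid n x)) \<le> H (flat_cube (corner n x) (1 / 2 ^ n))"
    by (rule hausdorff_raw_mono[OF cell_subset_cube])
  also have "\<dots> = kappa * ennreal ((1 / 2 ^ n) ^ codim1)"
    by (subst H_flat_cube) (auto simp: corner_e mult.commute)
  also have "ennreal ((1 / 2 ^ n) ^ codim1) \<le> emeasure flat_measure (cell n (grid n x))"
  proof (rule tendsto_upperbound)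
    show "((\<lambda>t. ennreal (t ^ codim1)) \<longlongrightarrow> ennreal ((1 / 2 ^ n) ^ codim1)) (at_left (1 / 2 ^ n))"
      by (intro tendsto_ennrealI tendsto_intros)
    have "\<forall>\<^sub>F t in at_left (1 / 2 ^ n). t \<in> {0<..<1 / 2 ^ n :: real}"
      by (rule eventually_at_left_real) simp
    then show "\<forall>\<^sub>F t in at_left (1 / 2 ^ n). ennreal (t ^ codim1) \<le> emeasure flat_measure (cell n (grid n x))"
    proof eventually_elim
      fix t :: real assume t: "t \<in> {0<..<1 / 2 ^ n}"
      have "ennreal (t ^ codim1) = emeasure flat_measure (flat_cube (corner n x) t)"
        using t by (simp add: emeasure_flat_measure_cube)
      also have "\<dots> \<le> emeasure flat_measure (cell n (grid n x))"
        using t cell_borel by (intro emeasure_mono cube_subset_cell) auto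
      finally show "ennreal (t ^ codim1) \<le> emeasure flat_measure (cell n (grid n x))" .
    qed
  qed simp
  finally show ?thesis by (simp add: mult_left_mono)
qed

lemma grid_coarser: "grid (Suc n) x = grid (Suc n) y \<Longrightarrow> grid n x = grid n y"
proof -
  assume eq: "grid (Suc n) x = grid (Suc n) y"
  have "\<lfloor>2 ^ n * (x \<bullet> b)\<rfloor> = \<lfloor>2 ^ n * (y \<bullet> b)\<rfloor>" if b: "b \<in> Basis - {e}" for b
  proof -
    have "\<lfloor>2 ^ Suc n * (x \<bullet> b)\<rfloor> = \<lfloor>2 ^ Suc n * (y \<bullet> b)\<rfloor>" using fun_cong[OF eq, of b] b by (simp add: grid_def)
    then show ?thesis
      using floor_divide_real_eq_div[of 2 "2 ^ Suc n * (x \<bullet> b)"] floor_divide_real_eq_div[of 2 "2 ^ Suc n * (y \<bullet> b)"] by simp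
  qed
  then show ?thesis by (auto simp: grid_def fun_eq_iff restrict_def)
qed

lemma grid_mono: "m \<le> n \<Longrightarrow> grid n x = grid n y \<Longrightarrow> grid m x = grid m y"
  by (induction rule: inc_induct) (auto intro: grid_coarser)

text \<open>An open set is the disjoint union of the largest dyadic cells that it contains.\<close>

lemma H_open_le:
  assumes O: "open O'"
  shows "H (O' \<inter> hyperplane) \<le> kappa * emeasure flat_measure O'"
proof -
  define Ok where "Ok n x \<longleftrightarrow> cell n (grid n x) \<subseteq> O'" for n x
  \<comment> \<open>Cells of the least level at which they lie in the open set; being of least level makes them disjoint.\<close>
  define I where "I = {(n, g). \<exists>x. x \<bullet> e = 0 \<and> grid n x = g \<and> Ok n x \<and> (\<forall>m<n. \<not> Ok m x)}"
  define C where "C = (\<lambda>(n, g). cell n g)"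
  have cI: "countable I"
  proof (rule countable_subset)
    have "grid n x \<in> (\<Pi>\<^sub>E b\<in>Basis - {e}. UNIV)" for n x by (simp add: grid_def)
    then show "I \<subseteq> UNIV \<times> (\<Pi>\<^sub>E b\<in>Basis - {e}. UNIV)" unfolding I_def by blast
    show "countable ((UNIV :: nat set) \<times> (\<Pi>\<^sub>E b\<in>Basis - {e}. (UNIV :: int set)))"
      by (intro countable_SIGMA countable_PiE) auto
  qed
  have cong: "Ok m x = Ok m y" if "grid n x = grid n y" "m \<le> n" for m n x y
    using grid_mono[OF that(2,1)] by (simp add: Ok_def)
  have disj: "disjoint_family_on C I"
    unfolding disjoint_family_on_def
  proof (intro ballI impI)
    fix i j assume i: "i \<in> I" and j: "j \<in> I" and ij: "i \<noteq> j"
    obtain n g where ng: "i = (n, g)" by (cases i)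
    obtain n' g' where ng': "j = (n', g')" by (cases j)
    have False if y: "y \<in> C i" "y \<in> C j" for y
    proof -
      have g: "grid n y = g" "grid n' y = g'" using y by (auto simp: C_def ng ng' cell_def)
      have 1: "Ok n y" "\<forall>m<n. \<not> Ok m y"
      proof -
        obtain x where x: "grid n x = g" "Ok n x" "\<forall>m<n. \<not> Ok m x" using i unfolding I_def ng by auto
        have "Ok m x = Ok m y" if "m \<le> n" for m using x(1) g(1) that by (intro cong[of n]) auto
        then show "Ok n y" "\<forall>m<n. \<not> Ok m y" using x(2,3) by (simp_all add: less_imp_le)
      qed
      have 2: "Ok n' y" "\<forall>m<n'. \<not> Ok m y"
      proof -
        obtain x where x: "grid n' x = g'" "Ok n' x" "\<forall>m<n'. \<not> Ok m x" using j unfolding I_def ng' by auto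
        have "Ok m x = Ok m y" if "m \<le> n'" for m using x(1) g(2) that by (intro cong[of n']) auto
        then show "Ok n' y" "\<forall>m<n'. \<not> Ok m y" using x(2,3) by (simp_all add: less_imp_le)
      qed
      have "n = n'" using 1 2 by (metis linorder_neqE_nat)
      then show False using g ij ng ng' by simp
    qed
    then show "C i \<inter> C j = {}" by auto
  qed
  have "O' \<inter> hyperplane \<subseteq> (\<Union>i\<in>I. C i)"
  proof
    fix x assume x: "x \<in> O' \<inter> hyperplane"
    obtain r where r: "r > 0" "ball x r \<subseteq> O'" using O x by (meson IntD1 openE)
    have "(\<lambda>n. real codim1 * (1 / 2) ^ n) \<longlonglongrightarrow> real codim1 * 0" by (intro tendsto_intros LIMSEQ_power_zero) auto
    then have "\<forall>\<^sub>F n in sequentially. real codim1 * (1 / 2) ^ n < r" using r(1) by (intro order_tendstoD) auto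
    then obtain n where n: "real codim1 * (1 / 2) ^ n < r" by (auto simp: eventually_sequentially)
    have "Ok n x"
      unfolding Ok_def
    proof
      fix y assume y: "y \<in> cell n (grid n x)"
      have "x \<in> cell n (grid n x)" using x by (simp add: cell_def)
      then have "dist x y \<le> diameter (flat_cube (corner n x) (1 / 2 ^ n))"
        using y cell_subset_cube diameter_flat_cube_le(1)[of "1 / 2 ^ n" "corner n x"]
        by (intro diameter_bounded_bound) auto
      also have "\<dots> \<le> real codim1 * (1 / 2 ^ n)" by (rule diameter_flat_cube_le) simp
      also have "\<dots> < r" using n by (simp add: power_one_over)
      finally show "y \<in> O'" using r(2) by auto
    qed
    define n0 where "n0 = (LEAST n. Ok n x)"
    have "Ok n0 x" "\<forall>m<n0. \<not> Ok m x"
      using \<open>Ok n x\<close> unfolding n0_def by (auto intro: LeastI dest: not_less_Least)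
    then have "(n0, grid n0 x) \<in> I" using x by (auto simp: I_def)
    moreover have "x \<in> C (n0, grid n0 x)" using x by (simp add: C_def cell_def)
    ultimately show "x \<in> (\<Union>i\<in>I. C i)" by blast
  qed
  then have "H (O' \<inter> hyperplane) \<le> H (\<Union>i\<in>I. C i)" by (rule hausdorff_raw_mono)
  also have "\<dots> \<le> (\<integral>\<^sup>+i. H (C i) \<partial>count_space I)" by (rule hausdorff_raw_countable_subadditive[OF cI])
  also have "\<dots> \<le> (\<integral>\<^sup>+i. kappa * emeasure flat_measure (C i) \<partial>count_space I)"
  proof (rule nn_integral_mono)
    fix i assume "i \<in> space (count_space I)"
    then show "H (C i) \<le> kappa * emeasure flat_measure (C i)"
      using H_cell_le by (auto simp: I_def C_def)
  qed
  also have "\<dots> = kappa * (\<integral>\<^sup>+i. emeasure flat_measure (C i) \<partial>count_space I)"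
    by (rule nn_integral_cmult) auto
  also have "(\<integral>\<^sup>+i. emeasure flat_measure (C i) \<partial>count_space I) = emeasure flat_measure (\<Union>i\<in>I. C i)"
    using cI disj cell_borel by (intro emeasure_UN_countable[symmetric]) (auto simp: I_def C_def)
  also have "\<dots> \<le> emeasure flat_measure O'"
    using O by (intro emeasure_mono) (auto simp: I_def C_def Ok_def)
  finally show ?thesis by (simp add: mult_left_mono)
qed

lemma emeasure_flat_measure_ball: "emeasure flat_measure (ball 0 r) < \<infinity>"
proof -
  have "norm x \<le> r + 1" if "x \<in> slab 1 (ball 0 r)" for x
  proof -
    have "x = flat x + (x \<bullet> e) *\<^sub>R e" by (simp add: flat_def)
    then have "norm x \<le> norm (flat x) + norm ((x \<bullet> e) *\<^sub>R e)" by (metis norm_triangle_ineq)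
    then show ?thesis using that by (auto simp: slab_def e_norm)
  qed
  then have "bounded (slab 1 (ball 0 r))" by (auto simp: bounded_iff)
  then have "emeasure lborel (slab 1 (ball 0 r)) < \<infinity>" by (rule emeasure_bounded_finite)
  then show ?thesis by (simp add: emeasure_flat_measure)
qed

text \<open>Outer regularity extends the bound from open sets.\<close>

lemma H_borel_le:
  assumes A: "A \<in> sets borel" "A \<subseteq> hyperplane" "bounded A"
  shows "H A \<le> kappa * emeasure flat_measure A"
proof -
  obtain R where R: "A \<subseteq> ball 0 R" using A(3) bounded_subset_ballD by blast
  define N where "N = density flat_measure (indicator (ball 0 R))"
  have flat_ball [measurable]: "ball 0 R \<in> sets flat_measure" by simp
  have N: "emeasure N X = emeasure flat_measure (X \<inter> ball 0 R)" if "X \<in> sets borel" for X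
    unfolding N_def using that flat_ball
    by (subst emeasure_density) (auto simp: nn_integral_indicator[symmetric] indicator_inter_arith[symmetric] mult.commute simp del: nn_integral_indicator intro!: nn_integral_cong)
  have NA: "emeasure N A = emeasure flat_measure A" using N[OF A(1)] R by (simp add: Int_absorb2)
  have le: "H A \<le> kappa * emeasure N U" if U: "A \<subseteq> U" "open U" for U
  proof -
    have "H A \<le> H ((U \<inter> ball 0 R) \<inter> hyperplane)" using U A R by (intro hausdorff_raw_mono) auto
    also have "\<dots> \<le> kappa * emeasure flat_measure (U \<inter> ball 0 R)" using U by (intro H_open_le) auto
    also have "emeasure flat_measure (U \<inter> ball 0 R) = emeasure N U" using N[of U] U by simp
    finally show ?thesis .
  qed
  have NA': "emeasure N A = (INF U\<in>{U. A \<subseteq> U \<and> open U}. emeasure N U)"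
  proof (rule outer_regular)
    show "sets N = sets borel" by (simp add: N_def)
    show "emeasure N (space N) \<noteq> \<infinity>" using N[of UNIV] emeasure_flat_measure_ball[of R] by (simp add: N_def)
  qed (rule A)

  obtain c where c: "kappa = ennreal c" "c > 0"
    using kappa_finite kappa_pos by (cases kappa) auto
  have inv: "ennreal (1 / c) * (ennreal c * z) = z" "ennreal c * (ennreal (1 / c) * z) = z" for z
    using c(2) by (simp_all add: mult.assoc[symmetric] ennreal_mult'[symmetric])
  have "ennreal (1 / c) * H A \<le> emeasure N A"
    unfolding NA'
  proof (rule INF_greatest)
    fix U assume "U \<in> {U. A \<subseteq> U \<and> open U}"
    then have "ennreal (1 / c) * H A \<le> ennreal (1 / c) * (ennreal c * emeasure N U)"
      using le[of U] c by (intro mult_left_mono) auto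
    then show "ennreal (1 / c) * H A \<le> emeasure N U" by (simp only: inv)
  qed
  then have "ennreal c * (ennreal (1 / c) * H A) \<le> ennreal c * emeasure N A" by (rule mult_left_mono) simp
  then show ?thesis by (simp only: inv NA c)
qed

text \<open>For a cube \<open>W\<close> around \<open>A\<close> the two measures are proportional. The upper bound for \<open>W - A\<close> and
  subadditivity turn this into the lower bound for \<open>A\<close>.\<close>

lemma H_borel_eq:
  assumes A: "A \<in> sets borel" "A \<subseteq> hyperplane" "bounded A"
  shows "H A = kappa * emeasure flat_measure A"
proof (rule antisym[OF H_borel_le[OF A]])
  obtain R where R: "R > 0" "\<And>x. x \<in> A \<Longrightarrow> norm x \<le> R" using A(3) by (auto simp: bounded_pos)
  define x where "x = (\<Sum>b\<in>Basis - {e}. (- R) *\<^sub>R b)"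
  define W where "W = flat_cube x (2 * R)"
  have xb: "x \<bullet> b = - R" if "b \<in> Basis - {e}" for b
    using that unfolding x_def by (auto simp: inner_sum_left inner_Basis if_distrib[of "\<lambda>t. _ * t"] sum.delta sum_negf cong: if_cong)
  have xe: "x \<bullet> e = 0"
    unfolding x_def using e_Basis by (simp add: inner_sum_left inner_Basis sum_negf)
  have W: "A \<subseteq> W"
  proof
    fix y assume y: "y \<in> A"
    have "\<bar>y \<bullet> b\<bar> \<le> R" if "b \<in> Basis" for b using Basis_le_norm[OF that, of y] R(2)[OF y] by simp
    then show "y \<in> W" using y A(2) xb by (fastforce simp: W_def flat_cube_def abs_le_iff)
  qed
  have HW: "H W = kappa * emeasure flat_measure W"
    unfolding W_def using R xe by (simp add: H_flat_cube emeasure_flat_measure_cube mult.commute)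
  have Wfin: "emeasure flat_measure (W - A) < \<infinity>"
  proof -
    have "emeasure flat_measure (W - A) \<le> emeasure flat_measure W" by (intro emeasure_mono) (auto simp: W_def)
    also have "\<dots> < \<infinity>" unfolding W_def using R by (simp add: emeasure_flat_measure_cube)
    finally show ?thesis .
  qed
  have "emeasure flat_measure W = emeasure flat_measure A + emeasure flat_measure (W - A)"
    using W A(1) by (subst plus_emeasure) (auto simp: W_def Un_absorb1)
  then have "kappa * emeasure flat_measure A + kappa * emeasure flat_measure (W - A) = H W"
    using HW by (simp add: distrib_left)
  also have "H W \<le> H (A \<union> (W - A))" by (rule hausdorff_raw_mono) auto
  also have "\<dots> \<le> H A + H (W - A)" by (rule hausdorff_raw_Un_le)
  also have "\<dots> \<le> H A + kappa * emeasure flat_measure (W - A)"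
  proof (intro add_left_mono H_borel_le)
    show "bounded (W - A)" unfolding W_def using R diameter_flat_cube_le(1)[of "2 * R" x] by (auto intro: bounded_subset)
  qed (use A in \<open>auto simp: W_def flat_cube_def[of x] intro: flat_cube_borel[unfolded flat_cube_def]\<close>)
  finally show "kappa * emeasure flat_measure A \<le> H A"
    using Wfin kappa_finite by (auto simp: ennreal_mult_less_top less_top[symmetric] ennreal_mult_eq_top_iff add.commute)
qed

end

section \<open>Surface measure on the unit sphere\<close>

lemma emeasure_lborel_scale_vimage:
  fixes X :: "'a::euclidean_space set"
  assumes t: "0 < t" and X: "X \<in> sets borel"
  shows "emeasure lborel ((\<lambda>x. (1 / t) *\<^sub>R x) -` X) = ennreal (t ^ DIM('a)) * emeasure lborel X"
proof -
  have m: "(\<lambda>x::'a. (1 / t) *\<^sub>R x) \<in> borel_measurable borel" by measurable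
  have "(lborel :: 'a measure) = density (distr lborel borel (\<lambda>x. 0 + (1 / t) *\<^sub>R x)) (\<lambda>_. ennreal (\<bar>1 / t\<bar> ^ DIM('a)))"
    using t by (intro lborel_affine) simp
  then have "emeasure lborel X = emeasure (density (distr lborel borel (\<lambda>x::'a. (1 / t) *\<^sub>R x)) (\<lambda>_. ennreal ((1 / t) ^ DIM('a)))) X"
    using t by simp
  also have "\<dots> = ennreal ((1 / t) ^ DIM('a)) * emeasure (distr lborel borel (\<lambda>x::'a. (1 / t) *\<^sub>R x)) X"
    using X by (simp add: emeasure_density nn_integral_cmult)
  also have "emeasure (distr lborel borel (\<lambda>x::'a. (1 / t) *\<^sub>R x)) X = emeasure lborel ((\<lambda>x. (1 / t) *\<^sub>R x) -` X)"
    using X m by (subst emeasure_distr) auto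
  finally show ?thesis
    using t by (simp add: mult.assoc[symmetric] ennreal_mult'[symmetric] power_mult_distrib[symmetric] del: power_one_over)
qed

definition cone :: "'a::euclidean_space set \<Rightarrow> 'a set" where
  "cone A = {x. sgn x \<in> A \<and> norm x \<le> 1}"

lemma sgn_measurable [measurable]: "(sgn :: 'a::euclidean_space \<Rightarrow> 'a) \<in> borel_measurable borel"
  unfolding sgn_div_norm[abs_def] by measurable

lemma cone_borel [measurable]:
  assumes [measurable]: "A \<in> sets borel"
  shows "cone A \<in> sets borel"
  unfolding cone_def by measurable

lemma emeasure_cone_finite: "emeasure lborel (cone A) < \<infinity>"
  by (rule emeasure_bounded_finite, rule bounded_subset[OF bounded_cball[of 0 1]]) (auto simp: cone_def)

text \<open>\<open>cone_measure\<close> is the candidate for surface measure on the unit sphere: \<open>d\<close> times the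
  volume of the cone over a set.\<close>

definition cone_measure :: "'a::euclidean_space measure" where
  "cone_measure = distr (density lborel (\<lambda>x. ennreal (real DIM('a)) * indicator (cball 0 1) x)) borel sgn"

lemma sets_cone_measure [simp, measurable_cong]: "sets cone_measure = sets borel"
  by (simp add: cone_measure_def)

lemma space_cone_measure [simp]: "space cone_measure = UNIV"
  by (simp add: cone_measure_def)

lemma cone_density_measurable:
  "(\<lambda>x::'a::euclidean_space. ennreal (real DIM('a)) * indicator (cball 0 1) x) \<in> borel_measurable borel"
proof -
  have [measurable]: "cball 0 1 \<in> sets (borel :: 'a measure)" by simp
  show ?thesis by measurable
qed

lemma emeasure_cone_measure:
  assumes [measurable]: "(A :: 'a::euclidean_space set) \<in> sets borel"
  shows "emeasure cone_measure A = ennreal (real DIM('a)) * emeasure lborel (cone A)"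
proof -
  have "emeasure cone_measure A =
      (\<integral>\<^sup>+x. (ennreal (real DIM('a)) * indicator (cball 0 1) x) * indicator (sgn -` A) x \<partial>lborel)"
    unfolding cone_measure_def
    using measurable_sets[OF sgn_measurable, of A] cone_density_measurable[where 'a='a]
    by (subst emeasure_distr) (auto simp: emeasure_density)
  also have "\<dots> = (\<integral>\<^sup>+x. ennreal (real DIM('a)) * indicator (cone A) x \<partial>lborel)"
    by (intro nn_integral_cong) (auto simp: cone_def indicator_def)
  also have "\<dots> = ennreal (real DIM('a)) * emeasure lborel (cone A)"
    by (subst nn_integral_cmult) auto
  finally show ?thesis .
qed

lemma finite_cone_measure: "emeasure (cone_measure :: 'a::euclidean_space measure) (space cone_measure) \<noteq> \<infinity>"
  using emeasure_cone_finite[of "UNIV :: 'a set"] by (auto simp: emeasure_cone_measure ennreal_mult_eq_top_iff)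

text \<open>Dilating the cone over \<open>A\<close> by the factor \<open>1 + s\<close> adds exactly this shell.\<close>

lemma emeasure_cone_shell:
  fixes A :: "'a::euclidean_space set"
  assumes s: "0 < s" and A [measurable]: "A \<in> sets borel" and sph: "A \<subseteq> sphere 0 1"
  shows "emeasure lborel {x. sgn x \<in> A \<and> 1 < norm x \<and> norm x \<le> 1 + s} =
    ennreal ((1 + s) ^ DIM('a) - 1) * emeasure lborel (cone A)"
proof -
  define S where "S = {x. sgn x \<in> A \<and> 1 < norm x \<and> norm x \<le> 1 + s}"
  have Sm [measurable]: "S \<in> sets borel" unfolding S_def by measurable
  have eq: "(\<lambda>x. (1 / (1 + s)) *\<^sub>R x) -` cone A = cone A \<union> S"
  proof -
    have "sgn ((1 / (1 + s)) *\<^sub>R x) = sgn x" for x :: 'a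
      using s by (simp add: sgn_div_norm inverse_eq_divide)
    then show ?thesis using s by (auto simp: cone_def S_def field_simps)
  qed
  have "ennreal ((1 + s) ^ DIM('a)) * emeasure lborel (cone A) = emeasure lborel (cone A \<union> S)"
    using emeasure_lborel_scale_vimage[of "1 + s" "cone A"] s eq by simp
  also have "\<dots> = emeasure lborel (cone A) + emeasure lborel S"
    by (intro plus_emeasure[symmetric]) (auto simp: cone_def S_def)
  finally have *: "ennreal ((1 + s) ^ DIM('a)) * emeasure lborel (cone A) = emeasure lborel (cone A) + emeasure lborel S" .
  have ge: "(1 + s) ^ DIM('a) \<ge> 1" using s by simp
  obtain V where V: "emeasure lborel (cone A) = ennreal V" "V \<ge> 0"
    using emeasure_cone_finite[of A] by (cases "emeasure lborel (cone A)") auto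
  have "emeasure lborel S = (emeasure lborel (cone A) + emeasure lborel S) - emeasure lborel (cone A)"
    using V by simp
  also have "\<dots> = ennreal ((1 + s) ^ DIM('a) * V) - ennreal V"
    unfolding *[symmetric] unfolding V using ge V by (subst ennreal_mult) auto
  also have "\<dots> = ennreal (((1 + s) ^ DIM('a) - 1) * V)"
    using V ge by (subst ennreal_minus) (auto simp: algebra_simps)
  also have "\<dots> = ennreal ((1 + s) ^ DIM('a) - 1) * emeasure lborel (cone A)"
    using V ge by (simp add: ennreal_mult)
  finally show ?thesis by (simp add: S_def)
qed

context unit_hyperplane
begin

text \<open>The open cap around the pole \<open>e\<close> that projects into the ball of radius \<open>r\<close>; for \<open>r \<le> 1\<close>, \<open>lift\<close>
  is the inverse of this projection.\<close>

definition cap :: "real \<Rightarrow> 'a set" where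
  "cap r = {y. norm y = 1 \<and> norm (flat y) < r \<and> 0 < y \<bullet> e}"

definition lift :: "'a \<Rightarrow> 'a" where
  "lift b = b + sqrt (1 - (norm b)\<^sup>2) *\<^sub>R e"

lemma lift_measurable [measurable]: "lift \<in> borel_measurable borel"
  unfolding lift_def[abs_def] by measurable

lemma flat_decomp: "x = flat x + (x \<bullet> e) *\<^sub>R e"
  by (simp add: flat_def)

lemma norm_decomp:
  assumes "b \<bullet> e = 0" shows "(norm (b + t *\<^sub>R e))\<^sup>2 = (norm b)\<^sup>2 + t\<^sup>2"
  using assms unfolding power2_norm_eq_inner by (simp add: inner_add inner_commute e_norm power2_eq_square)

lemma lift_flat:
  assumes "y \<in> cap r"
  shows "lift (flat y) = y"
proof -
  have "1 = (norm (flat y))\<^sup>2 + (y \<bullet> e)\<^sup>2"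
    using norm_decomp[OF flat_in[of y], of "y \<bullet> e"] flat_decomp[of y] assms by (simp add: cap_def)
  then have "sqrt (1 - (norm (flat y))\<^sup>2) = y \<bullet> e"
    using assms by (intro real_sqrt_unique) (auto simp: cap_def)
  then show ?thesis using flat_decomp[of y] by (simp add: lift_def)
qed

lemma flat_lift: "b \<bullet> e = 0 \<Longrightarrow> flat (lift b) = b"
  by (simp add: lift_def flat_def inner_add e_norm)

lemma sqrt_height_Lipschitz:
  fixes b c :: 'a
  assumes r: "0 < r" "r \<le> 1/8" and b: "norm b < r" and c: "norm c < r"
  shows "\<bar>sqrt (1 - (norm b)\<^sup>2) - sqrt (1 - (norm c)\<^sup>2)\<bar> \<le> 2 * r * norm (b - c)"
    and "\<bar>sqrt (1 - (norm b)\<^sup>2) - 1\<bar> \<le> r"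
proof -
  have half: "1/2 \<le> sqrt (1 - (norm d)\<^sup>2)" if "norm d < r" for d :: 'a
  proof -
    have "(norm d)\<^sup>2 \<le> (1/8)\<^sup>2" using that r by (intro power_mono) auto
    then show ?thesis by (intro real_le_rsqrt) (simp add: power2_eq_square)
  qed
  define u v where "u = sqrt (1 - (norm b)\<^sup>2)" and "v = sqrt (1 - (norm c)\<^sup>2)"
  have uv: "1/2 \<le> u" "1/2 \<le> v" using half b c by (auto simp: u_def v_def)
  have sq: "u\<^sup>2 = 1 - (norm b)\<^sup>2" "v\<^sup>2 = 1 - (norm c)\<^sup>2"
    using b c r power_le_one[of "norm b" 2] power_le_one[of "norm c" 2] by (auto simp: u_def v_def)
  have "(u - v) * (u + v) = (norm c - norm b) * (norm c + norm b)"
    using sq by (simp add: power2_eq_square algebra_simps)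
  then have "\<bar>u - v\<bar> * (u + v) = \<bar>norm c - norm b\<bar> * (norm c + norm b)"
    using uv by (metis abs_mult abs_of_nonneg add_nonneg_nonneg norm_ge_zero order_trans zero_le_divide_1_iff zero_le_numeral)
  moreover have "\<bar>u - v\<bar> * 1 \<le> \<bar>u - v\<bar> * (u + v)" using uv by (intro mult_left_mono) auto
  moreover have "\<bar>norm c - norm b\<bar> * (norm c + norm b) \<le> norm (b - c) * (2 * r)"
    using b c norm_triangle_ineq3[of c b] by (intro mult_mono) (auto simp: norm_minus_commute)
  ultimately show "\<bar>sqrt (1 - (norm b)\<^sup>2) - sqrt (1 - (norm c)\<^sup>2)\<bar> \<le> 2 * r * norm (b - c)"
    by (simp add: u_def v_def mult_ac)
  have "(1 - u) * (1 + u) = (norm b)\<^sup>2" using sq by (simp add: power2_eq_square algebra_simps)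
  moreover have "u \<le> 1" by (simp add: u_def)
  then have "(1 - u) * 1 \<le> (1 - u) * (1 + u)" using uv by (intro mult_left_mono) auto
  moreover have "(norm b)\<^sup>2 \<le> r * 1" unfolding power2_eq_square using b r by (intro mult_mono) auto
  ultimately show "\<bar>sqrt (1 - (norm b)\<^sup>2) - 1\<bar> \<le> r" using \<open>u \<le> 1\<close> by (simp add: u_def)
qed

lemma lift_Lipschitz:
  assumes r: "0 < r" "r \<le> 1/8" and b: "norm b < r" and c: "norm c < r"
  shows "dist (lift b) (lift c) \<le> (1 + 2 * r) * dist b c"
proof -
  have "lift b - lift c = (b - c) + (sqrt (1 - (norm b)\<^sup>2) - sqrt (1 - (norm c)\<^sup>2)) *\<^sub>R e"
    by (simp add: lift_def algebra_simps)
  then have "norm (lift b - lift c) \<le> norm (b - c) + \<bar>sqrt (1 - (norm b)\<^sup>2) - sqrt (1 - (norm c)\<^sup>2)\<bar>"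
    using norm_triangle_ineq[of "b - c"] by (metis e_norm(2) mult.right_neutral norm_scaleR real_norm_def)
  then show ?thesis using sqrt_height_Lipschitz(1)[OF assms] by (simp add: dist_norm algebra_simps)
qed

lemma flat_Lipschitz: "dist (flat x) (flat y) \<le> dist x y"
proof -
  have "flat x - flat y = flat (x - y)" by (simp add: flat_def inner_diff algebra_simps)
  then show ?thesis using norm_flat_le[of "x - y"] by (simp add: dist_norm)
qed

lemma emeasure_slab:
  assumes s: "0 < s" and A: "A \<in> sets borel"
  shows "emeasure lborel (slab s A) = ennreal s * emeasure flat_measure A"
proof -
  define c where "c = (\<lambda>b. if b = e then s else (1::real))"
  define T where "T x = flat x + (s * (x \<bullet> e)) *\<^sub>R e" for x
  have T: "(\<lambda>x. 0 + (\<Sum>j\<in>Basis. (c j * (x \<bullet> j)) *\<^sub>R j)) = T"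
  proof (rule ext)
    fix x :: 'a
    have "(\<Sum>j\<in>Basis. (c j * (x \<bullet> j)) *\<^sub>R j) = (s * (x \<bullet> e)) *\<^sub>R e + (\<Sum>j\<in>Basis - {e}. (x \<bullet> j) *\<^sub>R j)"
      using e_Basis by (simp add: sum.remove c_def)
    moreover have "flat x = (\<Sum>j\<in>Basis - {e}. (x \<bullet> j) *\<^sub>R j)"
      using euclidean_representation[of x] e_Basis by (simp add: flat_def sum.remove[of Basis e] algebra_simps)
    ultimately show "0 + (\<Sum>j\<in>Basis. (c j * (x \<bullet> j)) *\<^sub>R j) = T x" by (simp add: T_def)
  qed
  have pc: "(\<Prod>j\<in>Basis. \<bar>c j\<bar>) = s"
    using s by (subst prod_Basis_split) (simp add: c_def)
  have Tm [measurable]: "T \<in> borel_measurable borel" unfolding T_def by measurable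
  have l: "lborel = density (distr lborel borel T) (\<lambda>_. ennreal s)"
    by (rule lborel_affine_euclidean[of c 0, unfolded T pc]) (use s in \<open>simp add: c_def\<close>)
  have sl: "slab s A \<in> sets borel" using A by simp
  have eq: "T -` slab s A = slab 1 A"
    using s by (auto simp: slab_def T_def flat_def inner_add inner_diff e_norm zero_le_mult_iff)
  have "emeasure lborel (slab s A) = emeasure (density (distr lborel borel T) (\<lambda>_. ennreal s)) (slab s A)"
    using l by simp
  also have "\<dots> = ennreal s * emeasure (distr lborel borel T) (slab s A)"
    using sl by (simp add: emeasure_density nn_integral_cmult)
  also have "emeasure (distr lborel borel T) (slab s A) = emeasure lborel (slab 1 A)"
    using sl Tm by (subst emeasure_distr) (auto simp: eq)
  finally show ?thesis using A by (simp add: emeasure_flat_measure)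
qed

text \<open>The map \<open>spread\<close> sends the slab over a set in the hyperplane to the shell over its lift;
  it differs from a translation by a map with a small Lipschitz constant.\<close>

definition spread :: "'a \<Rightarrow> 'a" where
  "spread x = (1 + x \<bullet> e) *\<^sub>R lift (flat x)"

text \<open>The difference of \<open>spread\<close> and the identity has Lipschitz constant at most \<open>7 r\<close>.\<close>

lemma spread_almost_isometric:
  assumes r: "0 < r" "r \<le> 1/8"
    and x: "norm (flat x) < r" "0 < x \<bullet> e" "x \<bullet> e \<le> r"
    and y: "norm (flat y) < r" "0 < y \<bullet> e" "y \<bullet> e \<le> r"
  shows "dist (spread x) (spread y) \<le> (1 + 7 * r) * dist x y"
    and "(1 - 7 * r) * dist x y \<le> dist (spread x) (spread y)"
proof -
  define b c s t D where defs: "b = flat x" "c = flat y" "s = x \<bullet> e" "t = y \<bullet> e" "D = norm (x - y)"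
  define u v where "u = sqrt (1 - (norm b)\<^sup>2)" and "v = sqrt (1 - (norm c)\<^sup>2)"
  have xy: "x = b + s *\<^sub>R e" "y = c + t *\<^sub>R e" using flat_decomp by (auto simp: defs)
  have D0: "0 \<le> D" by (simp add: defs)
  have bc: "norm (b - c) \<le> D" using flat_Lipschitz[of x y] by (simp add: defs dist_norm)
  have st: "\<bar>s - t\<bar> \<le> D" using Basis_le_norm[OF e_Basis, of "x - y"] by (simp add: defs inner_diff)
  have uv: "\<bar>u - v\<bar> \<le> 2 * r * D"
  proof -
    have "\<bar>u - v\<bar> \<le> 2 * r * norm (b - c)"
      unfolding u_def v_def using sqrt_height_Lipschitz(1)[OF r] x y by (simp add: defs)
    also have "\<dots> \<le> 2 * r * D" using bc r by (intro mult_left_mono) auto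
    finally show ?thesis .
  qed
  have v1: "\<bar>v - 1\<bar> \<le> r" unfolding v_def using sqrt_height_Lipschitz(2)[OF r y(1) y(1)] by (simp add: defs)
  have "spread x - spread y - (x - y) =
      (s *\<^sub>R (b - c) + (s - t) *\<^sub>R c) + ((1 + s) * (u - v) + (s - t) * (v - 1)) *\<^sub>R e"
  proof -
    have "spread x = (1 + s) *\<^sub>R (b + u *\<^sub>R e)" "spread y = (1 + t) *\<^sub>R (c + v *\<^sub>R e)"
      by (simp_all add: spread_def lift_def defs u_def v_def)
    moreover have "x - y = (b + s *\<^sub>R e) - (c + t *\<^sub>R e)" using xy by simp
    ultimately show ?thesis by (simp add: algebra_simps)
  qed
  then have "norm (spread x - spread y - (x - y)) \<le>
      norm (s *\<^sub>R (b - c) + (s - t) *\<^sub>R c) + norm (((1 + s) * (u - v) + (s - t) * (v - 1)) *\<^sub>R e)"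
    using norm_triangle_ineq by metis
  also have "\<dots> \<le> (norm (s *\<^sub>R (b - c)) + norm ((s - t) *\<^sub>R c)) + (\<bar>(1 + s) * (u - v)\<bar> + \<bar>(s - t) * (v - 1)\<bar>)"
    by (intro add_mono norm_triangle_ineq) (simp add: e_norm)
  also have "\<dots> \<le> (r * D + D * r) + (2 * (2 * r * D) + D * r)"
  proof (intro add_mono)
    show "norm (s *\<^sub>R (b - c)) \<le> r * D" using x bc by (auto simp: defs(3) intro!: mult_mono)
    show "norm ((s - t) *\<^sub>R c) \<le> D * r" using st y by (auto simp: defs(2) intro!: mult_mono)
    show "\<bar>(1 + s) * (u - v)\<bar> \<le> 2 * (2 * r * D)" unfolding abs_mult using x r uv by (intro mult_mono) (auto simp: defs(3))
    show "\<bar>(s - t) * (v - 1)\<bar> \<le> D * r" unfolding abs_mult using st v1 D0 by (intro mult_mono) auto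
  qed
  also have "\<dots> = 7 * r * D" by simp
  finally have *: "norm (spread x - spread y - (x - y)) \<le> 7 * r * D" .
  have "norm (spread x - spread y) \<le> norm (x - y) + norm (spread x - spread y - (x - y))"
    using norm_triangle_ineq[of "x - y" "spread x - spread y - (x - y)"] by simp
  then show "dist (spread x) (spread y) \<le> (1 + 7 * r) * dist x y"
    using * by (simp add: dist_norm defs algebra_simps)
  have "norm (x - y) \<le> norm (spread x - spread y) + norm (spread x - spread y - (x - y))"
    using norm_triangle_ineq4[of "spread x - spread y" "spread x - spread y - (x - y)"] by simp
  then show "(1 - 7 * r) * dist x y \<le> dist (spread x) (spread y)"
    using * by (simp add: dist_norm defs algebra_simps)
qed

text \<open>Near the pole the sphere is almost flat. Projecting \<open>A\<close> to the hyperplane changes its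
  Hausdorff measure little. The slab of height \<open>r\<close> over the projection is nearly isometric to the
  shell of width \<open>r\<close> over \<open>A\<close>, whose volume is a multiple of the volume of the cone. The number
  \<open>F\<close> is the flat measure of the projection.\<close>

lemma cap_comparison:
  assumes r: "0 < r" "r \<le> 1/8" and A: "A \<in> sets borel" "A \<subseteq> cap r"
  obtains F where
    "H A \<le> ennreal ((1 + 2 * r) ^ codim1) * (kappa * F)" "kappa * F \<le> H A"
    "ennreal r * F \<le> ennreal ((1 / (1 - 7 * r)) ^ DIM('a)) * (ennreal ((1 + r) ^ DIM('a) - 1) * emeasure lborel (cone A))"
    "ennreal ((1 + r) ^ DIM('a) - 1) * emeasure lborel (cone A) \<le> ennreal ((1 + 7 * r) ^ DIM('a)) * (ennreal r * F)"
proof -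
  define B where "B = flat ` A"
  have B_eq: "B = {b. b \<bullet> e = 0 \<and> norm b < r \<and> lift b \<in> A}"
  proof (intro equalityI subsetI)
    fix b assume "b \<in> B"
    then show "b \<in> {b. b \<bullet> e = 0 \<and> norm b < r \<and> lift b \<in> A}"
      using A(2) lift_flat by (auto simp: B_def flat_in cap_def)
  next
    fix b assume "b \<in> {b. b \<bullet> e = 0 \<and> norm b < r \<and> lift b \<in> A}"
    then show "b \<in> B" unfolding B_def using flat_lift[of b] by force
  qed
  have Bm [measurable]: "B \<in> sets borel"
    unfolding B_eq using A(1) by measurable
  have AB: "A = lift ` B"
  proof -
    have "lift ` B = (\<lambda>y. lift (flat y)) ` A" by (simp add: B_def image_image)
    also have "\<dots> = id ` A" using A(2) lift_flat by (intro image_cong) auto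
    finally show ?thesis by simp
  qed
  have HB: "H B = kappa * emeasure flat_measure B"
  proof (rule H_borel_eq[OF Bm])
    show "B \<subseteq> hyperplane" by (auto simp: B_eq)
    show "bounded B" unfolding B_eq by (rule bounded_subset[OF bounded_ball[of 0 r]]) auto
  qed
  define Sh where "Sh = {x. sgn x \<in> A \<and> 1 < norm x \<and> norm x \<le> 1 + r}"
  define T where "T = {x. flat x \<in> B \<and> 0 < x \<bullet> e \<and> x \<bullet> e \<le> r}"
  have Shm [measurable]: "Sh \<in> sets borel" unfolding Sh_def using A(1) by measurable
  have Tm [measurable]: "T \<in> sets borel" unfolding T_def by measurable
  have ShV: "emeasure lborel Sh = ennreal ((1 + r) ^ DIM('a) - 1) * emeasure lborel (cone A)"
    unfolding Sh_def using A r by (intro emeasure_cone_shell) (auto simp: cap_def)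
  have TV: "emeasure lborel T = ennreal r * emeasure flat_measure B"
  proof -
    have "{x. x \<bullet> e = 0} \<in> null_sets lborel"
      using negligible_standard_hyperplane[OF e_Basis, of 0] by (simp add: negligible_iff_null_sets null_sets_completion_iff)
    then have "slab r B - T \<in> null_sets lborel"
      by (rule null_sets_subset) (auto simp: slab_def T_def)
    moreover have "T = slab r B - (slab r B - T)" by (auto simp: slab_def T_def)
    ultimately have "emeasure lborel T = emeasure lborel (slab r B)"
      using emeasure_Diff_null_set[of "slab r B - T" lborel "slab r B"] by simp
    then show ?thesis using emeasure_slab[OF r(1) Bm] by simp
  qed
  have T_props: "norm (flat x) < r" "0 < x \<bullet> e" "x \<bullet> e \<le> r" if "x \<in> T" for x
    using that by (auto simp: T_def B_eq)
  have Sh_eq: "Sh = spread ` T"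
  proof (intro equalityI subsetI)
    fix y assume y: "y \<in> Sh"
    define x where "x = flat (sgn y) + (norm y - 1) *\<^sub>R e"
    have x: "flat x = flat (sgn y)" "x \<bullet> e = norm y - 1"
      by (simp_all add: x_def flat_def inner_add inner_diff e_norm algebra_simps)
    have "x \<in> T" using y x by (auto simp: T_def Sh_def B_def)
    moreover have "spread x = y"
    proof -
      have "lift (flat (sgn y)) = sgn y" using y A(2) by (intro lift_flat[of _ r]) (auto simp: Sh_def)
      moreover have "y \<noteq> 0" using y by (auto simp: Sh_def)
      ultimately show ?thesis unfolding spread_def x by (simp add: sgn_div_norm)
    qed
    ultimately show "y \<in> spread ` T" by force
  next
    fix y assume "y \<in> spread ` T"
    then obtain x where x: "x \<in> T" "y = spread x" by auto
    have lA: "lift (flat x) \<in> A" using x by (auto simp: T_def B_eq)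
    then have n1: "norm (lift (flat x)) = 1" using A(2) by (auto simp: cap_def)
    have pos: "0 < 1 + x \<bullet> e" using T_props[OF x(1)] by simp
    have "norm y = 1 + x \<bullet> e" using n1 pos by (simp add: x spread_def)
    moreover have "sgn y = lift (flat x)" using n1 pos by (simp add: x spread_def sgn_div_norm)
    ultimately show "y \<in> Sh" using lA T_props[OF x(1)] by (auto simp: Sh_def)
  qed
  show thesis
  proof (rule that[of "emeasure flat_measure B"])
    have "H A \<le> ennreal ((1 + 2 * r) ^ codim1) * H B"
      unfolding AB using r lift_Lipschitz[OF r] by (intro hausdorff_raw_Lipschitz_image_le) (auto simp: B_eq)
    then show "H A \<le> ennreal ((1 + 2 * r) ^ codim1) * (kappa * emeasure flat_measure B)" by (simp add: HB)
    have "H B \<le> ennreal (1 ^ codim1) * H A"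
      unfolding B_def using flat_Lipschitz by (intro hausdorff_raw_Lipschitz_image_le) auto
    then show "kappa * emeasure flat_measure B \<le> H A" by (simp add: HB)
    have "emeasure lborel Sh \<le> ennreal ((1 + 7 * r) ^ DIM('a)) * emeasure lborel T"
      using r spread_almost_isometric(1)[OF r T_props T_props]
      by (intro emeasure_lborel_Lipschitz_image_le[of T Sh spread] refl Tm Shm) (auto simp: Sh_eq)
    then show "ennreal ((1 + r) ^ DIM('a) - 1) * emeasure lborel (cone A) \<le> ennreal ((1 + 7 * r) ^ DIM('a)) * (ennreal r * emeasure flat_measure B)"
      by (simp add: ShV TV)
    have r7: "0 < 1 - 7 * r" using r by simp
    have inj: "inj_on spread T"
    proof (rule inj_onI)
      fix x y assume xy: "x \<in> T" "y \<in> T" "spread x = spread y"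
      then have "(1 - 7 * r) * dist x y \<le> 0"
        using spread_almost_isometric(2)[OF r T_props[OF xy(1)] T_props[OF xy(2)]] by simp
      then show "x = y" using r7 by (simp add: mult_le_0_iff)
    qed
    have "emeasure lborel T \<le> ennreal ((1 / (1 - 7 * r)) ^ DIM('a)) * emeasure lborel Sh"
    proof (rule emeasure_lborel_Lipschitz_image_le[of Sh T "inv_into T spread"])
      show "T \<subseteq> inv_into T spread ` Sh" unfolding Sh_eq using inj by (force simp: inv_into_f_f)
      show "dist (inv_into T spread x) (inv_into T spread y) \<le> 1 / (1 - 7 * r) * dist x y" if xySh: "x \<in> Sh" "y \<in> Sh" for x y
      proof -
        obtain x' y' where xy: "x' \<in> T" "y' \<in> T" "x = spread x'" "y = spread y'" using xySh Sh_eq by auto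
        have "(1 - 7 * r) * dist x' y' \<le> dist x y"
          unfolding xy(3,4) using spread_almost_isometric(2)[OF r T_props[OF xy(1)] T_props[OF xy(2)]] .
        then show ?thesis using xy inj r7 by (simp add: inv_into_f_f field_simps)
      qed
    qed (use r7 in auto)
    then show "ennreal r * emeasure flat_measure B \<le> ennreal ((1 / (1 - 7 * r)) ^ DIM('a)) * (ennreal ((1 + r) ^ DIM('a) - 1) * emeasure lborel (cone A))"
      by (simp add: ShV TV)
  qed
qed

end

lemma unit_hyperplane_exists: "\<exists>e::'a::euclidean_space. unit_hyperplane e"
proof -
  define B where "B = (SOME B :: 'a set. B \<subseteq> Basis \<and> card B = DIM('a) - 1)"
  have "\<exists>B :: 'a set. B \<subseteq> Basis \<and> card B = DIM('a) - 1"
    using obtain_subset_with_card_n[of "DIM('a) - 1" "Basis :: 'a set"] by (metis diff_le_self)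
  then have "B \<subseteq> Basis \<and> card B = DIM('a) - 1"
    unfolding B_def by (rule someI_ex)
  then have B: "B \<subseteq> Basis" "card B = DIM('a) - 1" by simp_all
  have "card (Basis - B) = DIM('a) - (DIM('a) - 1)"
    using B finite_subset[OF B(1) finite_Basis] by (simp add: card_Diff_subset)
  then have "card (Basis - B) = 1" using DIM_positive[where 'a='a] by simp
  then obtain e where e: "Basis - B = {e}" by (auto simp: card_1_singleton_iff)
  then have "B = Basis - {e}" "e \<in> Basis" using B(1) by auto
  then show ?thesis
    by (intro exI[of _ e]) (simp add: unit_hyperplane_def B_def)
qed

locale sphere_chart = unit_hyperplane e for e :: "real ^ 'n"
begin

text \<open>The distortion of the comparison on caps of radius \<open>r\<close>, from above and from below; both
  factors tend to \<open>1\<close> as \<open>r\<close> tends to \<open>0\<close>.\<close>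

definition upper_factor :: "real \<Rightarrow> real" where
  "upper_factor r = (1 + 2 * r) ^ codim1 * ((1 / (1 - 7 * r)) ^ CARD('n) * (((1 + r) ^ CARD('n) - 1) / r / real CARD('n)))"

definition lower_factor :: "real \<Rightarrow> real" where
  "lower_factor r = (1 + 7 * r) ^ CARD('n) * (real CARD('n) / (((1 + r) ^ CARD('n) - 1) / r))"

lemma growth_tendsto: "((\<lambda>r. ((1 + r) ^ CARD('n) - 1) / r) \<longlongrightarrow> real CARD('n)) (at_right (0::real))"
proof -
  have "((\<lambda>x::real. x ^ CARD('n)) has_field_derivative real CARD('n) * 1 ^ (CARD('n) - 1)) (at 1)"
    by (rule DERIV_pow[THEN DERIV_cong]) simp
  then have "((\<lambda>h. ((1 + h) ^ CARD('n) - 1 ^ CARD('n)) / h) \<longlongrightarrow> real CARD('n) * 1 ^ (CARD('n) - 1)) (at (0::real))"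
    unfolding DERIV_def .
  then show ?thesis by (auto intro: tendsto_within_subset[of _ _ _ UNIV])
qed

lemma upper_factor_tendsto: "(upper_factor \<longlongrightarrow> 1) (at_right 0)"
proof -
  have id: "((\<lambda>r. r) \<longlongrightarrow> 0) (at_right (0::real))" by (rule tendsto_ident_at)
  have "(upper_factor \<longlongrightarrow> (1 + 2 * 0) ^ codim1 * ((1 / (1 - 7 * 0)) ^ CARD('n) * (real CARD('n) / real CARD('n)))) (at_right 0)"
    unfolding upper_factor_def[abs_def] by (intro tendsto_intros id growth_tendsto) auto
  then show ?thesis by simp
qed

lemma lower_factor_tendsto: "(lower_factor \<longlongrightarrow> 1) (at_right 0)"
proof -
  have id: "((\<lambda>r. r) \<longlongrightarrow> 0) (at_right (0::real))" by (rule tendsto_ident_at)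
  have "(lower_factor \<longlongrightarrow> (1 + 7 * 0) ^ CARD('n) * (real CARD('n) / real CARD('n))) (at_right 0)"
    unfolding lower_factor_def[abs_def] by (intro tendsto_intros id growth_tendsto) auto
  then show ?thesis by simp
qed

lemma cap_estimates:
  assumes r: "0 < r" "r \<le> 1/8" and A: "A \<in> sets borel" "A \<subseteq> cap r"
  shows "H A \<le> ennreal (upper_factor r) * (kappa * emeasure cone_measure A)"
    and "kappa * emeasure cone_measure A \<le> ennreal (lower_factor r) * H A"
proof -
  let ?d = "CARD('n)"
  define g where "g = (1 + r) ^ ?d - 1"
  define V where "V = emeasure lborel (cone A)"
  define a b c where "a = (1 / (1 - 7 * r)) ^ ?d" and "b = (1 + 2 * r) ^ codim1" and "c = (1 + 7 * r) ^ ?d"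
  have g: "g > 0" unfolding g_def using r by (simp add: one_less_power)
  have abc: "a > 0" "b > 0" "c > 0" using r by (auto simp: a_def b_def c_def)
  have d: "real ?d > 0" by simp
  obtain F where F:
    "H A \<le> ennreal b * (kappa * F)" "kappa * F \<le> H A"
    "ennreal r * F \<le> ennreal a * (ennreal g * V)"
    "ennreal g * V \<le> ennreal c * (ennreal r * F)"
    using cap_comparison[OF r A] unfolding a_def b_def c_def g_def V_def by auto
  have cm: "emeasure cone_measure A = ennreal (real ?d) * V"
    unfolding V_def using A by (simp add: emeasure_cone_measure)
  have cancel: "ennreal x * (ennreal y * z) = ennreal (x * y) * z" if "0 \<le> x" "0 \<le> y" for x y z
    using that by (simp add: mult.assoc[symmetric] ennreal_mult)
  have "F = ennreal (1 / r) * (ennreal r * F)" using r by (simp add: cancel)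
  also have "\<dots> \<le> ennreal (1 / r) * (ennreal a * (ennreal g * V))" using F(3) by (rule mult_left_mono) simp
  also have "\<dots> = ennreal (a * (g / r)) * V" using r abc g by (simp add: cancel)
  finally have F1: "F \<le> ennreal (a * (g / r)) * V" .
  have "H A \<le> ennreal b * (kappa * (ennreal (a * (g / r)) * V))"
    using F(1) F1 by (meson mult_left_mono order_trans zero_le)
  also have "\<dots> = ennreal b * (ennreal (a * (g / r)) * (kappa * V))" by (simp add: mult_ac)
  also have "\<dots> = ennreal (b * (a * (g / r))) * (kappa * V)" using r abc g by (simp add: cancel)
  also have "b * (a * (g / r)) = upper_factor r * real ?d"
    using d by (simp add: upper_factor_def a_def b_def g_def)
  also have "ennreal (upper_factor r * real ?d) * (kappa * V) = ennreal (upper_factor r) * (kappa * (ennreal (real ?d) * V))"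
    using r g abc by (subst ennreal_mult) (auto simp: upper_factor_def g_def[symmetric] a_def[symmetric] b_def[symmetric] mult_ac)
  finally show "H A \<le> ennreal (upper_factor r) * (kappa * emeasure cone_measure A)" by (simp add: cm)
  have "V = ennreal (1 / g) * (ennreal g * V)" using g by (simp add: cancel)
  also have "\<dots> \<le> ennreal (1 / g) * (ennreal c * (ennreal r * F))" using F(4) by (rule mult_left_mono) simp
  also have "\<dots> = ennreal (c * r / g) * F" using r abc g by (simp add: cancel)
  finally have V1: "V \<le> ennreal (c * r / g) * F" .
  have "kappa * (ennreal (real ?d) * V) \<le> kappa * (ennreal (real ?d) * (ennreal (c * r / g) * F))"
    by (intro mult_left_mono V1) auto
  also have "\<dots> = ennreal (real ?d * (c * r / g)) * (kappa * F)" using r abc g by (simp add: cancel mult.left_commute)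
  also have "\<dots> \<le> ennreal (real ?d * (c * r / g)) * H A" by (intro mult_left_mono F) auto
  also have "real ?d * (c * r / g) = lower_factor r" by (simp add: lower_factor_def c_def g_def)
  finally show "kappa * emeasure cone_measure A \<le> ennreal (lower_factor r) * H A" by (simp add: cm)
qed

text \<open>A rotation moves the centre of the ball to the pole.\<close>

lemma ball_estimates:
  assumes r: "0 < r" "r \<le> 1/8" and A: "A \<in> sets borel" "A \<subseteq> sphere 0 1" "A \<subseteq> ball y r" and y: "norm y = 1"
  shows "H A \<le> ennreal (upper_factor r) * (kappa * emeasure cone_measure A)"
    and "kappa * emeasure cone_measure A \<le> ennreal (lower_factor r) * H A"
proof -
  obtain f where f: "orthogonal_transformation f" "f y = e"
    using orthogonal_transformation_exists[of y e] y e_norm by auto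
  define g where "g = inv f"
  have bij: "bij f" by (rule orthogonal_transformation_bij[OF f(1)])
  have isof: "dist (f x) (f z) = dist x z" for x z
    using orthogonal_transformation_norm[OF f(1), of "x - z"] linear_diff[OF orthogonal_transformation_linear[OF f(1)]]
    by (simp add: dist_norm)
  have normf: "norm (f x) = norm x" for x by (rule orthogonal_transformation_norm[OF f(1)])
  have fg: "f (g x) = x" "g (f x) = x" for x
    unfolding g_def using bij by (simp_all add: bij_is_inj bij_is_surj surj_f_inv_f)
  have isog: "dist (g x) (g z) = dist x z" for x z using isof[of "g x" "g z"] by (simp add: fg)
  have normg: "norm (g x) = norm x" for x using normf[of "g x"] by (simp add: fg)
  have ling: "linear g"
    unfolding g_def using orthogonal_transformation_linear[OF orthogonal_transformation_inv[OF f(1)]] .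
  have surjg: "surj g" using fg(2) by (metis surjI)
  have contg: "continuous_on UNIV g" using ling by (simp add: linear_continuous_on linear_conv_bounded_linear)
  have im: "f ` A = g -` A" using fg by (auto simp: image_iff) metis
  have fA: "f ` A \<in> sets borel"
    unfolding im using measurable_sets[OF borel_measurable_continuous_onI[OF contg] A(1)] by simp
  have cap: "f ` A \<subseteq> cap r"
  proof
    fix z assume "z \<in> f ` A"
    then obtain x where x: "x \<in> A" "z = f x" by auto
    have n: "norm z = 1" using x A by (auto simp: normf)
    have d: "dist z e < r" using x A(3) f(2) isof[of x y] by (auto simp: dist_commute)
    have "flat e = 0" by (simp add: flat_def e_norm)
    then have 1: "norm (flat z) < r" using flat_Lipschitz[of z e] d by (simp add: dist_norm)
    have "\<bar>(z - e) \<bullet> e\<bar> < r" using Basis_le_norm[OF e_Basis, of "z - e"] d by (simp add: dist_norm)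
    then have "0 < z \<bullet> e" using r by (simp add: inner_diff e_norm)
    then show "z \<in> cap r" using n 1 by (simp add: cap_def)
  qed
  have H: "H (f ` A) = H A" by (rule hausdorff_raw_isometry_image[OF isof])
  have "sgn (g x) = g (sgn x)" for x
    using linear_scale[OF ling] by (simp add: sgn_div_norm normg)
  then have "cone (f ` A) = g -` cone A" unfolding im by (auto simp: cone_def normg)
  then have "emeasure lborel (cone (f ` A)) = emeasure lborel (cone A)"
    using A(1) isog surjg by (simp add: emeasure_lborel_isometry_vimage)
  then have C: "emeasure cone_measure (f ` A) = emeasure cone_measure A"
    using A(1) fA by (simp add: emeasure_cone_measure)
  show "H A \<le> ennreal (upper_factor r) * (kappa * emeasure cone_measure A)"
    and "kappa * emeasure cone_measure A \<le> ennreal (lower_factor r) * H A"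
    using cap_estimates[OF r fA cap] by (simp_all add: H C)
qed

text \<open>\<open>A\<close> is cut into finitely many pieces lying in small balls. The upper bound adds up by
  subadditivity. For the lower bound the pieces are replaced by compact subsets of almost full
  measure, on which Hausdorff measure is superadditive.\<close>

lemma sphere_estimates:
  assumes r: "0 < r" "r \<le> 1/8" and A: "A \<in> sets borel" "A \<subseteq> sphere 0 1"
  shows "H A \<le> ennreal (upper_factor r) * (kappa * emeasure cone_measure A)"
    and "kappa * emeasure cone_measure A \<le> ennreal (lower_factor r) * H A"
proof -
  have cov: "(sphere 0 1 :: (real ^ 'n) set) \<subseteq> (\<Union>c\<in>sphere 0 1. ball c r)"
  proof
    fix x :: "real ^ 'n" assume "x \<in> sphere 0 1"
    moreover have "x \<in> ball x r" using r by simp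
    ultimately show "x \<in> (\<Union>c\<in>sphere 0 1. ball c r)" by blast
  qed
  obtain Y :: "(real ^ 'n) set" where Y: "Y \<subseteq> sphere 0 1" "finite Y" "sphere 0 1 \<subseteq> (\<Union>y\<in>Y. ball y r)"
    by (rule compactE_image[OF compact_sphere _ cov]) auto
  obtain y where y: "bij_betw y {..<card Y} Y"
    using ex_bij_betw_nat_finite[OF Y(2)] by (auto simp: atLeast0LessThan)
  define m where "m = card Y"
  define B where "B n = (if n < m then ball (y n) r else {})" for n
  define P where "P n = A \<inter> disjointed B n" for n
  have yY: "norm (y n) = 1" if "n < m" for n
    using bij_betwE[OF y] Y(1) that by (auto simp: m_def)
  have AB: "A \<subseteq> (\<Union>n. B n)"
  proof
    fix x assume "x \<in> A"
    then obtain z where z: "z \<in> Y" "x \<in> ball z r" using A Y(3) by blast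
    then have "z \<in> y ` {..<m}" using bij_betw_imp_surj_on[OF y] by (simp add: m_def)
    then obtain n where "n < m" "z = y n" by auto
    then show "x \<in> (\<Union>n. B n)" using z by (auto simp: B_def)
  qed
  have AP: "A = (\<Union>n. P n)" using AB by (auto simp: P_def UN_disjointed_eq[of B, symmetric])
  have Bm: "B n \<in> sets borel" for n by (simp add: B_def)
  have Pm: "P n \<in> sets borel" for n
  proof -
    have "disjointed B n \<in> sets borel"
      using sets.range_disjointed_sets[of B borel] Bm by auto
    then show ?thesis unfolding P_def using A(1) by (rule sets.Int[rotated])
  qed
  have Pdisj: "disjoint_family P"
    using disjoint_family_disjointed[of B] unfolding P_def disjoint_family_on_def by blast
  have PB: "P n \<subseteq> B n" for n using disjointed_subset[of B n] by (auto simp: P_def)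
  have Pempty: "P n = {}" if "\<not> n < m" for n using PB[of n] that by (simp add: B_def)
  have sub: "P n \<subseteq> sphere 0 1" for n using A by (auto simp: P_def)
  have est: "H X \<le> ennreal (upper_factor r) * (kappa * emeasure cone_measure X)"
    "kappa * emeasure cone_measure X \<le> ennreal (lower_factor r) * H X" if "X \<in> sets borel" "X \<subseteq> P n" for X n
  proof -
    have "n < m \<or> X = {}" using Pempty[of n] that by auto
    then have "H X \<le> ennreal (upper_factor r) * (kappa * emeasure cone_measure X) \<and>
      kappa * emeasure cone_measure X \<le> ennreal (lower_factor r) * H X"
    proof
      assume n: "n < m"
      have "X \<subseteq> ball (y n) r" using that PB[of n] n by (auto simp: B_def)
      moreover have "X \<subseteq> sphere 0 1" using that sub by blast
      ultimately show ?thesis using ball_estimates[OF r that(1) _ _ yY[OF n]] by simp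
    qed simp
    then show "H X \<le> ennreal (upper_factor r) * (kappa * emeasure cone_measure X)"
      "kappa * emeasure cone_measure X \<le> ennreal (lower_factor r) * H X" by auto
  qed
  have coneA: "emeasure cone_measure A = (\<Sum>n. emeasure cone_measure (P n))"
    using Pm Pdisj by (subst AP, intro suminf_emeasure[symmetric]) auto
  have "H A \<le> (\<Sum>n. H (P n))" by (subst AP) (rule hausdorff_raw_subadditive)
  also have "\<dots> \<le> (\<Sum>n. ennreal (upper_factor r) * (kappa * emeasure cone_measure (P n)))"
    using est(1) Pm by (intro suminf_le) auto
  also have "\<dots> = ennreal (upper_factor r) * (kappa * emeasure cone_measure A)"
    unfolding coneA by simp
  finally show "H A \<le> ennreal (upper_factor r) * (kappa * emeasure cone_measure A)" .
  have coneA': "emeasure cone_measure A = (\<Sum>n<m. emeasure cone_measure (P n))"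
    unfolding coneA using Pempty by (intro suminf_finite) auto
  obtain k where k: "kappa = ennreal k" "k > 0" using kappa_finite kappa_pos by (cases kappa) auto
  show "kappa * emeasure cone_measure A \<le> ennreal (lower_factor r) * H A"
  proof (rule ennreal_le_epsilon)
    fix \<epsilon> :: real assume "0 < \<epsilon>"
    \<comment> \<open>The \<open>m\<close> pieces together lose at most \<open>\<epsilon>\<close>; the successor covers the case \<open>m = 0\<close>.\<close>
    define \<eta> where "\<eta> = \<epsilon> / (k * real (Suc m))"
    have \<eta>: "\<eta> > 0" using \<open>0 < \<epsilon>\<close> k by (simp add: \<eta>_def)
    have "\<exists>C. C \<subseteq> P n \<and> compact C \<and> emeasure cone_measure (P n) \<le> emeasure cone_measure C + ennreal \<eta>" for n
    proof (cases "emeasure cone_measure (P n) \<le> ennreal \<eta>")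
      case True then show ?thesis by (intro exI[of _ "{}"]) auto
    next
      case False
      have fin: "emeasure cone_measure (P n) < \<infinity>"
        using finite_cone_measure emeasure_space[of cone_measure "P n"] by (metis infinity_ennreal_def le_less_trans less_top)
      have "emeasure cone_measure (P n) - ennreal \<eta> < emeasure cone_measure (P n)"
        using fin False \<eta> by (intro ennreal_between) (auto simp: zero_less_iff_neq_zero)
      also have "emeasure cone_measure (P n) = (SUP C\<in>{C. C \<subseteq> P n \<and> compact C}. emeasure cone_measure C)"
        by (rule inner_regular) (use finite_cone_measure Pm in auto)
      finally obtain C where C: "C \<subseteq> P n" "compact C" "emeasure cone_measure (P n) - ennreal \<eta> < emeasure cone_measure C"
        by (auto simp: less_SUP_iff)
      have "emeasure cone_measure (P n) = (emeasure cone_measure (P n) - ennreal \<eta>) + ennreal \<eta>"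
        using False by (intro diff_add_cancel_ennreal[symmetric]) simp
      also have "\<dots> \<le> emeasure cone_measure C + ennreal \<eta>"
        using C(3) by (intro add_right_mono less_imp_le)
      finally show ?thesis using C by blast
    qed
    then obtain C where C: "\<And>n. C n \<subseteq> P n" "\<And>n. compact (C n)"
      "\<And>n. emeasure cone_measure (P n) \<le> emeasure cone_measure (C n) + ennreal \<eta>" by metis
    have Cm: "C n \<in> sets borel" for n using C(2) by (simp add: borel_compact)
    have "kappa * emeasure cone_measure A \<le> kappa * (\<Sum>n<m. emeasure cone_measure (C n) + ennreal \<eta>)"
      unfolding coneA' by (intro mult_left_mono sum_mono C) auto
    also have "\<dots> = (\<Sum>n<m. kappa * emeasure cone_measure (C n)) + kappa * (of_nat m * ennreal \<eta>)"
      by (simp add: sum.distrib distrib_left sum_distrib_left)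
    also have "\<dots> \<le> (\<Sum>n<m. ennreal (lower_factor r) * H (C n)) + ennreal \<epsilon>"
    proof (intro add_mono sum_mono)
      show "kappa * emeasure cone_measure (C n) \<le> ennreal (lower_factor r) * H (C n)" for n
        using est(2)[OF Cm C(1)] .
      have "kappa * (of_nat m * ennreal \<eta>) = ennreal (k * (real m * \<eta>))"
        using k \<eta> by (simp add: ennreal_of_nat_eq_real_of_nat ennreal_mult)
      also have "\<dots> \<le> ennreal \<epsilon>"
      proof (rule ennreal_leI)
        have "k * (real m * \<eta>) = \<epsilon> * (real m / real (Suc m))" using k by (simp add: \<eta>_def field_simps del: of_nat_Suc)
        also have "\<dots> \<le> \<epsilon> * 1" using \<open>0 < \<epsilon>\<close> by (intro mult_left_mono) auto
        finally show "k * (real m * \<eta>) \<le> \<epsilon>" by simp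
      qed
      finally show "kappa * (of_nat m * ennreal \<eta>) \<le> ennreal \<epsilon>" .
    qed
    also have "(\<Sum>n<m. ennreal (lower_factor r) * H (C n)) = ennreal (lower_factor r) * (\<Sum>n<m. H (C n))"
      by (simp add: sum_distrib_left)
    also have "\<dots> \<le> ennreal (lower_factor r) * H A"
    proof (rule mult_left_mono)
      have "(\<Sum>n<m. H (C n)) \<le> H (\<Union>n<m. C n)"
        using C Pdisj by (intro hausdorff_raw_sum_compact_le) (auto simp: disjoint_family_on_def, blast)
      also have "\<dots> \<le> H A" using C(1) AP by (intro hausdorff_raw_mono) blast
      finally show "(\<Sum>n<m. H (C n)) \<le> H A" .
    qed simp
    finally show "kappa * emeasure cone_measure A \<le> ennreal (lower_factor r) * H A + ennreal \<epsilon>"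
      by (simp add: add_mono)
  qed
qed

lemma H_sphere_eq:
  assumes A: "A \<in> sets borel" "A \<subseteq> sphere 0 1"
  shows "H A = kappa * emeasure cone_measure A"
proof -
  have ev: "\<forall>\<^sub>F r in at_right (0::real). r \<in> {0<..<1/8}" by (rule eventually_at_right_real) simp
  have lim: "((\<lambda>r. ennreal (f r) * X) \<longlongrightarrow> X) (at_right 0)" if "(f \<longlongrightarrow> 1) (at_right 0)" for f :: "real \<Rightarrow> real" and X
  proof -
    have "((\<lambda>r. ennreal (f r) * X) \<longlongrightarrow> ennreal 1 * X) (at_right 0)"
      using that by (intro tendsto_mult_ennreal tendsto_ennrealI tendsto_const) auto
    then show ?thesis by simp
  qed
  show ?thesis
  proof (rule antisym)
    show "H A \<le> kappa * emeasure cone_measure A"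
    proof (rule tendsto_lowerbound[OF lim[OF upper_factor_tendsto]])
      show "\<forall>\<^sub>F r in at_right 0. H A \<le> ennreal (upper_factor r) * (kappa * emeasure cone_measure A)"
        using ev by eventually_elim (rule sphere_estimates(1)[OF _ _ A], auto)
    qed simp
    show "kappa * emeasure cone_measure A \<le> H A"
    proof (rule tendsto_lowerbound[OF lim[OF lower_factor_tendsto]])
      show "\<forall>\<^sub>F r in at_right 0. kappa * emeasure cone_measure A \<le> ennreal (lower_factor r) * H A"
        using ev by eventually_elim (rule sphere_estimates(2)[OF _ _ A], auto)
    qed simp
  qed
qed

end

lemma hausdorff_sphere:
  fixes A :: "(real ^ 'n) set"
  assumes A: "A \<in> sets borel" "A \<subseteq> sphere 0 1"
  shows "hausdorff (CARD('n) - 1) A = emeasure cone_measure A"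
proof -
  obtain e :: "real ^ 'n" where "unit_hyperplane e" using unit_hyperplane_exists by auto
  then interpret sphere_chart e by (simp add: sphere_chart_def)
  obtain k where k: "kappa = ennreal k" "k > 0" using kappa_finite kappa_pos by (cases kappa) auto
  have c: "codim1 = CARD('n) - 1" using codim1_eq by simp
  have "hausdorff (CARD('n) - 1) A = (kappa * emeasure cone_measure A) / kappa"
    unfolding hausdorff_def using H_sphere_eq[OF A] by (simp add: kappa_def c)
  also have "\<dots> = emeasure cone_measure A"
    using k by (simp add: mult.commute[of "ennreal k"] ennreal_mult_divide_eq)
  finally show ?thesis .
qed

lemma sphere_measure_eq: "(sphere_measure :: (real ^ 'n) measure) = restrict_space cone_measure (sphere 0 1)"
proof -
  let ?R = "restrict_space (cone_measure :: (real ^ 'n) measure) (sphere 0 1)"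
  have sets: "sets ?R = sets (restrict_space borel (sphere 0 1))"
    by (simp add: sets_restrict_space)
  have space: "space ?R = sphere 0 1" by (simp add: space_restrict_space)
  have "measure_of (space ?R) (sets ?R) (emeasure ?R) = ?R" by (rule measure_of_of_measure)
  moreover have "measure_of (sphere 0 1) (sets (restrict_space borel (sphere 0 1))) (hausdorff (CARD('n) - 1))
      = measure_of (space ?R) (sets ?R) (emeasure ?R)"
    unfolding sets[symmetric] space
  proof (rule measure_of_eq)
    show "sets ?R \<subseteq> Pow (sphere 0 1)" using sets.space_closed[of ?R] space by simp
    fix A assume "A \<in> sigma_sets (sphere 0 1) (sets ?R)"
    then have "A \<in> sets ?R" using sets.sigma_sets_eq[of ?R] space by simp
    then have "A \<in> sets borel" "A \<subseteq> sphere 0 1" by (auto simp: sets_restrict_space)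
    then show "hausdorff (CARD('n) - 1) A = emeasure ?R A"
      using hausdorff_sphere[of A] by (simp add: emeasure_restrict_space)
  qed
  ultimately show ?thesis unfolding sphere_measure_def by simp
qed

text \<open>The measure on the sphere is the image of \<open>d\<close> times Lebesgue measure on the unit ball under
  radial projection.\<close>

lemma nn_integral_sphere_measure:
  fixes f :: "real ^ 'n \<Rightarrow> ennreal"
  assumes f [measurable]: "f \<in> borel_measurable borel"
  shows "(\<integral>\<^sup>+x. f x \<partial>sphere_measure) = ennreal (real CARD('n)) * (\<integral>\<^sup>+x. indicator (cball 0 1) x * f (sgn x) \<partial>lborel)"
proof -
  have [measurable]: "cball 0 1 \<in> sets (borel :: (real^'n) measure)" "sphere 0 1 \<in> sets (borel :: (real^'n) measure)" by simp_all
  have "(\<integral>\<^sup>+x. f x \<partial>sphere_measure) = (\<integral>\<^sup>+x. f x * indicator (sphere 0 1) x \<partial>cone_measure)"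
    unfolding sphere_measure_eq by (rule nn_integral_restrict_space) simp
  also have "\<dots> = (\<integral>\<^sup>+x. (ennreal (real CARD('n)) * indicator (cball 0 1) x) * (f (sgn x) * indicator (sphere 0 1) (sgn x)) \<partial>lborel)"
  proof -
    let ?g = "\<lambda>x :: real ^ 'n. f (sgn x) * indicator (sphere 0 1) (sgn x)"
    have "(\<integral>\<^sup>+x. f x * indicator (sphere 0 1) x \<partial>cone_measure) =
        (\<integral>\<^sup>+x. ?g x \<partial>density lborel (\<lambda>x. ennreal (real CARD('n)) * indicator (cball 0 1) x))"
      unfolding cone_measure_def by (subst nn_integral_distr) simp_all
    also have "\<dots> = (\<integral>\<^sup>+x. (ennreal (real CARD('n)) * indicator (cball 0 1) x) * ?g x \<partial>lborel)"
      using cone_density_measurable[where 'a = "real ^ 'n"] by (intro nn_integral_density) simp_all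
    finally show ?thesis .
  qed
  also have "\<dots> = (\<integral>\<^sup>+x. ennreal (real CARD('n)) * (indicator (cball 0 1) x * f (sgn x)) \<partial>lborel)"
  proof (rule nn_integral_cong_AE)
    have "AE x in lborel. x \<noteq> (0 :: real ^ 'n)" by (rule AE_lborel_singleton)
    then show "AE x in lborel. (ennreal (real CARD('n)) * indicator (cball 0 1) x) * (f (sgn x) * indicator (sphere 0 1) (sgn x)) =
        ennreal (real CARD('n)) * (indicator (cball 0 1) x * f (sgn x))"
      by eventually_elim (simp add: norm_sgn mult_ac)
  qed
  also have "\<dots> = ennreal (real CARD('n)) * (\<integral>\<^sup>+x. indicator (cball 0 1) x * f (sgn x) \<partial>lborel)"
    by (rule nn_integral_cmult) measurable
  finally show ?thesis .
qed

section \<open>Counts of a Poisson process\<close>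

lemma poisson_weights_sums:
  assumes "0 \<le> l"
  shows "(\<Sum>k. ennreal (exp (- l) * l ^ k / fact k)) = 1"
    and "(\<Sum>k. of_nat k * ennreal (exp (- l) * l ^ k / fact k)) = ennreal l"
proof -
  have s: "(\<lambda>k. exp (- l) * l ^ k / fact k) sums 1"
  proof -
    have "(\<lambda>k. exp (- l) * (l ^ k /\<^sub>R fact k)) sums (exp (- l) * exp l)" by (intro sums_mult exp_converges)
    then show ?thesis by (simp add: exp_minus field_simps)
  qed
  then show "(\<Sum>k. ennreal (exp (- l) * l ^ k / fact k)) = 1"
    using assms by (subst suminf_ennreal2) (auto simp: sums_iff)
  have "(\<lambda>k. real (Suc k) * (exp (- l) * l ^ Suc k / fact (Suc k))) sums (l * 1)"
  proof -
    have eq: "real (Suc k) * (exp (- l) * l ^ Suc k / fact (Suc k)) = l * (exp (- l) * l ^ k / fact k)" for k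
      by (simp add: field_simps del: of_nat_Suc)
    show ?thesis unfolding eq by (rule sums_mult[OF s])
  qed
  then have s': "(\<lambda>k. real k * (exp (- l) * l ^ k / fact k)) sums l"
    by (subst (asm) sums_Suc_iff) simp
  have "(\<Sum>k. of_nat k * ennreal (exp (- l) * l ^ k / fact k)) = (\<Sum>k. ennreal (real k * (exp (- l) * l ^ k / fact k)))"
    by (intro suminf_cong) (simp add: ennreal_of_nat_eq_real_of_nat ennreal_mult'[symmetric])
  also have "\<dots> = ennreal l"
    using s' assms by (subst suminf_ennreal2) (auto simp: sums_iff)
  finally show "(\<Sum>k. of_nat k * ennreal (exp (- l) * l ^ k / fact k)) = ennreal l" .
qed

text \<open>The height \<open>tau\<close> of a point has slices whose mass is at most proportional to their thickness.
  This makes the intensity measure \<open>\<sigma>\<close>-finite and the points simple. For hyperplanes, \<open>tau\<close> is the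
  distance from the origin.\<close>

locale poisson_points = prob_space M for M :: "'w measure" +
  fixes \<Lambda> :: "'b measure" and X :: "nat \<Rightarrow> 'w \<Rightarrow> 'b" and tau :: "'b \<Rightarrow> real" and c :: real
  assumes poisson: "poisson_process M \<Lambda> X"
    and tau_measurable [measurable]: "tau \<in> borel_measurable \<Lambda>"
    and c_nonneg: "0 \<le> c"
    and tau_le: "a \<le> b \<Longrightarrow> emeasure \<Lambda> {x \<in> space \<Lambda>. a < tau x \<and> tau x \<le> b} \<le> ennreal (c * (b - a))"
    and tau_pos: "x \<in> space \<Lambda> \<Longrightarrow> 0 < tau x"
begin

lemma X_measurable [measurable]: "X i \<in> M \<rightarrow>\<^sub>M \<Lambda>"
  using poisson by (auto simp: poisson_process_def)

lemma X_space: "\<omega> \<in> space M \<Longrightarrow> X i \<omega> \<in> space \<Lambda>"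
  using X_measurable by (rule measurable_space)

abbreviation N :: "'b set \<Rightarrow> 'w \<Rightarrow> ennreal" where "N \<equiv> point_count X"

lemma N_eq: "N A \<omega> = (\<Sum>i. indicator A (X i \<omega>))"
proof -
  have "N A \<omega> = (\<integral>\<^sup>+i. indicator {i. X i \<omega> \<in> A} i \<partial>count_space UNIV)"
    unfolding point_count_def by simp
  also have "\<dots> = (\<Sum>i. indicator A (X i \<omega>))"
    by (subst nn_integral_count_space_nat) (auto intro!: suminf_cong simp: indicator_def)
  finally show ?thesis .
qed

lemma N_measurable [measurable]:
  assumes [measurable]: "A \<in> sets \<Lambda>"
  shows "N A \<in> borel_measurable M"
  unfolding N_eq[abs_def] by measurable

lemma N_eq_0_iff: "N A \<omega> = 0 \<longleftrightarrow> (\<forall>i. X i \<omega> \<notin> A)"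
  unfolding point_count_def by (auto simp: emeasure_count_space_eq_0)

lemma prob_N:
  assumes "A \<in> sets \<Lambda>" "emeasure \<Lambda> A < \<infinity>"
  shows "prob {\<omega> \<in> space M. N A \<omega> = of_nat k} = exp (- measure \<Lambda> A) * measure \<Lambda> A ^ k / fact k"
  using poisson assms by (auto simp: poisson_process_def)

lemma AE_N_nat:
  assumes A [measurable]: "A \<in> sets \<Lambda>" and fin: "emeasure \<Lambda> A < \<infinity>"
  shows "AE \<omega> in M. \<exists>k::nat. N A \<omega> = of_nat k"
proof -
  have "emeasure M (\<Union>k. {\<omega> \<in> space M. N A \<omega> = of_nat k}) = (\<Sum>k. emeasure M {\<omega> \<in> space M. N A \<omega> = of_nat k})"
    by (rule suminf_emeasure[symmetric]) (auto simp: disjoint_family_on_def)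
  also have "\<dots> = (\<Sum>k. ennreal (exp (- measure \<Lambda> A) * measure \<Lambda> A ^ k / fact k))"
    by (simp only: emeasure_eq_measure prob_N[OF A fin])
  also have "\<dots> = 1" by (rule poisson_weights_sums(1)[OF measure_nonneg])
  finally have "prob (\<Union>k. {\<omega> \<in> space M. N A \<omega> = of_nat k}) = 1"
    by (simp add: emeasure_eq_measure)
  then have "AE \<omega> in M. \<omega> \<in> (\<Union>k. {\<omega> \<in> space M. N A \<omega> = of_nat k})" by (rule AE_prob_1)
  then show ?thesis by eventually_elim blast
qed

lemma nn_integral_N:
  assumes A [measurable]: "A \<in> sets \<Lambda>" and fin: "emeasure \<Lambda> A < \<infinity>"
  shows "(\<integral>\<^sup>+\<omega>. N A \<omega> \<partial>M) = emeasure \<Lambda> A"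
proof -
  have "(\<integral>\<^sup>+\<omega>. N A \<omega> \<partial>M) = (\<integral>\<^sup>+\<omega>. (\<Sum>k. of_nat k * indicator {\<omega> \<in> space M. N A \<omega> = of_nat k} \<omega>) \<partial>M)"
  proof (rule nn_integral_cong_AE)
    show "AE \<omega> in M. N A \<omega> = (\<Sum>k. of_nat k * indicator {\<omega> \<in> space M. N A \<omega> = of_nat k} \<omega>)"
      using AE_N_nat[OF A fin] AE_space
    proof eventually_elim
      fix \<omega> assume "\<exists>k::nat. N A \<omega> = of_nat k" and \<omega>: "\<omega> \<in> space M"
      then obtain m :: nat where m: "N A \<omega> = of_nat m" by auto
      have "(\<Sum>k. of_nat k * indicator {\<omega> \<in> space M. N A \<omega> = of_nat k} \<omega> :: ennreal) =
          (\<Sum>k\<in>{m}. of_nat k * indicator {\<omega> \<in> space M. N A \<omega> = of_nat k} \<omega>)"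
        using m by (intro suminf_finite) auto
      then show "N A \<omega> = (\<Sum>k. of_nat k * indicator {\<omega> \<in> space M. N A \<omega> = of_nat k} \<omega>)"
        using m \<omega> by simp
    qed
  qed
  also have "\<dots> = (\<Sum>k. of_nat k * emeasure M {\<omega> \<in> space M. N A \<omega> = of_nat k})"
    by (subst nn_integral_suminf) (auto simp: nn_integral_cmult)
  also have "\<dots> = ennreal (measure \<Lambda> A)"
    using poisson_weights_sums(2)[of "measure \<Lambda> A"] prob_N[OF A fin] by (simp add: emeasure_eq_measure)
  also have "\<dots> = emeasure \<Lambda> A" using fin by (simp add: emeasure_eq_ennreal_measure)
  finally show ?thesis .
qed

lemma nn_integral_void:
  assumes A [measurable]: "A \<in> sets \<Lambda>" and fin: "emeasure \<Lambda> A < \<infinity>"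
  shows "(\<integral>\<^sup>+\<omega>. (if N A \<omega> = 0 then 1 else 0) \<partial>M) = ennreal (exp (- measure \<Lambda> A))"
proof -
  have "(\<integral>\<^sup>+\<omega>. (if N A \<omega> = 0 then 1 else 0) \<partial>M) = (\<integral>\<^sup>+\<omega>. indicator {\<omega> \<in> space M. N A \<omega> = of_nat 0} \<omega> \<partial>M)"
    by (intro nn_integral_cong) (auto simp: indicator_def)
  also have "\<dots> = ennreal (exp (- measure \<Lambda> A))"
    using prob_N[OF A fin, of 0] by (simp add: emeasure_eq_measure)
  finally show ?thesis .
qed

text \<open>Independence is stated for families indexed by natural numbers, so the sets are enumerated,
  with the avoided set as the last one.\<close>

lemma nn_integral_prod_counts:
  fixes C :: "'k::finite \<Rightarrow> 'b set"
  assumes C: "\<And>k. C k \<in> sets \<Lambda>" "\<And>k. emeasure \<Lambda> (C k) < \<infinity>" "disjoint_family C"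
    and A: "A \<in> sets \<Lambda>" "emeasure \<Lambda> A < \<infinity>" "\<And>k. C k \<inter> A = {}"
  shows "(\<integral>\<^sup>+\<omega>. (\<Prod>k\<in>UNIV. N (C k) \<omega>) * (if N A \<omega> = 0 then 1 else 0) \<partial>M) =
    (\<Prod>k\<in>UNIV. emeasure \<Lambda> (C k)) * ennreal (exp (- measure \<Lambda> A))"
proof -
  obtain h where h: "bij_betw h {..<CARD('k)} (UNIV :: 'k set)"
    using ex_bij_betw_nat_finite[of "UNIV :: 'k set"] by (auto simp: atLeast0LessThan)
  define n where "n = CARD('k)"
  have inj: "inj_on h {..<n}" using h by (simp add: bij_betw_def n_def)
  define D where "D j = (if j < n then C (h j) else A)" for j
  define Y where "Y j x = (if j < n then x else if x = 0 then 1 else (0::ennreal))" for j and x :: ennreal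
  have Ym: "Y j \<in> borel_measurable borel" for j
    unfolding Y_def by (cases "j < n") auto
  have "disjoint_family_on D {..n}"
    using C(3) A(3) inj by (auto simp: disjoint_family_on_def D_def inj_on_def Int_commute) blast+
  moreover have "D ` {..n} \<subseteq> sets \<Lambda>" using C A by (auto simp: D_def)
  ultimately have "indep_vars (\<lambda>_. borel) (\<lambda>j. N (D j)) {..n}"
    using poisson unfolding poisson_process_def by blast
  then have "indep_vars (\<lambda>_. borel) (\<lambda>j \<omega>. Y j (N (D j) \<omega>)) {..n}"
    using Ym by (rule indep_vars_compose2)
  then have "(\<integral>\<^sup>+\<omega>. (\<Prod>j\<le>n. Y j (N (D j) \<omega>)) \<partial>M) = (\<Prod>j\<le>n. \<integral>\<^sup>+\<omega>. Y j (N (D j) \<omega>) \<partial>M)"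
    by (intro indep_vars_nn_integral) auto
  moreover have "(\<Prod>j\<le>n. Y j (N (D j) \<omega>)) = (\<Prod>k\<in>UNIV. N (C k) \<omega>) * (if N A \<omega> = 0 then 1 else 0)" for \<omega>
  proof -
    have "(\<Prod>j\<le>n. Y j (N (D j) \<omega>)) = (\<Prod>j<n. N (C (h j)) \<omega>) * (if N A \<omega> = 0 then 1 else 0)"
      by (simp add: Y_def D_def lessThan_Suc_atMost[symmetric])
    then show ?thesis using prod.reindex_bij_betw[OF h, of "\<lambda>k. N (C k) \<omega>"] by (simp add: n_def)
  qed
  moreover have "(\<Prod>j\<le>n. \<integral>\<^sup>+\<omega>. Y j (N (D j) \<omega>) \<partial>M) = (\<Prod>k\<in>UNIV. emeasure \<Lambda> (C k)) * ennreal (exp (- measure \<Lambda> A))"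
  proof -
    have "(\<Prod>j\<le>n. \<integral>\<^sup>+\<omega>. Y j (N (D j) \<omega>) \<partial>M) = (\<Prod>j<n. emeasure \<Lambda> (C (h j))) * ennreal (exp (- measure \<Lambda> A))"
      using C A by (simp add: Y_def D_def lessThan_Suc_atMost[symmetric] nn_integral_N nn_integral_void)
    then show ?thesis using prod.reindex_bij_betw[OF h, of "\<lambda>k. emeasure \<Lambda> (C k)"] by (simp add: n_def)
  qed
  ultimately show ?thesis by simp
qed

lemma tau_slice_measurable: "{x \<in> space \<Lambda>. a < tau x \<and> tau x \<le> b} \<in> sets \<Lambda>"
  by measurable

lemma tau_slice_finite: "emeasure \<Lambda> {x \<in> space \<Lambda>. a < tau x \<and> tau x \<le> b} < \<infinity>"
proof (cases "a \<le> b")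
  case True
  then show ?thesis using tau_le[of a b] by (simp add: le_less_trans)
next
  case False
  then have "{x \<in> space \<Lambda>. a < tau x \<and> tau x \<le> b} = {}" by auto
  then show ?thesis by (simp only: emeasure_empty) simp
qed

lemma tau_level_null: "emeasure \<Lambda> {x \<in> space \<Lambda>. tau x = s} = 0"
proof -
  have le: "emeasure \<Lambda> {x \<in> space \<Lambda>. tau x = s} \<le> ennreal (c * (1 / real (Suc n)))" for n
  proof -
    have "emeasure \<Lambda> {x \<in> space \<Lambda>. tau x = s} \<le> emeasure \<Lambda> {x \<in> space \<Lambda>. s - 1 / real (Suc n) < tau x \<and> tau x \<le> s}"
      by (intro emeasure_mono tau_slice_measurable) auto
    also have "\<dots> \<le> ennreal (c * (s - (s - 1 / real (Suc n))))" by (rule tau_le) simp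
    finally show ?thesis by simp
  qed
  have "emeasure \<Lambda> {x \<in> space \<Lambda>. tau x = s} \<le> ennreal (c * 0)"
  proof (rule LIMSEQ_le_const)
    show "(\<lambda>n. ennreal (c * (1 / real (Suc n)))) \<longlonglongrightarrow> ennreal (c * 0)"
      by (intro tendsto_ennrealI tendsto_mult tendsto_const LIMSEQ_Suc[OF lim_1_over_n])
  qed (use le in blast)
  then show ?thesis by simp
qed

lemma sigma_finite_Lambda: "sigma_finite_measure \<Lambda>"
proof
  define S where "S n = {x \<in> space \<Lambda>. 0 < tau x \<and> tau x \<le> real n}" for n
  have "\<Union> (range S) = space \<Lambda>"
  proof (intro equalityI subsetI)
    fix x assume x: "x \<in> space \<Lambda>"
    obtain n where "tau x \<le> real n" using real_arch_simple by auto
    then show "x \<in> \<Union> (range S)" using x tau_pos by (auto simp: S_def)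
  qed (auto simp: S_def)
  then show "\<exists>A. countable A \<and> A \<subseteq> sets \<Lambda> \<and> \<Union> A = space \<Lambda> \<and> (\<forall>a\<in>A. emeasure \<Lambda> a \<noteq> \<infinity>)"
    using tau_slice_measurable tau_slice_finite by (intro exI[of _ "range S"]) (auto simp: S_def less_top)
qed

text \<open>For a Poisson variable with mean \<open>m\<close> the probability of a value above \<open>1\<close> is
  \<open>1 - (1 + m) exp (- m) \<le> m\<^sup>2\<close>.\<close>

lemma prob_two_points:
  assumes A [measurable]: "A \<in> sets \<Lambda>" and le: "emeasure \<Lambda> A \<le> ennreal l" and l: "0 \<le> l"
  shows "prob {\<omega> \<in> space M. \<exists>i j. i \<noteq> j \<and> X i \<omega> \<in> A \<and> X j \<omega> \<in> A} \<le> l\<^sup>2"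
proof -
  have fin: "emeasure \<Lambda> A < \<infinity>" using le by (simp add: le_less_trans)
  define m where "m = measure \<Lambda> A"
  have m: "0 \<le> m" "m \<le> l" using le l by (auto simp: m_def measure_def intro: enn2real_leI)
  let ?E = "\<lambda>k. {\<omega> \<in> space M. N A \<omega> = of_nat k}"
  have sub: "{\<omega> \<in> space M. \<exists>i j. i \<noteq> j \<and> X i \<omega> \<in> A \<and> X j \<omega> \<in> A} \<subseteq> space M - (?E 0 \<union> ?E 1)"
  proof
    fix \<omega> assume \<omega>: "\<omega> \<in> {\<omega> \<in> space M. \<exists>i j. i \<noteq> j \<and> X i \<omega> \<in> A \<and> X j \<omega> \<in> A}"
    then obtain i j where ij: "i \<noteq> j" "X i \<omega> \<in> A" "X j \<omega> \<in> A" by auto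
    have "(2 :: ennreal) = emeasure (count_space UNIV) {i, j}" using ij(1) by (simp add: emeasure_count_space_finite)
    also have "\<dots> \<le> N A \<omega>" unfolding point_count_def using ij by (intro emeasure_mono) auto
    finally have "2 \<le> N A \<omega>" .
    then have "N A \<omega> \<noteq> 0" "N A \<omega> \<noteq> 1" by auto
    then show "\<omega> \<in> space M - (?E 0 \<union> ?E 1)" using \<omega> by auto
  qed
  have "prob {\<omega> \<in> space M. \<exists>i j. i \<noteq> j \<and> X i \<omega> \<in> A \<and> X j \<omega> \<in> A} \<le> prob (space M - (?E 0 \<union> ?E 1))"
    using sub by (rule finite_measure_mono) measurable
  also have "\<dots> = 1 - prob (?E 0 \<union> ?E 1)" by (rule prob_compl) measurable
  also have "prob (?E 0 \<union> ?E 1) = prob (?E 0) + prob (?E 1)"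
    by (rule finite_measure_Union) auto
  also have "\<dots> = (1 + m) * exp (- m)"
    using prob_N[OF A fin, of 0] prob_N[OF A fin, of 1] by (simp add: m_def algebra_simps)
  also have "1 - (1 + m) * exp (- m) \<le> 1 - (1 + m) * (1 - m)"
    using exp_ge_add_one_self[of "- m"] m by (intro diff_left_mono mult_left_mono) auto
  also have "\<dots> = m\<^sup>2" by (simp add: power2_eq_square algebra_simps)
  also have "\<dots> \<le> l\<^sup>2" using m by (intro power_mono) auto
  finally show ?thesis .
qed

text \<open>Cut \<open>(0, R]\<close> into \<open>n\<close> slices. The probability that one of them contains two points is at most
  \<open>n (c R / n)\<^sup>2\<close>, which tends to \<open>0\<close>.\<close>

lemma AE_tau_distinct: "AE \<omega> in M. \<forall>i j. i \<noteq> j \<longrightarrow> tau (X i \<omega>) \<noteq> tau (X j \<omega>)"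
proof -
  define E where "E R = {\<omega> \<in> space M. \<exists>i j. i \<noteq> j \<and> tau (X i \<omega>) = tau (X j \<omega>) \<and> tau (X i \<omega>) \<le> real R}" for R
  have Em [measurable]: "E R \<in> sets M" for R unfolding E_def by measurable
  have "prob (E R) \<le> (c * real R)\<^sup>2 * (1 / real (Suc m))" for R m
  proof -
    define C where "C l = {x \<in> space \<Lambda>. real R * real l / real (Suc m) < tau x \<and> tau x \<le> real R * real (Suc l) / real (Suc m)}" for l
    define F where "F l = {\<omega> \<in> space M. \<exists>i j. i \<noteq> j \<and> X i \<omega> \<in> C l \<and> X j \<omega> \<in> C l}" for l
    have Cm [measurable]: "C l \<in> sets \<Lambda>" for l unfolding C_def by (rule tau_slice_measurable)
    have Fm: "F l \<in> sets M" for l unfolding F_def by measurable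
    have CL: "emeasure \<Lambda> (C l) \<le> ennreal (c * real R / real (Suc m))" for l
    proof -
      have "emeasure \<Lambda> (C l) \<le> ennreal (c * (real R * real (Suc l) / real (Suc m) - real R * real l / real (Suc m)))"
        unfolding C_def by (rule tau_le) (auto intro!: divide_right_mono mult_left_mono)
      also have "c * (real R * real (Suc l) / real (Suc m) - real R * real l / real (Suc m)) = c * real R / real (Suc m)"
        by (simp only: diff_divide_distrib[symmetric] right_diff_distrib[symmetric]) simp
      finally show ?thesis .
    qed
    have "E R \<subseteq> (\<Union>l\<in>{..m}. F l)"
    proof
      fix \<omega> assume \<omega>: "\<omega> \<in> E R"
      then obtain i j where ij: "i \<noteq> j" "tau (X i \<omega>) = tau (X j \<omega>)" "tau (X i \<omega>) \<le> real R" and sp: "\<omega> \<in> space M"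
        by (auto simp: E_def)
      define t where "t = tau (X i \<omega>)"
      have t: "0 < t" "t \<le> real R" using tau_pos[OF X_space[OF sp]] ij by (auto simp: t_def)
      define k where "k = nat (\<lceil>t * real (Suc m) / real R\<rceil> - 1)"
      have R: "0 < real R" using t by simp
      have pos: "0 < t * real (Suc m) / real R" using t R by simp
      have le: "t * real (Suc m) / real R \<le> real (Suc m)"
        using t R by (simp add: divide_le_eq del: of_nat_Suc)
      have c1: "\<lceil>t * real (Suc m) / real R\<rceil> \<ge> 1" using pos by linarith
      then have k: "real k = real_of_int \<lceil>t * real (Suc m) / real R\<rceil> - 1" unfolding k_def by simp
      have k1: "real k < t * real (Suc m) / real R" "t * real (Suc m) / real R \<le> real (Suc k)"
        unfolding of_nat_Suc k by linarith+
      have "k \<le> m"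
      proof -
        have "\<lceil>t * real (Suc m) / real R\<rceil> \<le> int (Suc m)" using le by (simp add: ceiling_le_iff del: of_nat_Suc)
        then show ?thesis unfolding k_def by simp
      qed
      have "real R * real k / real (Suc m) < t" "t \<le> real R * real (Suc k) / real (Suc m)"
        using k1 R by (simp_all add: field_simps del: of_nat_Suc)
      then have "X i \<omega> \<in> C k" "X j \<omega> \<in> C k"
        using ij X_space[OF sp] by (auto simp: C_def t_def)
      then show "\<omega> \<in> (\<Union>l\<in>{..m}. F l)" using ij sp \<open>k \<le> m\<close> by (auto simp: F_def)
    qed
    then have "prob (E R) \<le> prob (\<Union>l\<in>{..m}. F l)" using Fm by (intro finite_measure_mono) auto
    also have "\<dots> \<le> (\<Sum>l\<in>{..m}. prob (F l))" using Fm by (intro finite_measure_subadditive_finite) auto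
    also have "\<dots> \<le> (\<Sum>l\<in>{..m}. (c * real R / real (Suc m))\<^sup>2)"
      unfolding F_def using CL c_nonneg by (intro sum_mono prob_two_points) auto
    also have "\<dots> = (c * real R)\<^sup>2 * (1 / real (Suc m))"
      by (simp add: power2_eq_square field_simps del: of_nat_Suc)
    finally show ?thesis .
  qed
  have "prob (E R) \<le> (c * real R)\<^sup>2 * 0" for R
  proof (rule LIMSEQ_le_const)
    show "(\<lambda>m. (c * real R)\<^sup>2 * (1 / real (Suc m))) \<longlonglongrightarrow> (c * real R)\<^sup>2 * 0"
      by (intro tendsto_intros LIMSEQ_Suc[OF lim_1_over_n])
    show "\<exists>N. \<forall>n\<ge>N. prob (E R) \<le> (c * real R)\<^sup>2 * (1 / real (Suc n))"
      using \<open>\<And>R m. prob (E R) \<le> (c * real R)\<^sup>2 * (1 / real (Suc m))\<close> by blast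
  qed
  then have "prob (E R) = 0" for R using measure_nonneg[of M "E R"] by (simp add: antisym)
  then have "E R \<in> null_sets M" for R using Em by (auto simp: emeasure_eq_measure)
  then have "AE \<omega> in M. \<forall>R. \<omega> \<notin> E R" by (subst AE_all_countable) (auto intro: AE_not_in)
  then show ?thesis using AE_space
  proof eventually_elim
    fix \<omega> assume nE: "\<forall>R. \<omega> \<notin> E R" and sp: "\<omega> \<in> space M"
    show "\<forall>i j. i \<noteq> j \<longrightarrow> tau (X i \<omega>) \<noteq> tau (X j \<omega>)"
    proof (intro allI impI notI)
      fix i j assume ij: "i \<noteq> j" "tau (X i \<omega>) = tau (X j \<omega>)"
      obtain R where "tau (X i \<omega>) \<le> real R" using real_arch_simple by auto
      then have "\<omega> \<in> E R" unfolding E_def using ij sp by blast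
      then show False using nE by auto
    qed
  qed
qed

end

section \<open>The Mecke formula\<close>

lemma finite_separation:
  fixes t :: "'k::finite \<Rightarrow> real"
  shows "\<exists>\<delta>>0. \<forall>k l. t k \<noteq> t l \<longrightarrow> 2 * \<delta> \<le> \<bar>t k - t l\<bar>"
proof -
  define S where "S = insert 1 {\<bar>t k - t l\<bar> | k l. t k \<noteq> t l}"
  have "S \<subseteq> insert 1 ((\<lambda>(k, l). \<bar>t k - t l\<bar>) ` UNIV)" by (auto simp: S_def)
  then have fin: "finite S" by (rule finite_subset) simp
  have pos: "x > 0" if "x \<in> S" for x using that by (auto simp: S_def)
  have ne: "S \<noteq> {}" by (simp add: S_def)
  have "Min S > 0" using pos Min_in[OF fin ne] by auto
  moreover have "Min S \<le> \<bar>t k - t l\<bar>" if "t k \<noteq> t l" for k l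
    using fin that by (intro Min_le) (auto simp: S_def)
  ultimately show ?thesis by (intro exI[of _ "Min S / 2"]) auto
qed

context poisson_points
begin

abbreviation Lambda_power :: "('k::finite \<Rightarrow> 'b) measure" where
  "Lambda_power \<equiv> \<Pi>\<^sub>M k\<in>UNIV. \<Lambda>"

lemma product_sigma_finite_Lambda: "product_sigma_finite (\<lambda>_::'k. \<Lambda>)"
  using sigma_finite_Lambda by (simp add: product_sigma_finite_def)

lemma tau_component [measurable]: "(\<lambda>x. tau (x k)) \<in> borel_measurable (Lambda_power :: ('k::finite \<Rightarrow> 'b) measure)"
  by (rule measurable_compose[OF measurable_component_singleton[of k UNIV "\<lambda>_. \<Lambda>"] tau_measurable]) simp

text \<open>For fixed values of the other coordinates, the \<open>k\<close>-th one would have to lie on a level set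
  of \<open>tau\<close>, which has mass \<open>0\<close>.\<close>

lemma AE_Lambda_power_distinct:
  "AE x in (Lambda_power :: ('k::finite \<Rightarrow> 'b) measure). \<forall>k l. k \<noteq> l \<longrightarrow> tau (x k) \<noteq> tau (x l)"
proof -
  interpret product_sigma_finite "\<lambda>_::'k. \<Lambda>" by (rule product_sigma_finite_Lambda)
  have *: "AE x in (Lambda_power :: ('k \<Rightarrow> 'b) measure). tau (x k) \<noteq> tau (x l)" if kl: "k \<noteq> l" for k l :: 'k
  proof -
    let ?S = "{x \<in> space Lambda_power. tau (x k) = tau (x l)} :: ('k \<Rightarrow> 'b) set"
    have Sm: "?S \<in> sets Lambda_power" by measurable
    have U: "(UNIV :: 'k set) = insert k (UNIV - {k})" by auto
    have "emeasure Lambda_power ?S = (\<integral>\<^sup>+x. indicator ?S x \<partial>Lambda_power)" using Sm by simp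
    also have "\<dots> = (\<integral>\<^sup>+x. \<integral>\<^sup>+y. indicator ?S (x(k := y)) \<partial>\<Lambda> \<partial>(\<Pi>\<^sub>M k\<in>UNIV - {k}. \<Lambda>))"
      using product_nn_integral_insert[of "UNIV - {k}" k "indicator ?S"] Sm U by simp
    also have "\<dots> = (\<integral>\<^sup>+x. 0 \<partial>(\<Pi>\<^sub>M k\<in>UNIV - {k}. \<Lambda>))"
    proof (rule nn_integral_cong)
      fix x assume x: "x \<in> space (\<Pi>\<^sub>M k\<in>UNIV - {k}. \<Lambda>)"
      have "(\<integral>\<^sup>+y. indicator ?S (x(k := y)) \<partial>\<Lambda>) \<le> (\<integral>\<^sup>+y. indicator {y \<in> space \<Lambda>. tau y = tau (x l)} y \<partial>\<Lambda>)"
        using kl by (intro nn_integral_mono) (auto simp: indicator_def)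
      also have "\<dots> = emeasure \<Lambda> {y \<in> space \<Lambda>. tau y = tau (x l)}" by (rule nn_integral_indicator) measurable
      also have "\<dots> = 0" by (rule tau_level_null)
      finally show "(\<integral>\<^sup>+y. indicator ?S (x(k := y)) \<partial>\<Lambda>) = 0" by simp
    qed
    finally have "?S \<in> null_sets Lambda_power" using Sm by auto
    then show ?thesis by (rule AE_I') auto
  qed
  show ?thesis
    unfolding AE_all_countable
  proof (intro allI)
    fix k l :: 'k
    show "AE x in Lambda_power. k \<noteq> l \<longrightarrow> tau (x k) \<noteq> tau (x l)"
      using *[of k l] by (cases "k = l") auto
  qed
qed

text \<open>Independence of the counts is available for disjoint sets only. It suffices nevertheless:
  tuples with distinct \<open>tau\<close>-values are covered by the countably many boxes whose sides have
  disjoint \<open>tau\<close>-intervals with rational end points.\<close>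

lemma measure_eqI_separated_boxes:
  fixes \<mu> \<nu> :: "('k::finite \<Rightarrow> 'b) measure"
  assumes sets: "sets \<mu> = sets Lambda_power" "sets \<nu> = sets Lambda_power"
    and box: "\<And>C a b. (\<And>k. C k \<in> sets \<Lambda>) \<Longrightarrow> (\<And>k x. x \<in> C k \<Longrightarrow> a k < tau x \<and> tau x \<le> b k) \<Longrightarrow>
        (\<And>k l. k \<noteq> l \<Longrightarrow> {a k<..b k} \<inter> {a l<..b l} = {}) \<Longrightarrow>
        emeasure \<mu> (\<Pi>\<^sub>E k\<in>UNIV. C k) = emeasure \<nu> (\<Pi>\<^sub>E k\<in>UNIV. C k) \<and> emeasure \<mu> (\<Pi>\<^sub>E k\<in>UNIV. C k) < \<infinity>"
    and dist: "AE x in \<mu>. \<forall>k l. k \<noteq> l \<longrightarrow> tau (x k) \<noteq> tau (x l)" "AE x in \<nu>. \<forall>k l. k \<noteq> l \<longrightarrow> tau (x k) \<noteq> tau (x l)"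
  shows "\<mu> = \<nu>"
proof -
  define good where "good q \<longleftrightarrow> (\<forall>k l. k \<noteq> l \<longrightarrow> {real_of_rat (fst (q k))<..real_of_rat (snd (q k))} \<inter> {real_of_rat (fst (q l))<..real_of_rat (snd (q l))} = {})"
    for q :: "'k \<Rightarrow> rat \<times> rat"
  define I where "I q k = {x \<in> space \<Lambda>. real_of_rat (fst (q k)) < tau x \<and> tau x \<le> real_of_rat (snd (q k))}" for q :: "'k \<Rightarrow> rat \<times> rat" and k
  define R where "R q = (\<Pi>\<^sub>E k\<in>UNIV. I q k)" for q
  have Im: "I q k \<in> sets \<Lambda>" for q k unfolding I_def by (rule tau_slice_measurable)
  have Rm: "R q \<in> sets Lambda_power" for q unfolding R_def using Im by (intro sets_PiM_I_finite) auto
  have eqR: "emeasure \<mu> (E \<inter> R q) = emeasure \<nu> (E \<inter> R q)" if q: "good q" and E: "E \<in> sets Lambda_power" for q E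
  proof -
    have b: "emeasure \<mu> (\<Pi>\<^sub>E k\<in>UNIV. B k \<inter> I q k) = emeasure \<nu> (\<Pi>\<^sub>E k\<in>UNIV. B k \<inter> I q k) \<and> emeasure \<mu> (\<Pi>\<^sub>E k\<in>UNIV. B k \<inter> I q k) < \<infinity>"
      if "\<And>k. B k \<in> sets \<Lambda>" for B
    proof (rule box[of "\<lambda>k. B k \<inter> I q k" "\<lambda>k. real_of_rat (fst (q k))" "\<lambda>k. real_of_rat (snd (q k))"])
      show "{real_of_rat (fst (q k))<..real_of_rat (snd (q k))} \<inter> {real_of_rat (fst (q l))<..real_of_rat (snd (q l))} = {}" if "k \<noteq> l" for k l
        using q that by (simp add: good_def)
    qed (use that Im in \<open>auto simp: I_def\<close>)
    have dens: "emeasure (density \<rho> (indicator (R q))) E = emeasure \<rho> (E \<inter> R q)"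
      if "sets \<rho> = sets Lambda_power" "E \<in> sets Lambda_power" for \<rho> E
    proof -
      have "R q \<in> sets \<rho>" "E \<in> sets \<rho>" using Rm that by auto
      then show ?thesis by (subst emeasure_density) (auto simp: indicator_inter_arith[symmetric] Int_commute mult.commute)
    qed
    have PiE_Int: "(\<Pi>\<^sub>E k\<in>UNIV. B k) \<inter> R q = (\<Pi>\<^sub>E k\<in>UNIV. B k \<inter> I q k)" for B
      by (auto simp: R_def PiE_iff)
    have "density \<mu> (indicator (R q)) = density \<nu> (indicator (R q))"
    proof (rule measure_eqI_PiM_finite)
      show "finite (UNIV :: 'k set)" by simp
      show "sets (density \<mu> (indicator (R q))) = sets Lambda_power" "sets (density \<nu> (indicator (R q))) = sets Lambda_power"
        using sets by simp_all
      show "emeasure (density \<mu> (indicator (R q))) (Pi\<^sub>E UNIV B) = emeasure (density \<nu> (indicator (R q))) (Pi\<^sub>E UNIV B)"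
        if "\<And>k. k \<in> UNIV \<Longrightarrow> B k \<in> sets \<Lambda>" for B
      proof -
        have "Pi\<^sub>E UNIV B \<in> sets Lambda_power" using that by (intro sets_PiM_I_finite) auto
        then show ?thesis using b[of B] that by (simp add: dens sets PiE_Int)
      qed
      show "range (\<lambda>_::nat. space Lambda_power) \<subseteq> prod_algebra UNIV (\<lambda>_::'k. \<Lambda>)"
        using prod_algebraI_finite[of UNIV "\<lambda>_. space \<Lambda>" "\<lambda>_::'k. \<Lambda>"] by (auto simp: space_PiM)
      show "(\<Union>i::nat. space Lambda_power) = space (Lambda_power :: ('k \<Rightarrow> 'b) measure)" by simp
      show "emeasure (density \<mu> (indicator (R q))) (space Lambda_power) \<noteq> \<infinity>" for i :: nat
      proof -
        have "emeasure \<mu> (\<Pi>\<^sub>E k\<in>UNIV. space \<Lambda> \<inter> I q k) < \<infinity>" using b[of "\<lambda>_. space \<Lambda>"] by blast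
        moreover have "emeasure (density \<mu> (indicator (R q))) (space Lambda_power) = emeasure \<mu> (\<Pi>\<^sub>E k\<in>UNIV. space \<Lambda> \<inter> I q k)"
        proof -
          have "space Lambda_power \<inter> R q = (\<Pi>\<^sub>E k\<in>UNIV. space \<Lambda> \<inter> I q k)"
            by (simp only: space_PiM PiE_Int)
          then show ?thesis using dens[OF sets(1) sets.top] by simp
        qed
        ultimately show ?thesis by simp
      qed
    qed
    then show ?thesis using dens[OF sets(1) E] dens[OF sets(2) E] by simp
  qed
  have cover: "\<exists>q. good q \<and> x \<in> R q" if x: "x \<in> space Lambda_power" "\<forall>k l. k \<noteq> l \<longrightarrow> tau (x k) \<noteq> tau (x l)" for x :: "'k \<Rightarrow> 'b"
  proof -
    obtain \<delta> where \<delta>: "\<delta> > 0" "\<And>k l. tau (x k) \<noteq> tau (x l) \<Longrightarrow> 2 * \<delta> \<le> \<bar>tau (x k) - tau (x l)\<bar>"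
      using finite_separation[of "\<lambda>k. tau (x k)"] by auto
    have "\<exists>p. tau (x k) - \<delta> < real_of_rat (fst p) \<and> real_of_rat (fst p) < tau (x k) \<and> tau (x k) < real_of_rat (snd p) \<and> real_of_rat (snd p) < tau (x k) + \<delta>" for k
    proof -
      obtain r1 where "tau (x k) - \<delta> < real_of_rat r1" "real_of_rat r1 < tau (x k)"
        using of_rat_dense[of "tau (x k) - \<delta>" "tau (x k)"] \<delta>(1) by auto
      moreover obtain r2 where "tau (x k) < real_of_rat r2" "real_of_rat r2 < tau (x k) + \<delta>"
        using of_rat_dense[of "tau (x k)" "tau (x k) + \<delta>"] \<delta>(1) by auto
      ultimately show ?thesis by (intro exI[of _ "(r1, r2)"]) simp
    qed
    then have "\<exists>q. \<forall>k. tau (x k) - \<delta> < real_of_rat (fst (q k)) \<and> real_of_rat (fst (q k)) < tau (x k) \<and> tau (x k) < real_of_rat (snd (q k)) \<and> real_of_rat (snd (q k)) < tau (x k) + \<delta>"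
      by (rule choice[OF allI])
    then obtain q where q: "\<And>k. tau (x k) - \<delta> < real_of_rat (fst (q k))" "\<And>k. real_of_rat (fst (q k)) < tau (x k)"
        "\<And>k. tau (x k) < real_of_rat (snd (q k))" "\<And>k. real_of_rat (snd (q k)) < tau (x k) + \<delta>" by blast
    have "good q"
      unfolding good_def
    proof (intro allI impI)
      fix k l :: 'k assume "k \<noteq> l"
      then have "2 * \<delta> \<le> \<bar>tau (x k) - tau (x l)\<bar>" using x(2) \<delta>(2) by blast
      then show "{real_of_rat (fst (q k))<..real_of_rat (snd (q k))} \<inter> {real_of_rat (fst (q l))<..real_of_rat (snd (q l))} = {}"
        using q(1,4)[of k] q(1,4)[of l] by (auto simp: abs_if split: if_splits)
    qed
    moreover have "x k \<in> I q k" for k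
      using q(2,3)[of k] x(1) by (auto simp: I_def space_PiM PiE_iff)
    then have "x \<in> R q" by (auto simp: R_def)
    ultimately show ?thesis by auto
  qed
  \<comment> \<open>An enumeration of the rational boxes with separated sides, which are then made disjoint.\<close>
  define R' where "R' n = (if good (from_nat n) then R (from_nat n) else {})" for n
  define D where "D = disjointed R'"
  have R'm: "range R' \<subseteq> sets Lambda_power" using Rm by (auto simp: R'_def)
  have Dm: "D n \<in> sets Lambda_power" for n
    using sets.range_disjointed_sets[OF R'm] by (auto simp: D_def)
  have sum: "emeasure \<rho> E = (\<Sum>n. emeasure \<rho> (E \<inter> D n))"
    if \<rho>: "sets \<rho> = sets Lambda_power" "AE x in \<rho>. \<forall>k l. k \<noteq> l \<longrightarrow> tau (x k) \<noteq> tau (x l)" and E: "E \<in> sets Lambda_power" for \<rho> E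
  proof -
    have ED: "E \<inter> D n \<in> sets \<rho>" for n using \<rho> E Dm by auto
    have "emeasure \<rho> E = emeasure \<rho> (\<Union>n. E \<inter> D n)"
    proof (rule emeasure_eq_AE)
      show "AE x in \<rho>. x \<in> E \<longleftrightarrow> x \<in> (\<Union>n. E \<inter> D n)"
        using \<rho>(2)
      proof eventually_elim
        fix x :: "'k \<Rightarrow> 'b" assume x: "\<forall>k l. k \<noteq> l \<longrightarrow> tau (x k) \<noteq> tau (x l)"
        have "x \<in> (\<Union>n. D n)" if "x \<in> E"
        proof -
          have "x \<in> space Lambda_power" using that sets.sets_into_space[OF E] by (rule subsetD[rotated])
          from cover[OF this x] obtain q where "good q \<and> x \<in> R q" by (rule exE)
          then have "x \<in> R' (to_nat q)" by (simp add: R'_def)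
          then have "x \<in> (\<Union>n. R' n)" by (rule UN_I[OF UNIV_I])
          then show ?thesis unfolding D_def UN_disjointed_eq .
        qed
        then show "x \<in> E \<longleftrightarrow> x \<in> (\<Union>n. E \<inter> D n)" by blast
      qed
      show "E \<in> sets \<rho>" using \<rho> E by simp
      show "(\<Union>n. E \<inter> D n) \<in> sets \<rho>" by (rule sets.countable_UN) (use ED in blast)
    qed
    also have "\<dots> = (\<Sum>n. emeasure \<rho> (E \<inter> D n))"
    proof (rule suminf_emeasure[symmetric])
      show "range (\<lambda>n. E \<inter> D n) \<subseteq> sets \<rho>" using ED by blast
      have "disjoint_family D" unfolding D_def by (rule disjoint_family_disjointed)
      then show "disjoint_family (\<lambda>n. E \<inter> D n)" unfolding disjoint_family_on_def by blast
    qed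
    finally show ?thesis .
  qed
  show ?thesis
  proof (rule measure_eqI)
    show "sets \<mu> = sets \<nu>" using sets by simp
    fix E assume "E \<in> sets \<mu>"
    then have E: "E \<in> sets Lambda_power" using sets by simp
    have "emeasure \<mu> (E \<inter> D n) = emeasure \<nu> (E \<inter> D n)" for n
    proof (cases "good (from_nat n :: 'k \<Rightarrow> rat \<times> rat)")
      case True
      have "D n \<subseteq> R (from_nat n)" using disjointed_subset[of R' n] True by (simp add: D_def R'_def)
      then have "(E \<inter> D n) \<inter> R (from_nat n) = E \<inter> D n" by auto
      then show ?thesis using eqR[OF True, of "E \<inter> D n"] E Dm by simp
    next
      case False
      then have "D n = {}" using disjointed_subset[of R' n] by (simp add: D_def R'_def)
      then show ?thesis by simp
    qed
    then show "emeasure \<mu> E = emeasure \<nu> E"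
      unfolding sum[OF sets(1) dist(1) E] sum[OF sets(2) dist(2) E] by simp
  qed
qed

abbreviation inj_tuples :: "('k::finite \<Rightarrow> nat) set" where "inj_tuples \<equiv> {i. inj i}"

definition tuple :: "('k::finite \<Rightarrow> nat) \<Rightarrow> 'w \<Rightarrow> 'k \<Rightarrow> 'b" where
  "tuple i \<omega> = (\<lambda>k. X (i k) \<omega>)"

lemma tuple_measurable [measurable]: "tuple (i :: 'k::finite \<Rightarrow> nat) \<in> M \<rightarrow>\<^sub>M Lambda_power"
  unfolding tuple_def[abs_def] by (rule measurable_PiM_single') (auto simp: X_space)

lemma indexed_tuple_measurable [measurable]:
  "(\<lambda>(i, \<omega>). tuple i \<omega>) \<in> count_space (inj_tuples :: ('k::finite \<Rightarrow> nat) set) \<Otimes>\<^sub>M M \<rightarrow>\<^sub>M Lambda_power"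
  by (rule measurable_pair_measure_countable1) auto

text \<open>The factorial moment measure of the process, restricted to the event that no point lies
  in \<open>A\<close>.\<close>

definition factorial_measure :: "'b set \<Rightarrow> ('k::finite \<Rightarrow> 'b) measure" where
  "factorial_measure A = distr (density (count_space (inj_tuples :: ('k \<Rightarrow> nat) set) \<Otimes>\<^sub>M M)
      (\<lambda>(i, \<omega>). if N A \<omega> = 0 then 1 else 0)) Lambda_power (\<lambda>(i, \<omega>). tuple i \<omega>)"

lemma sets_factorial_measure [simp, measurable_cong]: "sets (factorial_measure A) = sets Lambda_power"
  by (simp add: factorial_measure_def)

lemma nn_integral_indexed:
  assumes "\<And>i. i \<in> I \<Longrightarrow> f i \<in> borel_measurable M" and "countable I"
  shows "(\<integral>\<^sup>+z. (case z of (i, \<omega>) \<Rightarrow> f i \<omega>) \<partial>(count_space I \<Otimes>\<^sub>M M)) = (\<integral>\<^sup>+\<omega>. (\<integral>\<^sup>+i. f i \<omega> \<partial>count_space I) \<partial>M)"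
proof -
  have "(\<lambda>(i, \<omega>). f i \<omega>) \<in> borel_measurable (count_space I \<Otimes>\<^sub>M M)"
    using assms by (intro measurable_pair_measure_countable1) auto
  then have "(\<integral>\<^sup>+z. (case z of (i, \<omega>) \<Rightarrow> f i \<omega>) \<partial>(count_space I \<Otimes>\<^sub>M M)) = (\<integral>\<^sup>+i. (\<integral>\<^sup>+\<omega>. f i \<omega> \<partial>M) \<partial>count_space I)"
    by (subst nn_integral_fst[symmetric]) auto
  also have "\<dots> = (\<integral>\<^sup>+\<omega>. (\<integral>\<^sup>+i. f i \<omega> \<partial>count_space I) \<partial>M)"
    using assms by (intro nn_integral_count_space_nn_integral[symmetric]) auto
  finally show ?thesis .
qed

lemma void_measurable [measurable]:
  assumes "A \<in> sets \<Lambda>" shows "(\<lambda>\<omega>. if N A \<omega> = 0 then 1 else (0::ennreal)) \<in> borel_measurable M"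
proof -
  have [measurable]: "N A \<in> borel_measurable M" using assms by (rule N_measurable)
  show ?thesis by measurable
qed

lemma nn_integral_factorial_measure:
  fixes f :: "('k::finite \<Rightarrow> 'b) \<Rightarrow> ennreal"
  assumes A [measurable]: "A \<in> sets \<Lambda>" and f [measurable]: "f \<in> borel_measurable Lambda_power"
  shows "(\<integral>\<^sup>+x. f x \<partial>factorial_measure A) =
    (\<integral>\<^sup>+\<omega>. (\<integral>\<^sup>+i. f (tuple i \<omega>) * (if N A \<omega> = 0 then 1 else 0) \<partial>count_space inj_tuples) \<partial>M)"
proof -
  let ?T = "count_space (inj_tuples :: ('k \<Rightarrow> nat) set) \<Otimes>\<^sub>M M"
  have vm: "(\<lambda>(i, \<omega>). if N A \<omega> = 0 then 1 else (0::ennreal)) \<in> borel_measurable ?T"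
    by (rule measurable_pair_measure_countable1) (auto intro: void_measurable[OF A])
  have fm: "(\<lambda>(i, \<omega>). f (tuple i \<omega>)) \<in> borel_measurable ?T"
    by (rule measurable_pair_measure_countable1) auto
  have "(\<integral>\<^sup>+x. f x \<partial>factorial_measure A) = (\<integral>\<^sup>+z. (case z of (i, \<omega>) \<Rightarrow> f (tuple i \<omega>)) \<partial>density ?T (\<lambda>(i, \<omega>). if N A \<omega> = 0 then 1 else 0))"
    unfolding factorial_measure_def
    by (subst nn_integral_distr) (auto intro!: nn_integral_cong split: prod.split)
  also have "\<dots> = (\<integral>\<^sup>+z. (case z of (i, \<omega>) \<Rightarrow> f (tuple i \<omega>) * (if N A \<omega> = 0 then 1 else 0)) \<partial>?T)"
    using vm fm by (subst nn_integral_density) (auto intro!: nn_integral_cong split: prod.split)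
  also have "\<dots> = (\<integral>\<^sup>+\<omega>. (\<integral>\<^sup>+i. f (tuple i \<omega>) * (if N A \<omega> = 0 then 1 else 0) \<partial>count_space inj_tuples) \<partial>M)"
    by (rule nn_integral_indexed) (auto intro!: borel_measurable_times_ennreal void_measurable[OF A])
  finally show ?thesis .
qed

text \<open>Indices of points in disjoint sets are automatically distinct.\<close>

lemma prod_counts_eq:
  fixes C :: "'k::finite \<Rightarrow> 'b set"
  assumes disj: "\<And>k l. k \<noteq> l \<Longrightarrow> C k \<inter> C l = {}"
  shows "(\<integral>\<^sup>+i. (\<Prod>k\<in>UNIV. indicator (C k) (X (i k) \<omega>)) \<partial>count_space inj_tuples) = (\<Prod>k\<in>UNIV. N (C k) \<omega>)"
proof -
  interpret P: product_sigma_finite "\<lambda>_::'k. count_space (UNIV :: nat set)"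
    by (simp add: product_sigma_finite_def sigma_finite_measure_count_space)
  have PiM: "(\<Pi>\<^sub>M k\<in>UNIV. count_space (UNIV :: nat set)) = count_space (UNIV :: ('k \<Rightarrow> nat) set)"
    using count_space_PiM_finite[of "UNIV :: 'k set" "\<lambda>_. UNIV :: nat set"] by simp
  have "(\<integral>\<^sup>+i. (\<Prod>k\<in>UNIV. indicator (C k) (X (i k) \<omega>)) \<partial>count_space inj_tuples) =
      (\<integral>\<^sup>+i. (\<Prod>k\<in>UNIV. indicator (C k) (X (i k) \<omega>)) \<partial>count_space (UNIV :: ('k \<Rightarrow> nat) set))"
  proof (rule nn_integral_count_space_eq)
    fix i :: "'k \<Rightarrow> nat" assume "i \<in> UNIV - inj_tuples"
    then obtain k l where kl: "k \<noteq> l" "i k = i l" by (auto simp: inj_def)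
    then have "X (i k) \<omega> \<notin> C k \<or> X (i l) \<omega> \<notin> C l" using disj[OF kl(1)] by auto
    then obtain j where "X (i j) \<omega> \<notin> C j" by auto
    then show "(\<Prod>k\<in>UNIV. indicator (C k) (X (i k) \<omega>) :: ennreal) = 0"
      by (intro prod_zero bexI[of _ j]) auto
  qed auto
  also have "\<dots> = (\<Prod>k\<in>UNIV. \<integral>\<^sup>+i. indicator (C k) (X i \<omega>) \<partial>count_space UNIV)"
    unfolding PiM[symmetric] by (rule P.product_nn_integral_prod) auto
  also have "\<dots> = (\<Prod>k\<in>UNIV. N (C k) \<omega>)"
    by (simp add: N_eq nn_integral_count_space_nat)
  finally show ?thesis .
qed

lemma tuple_in_PiE: "indicator (\<Pi>\<^sub>E k\<in>UNIV. C k) (tuple i \<omega>) = (\<Prod>k\<in>UNIV. indicator (C k) (X (i k) \<omega>) :: ennreal)"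
proof (cases "\<forall>k. X (i k) \<omega> \<in> C k")
  case True then show ?thesis by (simp add: tuple_def PiE_iff indicator_def)
next
  case False
  then obtain k where "X (i k) \<omega> \<notin> C k" by auto
  then have "tuple i \<omega> \<notin> (\<Pi>\<^sub>E k\<in>UNIV. C k)" by (auto simp: tuple_def PiE_iff)
  then have 1: "indicator (\<Pi>\<^sub>E k\<in>UNIV. C k) (tuple i \<omega>) = (0 :: ennreal)" by simp
  have 2: "(\<Prod>k\<in>UNIV. indicator (C k) (X (i k) \<omega>) :: ennreal) = 0"
    using \<open>X (i k) \<omega> \<notin> C k\<close> by (intro prod_zero bexI[of _ k]) auto
  show ?thesis unfolding 1 2 ..
qed

lemma AE_factorial_measure_distinct:
  assumes A [measurable]: "A \<in> sets \<Lambda>"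
  shows "AE x in (factorial_measure A :: ('k::finite \<Rightarrow> 'b) measure). \<forall>k l. k \<noteq> l \<longrightarrow> tau (x k) \<noteq> tau (x l)"
proof -
  let ?S = "{x \<in> space Lambda_power. \<exists>k l. k \<noteq> l \<and> tau (x k) = tau (x l)} :: ('k \<Rightarrow> 'b) set"
  have S [measurable]: "?S \<in> sets Lambda_power"
  proof -
    have "{x \<in> space Lambda_power. tau (x k) = tau (x l)} \<in> sets Lambda_power" for k l :: 'k
      by measurable
    moreover have "?S = (\<Union>k. \<Union>l\<in>{l. k \<noteq> l}. {x \<in> space Lambda_power. tau (x k) = tau (x l)})" by auto
    ultimately show ?thesis by (simp only:) (intro sets.finite_UN, auto)
  qed
  have "emeasure (factorial_measure A) ?S = (\<integral>\<^sup>+x. indicator ?S x \<partial>factorial_measure A)" using S by simp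
  also have "\<dots> = (\<integral>\<^sup>+\<omega>. (\<integral>\<^sup>+i. indicator ?S (tuple i \<omega>) * (if N A \<omega> = 0 then 1 else 0) \<partial>count_space inj_tuples) \<partial>M)"
    by (rule nn_integral_factorial_measure) measurable
  also have "\<dots> = (\<integral>\<^sup>+\<omega>. 0 \<partial>M)"
  proof (rule nn_integral_cong_AE)
    show "AE \<omega> in M. (\<integral>\<^sup>+i. indicator ?S (tuple i \<omega>) * (if N A \<omega> = 0 then 1 else 0) \<partial>count_space inj_tuples) = 0"
      using AE_tau_distinct
    proof eventually_elim
      fix \<omega> assume d: "\<forall>i j. i \<noteq> j \<longrightarrow> tau (X i \<omega>) \<noteq> tau (X j \<omega>)"
      have "tuple i \<omega> \<notin> ?S" if "inj i" for i :: "'k \<Rightarrow> nat"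
        using d that by (auto simp: tuple_def inj_eq)
      then have "(\<integral>\<^sup>+i. indicator ?S (tuple i \<omega>) * (if N A \<omega> = 0 then 1 else 0) \<partial>count_space inj_tuples) =
          (\<integral>\<^sup>+i. 0 \<partial>count_space (inj_tuples :: ('k \<Rightarrow> nat) set))"
        by (intro nn_integral_cong) simp
      then show "(\<integral>\<^sup>+i. indicator ?S (tuple i \<omega>) * (if N A \<omega> = 0 then 1 else 0) \<partial>count_space inj_tuples) = 0" by simp
    qed
  qed
  finally have "?S \<in> null_sets (factorial_measure A)" by (auto intro!: null_setsI)
  then show ?thesis by (rule AE_I') (auto simp: factorial_measure_def)
qed

text \<open>The multivariate Mecke formula for a fixed avoided set. On boxes with disjoint sides both
  measures factor, because the counts are independent and Poisson distributed.\<close>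

theorem factorial_measure_eq:
  assumes A [measurable]: "A \<in> sets \<Lambda>" and fin: "emeasure \<Lambda> A < \<infinity>"
  shows "(factorial_measure A :: ('k::finite \<Rightarrow> 'b) measure) =
    density Lambda_power (\<lambda>x. ennreal (exp (- measure \<Lambda> A)) * (\<Prod>k\<in>UNIV. indicator (space \<Lambda> - A) (x k)))"
proof (rule measure_eqI_separated_boxes)
  interpret P: product_sigma_finite "\<lambda>_::'k. \<Lambda>" by (rule product_sigma_finite_Lambda)
  let ?g = "\<lambda>x :: 'k \<Rightarrow> 'b. ennreal (exp (- measure \<Lambda> A)) * (\<Prod>k\<in>UNIV. indicator (space \<Lambda> - A) (x k))"
  have gm [measurable]: "?g \<in> borel_measurable Lambda_power"
  proof -
    have [measurable]: "(\<lambda>x. indicator (space \<Lambda> - A) (x k) :: ennreal) \<in> borel_measurable Lambda_power" for k :: 'k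
      using measurable_compose[OF measurable_component_singleton[of k UNIV "\<lambda>_. \<Lambda>"], of "indicator (space \<Lambda> - A)"] by simp
    show ?thesis by measurable
  qed
  show "sets (factorial_measure A) = sets Lambda_power" by simp
  show "sets (density Lambda_power ?g) = sets Lambda_power" by simp
  show "AE x in factorial_measure A. \<forall>k l. k \<noteq> l \<longrightarrow> tau (x k) \<noteq> tau (x l)"
    using A by (rule AE_factorial_measure_distinct)
  show "AE x in density Lambda_power ?g. \<forall>k l. k \<noteq> l \<longrightarrow> tau (x k) \<noteq> tau (x l)"
    using AE_Lambda_power_distinct by (subst AE_density[OF gm]) auto
  fix C :: "'k \<Rightarrow> 'b set" and a b :: "'k \<Rightarrow> real"
  assume Cm: "\<And>k. C k \<in> sets \<Lambda>" and Ct: "\<And>k x. x \<in> C k \<Longrightarrow> a k < tau x \<and> tau x \<le> b k"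
    and ab: "\<And>k l. k \<noteq> l \<Longrightarrow> {a k<..b k} \<inter> {a l<..b l} = {}"
  have CS: "C k \<subseteq> {x \<in> space \<Lambda>. a k < tau x \<and> tau x \<le> b k}" for k
    using Ct sets.sets_into_space[OF Cm] by auto
  have Cfin: "emeasure \<Lambda> (C k - A) < \<infinity>" for k
  proof -
    have "emeasure \<Lambda> (C k - A) \<le> emeasure \<Lambda> {x \<in> space \<Lambda>. a k < tau x \<and> tau x \<le> b k}"
      using CS tau_slice_measurable by (intro emeasure_mono) auto
    then show ?thesis using tau_slice_finite le_less_trans by blast
  qed
  have disj: "C k \<inter> C l = {}" if "k \<noteq> l" for k l
    using Ct[of _ k] Ct[of _ l] ab[OF that] by fastforce
  have boxm: "(\<Pi>\<^sub>E k\<in>UNIV. C k) \<in> sets Lambda_power" using Cm by (intro sets_PiM_I_finite) auto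
  have "emeasure (factorial_measure A) (\<Pi>\<^sub>E k\<in>UNIV. C k) =
      (\<integral>\<^sup>+x. indicator (\<Pi>\<^sub>E k\<in>UNIV. C k) x \<partial>factorial_measure A)" using boxm by simp
  also have "\<dots> = (\<integral>\<^sup>+\<omega>. (\<integral>\<^sup>+i. indicator (\<Pi>\<^sub>E k\<in>UNIV. C k) (tuple i \<omega>) * (if N A \<omega> = 0 then 1 else 0) \<partial>count_space inj_tuples) \<partial>M)"
    using boxm by (intro nn_integral_factorial_measure A) simp
  also have "\<dots> = (\<integral>\<^sup>+\<omega>. (\<Prod>k\<in>UNIV. N (C k - A) \<omega>) * (if N A \<omega> = 0 then 1 else 0) \<partial>M)"
  proof (intro nn_integral_cong)
    fix \<omega>
    show "(\<integral>\<^sup>+i. indicator (\<Pi>\<^sub>E k\<in>UNIV. C k) (tuple i \<omega>) * (if N A \<omega> = 0 then 1 else 0) \<partial>count_space inj_tuples) =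
        (\<Prod>k\<in>UNIV. N (C k - A) \<omega>) * (if N A \<omega> = 0 then 1 else 0)"
    proof (cases "N A \<omega> = 0")
      case True
      then have "X i \<omega> \<notin> A" for i by (simp add: N_eq_0_iff)
      then have "N (C k - A) \<omega> = N (C k) \<omega>" for k by (simp add: point_count_def)
      then show ?thesis using True prod_counts_eq[of C \<omega>] disj by (simp add: tuple_in_PiE)
    qed simp
  qed
  also have "\<dots> = (\<Prod>k\<in>UNIV. emeasure \<Lambda> (C k - A)) * ennreal (exp (- measure \<Lambda> A))"
  proof (rule nn_integral_prod_counts)
    show "disjoint_family (\<lambda>k. C k - A)" using disj by (auto simp: disjoint_family_on_def)
  qed (use Cm Cfin fin in auto)
  finally have 1: "emeasure (factorial_measure A) (\<Pi>\<^sub>E k\<in>UNIV. C k) = (\<Prod>k\<in>UNIV. emeasure \<Lambda> (C k - A)) * ennreal (exp (- measure \<Lambda> A))" .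
  have "emeasure (density Lambda_power ?g) (\<Pi>\<^sub>E k\<in>UNIV. C k) = (\<integral>\<^sup>+x. ?g x * indicator (\<Pi>\<^sub>E k\<in>UNIV. C k) x \<partial>Lambda_power)"
    using boxm by (intro emeasure_density gm) simp
  also have "\<dots> = (\<integral>\<^sup>+x. ennreal (exp (- measure \<Lambda> A)) * indicator (\<Pi>\<^sub>E k\<in>UNIV. C k - A) x \<partial>Lambda_power)"
  proof (intro nn_integral_cong)
    fix x :: "'k \<Rightarrow> 'b"
    have "(\<Prod>k\<in>UNIV. indicator (space \<Lambda> - A) (x k) :: ennreal) * indicator (\<Pi>\<^sub>E k\<in>UNIV. C k) x = indicator (\<Pi>\<^sub>E k\<in>UNIV. C k - A) x"
    proof (cases "\<forall>k. x k \<in> C k - A")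
      case True
      then have "x k \<in> space \<Lambda>" for k using sets.sets_into_space[OF Cm] by blast
      then show ?thesis using True by (auto simp: PiE_iff indicator_def)
    next
      case False
      then obtain k where "x k \<notin> C k \<or> x k \<in> A" by auto
      then show ?thesis
      proof
        assume "x k \<in> A"
        then have "(\<Prod>k\<in>UNIV. indicator (space \<Lambda> - A) (x k) :: ennreal) = 0"
          by (intro prod_zero bexI[of _ k]) auto
        then show ?thesis using False by (auto simp: PiE_iff)
      next
        assume "x k \<notin> C k"
        then have "x \<notin> (\<Pi>\<^sub>E k\<in>UNIV. C k)" "x \<notin> (\<Pi>\<^sub>E k\<in>UNIV. C k - A)" by auto
        then show ?thesis by simp
      qed
    qed
    then show "?g x * indicator (\<Pi>\<^sub>E k\<in>UNIV. C k) x = ennreal (exp (- measure \<Lambda> A)) * indicator (\<Pi>\<^sub>E k\<in>UNIV. C k - A) x"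
      by (simp add: mult.assoc)
  qed
  also have "\<dots> = ennreal (exp (- measure \<Lambda> A)) * emeasure Lambda_power (\<Pi>\<^sub>E k\<in>UNIV. C k - A)"
    using Cm by (intro nn_integral_cmult_indicator sets_PiM_I_finite) auto
  also have "emeasure Lambda_power (\<Pi>\<^sub>E k\<in>UNIV. C k - A) = (\<Prod>k\<in>UNIV. emeasure \<Lambda> (C k - A))"
    using Cm by (intro P.emeasure_PiM) auto
  finally have 2: "emeasure (density Lambda_power ?g) (\<Pi>\<^sub>E k\<in>UNIV. C k) = ennreal (exp (- measure \<Lambda> A)) * (\<Prod>k\<in>UNIV. emeasure \<Lambda> (C k - A))" .
  have "(\<Prod>k\<in>UNIV. emeasure \<Lambda> (C k - A)) < \<infinity>"
  proof -
    have "emeasure \<Lambda> (C k - A) \<noteq> top" for k using Cfin[of k] by simp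
    then have "(\<Prod>k\<in>UNIV. emeasure \<Lambda> (C k - A)) \<noteq> top" by (simp add: ennreal_prod_eq_top)
    then show ?thesis by (simp add: less_top)
  qed
  then show "emeasure (factorial_measure A) (\<Pi>\<^sub>E k\<in>UNIV. C k) = emeasure (density Lambda_power ?g) (\<Pi>\<^sub>E k\<in>UNIV. C k) \<and>
      emeasure (factorial_measure A) (\<Pi>\<^sub>E k\<in>UNIV. C k) < \<infinity>"
    unfolding 1 2 by (simp add: mult.commute ennreal_mult_less_top)
qed

corollary emeasure_factorial_measure:
  assumes A: "A \<in> sets \<Lambda>" "emeasure \<Lambda> A < \<infinity>"
    and G: "G \<in> sets Lambda_power" and GA: "\<And>x k. x \<in> G \<Longrightarrow> x k \<notin> A"
  shows "emeasure (factorial_measure A) (G :: ('k::finite \<Rightarrow> 'b) set) = ennreal (exp (- measure \<Lambda> A)) * emeasure Lambda_power G"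
proof -
  have gm: "(\<lambda>x :: 'k \<Rightarrow> 'b. ennreal (exp (- measure \<Lambda> A)) * (\<Prod>k\<in>UNIV. indicator (space \<Lambda> - A) (x k))) \<in> borel_measurable Lambda_power"
  proof -
    have [measurable]: "(\<lambda>x. indicator (space \<Lambda> - A) (x k) :: ennreal) \<in> borel_measurable Lambda_power" for k :: 'k
      using measurable_compose[OF measurable_component_singleton[of k UNIV "\<lambda>_. \<Lambda>"], of "indicator (space \<Lambda> - A)"] A by simp
    show ?thesis by measurable
  qed
  have "emeasure (factorial_measure A) G =
      (\<integral>\<^sup>+x. (ennreal (exp (- measure \<Lambda> A)) * (\<Prod>k\<in>UNIV. indicator (space \<Lambda> - A) (x k))) * indicator G x \<partial>Lambda_power)"
    unfolding factorial_measure_eq[OF A] using G by (intro emeasure_density gm) simp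
  also have "\<dots> = (\<integral>\<^sup>+x. ennreal (exp (- measure \<Lambda> A)) * indicator G x \<partial>Lambda_power)"
  proof (intro nn_integral_cong)
    fix x :: "'k \<Rightarrow> 'b" assume x: "x \<in> space Lambda_power"
    have "x k \<in> space \<Lambda> - A" if "x \<in> G" for k using x GA[OF that] by (auto simp: space_PiM PiE_iff)
    then show "(ennreal (exp (- measure \<Lambda> A)) * (\<Prod>k\<in>UNIV. indicator (space \<Lambda> - A) (x k))) * indicator G x = ennreal (exp (- measure \<Lambda> A)) * indicator G x"
      by (cases "x \<in> G") (simp_all add: indicator_def)
  qed
  also have "\<dots> = ennreal (exp (- measure \<Lambda> A)) * emeasure Lambda_power G"
    using G by (rule nn_integral_cmult_indicator)
  finally show ?thesis .
qed

end

text \<open>A countably valued approximation of the identity, used to replace an avoided set that depends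
  on the tuple by countably many fixed ones.\<close>

definition round_grid :: "nat \<Rightarrow> 'p::euclidean_space \<Rightarrow> 'p" where
  "round_grid n p = (\<Sum>b\<in>Basis. (of_int \<lfloor>real (Suc n) * (p \<bullet> b)\<rfloor> / real (Suc n)) *\<^sub>R b)"

lemma round_grid_measurable [measurable]: "round_grid n \<in> borel_measurable borel"
  unfolding round_grid_def[abs_def] by measurable

lemma countable_range_round_grid: "countable (range (round_grid n :: 'p \<Rightarrow> 'p::euclidean_space))"
proof -
  have "range (round_grid n :: 'p \<Rightarrow> 'p) \<subseteq> (\<lambda>g. \<Sum>b\<in>Basis. (of_int (g b) / real (Suc n)) *\<^sub>R b) ` (\<Pi>\<^sub>E b\<in>(Basis :: 'p set). (UNIV :: int set))"
  proof
    fix q assume "q \<in> range (round_grid n :: 'p \<Rightarrow> 'p)"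
    then obtain p :: 'p where p: "q = round_grid n p" by auto
    have "q = (\<Sum>b\<in>Basis. (of_int ((restrict (\<lambda>b. \<lfloor>real (Suc n) * (p \<bullet> b)\<rfloor>) Basis) b) / real (Suc n)) *\<^sub>R b)"
      unfolding p round_grid_def by (intro sum.cong) auto
    moreover have "restrict (\<lambda>b. \<lfloor>real (Suc n) * (p \<bullet> b)\<rfloor>) Basis \<in> (\<Pi>\<^sub>E b\<in>(Basis :: 'p set). (UNIV :: int set))"
      by simp
    ultimately show "q \<in> (\<lambda>g. \<Sum>b\<in>Basis. (of_int (g b) / real (Suc n)) *\<^sub>R b) ` (\<Pi>\<^sub>E b\<in>(Basis :: 'p set). (UNIV :: int set))"
      by blast
  qed
  then show ?thesis by (rule countable_subset) (intro countable_image countable_PiE, auto)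
qed

lemma norm_round_grid_le: "norm (p - round_grid n p) \<le> real DIM('p) / real (Suc n)" for p :: "'p::euclidean_space"
proof -
  have rg: "round_grid n p \<bullet> b = of_int \<lfloor>real (Suc n) * (p \<bullet> b)\<rfloor> / real (Suc n)" if "b \<in> Basis" for b
    using that unfolding round_grid_def by (simp add: inner_sum_left inner_Basis if_distrib[of "\<lambda>t. _ * t"] cong: if_cong)
  have "\<bar>(p - round_grid n p) \<bullet> b\<bar> \<le> 1 / real (Suc n)" if b: "b \<in> Basis" for b
  proof -
    have fl: "of_int \<lfloor>real (Suc n) * (p \<bullet> b)\<rfloor> \<le> real (Suc n) * (p \<bullet> b)" "real (Suc n) * (p \<bullet> b) < of_int \<lfloor>real (Suc n) * (p \<bullet> b)\<rfloor> + 1"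
      by linarith+
    have "p \<bullet> b - of_int \<lfloor>real (Suc n) * (p \<bullet> b)\<rfloor> / real (Suc n) = (real (Suc n) * (p \<bullet> b) - of_int \<lfloor>real (Suc n) * (p \<bullet> b)\<rfloor>) / real (Suc n)"
      by (simp add: field_simps del: of_nat_Suc)
    moreover have "\<bar>(real (Suc n) * (p \<bullet> b) - of_int \<lfloor>real (Suc n) * (p \<bullet> b)\<rfloor>) / real (Suc n)\<bar> \<le> 1 / real (Suc n)"
    proof -
      have "\<bar>real (Suc n) * (p \<bullet> b) - of_int \<lfloor>real (Suc n) * (p \<bullet> b)\<rfloor>\<bar> \<le> 1" using fl by linarith
      then show ?thesis unfolding abs_divide by (simp add: divide_right_mono del: of_nat_Suc)
    qed
    ultimately show ?thesis by (simp add: inner_diff_left rg[OF b])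
  qed
  then have "(\<Sum>b\<in>Basis. \<bar>(p - round_grid n p) \<bullet> b\<bar>) \<le> (\<Sum>b\<in>(Basis :: 'p set). 1 / real (Suc n))" by (intro sum_mono)
  then show ?thesis using norm_le_l1[of "p - round_grid n p"] by simp
qed

lemma borel_measurable_sum_countable:
  assumes f: "\<And>i. i \<in> I \<Longrightarrow> f i \<in> borel_measurable M" and I: "countable I"
  shows "(\<lambda>\<omega>. \<integral>\<^sup>+i. (f i \<omega> :: ennreal) \<partial>count_space I) \<in> borel_measurable M"
proof -
  interpret C: sigma_finite_measure "count_space I" by (rule sigma_finite_measure_count_space_countable[OF I])
  have "(\<lambda>(i, \<omega>). f i \<omega>) \<in> borel_measurable (count_space I \<Otimes>\<^sub>M M)"
    using f I by (intro measurable_pair_measure_countable1) auto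
  from measurable_pair_swap[OF this] have "(\<lambda>(\<omega>, i). f i \<omega>) \<in> borel_measurable (M \<Otimes>\<^sub>M count_space I)"
    by simp
  then show ?thesis by (intro C.borel_measurable_nn_integral)
qed

context poisson_points
begin

text \<open>The multivariate Mecke formula with an avoided set \<open>{y. 0 < \<phi> y (p x)}\<close> that depends on the
  tuple \<open>x\<close>. If \<open>p\<close> takes countably many values, it follows from the case of a fixed avoided set.
  In general \<open>p\<close> is rounded to a grid, and the avoided set is shrunk to \<open>{y. \<delta> < \<phi> y q}\<close>, where \<open>\<delta>\<close>
  bounds the rounding error. These sets are contained in the given one and exhaust it in the
  limit.\<close>

lemma mecke_avoiding_bounded:
  fixes p :: "('k::finite \<Rightarrow> 'b) \<Rightarrow> 'p::euclidean_space" and \<phi> :: "'b \<Rightarrow> 'p \<Rightarrow> real"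
  assumes p [measurable]: "p \<in> borel_measurable Lambda_power"
    and \<phi> [measurable]: "(\<lambda>(y, q). \<phi> y q) \<in> borel_measurable (\<Lambda> \<Otimes>\<^sub>M borel)"
    and lip: "\<And>y q q'. y \<in> space \<Lambda> \<Longrightarrow> \<bar>\<phi> y q - \<phi> y q'\<bar> \<le> norm (q - q')"
    and fin: "\<And>q. emeasure \<Lambda> {y \<in> space \<Lambda>. 0 < \<phi> y q} < \<infinity>"
    and G [measurable]: "G \<in> sets Lambda_power" and Gfin: "emeasure Lambda_power G < \<infinity>"
    and G\<phi>: "\<And>x k. x \<in> G \<Longrightarrow> \<phi> (x k) (p x) \<le> 0"
  shows "(\<integral>\<^sup>+\<omega>. (\<integral>\<^sup>+i. indicator G (tuple i \<omega>) * (if N {y \<in> space \<Lambda>. 0 < \<phi> y (p (tuple i \<omega>))} \<omega> = 0 then 1 else 0) \<partial>count_space inj_tuples) \<partial>M)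
     = (\<integral>\<^sup>+x. indicator G x * ennreal (exp (- measure \<Lambda> {y \<in> space \<Lambda>. 0 < \<phi> y (p x)})) \<partial>Lambda_power)"
proof -
  interpret L: sigma_finite_measure \<Lambda> by (rule sigma_finite_Lambda)
  define \<delta> where "\<delta> n = real DIM('p) / real (Suc n)" for n
  define A where "A q d = {y \<in> space \<Lambda>. d < \<phi> y q}" for q d
  have \<phi>1 [measurable]: "(\<lambda>y. \<phi> y q) \<in> borel_measurable \<Lambda>" for q
    using measurable_compose[OF measurable_Pair[OF measurable_ident measurable_const[of q borel]] \<phi>] by simp
  have Am [measurable]: "A q d \<in> sets \<Lambda>" for q d unfolding A_def by measurable
  have \<delta>0: "\<delta> n \<ge> 0" for n by (simp add: \<delta>_def)
  have Afin: "emeasure \<Lambda> (A q d) < \<infinity>" if "d \<ge> 0" for q d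
  proof -
    have "emeasure \<Lambda> (A q d) \<le> emeasure \<Lambda> (A q 0)" using that by (intro emeasure_mono) (auto simp: A_def)
    also have "\<dots> < \<infinity>" using fin[of q] by (simp add: A_def)
    finally show ?thesis .
  qed
  have \<delta>lim: "\<delta> \<longlonglongrightarrow> 0"
  proof -
    have "(\<lambda>n. real DIM('p) * (1 / real (Suc n))) \<longlonglongrightarrow> real DIM('p) * 0" by (intro tendsto_intros LIMSEQ_Suc[OF lim_1_over_n])
    then show ?thesis by (simp add: \<delta>_def[abs_def])
  qed
  have rg: "norm (q - round_grid n q) \<le> \<delta> n" for q :: 'p and n unfolding \<delta>_def by (rule norm_round_grid_le)
  have sub: "A (round_grid n q) (\<delta> n) \<subseteq> A q 0" for n q
    using lip[of _ "round_grid n q" q] rg[of q n] by (fastforce simp: A_def norm_minus_commute abs_le_iff)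
  have ev: "\<forall>\<^sub>F n in sequentially. y \<in> A (round_grid n q) (\<delta> n)" if y: "y \<in> A q 0" for y q
  proof -
    have ysp: "y \<in> space \<Lambda>" and pos: "0 < \<phi> y q" using y by (auto simp: A_def)
    have "\<forall>\<^sub>F n in sequentially. \<delta> n < \<phi> y q / 2" using \<delta>lim pos by (intro order_tendstoD) auto
    then show ?thesis
    proof eventually_elim
      fix n assume "\<delta> n < \<phi> y q / 2"
      then show "y \<in> A (round_grid n q) (\<delta> n)"
        using lip[OF ysp, of q "round_grid n q"] rg[of q n] ysp by (auto simp: A_def abs_le_iff)
    qed
  qed
  let ?T = "count_space (inj_tuples :: ('k \<Rightarrow> nat) set) \<Otimes>\<^sub>M M"
  define v where "v B \<omega> = (if N B \<omega> = 0 then 1 else (0::ennreal))" for B \<omega>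
  have vlim: "(\<lambda>n. v (A (round_grid n q) (\<delta> n)) \<omega>) \<longlonglongrightarrow> v (A q 0) \<omega>" for q \<omega>
  proof (cases "N (A q 0) \<omega> = 0")
    case True
    then have "v (A (round_grid n q) (\<delta> n)) \<omega> = 1" for n using sub[of n q] unfolding v_def N_eq_0_iff by auto
    moreover have "v (A q 0) \<omega> = 1" using True by (simp add: v_def)
    ultimately show ?thesis by simp
  next
    case False
    then obtain i where i: "X i \<omega> \<in> A q 0" by (auto simp: N_eq_0_iff)
    have "\<forall>\<^sub>F n in sequentially. v (A (round_grid n q) (\<delta> n)) \<omega> = v (A q 0) \<omega>"
      using ev[OF i]
    proof eventually_elim
      fix n assume "X i \<omega> \<in> A (round_grid n q) (\<delta> n)"
      then have "N (A (round_grid n q) (\<delta> n)) \<omega> \<noteq> 0" by (auto simp: N_eq_0_iff)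
      then show "v (A (round_grid n q) (\<delta> n)) \<omega> = v (A q 0) \<omega>" using False by (simp add: v_def)
    qed
    then show ?thesis by (rule tendsto_eventually)
  qed
  have mlim: "(\<lambda>n. measure \<Lambda> (A (round_grid n q) (\<delta> n))) \<longlonglongrightarrow> measure \<Lambda> (A q 0)" for q
  proof -
    have "(\<lambda>n. \<integral>\<^sup>+y. indicator (A (round_grid n q) (\<delta> n)) y \<partial>\<Lambda>) \<longlonglongrightarrow> (\<integral>\<^sup>+y. indicator (A q 0) y \<partial>\<Lambda>)"
    proof (rule nn_integral_dominated_convergence[where w = "indicator (A q 0)"])
      show "AE y in \<Lambda>. indicator (A (round_grid n q) (\<delta> n)) y \<le> (indicator (A q 0) y :: ennreal)" for n
        using sub[of n q] by (intro AE_I2) (auto simp: indicator_def)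
      show "(\<integral>\<^sup>+y. indicator (A q 0) y \<partial>\<Lambda>) < \<infinity>" using Afin[of 0 q] by simp
      show "AE y in \<Lambda>. (\<lambda>n. indicator (A (round_grid n q) (\<delta> n)) y) \<longlonglongrightarrow> (indicator (A q 0) y :: ennreal)"
      proof (rule AE_I2)
        fix y
        show "(\<lambda>n. indicator (A (round_grid n q) (\<delta> n)) y) \<longlonglongrightarrow> (indicator (A q 0) y :: ennreal)"
        proof (cases "y \<in> A q 0")
          case True
          have "\<forall>\<^sub>F n in sequentially. indicator (A (round_grid n q) (\<delta> n)) y = (indicator (A q 0) y :: ennreal)"
            using ev[OF True] by eventually_elim (use True in simp)
          then show ?thesis by (rule tendsto_eventually)
        next
          case False
          then have "y \<notin> A (round_grid n q) (\<delta> n)" for n using sub by blast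
          then show ?thesis using False by simp
        qed
      qed
    qed simp_all
    then have "(\<lambda>n. emeasure \<Lambda> (A (round_grid n q) (\<delta> n))) \<longlonglongrightarrow> ennreal (measure \<Lambda> (A q 0))"
      using Afin[of 0 q] by (simp add: emeasure_eq_ennreal_measure)
    then show ?thesis unfolding measure_def[of \<Lambda> "A (round_grid _ q) _"] by (rule tendsto_enn2real) simp
  qed
  define m where "m n q = measure \<Lambda> (A (round_grid n q) (\<delta> n))" for n q
  have mm [measurable]: "m n \<in> borel_measurable borel" for n
  proof -
    have "m n = (\<lambda>r. measure \<Lambda> (A r (\<delta> n))) \<circ> round_grid n" by (auto simp: m_def)
    moreover have "(\<lambda>r. measure \<Lambda> (A r (\<delta> n))) \<circ> round_grid n \<in> borel_measurable borel"
      unfolding o_def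
    proof (rule measurable_compose_countable'[where I = "range (round_grid n)" and g = "round_grid n"])
      show "round_grid n \<in> borel \<rightarrow>\<^sub>M count_space (range (round_grid n :: 'p \<Rightarrow> 'p))"
        using countable_range_round_grid[of n]
        by (subst measurable_count_space_eq_countable) (auto intro!: measurable_sets[OF round_grid_measurable, of "{_}", simplified])
    qed (auto intro: countable_range_round_grid)
    ultimately show ?thesis by simp
  qed
  define L where "L n i \<omega> = indicator G (tuple i \<omega>) * v (A (round_grid n (p (tuple i \<omega>))) (\<delta> n)) \<omega>" for n and i :: "'k \<Rightarrow> nat" and \<omega>
  define L' where "L' i \<omega> = indicator G (tuple i \<omega>) * v (A (p (tuple i \<omega>)) 0) \<omega>" for i :: "'k \<Rightarrow> nat" and \<omega>
  \<comment> \<open>On \<open>Gr n r\<close> the rounded avoided set is fixed.\<close>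
  define Gr where "Gr n r = {x \<in> G. round_grid n (p x) = r}" for n r
  have Grm [measurable]: "Gr n r \<in> sets Lambda_power" for n r
  proof -
    have "Gr n r = G \<inter> {x \<in> space Lambda_power. round_grid n (p x) = r}"
      unfolding Gr_def using sets.sets_into_space[OF G] by auto
    then show ?thesis by simp
  qed
  have Lsum: "L n i \<omega> = (\<integral>\<^sup>+r. indicator (Gr n r) (tuple i \<omega>) * v (A r (\<delta> n)) \<omega> \<partial>count_space (range (round_grid n)))" for n i \<omega>
  proof -
    let ?r = "round_grid n (p (tuple i \<omega>))"
    have "(\<integral>\<^sup>+r. indicator (Gr n r) (tuple i \<omega>) * v (A r (\<delta> n)) \<omega> \<partial>count_space (range (round_grid n))) =
        (\<integral>\<^sup>+r. indicator (Gr n r) (tuple i \<omega>) * v (A r (\<delta> n)) \<omega> \<partial>count_space {?r})"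
      by (rule nn_integral_count_space_eq) (auto simp: Gr_def)
    then show ?thesis by (simp add: nn_integral_count_space_finite L_def Gr_def indicator_def)
  qed
  have vm [measurable]: "v (A q d) \<in> borel_measurable M" for q d unfolding v_def[abs_def] by (rule void_measurable) simp
  have tm: "(\<lambda>\<omega>. indicator (Gr n r) (tuple i \<omega>) * v (A r (\<delta> n)) \<omega>) \<in> borel_measurable M" for n r i
  proof -
    have "(\<lambda>\<omega>. indicator (Gr n r) (tuple i \<omega>) :: ennreal) \<in> borel_measurable M"
      using measurable_compose[OF tuple_measurable[of i] borel_measurable_indicator[OF Grm[of n r]]] .
    then show ?thesis by (intro borel_measurable_times_ennreal vm)
  qed
  have Lm: "L n i \<in> borel_measurable M" for n i
  proof -
    have "(\<lambda>\<omega>. \<integral>\<^sup>+r. indicator (Gr n r) (tuple i \<omega>) * v (A r (\<delta> n)) \<omega> \<partial>count_space (range (round_grid n))) \<in> borel_measurable M"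
      using tm countable_range_round_grid by (intro borel_measurable_sum_countable)
    then show ?thesis unfolding Lsum[abs_def, symmetric] by (simp add: Lsum[abs_def])
  qed
  have Llim: "(\<lambda>n. L n i \<omega>) \<longlonglongrightarrow> L' i \<omega>" for i \<omega>
    unfolding L_def L'_def using vlim by (cases "tuple i \<omega> \<in> G") auto
  have L'm: "L' i \<in> borel_measurable M" for i
    by (rule borel_measurable_LIMSEQ_order[OF Llim Lm])
  have LT: "(\<lambda>(i, \<omega>). L n i \<omega>) \<in> borel_measurable ?T" for n
    by (rule measurable_pair_measure_countable1) (auto intro: Lm)
  have L'T: "(\<lambda>(i, \<omega>). L' i \<omega>) \<in> borel_measurable ?T"
    by (rule measurable_pair_measure_countable1) (auto intro: L'm)
  define W where "W i \<omega> = (indicator G (tuple i \<omega>) :: ennreal)" for i :: "'k \<Rightarrow> nat" and \<omega>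
  have Wm: "W i \<in> borel_measurable M" for i
    unfolding W_def using measurable_compose[OF tuple_measurable[of i] borel_measurable_indicator[OF G]] .
  have WT: "(\<lambda>(i, \<omega>). W i \<omega>) \<in> borel_measurable ?T"
    by (rule measurable_pair_measure_countable1) (auto intro: Wm)
  have "(\<integral>\<^sup>+z. (case z of (i, \<omega>) \<Rightarrow> W i \<omega>) \<partial>?T) = (\<integral>\<^sup>+\<omega>. (\<integral>\<^sup>+i. indicator G (tuple i \<omega>) * (if N {} \<omega> = 0 then 1 else 0) \<partial>count_space inj_tuples) \<partial>M)"
    using Wm by (subst nn_integral_indexed) (auto simp: W_def N_eq_0_iff)
  also have "\<dots> = (\<integral>\<^sup>+x. indicator G x \<partial>factorial_measure {})"
    by (rule nn_integral_factorial_measure[symmetric]) auto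
  also have "\<dots> = emeasure Lambda_power G"
    using G emeasure_factorial_measure[of "{}" G] by simp
  finally have Wfin: "(\<integral>\<^sup>+z. (case z of (i, \<omega>) \<Rightarrow> W i \<omega>) \<partial>?T) < \<infinity>" using Gfin by simp
  have step: "(\<integral>\<^sup>+z. (case z of (i, \<omega>) \<Rightarrow> L n i \<omega>) \<partial>?T) = (\<integral>\<^sup>+x. indicator G x * ennreal (exp (- m n (p x))) \<partial>Lambda_power)" for n
  proof -
    have "(\<integral>\<^sup>+z. (case z of (i, \<omega>) \<Rightarrow> L n i \<omega>) \<partial>?T) =
        (\<integral>\<^sup>+z. (\<integral>\<^sup>+r. (case z of (i, \<omega>) \<Rightarrow> indicator (Gr n r) (tuple i \<omega>) * v (A r (\<delta> n)) \<omega>) \<partial>count_space (range (round_grid n))) \<partial>?T)"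
      by (intro nn_integral_cong) (auto simp: Lsum split: prod.split)
    also have "\<dots> = (\<integral>\<^sup>+r. (\<integral>\<^sup>+z. (case z of (i, \<omega>) \<Rightarrow> indicator (Gr n r) (tuple i \<omega>) * v (A r (\<delta> n)) \<omega>) \<partial>?T) \<partial>count_space (range (round_grid n)))"
    proof (rule nn_integral_count_space_nn_integral[OF countable_range_round_grid])
      fix r
      show "(\<lambda>z. case z of (i, \<omega>) \<Rightarrow> indicator (Gr n r) (tuple i \<omega>) * v (A r (\<delta> n)) \<omega>) \<in> borel_measurable ?T"
        by (rule measurable_pair_measure_countable1) (auto intro: tm)
    qed
    also have "\<dots> = (\<integral>\<^sup>+r. (\<integral>\<^sup>+x. indicator (Gr n r) x * ennreal (exp (- measure \<Lambda> (A r (\<delta> n)))) \<partial>Lambda_power) \<partial>count_space (range (round_grid n)))"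
    proof (intro nn_integral_cong)
      fix r
      have "(\<integral>\<^sup>+z. (case z of (i, \<omega>) \<Rightarrow> indicator (Gr n r) (tuple i \<omega>) * v (A r (\<delta> n)) \<omega>) \<partial>?T) =
        (\<integral>\<^sup>+\<omega>. (\<integral>\<^sup>+i. indicator (Gr n r) (tuple i \<omega>) * (if N (A r (\<delta> n)) \<omega> = 0 then 1 else 0) \<partial>count_space inj_tuples) \<partial>M)"
        using tm by (subst nn_integral_indexed) (auto simp: v_def)
      also have "\<dots> = (\<integral>\<^sup>+x. indicator (Gr n r) x \<partial>factorial_measure (A r (\<delta> n)))"
        by (rule nn_integral_factorial_measure[symmetric]) auto
      also have "\<dots> = emeasure (factorial_measure (A r (\<delta> n))) (Gr n r)" by simp
      also have "\<dots> = ennreal (exp (- measure \<Lambda> (A r (\<delta> n)))) * emeasure Lambda_power (Gr n r)"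
      proof (rule emeasure_factorial_measure)
        fix x k assume x: "x \<in> Gr n r"
        then have "x \<in> space Lambda_power" using sets.sets_into_space[OF Grm] by blast
        then have "x k \<in> space \<Lambda>" by (auto simp: space_PiM PiE_iff)
        moreover have "\<phi> (x k) (p x) \<le> 0" "round_grid n (p x) = r" using x G\<phi> by (auto simp: Gr_def)
        ultimately show "x k \<notin> A r (\<delta> n)" using sub[of n "p x"] by (auto simp: A_def)
      qed (use Afin[OF \<delta>0] in auto)
      also have "\<dots> = (\<integral>\<^sup>+x. indicator (Gr n r) x * ennreal (exp (- measure \<Lambda> (A r (\<delta> n)))) \<partial>Lambda_power)"
        by (subst mult.commute[of "indicator _ _"], subst nn_integral_cmult_indicator) auto
      finally show "(\<integral>\<^sup>+z. (case z of (i, \<omega>) \<Rightarrow> indicator (Gr n r) (tuple i \<omega>) * v (A r (\<delta> n)) \<omega>) \<partial>?T) =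
        (\<integral>\<^sup>+x. indicator (Gr n r) x * ennreal (exp (- measure \<Lambda> (A r (\<delta> n)))) \<partial>Lambda_power)" .
    qed
    also have "\<dots> = (\<integral>\<^sup>+x. (\<integral>\<^sup>+r. indicator (Gr n r) x * ennreal (exp (- measure \<Lambda> (A r (\<delta> n)))) \<partial>count_space (range (round_grid n))) \<partial>Lambda_power)"
      by (rule nn_integral_count_space_nn_integral[symmetric, OF countable_range_round_grid]) measurable
    also have "\<dots> = (\<integral>\<^sup>+x. indicator G x * ennreal (exp (- m n (p x))) \<partial>Lambda_power)"
    proof (intro nn_integral_cong)
      fix x
      let ?r = "round_grid n (p x)"
      have "(\<integral>\<^sup>+r. indicator (Gr n r) x * ennreal (exp (- measure \<Lambda> (A r (\<delta> n)))) \<partial>count_space (range (round_grid n))) =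
          (\<integral>\<^sup>+r. indicator (Gr n r) x * ennreal (exp (- measure \<Lambda> (A r (\<delta> n)))) \<partial>count_space {?r})"
        by (rule nn_integral_count_space_eq) (auto simp: Gr_def)
      then show "(\<integral>\<^sup>+r. indicator (Gr n r) x * ennreal (exp (- measure \<Lambda> (A r (\<delta> n)))) \<partial>count_space (range (round_grid n))) = indicator G x * ennreal (exp (- m n (p x)))"
        by (simp add: nn_integral_count_space_finite Gr_def indicator_def m_def)
    qed
    finally show ?thesis .
  qed
  have lim1: "(\<lambda>n. \<integral>\<^sup>+z. (case z of (i, \<omega>) \<Rightarrow> L n i \<omega>) \<partial>?T) \<longlonglongrightarrow> (\<integral>\<^sup>+z. (case z of (i, \<omega>) \<Rightarrow> L' i \<omega>) \<partial>?T)"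
  proof (rule nn_integral_dominated_convergence[OF LT L'T WT _ Wfin])
    show "AE z in ?T. (case z of (i, \<omega>) \<Rightarrow> L n i \<omega>) \<le> (case z of (i, \<omega>) \<Rightarrow> W i \<omega>)" for n
      by (intro AE_I2) (auto simp: L_def W_def v_def indicator_def split: prod.split)
    show "AE z in ?T. (\<lambda>n. case z of (i, \<omega>) \<Rightarrow> L n i \<omega>) \<longlonglongrightarrow> (case z of (i, \<omega>) \<Rightarrow> L' i \<omega>)"
      using Llim by (intro AE_I2) (auto split: prod.split)
  qed
  have m0: "(\<lambda>q. measure \<Lambda> (A q 0)) \<in> borel_measurable borel"
    using mlim mm unfolding m_def by (rule borel_measurable_LIMSEQ_real)
  have lim2: "(\<lambda>n. \<integral>\<^sup>+x. indicator G x * ennreal (exp (- m n (p x))) \<partial>Lambda_power) \<longlonglongrightarrow>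
      (\<integral>\<^sup>+x. indicator G x * ennreal (exp (- measure \<Lambda> (A (p x) 0))) \<partial>Lambda_power)"
  proof (rule nn_integral_dominated_convergence[where w = "indicator G"])
    show "AE x in Lambda_power. indicator G x * ennreal (exp (- m n (p x))) \<le> indicator G x" for n
    proof (rule AE_I2)
      fix x
      have "ennreal (exp (- m n (p x))) \<le> 1" by (simp add: m_def)
      then show "indicator G x * ennreal (exp (- m n (p x))) \<le> indicator G x" by (simp add: indicator_def)
    qed
    show "(\<integral>\<^sup>+x. indicator G x \<partial>Lambda_power) < \<infinity>" using Gfin G by simp
    show "AE x in Lambda_power. (\<lambda>n. indicator G x * ennreal (exp (- m n (p x)))) \<longlonglongrightarrow> indicator G x * ennreal (exp (- measure \<Lambda> (A (p x) 0)))"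
    proof (rule AE_I2)
      fix x
      have "(\<lambda>n. ennreal (exp (- m n (p x)))) \<longlonglongrightarrow> ennreal (exp (- measure \<Lambda> (A (p x) 0)))"
        unfolding m_def by (intro tendsto_ennrealI tendsto_exp tendsto_minus mlim)
      then show "(\<lambda>n. indicator G x * ennreal (exp (- m n (p x)))) \<longlonglongrightarrow> indicator G x * ennreal (exp (- measure \<Lambda> (A (p x) 0)))"
        by (cases "x \<in> G") auto
    qed
    have [measurable]: "(\<lambda>x. measure \<Lambda> (A (p x) 0)) \<in> borel_measurable Lambda_power"
      using measurable_compose[OF p m0] .
    show "(\<lambda>x. indicator G x * ennreal (exp (- measure \<Lambda> (A (p x) 0)))) \<in> borel_measurable Lambda_power" by measurable
  qed measurable
  have "(\<integral>\<^sup>+z. (case z of (i, \<omega>) \<Rightarrow> L' i \<omega>) \<partial>?T) = (\<integral>\<^sup>+x. indicator G x * ennreal (exp (- measure \<Lambda> (A (p x) 0))) \<partial>Lambda_power)"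
    using lim1 lim2 unfolding step by (rule LIMSEQ_unique)
  moreover have "(\<integral>\<^sup>+z. (case z of (i, \<omega>) \<Rightarrow> L' i \<omega>) \<partial>?T) = (\<integral>\<^sup>+\<omega>. (\<integral>\<^sup>+i. L' i \<omega> \<partial>count_space inj_tuples) \<partial>M)"
    by (rule nn_integral_indexed) (auto intro: L'm)
  ultimately show ?thesis by (simp add: L'_def v_def A_def)
qed

text \<open>Finiteness of the measure of \<open>G\<close> is removed by monotone convergence along the tuples of
  height at most \<open>n\<close>. The function \<open>E\<close> is a measurable version of the void probability.\<close>

theorem mecke_avoiding:
  fixes p :: "('k::finite \<Rightarrow> 'b) \<Rightarrow> 'p::euclidean_space" and \<phi> :: "'b \<Rightarrow> 'p \<Rightarrow> real"
  assumes p [measurable]: "p \<in> borel_measurable Lambda_power"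
    and \<phi> [measurable]: "(\<lambda>(y, q). \<phi> y q) \<in> borel_measurable (\<Lambda> \<Otimes>\<^sub>M borel)"
    and lip: "\<And>y q q'. y \<in> space \<Lambda> \<Longrightarrow> \<bar>\<phi> y q - \<phi> y q'\<bar> \<le> norm (q - q')"
    and fin: "\<And>q. emeasure \<Lambda> {y \<in> space \<Lambda>. 0 < \<phi> y q} < \<infinity>"
    and G [measurable]: "G \<in> sets Lambda_power"
    and G\<phi>: "\<And>x k. x \<in> G \<Longrightarrow> \<phi> (x k) (p x) \<le> 0"
    and E: "E \<in> borel_measurable Lambda_power" "\<And>x. x \<in> G \<Longrightarrow> E x = ennreal (exp (- measure \<Lambda> {y \<in> space \<Lambda>. 0 < \<phi> y (p x)}))"
    and void: "\<And>i. inj i \<Longrightarrow> (\<lambda>\<omega>. indicator G (tuple i \<omega>) * (if N {y \<in> space \<Lambda>. 0 < \<phi> y (p (tuple i \<omega>))} \<omega> = 0 then 1 else (0 :: ennreal))) \<in> borel_measurable M"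
  shows "(\<integral>\<^sup>+\<omega>. (\<integral>\<^sup>+i. indicator G (tuple i \<omega>) * (if N {y \<in> space \<Lambda>. 0 < \<phi> y (p (tuple i \<omega>))} \<omega> = 0 then 1 else 0) \<partial>count_space inj_tuples) \<partial>M)
     = (\<integral>\<^sup>+x. indicator G x * E x \<partial>Lambda_power)"
proof -
  interpret PS: product_sigma_finite "\<lambda>_::'k. \<Lambda>" by (rule product_sigma_finite_Lambda)
  let ?T = "count_space (inj_tuples :: ('k \<Rightarrow> nat) set) \<Otimes>\<^sub>M M"
  define B where "B n = (\<Pi>\<^sub>E k\<in>(UNIV :: 'k set). {x \<in> space \<Lambda>. 0 < tau x \<and> tau x \<le> real n})" for n
  define w where "w i \<omega> = (if N {y \<in> space \<Lambda>. 0 < \<phi> y (p (tuple i \<omega>))} \<omega> = 0 then 1 else (0 :: ennreal))" for i :: "'k \<Rightarrow> nat" and \<omega>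
  have Bm [measurable]: "B n \<in> sets Lambda_power" for n
    unfolding B_def using tau_slice_measurable by (intro sets_PiM_I_finite) auto
  have Bfin: "emeasure Lambda_power (B n) < \<infinity>" for n
  proof -
    have "emeasure \<Lambda> {x \<in> space \<Lambda>. 0 < tau x \<and> tau x \<le> real n} \<noteq> top" using tau_slice_finite[of 0 "real n"] by simp
    moreover have "emeasure Lambda_power (B n) = (\<Prod>k\<in>(UNIV :: 'k set). emeasure \<Lambda> {x \<in> space \<Lambda>. 0 < tau x \<and> tau x \<le> real n})"
      unfolding B_def using tau_slice_measurable by (intro PS.emeasure_PiM) auto
    ultimately have "emeasure Lambda_power (B n) \<noteq> top"
      by (simp add: ennreal_prod_eq_top del: prod_constant)
    then show ?thesis by (simp add: less_top)
  qed
  have inc: "B m \<subseteq> B n" if "m \<le> n" for m n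
    unfolding B_def using that by (intro PiE_mono) auto
  have cov: "\<exists>n. x \<in> B n" if "x \<in> space Lambda_power" for x :: "'k \<Rightarrow> 'b"
  proof -
    obtain n where n: "Max (range (\<lambda>k. tau (x k))) \<le> real n" using real_arch_simple by blast
    have "tau (x k) \<le> real n" for k using Max_ge[of "range (\<lambda>k. tau (x k))" "tau (x k)"] n by simp
    then show ?thesis using that tau_pos by (intro exI[of _ n]) (auto simp: B_def space_PiM PiE_iff)
  qed
  have sup: "(SUP n. indicator (G \<inter> B n) x) = (indicator G x :: ennreal)" if x: "x \<in> space Lambda_power" for x
  proof (rule antisym)
    show "(SUP n. indicator (G \<inter> B n) x) \<le> (indicator G x :: ennreal)"
      by (intro SUP_least) (auto simp: indicator_def)
    obtain n where "x \<in> B n" using cov[OF x] by auto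
    then have "(indicator G x :: ennreal) \<le> indicator (G \<inter> B n) x" by (auto simp: indicator_def)
    also have "\<dots> \<le> (SUP n. indicator (G \<inter> B n) x)" by (rule SUP_upper) simp
    finally show "(indicator G x :: ennreal) \<le> (SUP n. indicator (G \<inter> B n) x)" .
  qed
  have incG: "incseq (\<lambda>n x. indicator (G \<inter> B n) x * f x)" for f :: "('k \<Rightarrow> 'b) \<Rightarrow> ennreal"
    using inc by (auto simp: incseq_def le_fun_def indicator_def)
  have tsp: "tuple i \<omega> \<in> space Lambda_power" if "\<omega> \<in> space M" for i :: "'k \<Rightarrow> nat" and \<omega>
    using measurable_space[OF tuple_measurable that] .
  have wm: "(\<lambda>\<omega>. indicator (G \<inter> B n) (tuple i \<omega>) * w i \<omega>) \<in> borel_measurable M" if "inj i" for i n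
  proof -
    have "(\<lambda>\<omega>. indicator (B n) (tuple i \<omega>) :: ennreal) \<in> borel_measurable M"
      using measurable_compose[OF tuple_measurable[of i] borel_measurable_indicator[OF Bm]] .
    then have "(\<lambda>\<omega>. indicator (B n) (tuple i \<omega>) * (indicator G (tuple i \<omega>) * w i \<omega>)) \<in> borel_measurable M"
      using void[OF that] unfolding w_def by (rule borel_measurable_times_ennreal)
    then show ?thesis by (simp add: indicator_inter_arith mult_ac)
  qed
  have wT: "(\<lambda>(i, \<omega>). indicator (G \<inter> B n) (tuple i \<omega>) * w i \<omega>) \<in> borel_measurable ?T" for n
    by (rule measurable_pair_measure_countable1) (auto intro: wm)
  have "(\<integral>\<^sup>+\<omega>. (\<integral>\<^sup>+i. indicator G (tuple i \<omega>) * w i \<omega> \<partial>count_space inj_tuples) \<partial>M) =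
      (\<integral>\<^sup>+z. (case z of (i, \<omega>) \<Rightarrow> indicator G (tuple i \<omega>) * w i \<omega>) \<partial>?T)"
    using void unfolding w_def by (intro nn_integral_indexed[symmetric]) auto
  also have "\<dots> = (\<integral>\<^sup>+z. (SUP n. (case z of (i, \<omega>) \<Rightarrow> indicator (G \<inter> B n) (tuple i \<omega>) * w i \<omega>)) \<partial>?T)"
  proof (intro nn_integral_cong)
    fix z assume "z \<in> space ?T"
    then obtain i \<omega> where z: "z = (i, \<omega>)" "\<omega> \<in> space M" by (auto simp: space_pair_measure)
    show "(case z of (i, \<omega>) \<Rightarrow> indicator G (tuple i \<omega>) * w i \<omega>) = (SUP n. (case z of (i, \<omega>) \<Rightarrow> indicator (G \<inter> B n) (tuple i \<omega>) * w i \<omega>))"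
      unfolding z prod.case SUP_mult_right_ennreal sup[OF tsp[OF z(2)], symmetric] ..
  qed
  also have "\<dots> = (SUP n. (\<integral>\<^sup>+z. (case z of (i, \<omega>) \<Rightarrow> indicator (G \<inter> B n) (tuple i \<omega>) * w i \<omega>) \<partial>?T))"
    using inc by (intro nn_integral_monotone_convergence_SUP wT) (auto simp: incseq_def le_fun_def indicator_def)
  also have "\<dots> = (SUP n. (\<integral>\<^sup>+x. indicator (G \<inter> B n) x * E x \<partial>Lambda_power))"
  proof (intro SUP_cong refl)
    fix n
    have "(\<integral>\<^sup>+z. (case z of (i, \<omega>) \<Rightarrow> indicator (G \<inter> B n) (tuple i \<omega>) * w i \<omega>) \<partial>?T) =
        (\<integral>\<^sup>+\<omega>. (\<integral>\<^sup>+i. indicator (G \<inter> B n) (tuple i \<omega>) * w i \<omega> \<partial>count_space inj_tuples) \<partial>M)"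
      by (rule nn_integral_indexed) (auto intro: wm)
    also have "\<dots> = (\<integral>\<^sup>+x. indicator (G \<inter> B n) x * ennreal (exp (- measure \<Lambda> {y \<in> space \<Lambda>. 0 < \<phi> y (p x)})) \<partial>Lambda_power)"
      unfolding w_def
    proof (rule mecke_avoiding_bounded[OF p \<phi> lip fin])
      have "emeasure Lambda_power (G \<inter> B n) \<le> emeasure Lambda_power (B n)" by (intro emeasure_mono) auto
      then show "emeasure Lambda_power (G \<inter> B n) < \<infinity>" using Bfin le_less_trans by blast
    qed (use G\<phi> in auto)
    also have "\<dots> = (\<integral>\<^sup>+x. indicator (G \<inter> B n) x * E x \<partial>Lambda_power)"
      using E(2) by (intro nn_integral_cong) (auto simp: indicator_def)
    finally show "(\<integral>\<^sup>+z. (case z of (i, \<omega>) \<Rightarrow> indicator (G \<inter> B n) (tuple i \<omega>) * w i \<omega>) \<partial>?T) = (\<integral>\<^sup>+x. indicator (G \<inter> B n) x * E x \<partial>Lambda_power)" .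
  qed
  also have "\<dots> = (\<integral>\<^sup>+x. (SUP n. indicator (G \<inter> B n) x * E x) \<partial>Lambda_power)"
    using incG E(1) by (intro nn_integral_monotone_convergence_SUP[symmetric]) auto
  also have "\<dots> = (\<integral>\<^sup>+x. indicator G x * E x \<partial>Lambda_power)"
    by (intro nn_integral_cong) (simp add: SUP_mult_right_ennreal[symmetric] sup)
  finally show ?thesis by (simp add: w_def)
qed

text \<open>By the Mecke formula with an empty avoided set, the mean number of tuples in \<open>G\<close> is the
  measure of \<open>G\<close>.\<close>

lemma AE_tuples_avoid_null:
  assumes G: "(G :: ('k::finite \<Rightarrow> 'b) set) \<in> null_sets Lambda_power"
  shows "AE \<omega> in M. \<forall>i. inj i \<longrightarrow> tuple i \<omega> \<notin> G"
proof -
  have Gm [measurable]: "G \<in> sets Lambda_power" using G by auto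
  have Wm: "(\<lambda>\<omega>. indicator G (tuple i \<omega>) :: ennreal) \<in> borel_measurable M" for i
    using measurable_compose[OF tuple_measurable[of i] borel_measurable_indicator[OF Gm]] .
  have "(\<integral>\<^sup>+\<omega>. (\<integral>\<^sup>+i. indicator G (tuple i \<omega>) \<partial>count_space inj_tuples) \<partial>M) =
      (\<integral>\<^sup>+\<omega>. (\<integral>\<^sup>+i. indicator G (tuple i \<omega>) * (if N {} \<omega> = 0 then 1 else 0) \<partial>count_space inj_tuples) \<partial>M)"
    by (simp add: N_eq_0_iff)
  also have "\<dots> = (\<integral>\<^sup>+x. indicator G x \<partial>factorial_measure {})"
    by (rule nn_integral_factorial_measure[symmetric]) auto
  also have "\<dots> = 0" using Gm emeasure_factorial_measure[of "{}" G] null_setsD1[OF G] by simp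
  finally have "AE \<omega> in M. (\<integral>\<^sup>+i. indicator G (tuple i \<omega>) \<partial>count_space inj_tuples) = (0 :: ennreal)"
    using Wm by (subst (asm) nn_integral_0_iff_AE) (auto intro!: borel_measurable_sum_countable)
  then show ?thesis
  proof eventually_elim
    fix \<omega> assume z: "(\<integral>\<^sup>+i. indicator G (tuple i \<omega>) \<partial>count_space inj_tuples) = (0 :: ennreal)"
    show "\<forall>i. inj i \<longrightarrow> tuple i \<omega> \<notin> G"
    proof (intro allI impI notI)
      fix i :: "'k \<Rightarrow> nat" assume i: "inj i" "tuple i \<omega> \<in> G"
      have "(1 :: ennreal) = indicator G (tuple i \<omega>)" using i by simp
      also have "\<dots> \<le> (\<integral>\<^sup>+i. indicator G (tuple i \<omega>) \<partial>count_space inj_tuples)" using i by (intro nn_integral_ge_point) simp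
      finally show False using z by simp
    qed
  qed
qed

end

section \<open>Vertices of the zero cell in general position\<close>

text \<open>A hyperplane is given as the pair of its distance from the origin and its unit normal.\<close>

definition normals :: "('n::finite \<Rightarrow> real \<times> (real ^ 'n)) \<Rightarrow> real ^ 'n ^ 'n" where
  "normals x = (\<chi> i. snd (x i))"

text \<open>Cramer's rule, which makes the common point of the hyperplanes a measurable function of
  them.\<close>

definition meet :: "('n::finite \<Rightarrow> real \<times> (real ^ 'n)) \<Rightarrow> real ^ 'n" where
  "meet x = (\<chi> k. det (\<chi> i j. if j = k then fst (x i) else snd (x i) $ j) / det (normals x))"

lemma meet_iff:
  assumes "det (normals x) \<noteq> 0"
  shows "(\<forall>i. q \<bullet> snd (x i) = fst (x i)) \<longleftrightarrow> q = meet x"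
proof -
  have mv: "(normals x *v q) $ i = q \<bullet> snd (x i)" for i
    by (simp add: normals_def matrix_vector_mult_def inner_vec_def mult.commute)
  have "(\<forall>i. q \<bullet> snd (x i) = fst (x i)) \<longleftrightarrow> normals x *v q = (\<chi> i. fst (x i))"
    by (simp add: vec_eq_iff mv)
  also have "\<dots> \<longleftrightarrow> q = meet x"
    unfolding cramer[OF assms] meet_def by (simp add: normals_def cong: if_cong)
  finally show ?thesis .
qed

lemma meet_inner: "det (normals x) \<noteq> 0 \<Longrightarrow> meet x \<bullet> snd (x i) = fst (x i)"
  using meet_iff[of x "meet x"] by blast

lemma det_normals_iff: "det (normals x) \<noteq> 0 \<longleftrightarrow> span (range (\<lambda>i. snd (x i))) = UNIV"
proof -
  have "rows (normals x) = range (\<lambda>i. snd (x i))"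
    by (auto simp: rows_def row_def normals_def)
  moreover have "det (normals x) \<noteq> 0 \<longleftrightarrow> (\<exists>B. B ** normals x = mat 1)"
    using invertible_det_nz[of "normals x"] invertible_left_inverse[of "normals x"] by simp
  ultimately show ?thesis using matrix_left_invertible_span_rows[of "normals x"] by simp
qed

text \<open>A tuple indexed by \<open>'n option\<close> consists of \<open>d\<close> hyperplanes, indexed by \<open>Some\<close>, and a further
  one, indexed by \<open>None\<close>, which in general position misses the common point of the others.\<close>

locale simple_hyperplane_system =
  fixes P :: "nat \<Rightarrow> real \<times> (real ^ 'n)"
  assumes locally_finite: "\<And>R. finite {i. fst (P i) \<le> R}"
    and unit: "\<And>i. norm (snd (P i)) = 1"
    and general_position: "\<And>\<iota> :: 'n option \<Rightarrow> nat. inj \<iota> \<Longrightarrow> det (normals (\<lambda>k. P (\<iota> (Some k)))) \<noteq> 0 \<Longrightarrow>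
        meet (\<lambda>k. P (\<iota> (Some k))) \<bullet> snd (P (\<iota> None)) \<noteq> fst (P (\<iota> None))"
begin

definition active :: "real ^ 'n \<Rightarrow> nat set" where
  "active v = {i. v \<bullet> snd (P i) = fst (P i)}"

definition vertex_tuples :: "('n \<Rightarrow> nat) set" where
  "vertex_tuples = {\<iota>. inj \<iota> \<and> det (normals (\<lambda>k. P (\<iota> k))) \<noteq> 0 \<and>
      (\<forall>i. meet (\<lambda>k. P (\<iota> k)) \<bullet> snd (P i) \<le> fst (P i))}"

abbreviation vertex :: "('n \<Rightarrow> nat) \<Rightarrow> real ^ 'n" where
  "vertex \<iota> \<equiv> meet (\<lambda>k. P (\<iota> k))"

lemma mem_zero_cell: "v \<in> zero_cell P \<longleftrightarrow> (\<forall>i. v \<bullet> snd (P i) \<le> fst (P i))"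
  by (simp add: zero_cell_def)

lemma active_vertex:
  assumes "\<iota> \<in> vertex_tuples"
  shows "active (vertex \<iota>) = range \<iota>"
proof (intro equalityI subsetI)
  fix j assume "j \<in> range \<iota>"
  then show "j \<in> active (vertex \<iota>)"
    using assms meet_inner[of "\<lambda>k. P (\<iota> k)"] by (auto simp: active_def vertex_tuples_def)
next
  fix j assume j: "j \<in> active (vertex \<iota>)"
  show "j \<in> range \<iota>"
  proof (rule ccontr)
    assume nj: "j \<notin> range \<iota>"
    \<comment> \<open>A further hyperplane through the vertex would contradict general position.\<close>
    define \<kappa> where "\<kappa> = (\<lambda>x. case x of None \<Rightarrow> j | Some k \<Rightarrow> \<iota> k)"
    have "inj \<kappa>" using assms nj by (auto simp: inj_def \<kappa>_def vertex_tuples_def split: option.splits)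
    then have "vertex \<iota> \<bullet> snd (P j) \<noteq> fst (P j)"
      using general_position[of \<kappa>] assms by (simp add: \<kappa>_def vertex_tuples_def)
    then show False using j by (simp add: active_def)
  qed
qed

text \<open>If a point of a segment in the cell lies on a bounding hyperplane and is not an end point,
  the whole segment lies on that hyperplane. The \<open>d\<close> hyperplanes have only one common point.\<close>

lemma vertex_extreme:
  assumes i: "\<iota> \<in> vertex_tuples"
  shows "vertex \<iota> extreme_point_of zero_cell P"
  unfolding extreme_point_of_def
proof (intro conjI ballI notI)
  show "vertex \<iota> \<in> zero_cell P" using i by (simp add: mem_zero_cell vertex_tuples_def)
  fix a b assume a: "a \<in> zero_cell P" and b: "b \<in> zero_cell P" and "vertex \<iota> \<in> open_segment a b"
  then obtain s where ab: "a \<noteq> b" and s: "0 < s" "s < 1" "vertex \<iota> = (1 - s) *\<^sub>R a + s *\<^sub>R b"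
    by (auto simp: in_segment)
  have det: "det (normals (\<lambda>k. P (\<iota> k))) \<noteq> 0" using i by (simp add: vertex_tuples_def)
  have "a \<bullet> snd (P (\<iota> k)) = fst (P (\<iota> k)) \<and> b \<bullet> snd (P (\<iota> k)) = fst (P (\<iota> k))" for k
  proof -
    define t where "t = fst (P (\<iota> k))"
    have "(1 - s) * (a \<bullet> snd (P (\<iota> k))) + s * (b \<bullet> snd (P (\<iota> k))) = t"
      using meet_inner[OF det, of k] s(3) by (simp add: inner_add t_def)
    then have eq: "(1 - s) * (t - a \<bullet> snd (P (\<iota> k))) + s * (t - b \<bullet> snd (P (\<iota> k))) = 0" by (simp add: algebra_simps)
    have ge: "0 \<le> t - a \<bullet> snd (P (\<iota> k))" "0 \<le> t - b \<bullet> snd (P (\<iota> k))"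
      using a b by (auto simp: mem_zero_cell t_def)
    then have "(1 - s) * (t - a \<bullet> snd (P (\<iota> k))) = 0" "s * (t - b \<bullet> snd (P (\<iota> k))) = 0"
      using eq s by (auto simp: add_nonneg_eq_0_iff)
    then show ?thesis using s by (simp add: t_def)
  qed
  then have "a = vertex \<iota>" "b = vertex \<iota>" using meet_iff[OF det] by blast+
  then show False using ab by simp
qed

text \<open>Otherwise the point could be moved a little in opposite directions orthogonal to the normals
  of the hyperplanes through it: only finitely many of the remaining hyperplanes are close to the
  origin, and these keep a positive gap.\<close>

lemma active_span:
  assumes v: "v extreme_point_of zero_cell P"
  shows "span ((\<lambda>i. snd (P i)) ` active v) = UNIV"
proof (rule ccontr)
  assume "span ((\<lambda>i. snd (P i)) ` active v) \<noteq> UNIV"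
  then obtain w where w: "w \<noteq> 0" "\<And>x. x \<in> span ((\<lambda>i. snd (P i)) ` active v) \<Longrightarrow> w \<bullet> x = 0"
    using span_not_UNIV_orthogonal by blast
  have w0: "w \<bullet> snd (P i) = 0" if "i \<in> active v" for i using that by (intro w(2) span_base) auto
  have vZ: "v \<bullet> snd (P i) \<le> fst (P i)" for i using v by (auto simp: extreme_point_of_def mem_zero_cell)
  define F where "F = {i. fst (P i) \<le> norm v + 1} - active v"
  define gap where "gap i = fst (P i) - v \<bullet> snd (P i)" for i
  have finF: "finite F" unfolding F_def using locally_finite by simp
  have gap_pos: "0 < gap i" if "i \<in> F" for i
    using that vZ[of i] by (auto simp: F_def active_def gap_def)
  \<comment> \<open>The number \<open>1\<close> stands for the gap of the hyperplanes outside \<open>F\<close>.\<close>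
  define m where "m = Min (insert 1 (gap ` F))"
  have m: "0 < m" "m \<le> 1" "\<And>i. i \<in> F \<Longrightarrow> m \<le> gap i"
    unfolding m_def using finF gap_pos by (auto simp: Min_gr_iff intro: Min_le)
  define \<epsilon> where "\<epsilon> = m / norm w"
  have \<epsilon>: "0 < \<epsilon>" "\<epsilon> * norm w = m" using m w by (auto simp: \<epsilon>_def)
  have inZ: "v + c *\<^sub>R w \<in> zero_cell P" if c: "\<bar>c\<bar> = \<epsilon>" for c
    unfolding mem_zero_cell
  proof
    fix i
    have "\<bar>w \<bullet> snd (P i)\<bar> \<le> norm w" using Cauchy_Schwarz_ineq2[of w "snd (P i)"] unit[of i] by simp
    then have "\<bar>c * (w \<bullet> snd (P i))\<bar> \<le> \<epsilon> * norm w" unfolding abs_mult c using \<epsilon>(1) by (intro mult_left_mono) auto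
    then have cw: "c * (w \<bullet> snd (P i)) \<le> m" using \<epsilon>(2) by linarith
    have "i \<in> active v \<or> i \<in> F \<or> norm v + 1 < fst (P i)" by (auto simp: F_def)
    then consider "i \<in> active v" | "i \<in> F" | "norm v + 1 < fst (P i)" by blast
    then show "(v + c *\<^sub>R w) \<bullet> snd (P i) \<le> fst (P i)"
    proof cases
      case 1 then show ?thesis using w0[OF 1] vZ[of i] by (simp add: inner_add)
    next
      case 2 then show ?thesis using cw m(3)[OF 2] by (simp add: inner_add gap_def)
    next
      case 3
      have "v \<bullet> snd (P i) \<le> norm v" using norm_cauchy_schwarz[of v "snd (P i)"] unit[of i] by simp
      then show ?thesis using 3 cw m(2) by (simp add: inner_add)
    qed
  qed
  have "v \<in> open_segment (v + \<epsilon> *\<^sub>R w) (v + (- \<epsilon>) *\<^sub>R w)"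
    unfolding in_segment
  proof (intro conjI exI[of _ "1/2"])
    show "v + \<epsilon> *\<^sub>R w \<noteq> v + (- \<epsilon>) *\<^sub>R w"
    proof
      assume eq: "v + \<epsilon> *\<^sub>R w = v + (- \<epsilon>) *\<^sub>R w"
      have "(\<epsilon> + \<epsilon>) *\<^sub>R w = (v + \<epsilon> *\<^sub>R w) - (v + (- \<epsilon>) *\<^sub>R w)" by (simp add: vec_eq_iff field_simps)
      also have "\<dots> = 0" unfolding eq by simp
      finally have "\<epsilon> + \<epsilon> = 0 \<or> w = 0" by (simp only: scaleR_eq_0_iff)
      then show False using \<epsilon>(1) w(1) by linarith
    qed
    show "v = (1 - 1/2) *\<^sub>R (v + \<epsilon> *\<^sub>R w) + (1/2) *\<^sub>R (v + (- \<epsilon>) *\<^sub>R w)"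
      by (simp add: vec_eq_iff field_simps)
  qed auto
  then show False
    using v inZ[of \<epsilon>] inZ[of "- \<epsilon>"] \<epsilon>(1) by (auto simp: extreme_point_of_def)
qed

text \<open>Among the normals of the hyperplanes through an extreme point there is a basis.\<close>

lemma extreme_vertex:
  assumes v: "v extreme_point_of zero_cell P"
  shows "\<exists>\<iota>\<in>vertex_tuples. vertex \<iota> = v"
proof -
  let ?S = "(\<lambda>i. snd (P i)) ` active v"
  obtain B where B: "B \<subseteq> ?S" "independent B" "?S \<subseteq> span B" "card B = dim ?S"
    using basis_exists[of ?S] by metis
  have spB: "span B = UNIV"
    using active_span[OF v] B(3) by (metis span_mono span_span top.extremum_uniqueI)
  have "dim ?S = CARD('n)"
    using active_span[OF v] dim_span[of ?S] by (simp add: dim_UNIV)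
  then have "card B = CARD('n)" "finite B" using B independent_imp_finite by auto
  then obtain f where f: "bij_betw f (UNIV :: 'n set) B"
    using finite_same_card_bij[of "UNIV :: 'n set" B] by auto
  have "\<exists>i. i \<in> active v \<and> snd (P i) = f k" for k
  proof -
    have "f k \<in> B" using bij_betwE[OF f] by blast
    then have "f k \<in> (\<lambda>i. snd (P i)) ` active v" using B(1) by blast
    then show ?thesis by (auto simp: image_iff)
  qed
  then obtain \<iota> where \<iota>: "\<And>k. \<iota> k \<in> active v" "\<And>k. snd (P (\<iota> k)) = f k" by metis
  have inj: "inj \<iota>"
    using bij_betw_imp_inj_on[OF f] \<iota>(2) by (metis injD injI)
  have det: "det (normals (\<lambda>k. P (\<iota> k))) \<noteq> 0"
    unfolding det_normals_iff \<iota>(2) using bij_betw_imp_surj_on[OF f] spB by simp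
  have "\<forall>k. v \<bullet> snd (P (\<iota> k)) = fst (P (\<iota> k))" using \<iota>(1) by (auto simp: active_def)
  then have "v = vertex \<iota>" using meet_iff[OF det] by blast
  moreover have "v \<in> zero_cell P" using v by (simp add: extreme_point_of_def)
  ultimately show ?thesis using inj det by (intro bexI[of _ \<iota>]) (auto simp: vertex_tuples_def mem_zero_cell)
qed

text \<open>By general position the tuples belonging to a vertex are the enumerations of the \<open>d\<close>
  hyperplanes through it.\<close>

lemma card_vertex_fiber:
  assumes v: "v extreme_point_of zero_cell P"
  shows "finite {\<iota>\<in>vertex_tuples. vertex \<iota> = v}" "card {\<iota>\<in>vertex_tuples. vertex \<iota> = v} = fact CARD('n)"
proof -
  obtain \<iota>\<^sub>0 where i0: "\<iota>\<^sub>0 \<in> vertex_tuples" "vertex \<iota>\<^sub>0 = v" using extreme_vertex[OF v] by blast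
  have inj0: "inj \<iota>\<^sub>0" using i0 by (simp add: vertex_tuples_def)
  have rng0: "active v = range \<iota>\<^sub>0" using active_vertex[OF i0(1)] i0(2) by simp
  have eq: "{\<iota>\<in>vertex_tuples. vertex \<iota> = v} = (\<lambda>\<pi>. \<iota>\<^sub>0 \<circ> \<pi>) ` {\<pi>. \<pi> permutes UNIV}"
  proof (intro equalityI subsetI)
    fix \<iota> assume "\<iota> \<in> {\<iota>\<in>vertex_tuples. vertex \<iota> = v}"
    then have i: "\<iota> \<in> vertex_tuples" "vertex \<iota> = v" by auto
    have rng: "range \<iota> = range \<iota>\<^sub>0" using active_vertex[OF i(1)] i(2) rng0 by simp
    define \<pi> where "\<pi> = inv \<iota>\<^sub>0 \<circ> \<iota>"
    have comp: "\<iota>\<^sub>0 \<circ> \<pi> = \<iota>"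
    proof (rule ext)
      fix x
      have "\<iota> x \<in> range \<iota>\<^sub>0" using rng by blast
      then show "(\<iota>\<^sub>0 \<circ> \<pi>) x = \<iota> x" by (simp add: \<pi>_def f_inv_into_f)
    qed
    have "inj (\<iota>\<^sub>0 \<circ> \<pi>)" using comp i(1) by (simp add: vertex_tuples_def)
    then have "inj \<pi>" by (rule inj_on_imageI2)
    then have "bij \<pi>" by (simp add: bij_def finite_UNIV_inj_surj)
    then have "\<pi> permutes UNIV" by (intro bij_imp_permutes) auto
    then show "\<iota> \<in> (\<lambda>\<pi>. \<iota>\<^sub>0 \<circ> \<pi>) ` {\<pi>. \<pi> permutes UNIV}" using comp by auto
  next
    fix \<iota> assume "\<iota> \<in> (\<lambda>\<pi>. \<iota>\<^sub>0 \<circ> \<pi>) ` {\<pi>. \<pi> permutes UNIV}"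
    then obtain \<pi> where \<pi>: "\<pi> permutes UNIV" "\<iota> = \<iota>\<^sub>0 \<circ> \<pi>" by auto
    have bij: "bij \<pi>" using \<pi>(1) by (rule permutes_bij)
    have inj: "inj \<iota>" unfolding \<pi>(2) using inj0 bij by (simp add: bij_is_inj inj_compose)
    have "range \<iota> = \<iota>\<^sub>0 ` range \<pi>" unfolding \<pi>(2) by (rule image_comp[symmetric])
    then have rng: "range \<iota> = range \<iota>\<^sub>0" using bij_is_surj[OF bij] by simp
    have "range (\<lambda>k. snd (P (\<iota> k))) = (\<lambda>i. snd (P i)) ` range \<iota>" by (simp add: image_image)
    also have "\<dots> = range (\<lambda>k. snd (P (\<iota>\<^sub>0 k)))" unfolding rng by (simp add: image_image)
    finally have det: "det (normals (\<lambda>k. P (\<iota> k))) \<noteq> 0"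
      using i0(1) by (simp add: det_normals_iff vertex_tuples_def)
    have "\<iota> k \<in> active v" for k using rng rng0 by auto
    then have "v = vertex \<iota>" using meet_iff[OF det, of v] by (auto simp: active_def)
    moreover have "v \<in> zero_cell P" using v by (simp add: extreme_point_of_def)
    ultimately show "\<iota> \<in> {\<iota>\<in>vertex_tuples. vertex \<iota> = v}" using inj det by (auto simp: vertex_tuples_def mem_zero_cell)
  qed
  have inj_comp: "inj_on (\<lambda>\<pi>. \<iota>\<^sub>0 \<circ> \<pi>) {\<pi>. \<pi> permutes UNIV}"
  proof (rule inj_onI, rule ext)
    fix a b :: "'n \<Rightarrow> 'n" and x assume "\<iota>\<^sub>0 \<circ> a = \<iota>\<^sub>0 \<circ> b"
    from fun_cong[OF this, of x] have "\<iota>\<^sub>0 (a x) = \<iota>\<^sub>0 (b x)" by simp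
    then show "a x = b x" using inj0 by (simp add: inj_eq)
  qed
  show "finite {\<iota>\<in>vertex_tuples. vertex \<iota> = v}" unfolding eq by simp
  show "card {\<iota>\<in>vertex_tuples. vertex \<iota> = v} = fact CARD('n)"
    unfolding eq card_image[OF inj_comp] by (intro card_permutations) auto
qed

theorem card_vertex_tuples:
  "emeasure (count_space UNIV) vertex_tuples = of_nat (fact CARD('n)) * num_vertices (zero_cell P)"
proof -
  define E where "E = {v. v extreme_point_of zero_cell P}"
  define fib where "fib v = {\<iota>\<in>vertex_tuples. vertex \<iota> = v}" for v
  have im: "vertex ` vertex_tuples = E" using vertex_extreme extreme_vertex by (auto simp: E_def)
  have U: "vertex_tuples = (\<Union>v\<in>E. fib v)" using vertex_extreme by (auto simp: fib_def E_def)
  show ?thesis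
  proof (cases "finite E")
    case True
    have fin: "finite (fib v)" if "v \<in> E" for v using card_vertex_fiber(1) that by (simp add: fib_def E_def)
    have "finite vertex_tuples" unfolding U using True fin by blast
    have "card vertex_tuples = (\<Sum>v\<in>E. card (fib v))"
      unfolding U using True fin by (intro card_UN_disjoint) (auto simp: fib_def)
    also have "\<dots> = (\<Sum>v\<in>E. fact CARD('n))"
      using card_vertex_fiber(2) by (intro sum.cong) (auto simp: fib_def E_def)
    finally have "card vertex_tuples = fact CARD('n) * card E" by simp
    then show ?thesis
      using True \<open>finite vertex_tuples\<close> by (simp add: num_vertices_def E_def[symmetric] emeasure_count_space_finite)
  next
    case False
    then have "infinite vertex_tuples" using im finite_imageI by metis
    then show ?thesis
      using False by (simp add: num_vertices_def E_def[symmetric] emeasure_count_space_infinite ennreal_mult_top)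
  qed
qed

end

section \<open>Linear substitution and radial integration\<close>

lemma emeasure_lborel_vec_box:
  fixes B :: "'n::finite \<Rightarrow> real set"
  assumes B: "\<And>k. B k \<in> sets borel"
  shows "emeasure lborel {t :: real ^ 'n. \<forall>k. t $ k \<in> B k} = (\<Prod>k\<in>UNIV. emeasure lborel (B k))"
proof -
  have bij: "bij_betw (\<lambda>k. axis k (1::real)) (UNIV :: 'n set) Basis"
    by (rule bij_betw_imageI) (auto simp: inj_on_def axis_eq_axis Basis_vec_def)
  define idx where "idx b = (SOME k. b = axis k (1::real))" for b :: "real ^ 'n"
  have idx: "idx (axis k 1) = k" for k
    unfolding idx_def by (rule some_equality) (auto simp: axis_eq_axis)
  have Sm: "{t :: real ^ 'n. \<forall>k. t $ k \<in> B k} \<in> sets borel"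
    using B by measurable
  have "emeasure lborel {t :: real ^ 'n. \<forall>k. t $ k \<in> B k} = (\<integral>\<^sup>+t. indicator {t. \<forall>k. t $ k \<in> B k} t \<partial>lborel)"
    using Sm by simp
  also have "\<dots> = (\<integral>\<^sup>+t. (\<Prod>b\<in>Basis. indicator (B (idx b)) (t \<bullet> b)) \<partial>(lborel :: (real ^ 'n) measure))"
  proof (intro nn_integral_cong)
    fix t :: "real ^ 'n"
    have "(\<Prod>b\<in>Basis. indicator (B (idx b)) (t \<bullet> b) :: ennreal) = (\<Prod>k\<in>UNIV. indicator (B k) (t $ k))"
      by (subst prod.reindex_bij_betw[OF bij, symmetric]) (simp add: idx inner_axis)
    also have "\<dots> = indicator {t. \<forall>k. t $ k \<in> B k} t"
    proof (cases "\<forall>k. t $ k \<in> B k")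
      case False
      then obtain k where "t $ k \<notin> B k" by auto
      then have "(\<Prod>k\<in>UNIV. indicator (B k) (t $ k) :: ennreal) = 0" by (intro prod_zero bexI[of _ k]) auto
      then show ?thesis using False by simp
    qed simp
    finally show "indicator {t. \<forall>k. t $ k \<in> B k} t = (\<Prod>b\<in>Basis. indicator (B (idx b)) (t \<bullet> b) :: ennreal)" by simp
  qed
  also have "\<dots> = (\<Prod>b\<in>(Basis :: (real ^ 'n) set). \<integral>\<^sup>+s. indicator (B (idx b)) s \<partial>lborel)"
    using B by (intro nn_integral_lborel_prod) auto
  also have "\<dots> = (\<Prod>k\<in>(UNIV :: 'n set). emeasure lborel (B k))"
    using B by (subst prod.reindex_bij_betw[OF bij, symmetric]) (simp add: idx)
  finally show ?thesis .
qed

lemma nn_integral_lborel_matrix: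
  fixes U :: "real ^ 'n ^ 'n"
  assumes det: "det U \<noteq> 0" and f: "f \<in> borel_measurable borel"
  shows "(\<integral>\<^sup>+t. f t \<partial>lborel) = ennreal \<bar>det U\<bar> * (\<integral>\<^sup>+p. f (U *v p) \<partial>lborel)"
proof -
  have m [measurable]: "(*v) U \<in> borel_measurable borel"
    by (intro borel_measurable_continuous_onI matrix_vector_mult_linear_continuous_on)
  have "(lborel :: (real ^ 'n) measure) = density (distr lborel borel ((*v) U)) (\<lambda>_. ennreal \<bar>det U\<bar>)"
  proof (rule measure_eqI)
    fix B :: "(real ^ 'n) set" assume "B \<in> sets lborel"
    then have B: "B \<in> sets borel" by simp
    have "emeasure (density (distr lborel borel ((*v) U)) (\<lambda>_. ennreal \<bar>det U\<bar>)) B = ennreal \<bar>det U\<bar> * emeasure (distr lborel borel ((*v) U)) B"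
      using B by (simp add: emeasure_density nn_integral_cmult)
    also have "\<dots> = ennreal \<bar>det U\<bar> * emeasure lborel ((*v) U -` B)"
      using B by (subst emeasure_distr) auto
    also have "\<dots> = emeasure lborel B" by (rule emeasure_lborel_vimage_matrix[OF det B])
    finally show "emeasure lborel B = emeasure (density (distr lborel borel ((*v) U)) (\<lambda>_. ennreal \<bar>det U\<bar>)) B" ..
  qed simp
  then have "(\<integral>\<^sup>+t. f t \<partial>lborel) = (\<integral>\<^sup>+t. f t \<partial>density (distr lborel borel ((*v) U)) (\<lambda>_. ennreal \<bar>det U\<bar>))" by simp
  also have "\<dots> = (\<integral>\<^sup>+t. ennreal \<bar>det U\<bar> * f t \<partial>distr lborel borel ((*v) U))"
    using f by (subst nn_integral_density) auto
  also have "\<dots> = (\<integral>\<^sup>+p. ennreal \<bar>det U\<bar> * f (U *v p) \<partial>lborel)"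
    using f by (subst nn_integral_distr) auto
  also have "\<dots> = ennreal \<bar>det U\<bar> * (\<integral>\<^sup>+p. f (U *v p) \<partial>lborel)"
    using measurable_compose[OF m f] by (intro nn_integral_cmult) simp
  finally show ?thesis .
qed

lemma parallelepiped_volume_eq:
  fixes v :: "'n::finite \<Rightarrow> real ^ 'n"
  shows "parallelepiped_volume v = \<bar>det (\<chi> i. v i)\<bar>"
proof -
  define U where "U = transpose (\<chi> i. v i)"
  define Q where "Q = {a :: real ^ 'n. \<forall>i. 0 \<le> a $ i \<and> a $ i \<le> 1}"
  have Q: "Q = cbox 0 (\<chi> i. 1)" by (auto simp: Q_def mem_box_cart)
  have Uv: "U *v a = (\<Sum>i\<in>UNIV. a $ i *\<^sub>R v i)" for a
    by (simp add: U_def vec_eq_iff matrix_vector_mult_def transpose_def mult.commute)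
  have S: "{\<Sum>i\<in>UNIV. a i *\<^sub>R v i | a :: 'n \<Rightarrow> real. \<forall>i. 0 \<le> a i \<and> a i \<le> 1} = (*v) U ` Q"
  proof (intro equalityI subsetI)
    fix x assume "x \<in> {\<Sum>i\<in>UNIV. a i *\<^sub>R v i | a :: 'n \<Rightarrow> real. \<forall>i. 0 \<le> a i \<and> a i \<le> 1}"
    then obtain a :: "'n \<Rightarrow> real" where a: "x = (\<Sum>i\<in>UNIV. a i *\<^sub>R v i)" "\<forall>i. 0 \<le> a i \<and> a i \<le> 1" by auto
    then have "x = U *v (\<chi> i. a i)" "(\<chi> i. a i) \<in> Q" by (simp_all add: Uv Q_def)
    then show "x \<in> (*v) U ` Q" by blast
  next
    fix x assume "x \<in> (*v) U ` Q"
    then obtain a where "x = U *v a" "a \<in> Q" by auto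
    then show "x \<in> {\<Sum>i\<in>UNIV. a i *\<^sub>R v i | a :: 'n \<Rightarrow> real. \<forall>i. 0 \<le> a i \<and> a i \<le> 1}"
      unfolding Uv Q_def by (intro CollectI exI[of _ "\<lambda>i. a $ i"]) auto
  qed
  have det: "det U = det (\<chi> i. v i)" by (simp add: U_def det_transpose)
  have comp: "compact ((*v) U ` Q)"
    unfolding Q by (intro compact_continuous_image matrix_vector_mult_linear_continuous_on compact_cbox)
  have Qm: "emeasure lborel Q = 1"
  proof -
    have "emeasure lborel Q = emeasure lborel {t :: real ^ 'n. \<forall>k. t $ k \<in> {0..1}}" by (simp add: Q_def)
    also have "\<dots> = 1" by (subst emeasure_lborel_vec_box) auto
    finally show ?thesis .
  qed
  show ?thesis
  proof (cases "det U = 0")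
    case True
    then have "dim (range ((*v) U)) < CARD('n)"
      using det_eq_0_rank[of U] by (simp add: rank_dim_range)
    then have "negligible (range ((*v) U))" by (intro negligible_lowdim) simp
    then have "negligible ((*v) U ` Q)" by (rule negligible_subset) auto
    then have "(*v) U ` Q \<in> null_sets lborel"
      using comp by (simp add: negligible_iff_null_sets null_sets_completion_iff borel_compact)
    then show ?thesis unfolding parallelepiped_volume_def S using True det by (simp add: measure_def null_setsD1)
  next
    case False
    have inj: "inj ((*v) U)" using False det_nz_iff_inj[of "(*v) U"] by (simp add: matrix_vector_mul_linear)
    have "(*v) U -` ((*v) U ` Q) = Q" using inj by (rule inj_vimage_image_eq)
    then have "emeasure lborel ((*v) U ` Q) = ennreal \<bar>det U\<bar> * emeasure lborel Q"
      using emeasure_lborel_vimage_matrix[OF False, of "(*v) U ` Q"] comp by (simp add: borel_compact)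
    then show ?thesis unfolding parallelepiped_volume_def S using Qm det by (simp add: measure_def)
  qed
qed

text \<open>The radius is integrated without polar coordinates: \<open>exp (- h x)\<close> is written as an integral
  over the radii beyond \<open>norm x\<close>, and each ball is scaled to the unit ball. The last hypothesis
  covers the directions in which the exponential does not decay.\<close>

lemma nn_integral_homogeneous_exp:
  fixes g h :: "real ^ 'n \<Rightarrow> real"
  assumes g [measurable]: "g \<in> borel_measurable borel" and g0: "\<And>x. 0 \<le> g x"
    and gh: "\<And>x c. 0 < c \<Longrightarrow> g (c *\<^sub>R x) = g x"
    and h [measurable]: "h \<in> borel_measurable borel" and h0: "\<And>x. 0 \<le> h x"
    and hh: "\<And>x c. 0 < c \<Longrightarrow> h (c *\<^sub>R x) = c * h x"
    and zero: "\<And>x. x \<noteq> 0 \<Longrightarrow> h x = 0 \<Longrightarrow> g x = 0"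
  shows "(\<integral>\<^sup>+x. ennreal (g x * exp (- h x)) \<partial>lborel) =
    ennreal (fact CARD('n)) * (\<integral>\<^sup>+x. indicator (cball 0 1) x * ennreal (g (sgn x) / h (sgn x) ^ CARD('n)) \<partial>lborel)"
proof -
  let ?d = "CARD('n)"
  have sgn_scale: "g (sgn x) = g x" "norm x * h (sgn x) = h x" if "x \<noteq> 0" for x
  proof -
    have x: "x = norm x *\<^sub>R sgn x" using that by (simp add: sgn_div_norm)
    show "g (sgn x) = g x" using gh[of "norm x" "sgn x"] x that by simp
    show "norm x * h (sgn x) = h x" using hh[of "norm x" "sgn x"] x that by simp
  qed
  have gamma: "(\<integral>\<^sup>+s. ennreal (s ^ k * exp (- (s * c))) * indicator {0..} s \<partial>lborel) = ennreal (fact k / c ^ Suc k)" if c: "c > 0" for c :: real and k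
  proof -
    have "(\<integral>\<^sup>+s. ennreal (s ^ k * exp (- s)) * indicator {0..} s \<partial>lborel) =
        ennreal \<bar>c\<bar> * (\<integral>\<^sup>+s. ennreal ((0 + c * s) ^ k * exp (- (0 + c * s))) * indicator {0..} (0 + c * s) \<partial>lborel)"
      using c by (intro nn_integral_real_affine) auto
    also have "\<dots> = ennreal c * (\<integral>\<^sup>+s. ennreal (c ^ k) * (ennreal (s ^ k * exp (- (s * c))) * indicator {0..} s) \<partial>lborel)"
    proof -
      have inner: "ennreal ((0 + c * s) ^ k * exp (- (0 + c * s))) * indicator {0..} (0 + c * s) =
          ennreal (c ^ k) * (ennreal (s ^ k * exp (- (s * c))) * indicator {0..} s)" for s
        using c by (auto simp: indicator_def power_mult_distrib zero_le_mult_iff ennreal_mult'[symmetric] mult_ac)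
      show ?thesis unfolding inner using c by simp
    qed
    also have "\<dots> = ennreal c * (ennreal (c ^ k) * (\<integral>\<^sup>+s. ennreal (s ^ k * exp (- (s * c))) * indicator {0..} s \<partial>lborel))"
      by (subst nn_integral_cmult) auto
    finally have eq: "ennreal (fact k) = ennreal (c ^ Suc k) * (\<integral>\<^sup>+s. ennreal (s ^ k * exp (- (s * c))) * indicator {0..} s \<partial>lborel)"
      using c unfolding nn_intergal_power_times_exp_Ici by (simp add: ennreal_mult mult.assoc)
    have "(\<integral>\<^sup>+s. ennreal (s ^ k * exp (- (s * c))) * indicator {0..} s \<partial>lborel) =
      ennreal (1 / c ^ Suc k) * (ennreal (c ^ Suc k) * (\<integral>\<^sup>+s. ennreal (s ^ k * exp (- (s * c))) * indicator {0..} s \<partial>lborel))"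
      using c by (simp add: mult.assoc[symmetric] ennreal_mult'[symmetric] del: power_Suc)
    also have "\<dots> = ennreal (fact k / c ^ Suc k)"
      unfolding eq[symmetric] using c by (subst ennreal_mult'[symmetric]) auto
    finally show ?thesis .
  qed
  have tail: "(\<integral>\<^sup>+s. ennreal (c * exp (- (s * c))) * indicator {r..} s \<partial>lborel) = ennreal (exp (- (r * c)))" if c: "c > 0" for r c :: real
  proof -
    have "(\<integral>\<^sup>+s. ennreal (c * exp (- (s * c))) * indicator {r..} s \<partial>lborel) =
        ennreal \<bar>1\<bar> * (\<integral>\<^sup>+s. ennreal (c * exp (- ((r + 1 * s) * c))) * indicator {r..} (r + 1 * s) \<partial>lborel)"
      by (intro nn_integral_real_affine) auto
    also have "\<dots> = (\<integral>\<^sup>+s. ennreal (c * exp (- (r * c))) * (ennreal (s ^ 0 * exp (- (s * c))) * indicator {0..} s) \<partial>lborel)"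
      using c by (simp, intro nn_integral_cong)
        (auto simp: indicator_def ennreal_mult'[symmetric] exp_add[symmetric] algebra_simps)
    also have "\<dots> = ennreal (c * exp (- (r * c))) * (\<integral>\<^sup>+s. ennreal (s ^ 0 * exp (- (s * c))) * indicator {0..} s \<partial>lborel)"
      by (rule nn_integral_cmult) auto
    also have "\<dots> = ennreal (exp (- (r * c)))"
      unfolding gamma[OF c] using c by (subst ennreal_mult'[symmetric]) auto
    finally show ?thesis .
  qed
  define q where "q s x = g (sgn x) * (h (sgn x) * exp (- (s * h (sgn x))))" for s x
  have q0: "0 \<le> q s x" for s x using g0 h0 by (simp add: q_def)
  have qm [measurable]: "(\<lambda>(s, x). q s x) \<in> borel_measurable (borel \<Otimes>\<^sub>M borel)"
    unfolding q_def by measurable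
  have qm1 [measurable]: "(\<lambda>x. q s x) \<in> borel_measurable borel" for s
    unfolding q_def by measurable
  have AE0: "AE x in lborel. x \<noteq> (0 :: real ^ 'n)" by (rule AE_lborel_singleton)
  have "(\<integral>\<^sup>+x. ennreal (g x * exp (- h x)) \<partial>lborel) = (\<integral>\<^sup>+x. (\<integral>\<^sup>+s. ennreal (q s x) * indicator {norm x..} s \<partial>lborel) \<partial>lborel)"
  proof (rule nn_integral_cong_AE)
    show "AE x in lborel. ennreal (g x * exp (- h x)) = (\<integral>\<^sup>+s. ennreal (q s x) * indicator {norm x..} s \<partial>lborel)"
      using AE0
    proof eventually_elim
      fix x :: "real ^ 'n" assume x: "x \<noteq> 0"
      show "ennreal (g x * exp (- h x)) = (\<integral>\<^sup>+s. ennreal (q s x) * indicator {norm x..} s \<partial>lborel)"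
      proof (cases "h x = 0")
        case True
        then have "g x = 0" using zero x by simp
        then show ?thesis using sgn_scale(1)[OF x] by (simp add: q_def)
      next
        case False
        then have hp: "0 < h (sgn x)" using sgn_scale(2)[OF x] h0[of "sgn x"] by (metis less_le mult_zero_right)
        have "(\<integral>\<^sup>+s. ennreal (q s x) * indicator {norm x..} s \<partial>lborel) =
            (\<integral>\<^sup>+s. ennreal (g x) * (ennreal (h (sgn x) * exp (- (s * h (sgn x)))) * indicator {norm x..} s) \<partial>lborel)"
          using g0[of x] sgn_scale(1)[OF x] by (intro nn_integral_cong) (simp add: q_def ennreal_mult' mult.assoc)
        also have "\<dots> = ennreal (g x) * ennreal (exp (- (norm x * h (sgn x))))"
          unfolding tail[OF hp, symmetric] by (rule nn_integral_cmult) auto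
        finally show ?thesis using g0[of x] sgn_scale(2)[OF x] by (simp add: ennreal_mult')
      qed
    qed
  qed
  also have "\<dots> = (\<integral>\<^sup>+s. (\<integral>\<^sup>+x. ennreal (q s x) * indicator {norm x..} s \<partial>lborel) \<partial>lborel)"
  proof (rule lborel_pair.Fubini')
    have "(\<lambda>(s, x). ennreal (q s x) * indicator {norm x..} s) = (\<lambda>z. ennreal (case z of (s, x) \<Rightarrow> q s x) * indicator {z. norm (snd z) \<le> fst z} z)"
      by (auto simp: fun_eq_iff indicator_def)
    moreover have "{z :: real \<times> (real ^ 'n). norm (snd z) \<le> fst z} \<in> sets (borel \<Otimes>\<^sub>M borel)"
      unfolding borel_prod by (intro borel_closed closed_Collect_le continuous_intros)
    ultimately show "(\<lambda>(s, x). ennreal (q s x) * indicator {norm x..} s) \<in> borel_measurable (lborel \<Otimes>\<^sub>M (lborel :: (real ^ 'n) measure))"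
      using qm by simp
  qed
  also have "\<dots> = (\<integral>\<^sup>+s. (\<integral>\<^sup>+x. indicator (cball 0 1) x * (ennreal (s ^ ?d * q s x) * indicator {0..} s) \<partial>lborel) \<partial>lborel)"
  proof (rule nn_integral_cong_AE)
    have "AE s in lborel. s \<noteq> (0 :: real)" by (rule AE_lborel_singleton)
    then show "AE s in lborel. (\<integral>\<^sup>+x. ennreal (q s x) * indicator {norm x..} s \<partial>(lborel :: (real ^ 'n) measure)) =
        (\<integral>\<^sup>+x. indicator (cball 0 1) x * (ennreal (s ^ ?d * q s x) * indicator {0..} s) \<partial>lborel)"
    proof eventually_elim
      fix s :: real assume s: "s \<noteq> 0"
      show "(\<integral>\<^sup>+x. ennreal (q s x) * indicator {norm x..} s \<partial>(lborel :: (real ^ 'n) measure)) =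
        (\<integral>\<^sup>+x. indicator (cball 0 1) x * (ennreal (s ^ ?d * q s x) * indicator {0..} s) \<partial>lborel)"
      proof (cases "s > 0")
        case False
        have "(\<integral>\<^sup>+x. ennreal (q s x) * indicator {norm x..} s \<partial>(lborel :: (real ^ 'n) measure)) = (\<integral>\<^sup>+x. 0 \<partial>(lborel :: (real ^ 'n) measure))"
        proof (intro nn_integral_cong)
          fix x :: "real ^ 'n"
          have "\<not> norm x \<le> s" using False s norm_ge_zero[of x] by linarith
          then show "ennreal (q s x) * indicator {norm x..} s = 0" by simp
        qed
        then show ?thesis using False s by simp
      next
        case True
        have qs: "q s (s *\<^sub>R x) = q s x" for x
        proof -
          have "sgn (s *\<^sub>R x) = sgn x" using True by (simp add: sgn_scaleR)
          then show ?thesis by (simp add: q_def)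
        qed
        have fm: "(\<lambda>x. ennreal (q s x) * indicator (cball 0 s) x) \<in> borel_measurable (borel :: (real ^ 'n) measure)"
        proof -
          have [measurable]: "cball 0 s \<in> sets (borel :: (real ^ 'n) measure)" by simp
          show ?thesis by measurable
        qed
        have "(\<integral>\<^sup>+x. ennreal (q s x) * indicator {norm x..} s \<partial>(lborel :: (real ^ 'n) measure)) = (\<integral>\<^sup>+x. ennreal (q s x) * indicator (cball 0 s) x \<partial>lborel)"
          by (intro nn_integral_cong) (auto simp: indicator_def)
        also have "\<dots> = (\<integral>\<^sup>+x. ennreal (q s x) * indicator (cball 0 s) x \<partial>density (distr lborel borel (\<lambda>x. 0 + s *\<^sub>R x)) (\<lambda>_. \<bar>s\<bar> ^ DIM(real ^ 'n)))"
          using lborel_affine[of s "0 :: real ^ 'n"] True by simp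
        also have "\<dots> = (\<integral>\<^sup>+x. ennreal (s ^ ?d) * (ennreal (q s x) * indicator (cball 0 s) x) \<partial>distr lborel borel (\<lambda>x. s *\<^sub>R x))"
          using fm True by (subst nn_integral_density) auto
        also have "\<dots> = (\<integral>\<^sup>+x. ennreal (s ^ ?d) * (ennreal (q s (s *\<^sub>R x)) * indicator (cball 0 s) (s *\<^sub>R x)) \<partial>lborel)"
          using fm by (subst nn_integral_distr) auto
        also have "\<dots> = (\<integral>\<^sup>+x. indicator (cball 0 1) x * (ennreal (s ^ ?d * q s x) * indicator {0..} s) \<partial>lborel)"
          using True q0 by (intro nn_integral_cong) (auto simp: indicator_def qs ennreal_mult)
        finally show ?thesis .
      qed
    qed
  qed
  also have "\<dots> = (\<integral>\<^sup>+x. (\<integral>\<^sup>+s. indicator (cball 0 1) x * (ennreal (s ^ ?d * q s x) * indicator {0..} s) \<partial>lborel) \<partial>(lborel :: (real ^ 'n) measure))"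
  proof (rule lborel_pair.Fubini'[symmetric])
    have [measurable]: "cball 0 1 \<in> sets (borel :: (real ^ 'n) measure)" by simp
    have "(\<lambda>(s, x). indicator (cball 0 1) x * (ennreal (s ^ ?d * q s x) * indicator {0..} s)) \<in> borel_measurable (borel \<Otimes>\<^sub>M (borel :: (real ^ 'n) measure))"
      unfolding q_def by measurable
    then show "(\<lambda>(s, x). indicator (cball 0 1) x * (ennreal (s ^ ?d * q s x) * indicator {0..} s)) \<in> borel_measurable (lborel \<Otimes>\<^sub>M (lborel :: (real ^ 'n) measure))"
      by simp
  qed
  also have "\<dots> = (\<integral>\<^sup>+x. ennreal (fact ?d) * (indicator (cball 0 1) x * ennreal (g (sgn x) / h (sgn x) ^ ?d)) \<partial>lborel)"
  proof (rule nn_integral_cong_AE)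
    show "AE x in lborel. (\<integral>\<^sup>+s. indicator (cball 0 1) x * (ennreal (s ^ ?d * q s x) * indicator {0..} s) \<partial>lborel) =
        ennreal (fact ?d) * (indicator (cball 0 1) x * ennreal (g (sgn x) / h (sgn x) ^ ?d))"
      using AE0
    proof eventually_elim
      fix x :: "real ^ 'n" assume x: "x \<noteq> 0"
      define c where "c = h (sgn x)"
      have "(\<integral>\<^sup>+s. indicator (cball 0 1) x * (ennreal (s ^ ?d * q s x) * indicator {0..} s) \<partial>lborel) =
          (\<integral>\<^sup>+s. (indicator (cball 0 1) x * ennreal (g (sgn x) * c)) * (ennreal (s ^ ?d * exp (- (s * c))) * indicator {0..} s) \<partial>lborel)"
        using g0[of "sgn x"] h0[of "sgn x"]
        by (intro nn_integral_cong) (auto simp: q_def c_def indicator_def ennreal_mult'[symmetric] mult_ac)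
      also have "\<dots> = (indicator (cball 0 1) x * ennreal (g (sgn x) * c)) * (\<integral>\<^sup>+s. ennreal (s ^ ?d * exp (- (s * c))) * indicator {0..} s \<partial>lborel)"
        by (rule nn_integral_cmult) auto
      also have "\<dots> = ennreal (fact ?d) * (indicator (cball 0 1) x * ennreal (g (sgn x) / c ^ ?d))"
      proof (cases "c = 0")
        case True
        then have "g (sgn x) = 0" using zero[of "sgn x"] x by (simp add: c_def sgn_zero_iff)
        then show ?thesis by simp
      next
        case False
        then have c: "c > 0" using h0[of "sgn x"] by (simp add: c_def less_le)
        have "ennreal (g (sgn x) * c) * ennreal (fact ?d / c ^ Suc ?d) = ennreal (fact ?d) * ennreal (g (sgn x) / c ^ ?d)"
          using c g0[of "sgn x"] by (simp add: ennreal_mult'[symmetric] ennreal_mult[symmetric] field_simps)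
        then show ?thesis unfolding gamma[OF c] by (simp add: indicator_def)
      qed
      finally show "(\<integral>\<^sup>+s. indicator (cball 0 1) x * (ennreal (s ^ ?d * q s x) * indicator {0..} s) \<partial>lborel) =
        ennreal (fact ?d) * (indicator (cball 0 1) x * ennreal (g (sgn x) / h (sgn x) ^ ?d))" by (simp add: c_def)
    qed
  qed
  also have "\<dots> = ennreal (fact ?d) * (\<integral>\<^sup>+x. indicator (cball 0 1) x * ennreal (g (sgn x) / h (sgn x) ^ ?d) \<partial>lborel)"
  proof (rule nn_integral_cmult)
    have [measurable]: "cball 0 1 \<in> sets (borel :: (real ^ 'n) measure)" by simp
    show "(\<lambda>x. indicator (cball 0 1) x * ennreal (g (sgn x) / h (sgn x) ^ ?d)) \<in> borel_measurable lborel"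
      by measurable
  qed
  finally show ?thesis .
qed

section \<open>The intensity measure and the projection body\<close>

lemma measurable_vec_components:
  fixes f :: "'a \<Rightarrow> real ^ 'n"
  assumes "\<And>k. (\<lambda>x. f x $ k) \<in> borel_measurable A"
  shows "f \<in> borel_measurable A"
  unfolding borel_measurable_euclidean_space[of f]
  using assms by (auto simp: Basis_vec_def inner_axis)

lemma borel_measurable_det:
  fixes A :: "'a \<Rightarrow> real ^ 'n ^ 'n"
  assumes [measurable]: "\<And>i j. (\<lambda>x. A x $ i $ j) \<in> borel_measurable B"
  shows "(\<lambda>x. det (A x)) \<in> borel_measurable B"
  unfolding det_def by measurable

lemma abs_det_le_fact:
  fixes A :: "real ^ 'n ^ 'n"
  assumes "\<And>i j. \<bar>A $ i $ j\<bar> \<le> 1"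
  shows "\<bar>det A\<bar> \<le> fact CARD('n)"
proof -
  have "\<bar>det A\<bar> \<le> (\<Sum>p | p permutes (UNIV :: 'n set). \<bar>of_int (sign p) * (\<Prod>i\<in>UNIV. A $ i $ p i)\<bar>)"
    unfolding det_def by (rule sum_abs)
  also have "\<dots> \<le> (\<Sum>p | p permutes (UNIV :: 'n set). 1)"
  proof (rule sum_mono)
    fix p :: "'n \<Rightarrow> 'n"
    have "\<bar>\<Prod>i\<in>UNIV. A $ i $ p i\<bar> \<le> 1"
      unfolding abs_prod using assms by (intro prod_le_1) auto
    then show "\<bar>of_int (sign p) * (\<Prod>i\<in>UNIV. A $ i $ p i)\<bar> \<le> (1 :: real)"
      by (simp add: abs_mult sign_def)
  qed
  also have "\<dots> = fact CARD('n)" by (simp add: card_permutations)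
  finally show ?thesis .
qed

locale tessellation_body = convex_body K for K :: "(real ^ 'n) set" +
  assumes interior: "0 \<in> interior K"
begin

abbreviation "V \<equiv> measure lborel K"
abbreviation "S \<equiv> surface_area_measure K"
definition "T = scale_measure (ennreal (inverse V)) (restrict_space lborel {0::real<..})"
abbreviation "\<Lambda> \<equiv> tessellation_intensity K"
abbreviation "h \<equiv> proj_body_support K"

lemma V_pos: "0 < V"
proof -
  obtain r where r: "0 < r" "ball 0 r \<subseteq> K"
    using interior open_contains_ball[of "interior K"] interior_subset[of K] by (metis open_interior subset_trans)
  have "0 < measure lborel (ball (0 :: real ^ 'n) r)" by (rule content_ball_pos[OF r(1)])
  also have "\<dots> \<le> V"
    using r compact emeasure_bounded_finite[OF compact_imp_bounded[OF compact]]
    by (intro measure_mono_fmeasurable fmeasurableI) (auto intro: borel_compact)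
  finally show ?thesis .
qed

lemma sets_S [measurable_cong]: "sets S = sets (restrict_space borel (sphere 0 1))"
  by (rule sets_surface_area_measure)

lemma space_T: "space T = {0<..}"
  by (simp add: T_def space_scale_measure space_restrict_space)

lemma sets_T [measurable_cong]: "sets T = sets (restrict_space borel {0<..})"
  by (simp add: T_def sets_restrict_space)

lemma emeasure_T: "B \<in> sets borel \<Longrightarrow> B \<subseteq> {0<..} \<Longrightarrow> emeasure T B = ennreal (inverse V) * emeasure lborel B"
  by (simp add: T_def emeasure_restrict_space)

lemma sets_TD: "B \<in> sets T \<Longrightarrow> B \<in> sets borel" "B \<in> sets T \<Longrightarrow> B \<subseteq> {0<..}"
  by (auto simp: sets_T sets_restrict_space)

lemma borel_in_T: "B \<in> sets borel \<Longrightarrow> B \<subseteq> {0<..} \<Longrightarrow> B \<in> sets T"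
  by (auto simp: sets_T sets_restrict_space)

lemma finite_S: "finite_measure S"
  by (rule finite_surface_area_measure)

lemma sigma_finite_T: "sigma_finite_measure T"
proof
  show "\<exists>A. countable A \<and> A \<subseteq> sets T \<and> \<Union> A = space T \<and> (\<forall>a\<in>A. emeasure T a \<noteq> \<infinity>)"
  proof (intro exI conjI ballI)
    show "countable (range (\<lambda>n::nat. {0<..real n}))" by simp
    show "range (\<lambda>n::nat. {0<..real n}) \<subseteq> sets T" by (auto intro: borel_in_T)
    show "\<Union> (range (\<lambda>n::nat. {0<..real n})) = space T"
      unfolding space_T using real_arch_simple by auto
    fix a assume "a \<in> range (\<lambda>n::nat. {0<..real n})"
    then obtain n :: nat where a: "a = {0<..real n}" by auto
    have "emeasure T a = ennreal (inverse V) * ennreal (real n)"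
      unfolding a by (subst emeasure_T) auto
    then show "emeasure T a \<noteq> \<infinity>" by (simp add: ennreal_mult_eq_top_iff)
  qed
qed

lemma Lambda_eq: "\<Lambda> = T \<Otimes>\<^sub>M S"
  by (simp add: tessellation_intensity_def T_def)

lemma sets_Lambda [measurable_cong]: "sets \<Lambda> = sets (T \<Otimes>\<^sub>M S)"
  by (simp add: Lambda_eq)

lemma space_Lambda: "space \<Lambda> = {0<..} \<times> sphere 0 1"
  by (simp only: Lambda_eq space_pair_measure space_T space_surface_area_measure)

lemma fst_Lambda [measurable]: "fst \<in> borel_measurable \<Lambda>"
proof -
  have "(\<lambda>t. t) \<in> borel_measurable T"
    unfolding measurable_cong_sets[OF sets_T refl] by (rule measurable_restrict_space1) simp
  from measurable_compose[OF measurable_fst this] show ?thesis unfolding Lambda_eq .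
qed

lemma S_borel [measurable]: "(\<lambda>u. u) \<in> borel_measurable S"
  unfolding measurable_cong_sets[OF sets_S refl] by (rule measurable_restrict_space1) simp

lemma snd_Lambda [measurable]: "snd \<in> borel_measurable \<Lambda>"
  unfolding Lambda_eq using measurable_compose[OF measurable_snd S_borel] by simp

lemma inner_S [measurable]: "(\<lambda>u. q \<bullet> u) \<in> borel_measurable S"
  by measurable

lemma emeasure_Lambda_strip:
  fixes f g :: "real ^ 'n \<Rightarrow> real"
  assumes m: "{y \<in> space \<Lambda>. fst y \<in> I (snd y)} \<in> sets \<Lambda>" and I: "\<And>u. I u \<inter> {0<..} \<in> sets borel"
  shows "emeasure \<Lambda> {y \<in> space \<Lambda>. fst y \<in> I (snd y)} =
    (\<integral>\<^sup>+u. ennreal (inverse V) * emeasure lborel (I u \<inter> {0<..}) \<partial>S)"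
proof -
  interpret T: sigma_finite_measure T by (rule sigma_finite_T)
  interpret S: finite_measure S by (rule finite_S)
  interpret P: pair_sigma_finite T S ..
  have "emeasure \<Lambda> {y \<in> space \<Lambda>. fst y \<in> I (snd y)} =
      (\<integral>\<^sup>+u. emeasure T ((\<lambda>t. (t, u)) -` {y \<in> space \<Lambda>. fst y \<in> I (snd y)}) \<partial>S)"
    unfolding Lambda_eq by (rule P.emeasure_pair_measure_alt2) (use m in \<open>simp add: Lambda_eq\<close>)
  also have "\<dots> = (\<integral>\<^sup>+u. ennreal (inverse V) * emeasure lborel (I u \<inter> {0<..}) \<partial>S)"
  proof (intro nn_integral_cong)
    fix u assume "u \<in> space S"
    then have "(\<lambda>t. (t, u)) -` {y \<in> space \<Lambda>. fst y \<in> I (snd y)} = I u \<inter> {0<..}"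
      unfolding space_Lambda space_surface_area_measure by auto
    then show "emeasure T ((\<lambda>t. (t, u)) -` {y \<in> space \<Lambda>. fst y \<in> I (snd y)}) = ennreal (inverse V) * emeasure lborel (I u \<inter> {0<..})"
      using I by (simp only:) (rule emeasure_T, auto)
  qed
  finally show ?thesis .
qed

lemma abs_inner_unit_le: "norm (u :: real ^ 'n) = 1 \<Longrightarrow> \<bar>q \<bullet> u\<bar> \<le> norm q"
  using Cauchy_Schwarz_ineq2[of q u] by simp

lemma integrable_abs_inner: "integrable S (\<lambda>u. \<bar>q \<bullet> u\<bar>)"
  by (rule integrable_bounded_surface_area[of _ "norm q"]) (use abs_inner_unit_le in auto)

lemma integrable_inner: "integrable S (\<lambda>u. q \<bullet> u)"
  by (rule integrable_bounded_surface_area[of _ "norm q"]) (use abs_inner_unit_le in auto)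

text \<open>Positive and negative parts of \<open>\<langle>q, u\<rangle>\<close> have the same integral, because the centroid of the
  surface area measure is the origin.\<close>

lemma support_eq: "h q = (\<integral>u. max 0 (q \<bullet> u) \<partial>S)"
proof -
  have "(\<integral>u. max 0 (q \<bullet> u) \<partial>S) = (\<integral>u. 1/2 * \<bar>q \<bullet> u\<bar> + 1/2 * (q \<bullet> u) \<partial>S)"
    by (intro Bochner_Integration.integral_cong) auto
  also have "\<dots> = 1/2 * (\<integral>u. \<bar>q \<bullet> u\<bar> \<partial>S) + 1/2 * (\<integral>u. q \<bullet> u \<partial>S)"
    using integrable_abs_inner integrable_inner by simp
  also have "(\<integral>u. q \<bullet> u \<partial>S) = 0"
    using integral_surface_area_inner[of q] by (simp add: inner_commute)
  finally show ?thesis by (simp add: proj_body_support_def)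
qed

lemma support_nonneg: "0 \<le> h q"
  by (simp add: proj_body_support_def)

lemma support_scale: "0 < c \<Longrightarrow> h (c *\<^sub>R q) = c * h q"
  by (simp add: proj_body_support_def abs_mult)

lemma support_Lipschitz: "\<bar>h p - h q\<bar> \<le> measure S (space S) * norm (p - q)"
proof -
  interpret S: finite_measure S by (rule finite_S)
  have le: "h p - h q \<le> measure S (space S) * norm (p - q)" for p q
  proof -
    have "h p - h q = (\<integral>u. max 0 (p \<bullet> u) - max 0 (q \<bullet> u) \<partial>S)"
      unfolding support_eq
    proof (rule Bochner_Integration.integral_diff[symmetric])
      have int: "integrable S (\<lambda>u. max 0 (r \<bullet> u))" for r
        by (rule Bochner_Integration.integrable_bound[OF integrable_abs_inner[of r]]) auto
      show "integrable S (\<lambda>u. max 0 (p \<bullet> u))" "integrable S (\<lambda>u. max 0 (q \<bullet> u))" by (rule int)+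
    qed
    also have "\<dots> \<le> (\<integral>u. norm (p - q) \<partial>S)"
    proof (rule integral_mono_AE')
      show "AE u in S. max 0 (p \<bullet> u) - max 0 (q \<bullet> u) \<le> norm (p - q)"
      proof (rule AE_I2)
        fix u assume "u \<in> space S"
        then have "norm u = 1" by (simp add: space_surface_area_measure)
        then have "\<bar>(p - q) \<bullet> u\<bar> \<le> norm (p - q)" using Cauchy_Schwarz_ineq2[of "p - q" u] by simp
        then show "max 0 (p \<bullet> u) - max 0 (q \<bullet> u) \<le> norm (p - q)" by (auto simp: inner_diff_left max_def)
      qed
    qed auto
    also have "\<dots> = measure S (space S) * norm (p - q)" by simp
    finally show ?thesis .
  qed
  show ?thesis using le[of p q] le[of q p] by (simp add: norm_minus_commute abs_le_iff)
qed

lemma support_continuous: "continuous_on UNIV h"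
  by (rule lipschitz_on_continuous_on[of "measure S (space S)"], rule lipschitz_onI)
    (auto simp: dist_norm support_Lipschitz)

lemma support_measurable [measurable]: "h \<in> borel_measurable borel"
  by (rule borel_measurable_continuous_onI[OF support_continuous])

text \<open>A hyperplane with normal \<open>u\<close> separates \<open>q\<close> from the origin exactly if its distance lies
  strictly between \<open>0\<close> and \<open>\<langle>q, u\<rangle>\<close>, in an interval of length \<open>max 0 \<langle>q, u\<rangle>\<close>.\<close>

lemma emeasure_separating:
  "emeasure \<Lambda> {y \<in> space \<Lambda>. 0 < q \<bullet> snd y - fst y} = ennreal (h q / V)"
proof -
  have "emeasure \<Lambda> {y \<in> space \<Lambda>. fst y \<in> {..<q \<bullet> snd y}} = (\<integral>\<^sup>+u. ennreal (inverse V) * emeasure lborel ({..<q \<bullet> u} \<inter> {0<..}) \<partial>S)"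
  proof (rule emeasure_Lambda_strip)
    have "{y \<in> space \<Lambda>. fst y < q \<bullet> snd y} \<in> sets \<Lambda>" by measurable
    then show "{y \<in> space \<Lambda>. fst y \<in> {..<q \<bullet> snd y}} \<in> sets \<Lambda>" by simp
  qed simp
  also have "\<dots> = (\<integral>\<^sup>+u. ennreal (inverse V * max 0 (q \<bullet> u)) \<partial>S)"
  proof (intro nn_integral_cong)
    fix u :: "real ^ 'n"
    have "{..<q \<bullet> u} \<inter> {0<..} = {0<..<q \<bullet> u}" by auto
    then have "emeasure lborel ({..<q \<bullet> u} \<inter> {0<..}) = ennreal (max 0 (q \<bullet> u))"
      by (cases "0 \<le> q \<bullet> u") (auto simp: max_def)
    then show "ennreal (inverse V) * emeasure lborel ({..<q \<bullet> u} \<inter> {0<..}) = ennreal (inverse V * max 0 (q \<bullet> u))"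
      using V_pos by (simp add: ennreal_mult')
  qed
  also have "\<dots> = ennreal (\<integral>u. inverse V * max 0 (q \<bullet> u) \<partial>S)"
  proof (rule nn_integral_eq_integral)
    show "integrable S (\<lambda>u. inverse V * max 0 (q \<bullet> u))"
      by (intro integrable_mult_right Bochner_Integration.integrable_bound[OF integrable_abs_inner[of q]]) auto
  qed (use V_pos in auto)
  also have "\<dots> = ennreal (h q / V)" by (simp add: support_eq divide_inverse mult.commute)
  finally show ?thesis by (simp add: algebra_simps)
qed

lemma emeasure_through_null: "emeasure \<Lambda> {y \<in> space \<Lambda>. q \<bullet> snd y = fst y} = 0"
proof -
  have "emeasure \<Lambda> {y \<in> space \<Lambda>. fst y \<in> {q \<bullet> snd y}} = (\<integral>\<^sup>+u. ennreal (inverse V) * emeasure lborel ({q \<bullet> u} \<inter> {0<..}) \<partial>S)"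
  proof (rule emeasure_Lambda_strip)
    have "{y \<in> space \<Lambda>. fst y = q \<bullet> snd y} \<in> sets \<Lambda>" by measurable
    then show "{y \<in> space \<Lambda>. fst y \<in> {q \<bullet> snd y}} \<in> sets \<Lambda>" by simp
  qed simp
  also have "\<dots> = (\<integral>\<^sup>+u. 0 \<partial>S)"
  proof (intro nn_integral_cong)
    fix u :: "real ^ 'n"
    have "emeasure lborel ({q \<bullet> u} \<inter> {0<..}) \<le> emeasure lborel {q \<bullet> u}" by (intro emeasure_mono) auto
    then show "ennreal (inverse V) * emeasure lborel ({q \<bullet> u} \<inter> {0<..}) = 0" by simp
  qed
  finally have "emeasure \<Lambda> {y \<in> space \<Lambda>. fst y \<in> {q \<bullet> snd y}} = 0" by simp
  moreover have "{y \<in> space \<Lambda>. q \<bullet> snd y = fst y} = {y \<in> space \<Lambda>. fst y \<in> {q \<bullet> snd y}}" by auto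
  ultimately show ?thesis by simp
qed

lemma emeasure_slice_le:
  assumes "a \<le> b"
  shows "emeasure \<Lambda> {y \<in> space \<Lambda>. a < fst y \<and> fst y \<le> b} \<le> ennreal (measure S (space S) / V * (b - a))"
proof -
  interpret S: finite_measure S by (rule finite_S)
  have "emeasure \<Lambda> {y \<in> space \<Lambda>. fst y \<in> {a<..b}} = (\<integral>\<^sup>+u. ennreal (inverse V) * emeasure lborel ({a<..b} \<inter> {0<..}) \<partial>S)"
  proof (rule emeasure_Lambda_strip)
    have "{y \<in> space \<Lambda>. a < fst y \<and> fst y \<le> b} \<in> sets \<Lambda>" by measurable
    then show "{y \<in> space \<Lambda>. fst y \<in> {a<..b}} \<in> sets \<Lambda>" by simp
  qed simp
  also have "\<dots> \<le> (\<integral>\<^sup>+u. ennreal (inverse V) * ennreal (b - a) \<partial>S)"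
  proof (intro nn_integral_mono mult_left_mono)
    have "emeasure lborel ({a<..b} \<inter> {0<..}) \<le> emeasure lborel {a<..b}" by (intro emeasure_mono) auto
    then show "emeasure lborel ({a<..b} \<inter> {0<..}) \<le> ennreal (b - a)" using assms by simp
  qed auto
  also have "\<dots> = ennreal (inverse V) * ennreal (b - a) * ennreal (measure S (space S))"
    by (simp add: S.emeasure_eq_measure)
  also have "\<dots> = ennreal (measure S (space S) / V * (b - a))"
    using assms V_pos by (simp add: ennreal_mult'[symmetric] ennreal_mult''[symmetric] divide_inverse mult_ac)
  finally show ?thesis by simp
qed

end

section \<open>Integration over tuples of hyperplanes\<close>

context tessellation_body
begin

abbreviation "S_power \<equiv> (\<Pi>\<^sub>M k\<in>(UNIV :: 'n set). S)"
abbreviation "L_power \<equiv> (\<Pi>\<^sub>M k\<in>(UNIV :: 'n set). \<Lambda>)"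
abbreviation "positive_orthant \<equiv> {t :: real ^ 'n. \<forall>k. 0 < t $ k}"

lemma product_sigma_finite_S: "product_sigma_finite (\<lambda>_. S)"
  using finite_S by (simp add: product_sigma_finite_def finite_measure.axioms(1))

lemma sigma_finite_Lambda: "sigma_finite_measure \<Lambda>"
proof -
  interpret T: sigma_finite_measure T by (rule sigma_finite_T)
  interpret S: finite_measure S by (rule finite_S)
  interpret P: pair_sigma_finite T S ..
  show ?thesis unfolding Lambda_eq by (rule P.sigma_finite_measure_axioms)
qed

lemma finite_S_power: "finite_measure S_power"
proof
  interpret S: finite_measure S by (rule finite_S)
  interpret PS: product_sigma_finite "\<lambda>_::'n. S" by (rule product_sigma_finite_S)
  have "emeasure S_power (\<Pi>\<^sub>E k\<in>UNIV. space S) = (\<Prod>k\<in>(UNIV :: 'n set). emeasure S (space S))"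
    by (rule PS.emeasure_PiM) auto
  moreover have "(\<Prod>k\<in>(UNIV :: 'n set). emeasure S (space S)) \<noteq> \<infinity>"
    using S.emeasure_finite by (simp add: ennreal_prod_eq_top power_eq_top_ennreal)
  ultimately show "emeasure S_power (space S_power) \<noteq> \<infinity>" by (simp add: space_PiM)
qed

lemma orthant_borel [measurable]: "positive_orthant \<in> sets borel"
  by measurable

text \<open>The \<open>d\<close>-th power of the intensity measure in coordinates that separate directions and
  distances. The two sides are compared on boxes, where both factor.\<close>

lemma nn_integral_L_power:
  assumes g [measurable]: "g \<in> borel_measurable L_power"
  shows "(\<integral>\<^sup>+x. g x \<partial>L_power) = ennreal (inverse V ^ CARD('n)) *
    (\<integral>\<^sup>+u. (\<integral>\<^sup>+t. g (\<lambda>k. (t $ k, u k)) * indicator positive_orthant t \<partial>lborel) \<partial>S_power)"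
proof -
  interpret S: finite_measure S by (rule finite_S)
  interpret PS: product_sigma_finite "\<lambda>_::'n. S" by (rule product_sigma_finite_S)
  interpret PL: product_sigma_finite "\<lambda>_::'n. \<Lambda>"
    using sigma_finite_Lambda by (simp add: product_sigma_finite_def)
  define W where "W = restrict_space lborel positive_orthant"
  have spW: "space W = positive_orthant" by (simp add: W_def space_restrict_space)
  have sW: "sets W = sets (restrict_space borel positive_orthant)"
    unfolding W_def by (simp add: sets_restrict_space)
  interpret W: sigma_finite_measure W
    unfolding W_def by (rule sigma_finite_measure_restrict_space) (auto intro: lborel.sigma_finite_measure_axioms)
  define j where "j z = (\<lambda>k. (snd z $ k, fst z k))" for z :: "('n \<Rightarrow> real ^ 'n) \<times> (real ^ 'n)"
  have jm [measurable]: "j \<in> S_power \<Otimes>\<^sub>M W \<rightarrow>\<^sub>M L_power"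
  proof (rule measurable_PiM_single')
    fix k :: 'n
    have 1: "(\<lambda>t. t $ k) \<in> W \<rightarrow>\<^sub>M T"
      unfolding measurable_cong_sets[OF sW sets_T]
      by (rule measurable_restrict_space3) auto
    have "(\<lambda>z. (snd z $ k, fst z k)) \<in> S_power \<Otimes>\<^sub>M W \<rightarrow>\<^sub>M T \<Otimes>\<^sub>M S"
      by (intro measurable_Pair measurable_compose[OF measurable_snd 1] measurable_compose[OF measurable_fst measurable_component_singleton]) auto
    then show "(\<lambda>z. j z k) \<in> S_power \<Otimes>\<^sub>M W \<rightarrow>\<^sub>M \<Lambda>" by (simp add: j_def Lambda_eq)
  qed (auto simp: PiE_UNIV_domain j_def space_pair_measure spW space_PiM space_Lambda space_surface_area_measure)
  define Q where "Q = scale_measure (ennreal (inverse V ^ CARD('n))) (distr (S_power \<Otimes>\<^sub>M W) L_power j)"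
  have "Q = L_power"
  proof (rule PL.PiM_eqI)
    show "sets Q = sets L_power" by (simp add: Q_def)
    fix A assume A: "\<And>k. k \<in> (UNIV :: 'n set) \<Longrightarrow> A k \<in> sets \<Lambda>"
    have AS: "A k \<subseteq> {0<..} \<times> sphere 0 1" for k
      using sets.sets_into_space[OF A[of k]] by (simp add: space_Lambda)
    have slice: "(\<lambda>t. (t, v)) -` A k \<in> sets T" for v k
      using sets_Pair2[of "A k" T S v] A[of k] by (simp add: Lambda_eq)
    have slice_b: "(\<lambda>t. (t, v)) -` A k \<in> sets borel" for v k using slice sets_TD(1) by blast
    have PA: "(\<Pi>\<^sub>E k\<in>UNIV. A k) \<in> sets L_power" using A by (intro sets_PiM_I_finite) auto
    have jA: "j -` (\<Pi>\<^sub>E k\<in>UNIV. A k) \<inter> space (S_power \<Otimes>\<^sub>M W) \<in> sets (S_power \<Otimes>\<^sub>M W)"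
      using jm PA by (rule measurable_sets)
    have emS: "(\<lambda>v. ennreal (inverse V) * emeasure lborel ((\<lambda>t. (t, v)) -` A k)) \<in> borel_measurable S" for k
    proof -
      interpret T: sigma_finite_measure T by (rule sigma_finite_T)
      interpret P: pair_sigma_finite T S ..
      have "(\<lambda>v. emeasure T ((\<lambda>t. (t, v)) -` A k)) \<in> borel_measurable S"
        by (rule P.measurable_emeasure_Pair2) (use A in \<open>simp add: Lambda_eq\<close>)
      moreover have "emeasure T ((\<lambda>t. (t, v)) -` A k) = ennreal (inverse V) * emeasure lborel ((\<lambda>t. (t, v)) -` A k)" for v
        using slice sets_TD by (intro emeasure_T) blast+
      ultimately show ?thesis by simp
    qed
    have emA: "emeasure \<Lambda> (A k) = (\<integral>\<^sup>+v. ennreal (inverse V) * emeasure lborel ((\<lambda>t. (t, v)) -` A k) \<partial>S)" for k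
    proof -
      interpret T: sigma_finite_measure T by (rule sigma_finite_T)
      interpret P: pair_sigma_finite T S ..
      have "emeasure \<Lambda> (A k) = (\<integral>\<^sup>+v. emeasure T ((\<lambda>t. (t, v)) -` A k) \<partial>S)"
        unfolding Lambda_eq by (rule P.emeasure_pair_measure_alt2) (use A in \<open>simp add: Lambda_eq\<close>)
      also have "\<dots> = (\<integral>\<^sup>+v. ennreal (inverse V) * emeasure lborel ((\<lambda>t. (t, v)) -` A k) \<partial>S)"
        using slice sets_TD by (intro nn_integral_cong emeasure_T) blast+
      finally show ?thesis .
    qed
    have "emeasure Q (\<Pi>\<^sub>E k\<in>UNIV. A k) = ennreal (inverse V ^ CARD('n)) * emeasure (S_power \<Otimes>\<^sub>M W) (j -` (\<Pi>\<^sub>E k\<in>UNIV. A k) \<inter> space (S_power \<Otimes>\<^sub>M W))"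
      unfolding Q_def emeasure_scale_measure using PA jm by (subst emeasure_distr) auto
    also have "emeasure (S_power \<Otimes>\<^sub>M W) (j -` (\<Pi>\<^sub>E k\<in>UNIV. A k) \<inter> space (S_power \<Otimes>\<^sub>M W)) =
        (\<integral>\<^sup>+u. emeasure W (Pair u -` (j -` (\<Pi>\<^sub>E k\<in>UNIV. A k) \<inter> space (S_power \<Otimes>\<^sub>M W))) \<partial>S_power)"
      by (rule W.emeasure_pair_measure_alt[OF jA])
    also have "\<dots> = (\<integral>\<^sup>+u. (\<Prod>k\<in>UNIV. emeasure lborel ((\<lambda>t. (t, u k)) -` A k)) \<partial>S_power)"
    proof (intro nn_integral_cong)
      fix u assume u: "u \<in> space S_power"
      have "Pair u -` (j -` (\<Pi>\<^sub>E k\<in>UNIV. A k) \<inter> space (S_power \<Otimes>\<^sub>M W)) = {t. \<forall>k. t $ k \<in> (\<lambda>t. (t, u k)) -` A k}"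
        using u AS by (fastforce simp: j_def space_pair_measure spW PiE_UNIV_domain)
      moreover have "emeasure W {t. \<forall>k. t $ k \<in> (\<lambda>t. (t, u k)) -` A k} = emeasure lborel {t. \<forall>k. t $ k \<in> (\<lambda>t. (t, u k)) -` A k}"
        unfolding W_def using AS by (intro emeasure_restrict_space) fastforce+
      ultimately show "emeasure W (Pair u -` (j -` (\<Pi>\<^sub>E k\<in>UNIV. A k) \<inter> space (S_power \<Otimes>\<^sub>M W))) = (\<Prod>k\<in>UNIV. emeasure lborel ((\<lambda>t. (t, u k)) -` A k))"
        using emeasure_lborel_vec_box[of "\<lambda>k. (\<lambda>t. (t, u k)) -` A k"] slice_b by simp
    qed
    also have "ennreal (inverse V ^ CARD('n)) * \<dots> = (\<integral>\<^sup>+u. ennreal (inverse V ^ CARD('n)) * (\<Prod>k\<in>UNIV. emeasure lborel ((\<lambda>t. (t, u k)) -` A k)) \<partial>S_power)"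
    proof (rule nn_integral_cmult[symmetric])
      have em1: "(\<lambda>v. emeasure lborel ((\<lambda>t. (t, v)) -` A k)) \<in> borel_measurable S" for k
      proof -
        note emS [measurable]
        have "(\<lambda>v. ennreal V * (ennreal (inverse V) * emeasure lborel ((\<lambda>t. (t, v)) -` A k))) \<in> borel_measurable S"
          by measurable
        moreover have "ennreal V * ennreal (inverse V) = 1" using V_pos by (simp add: ennreal_mult'[symmetric])
        ultimately show ?thesis by (simp add: mult.assoc[symmetric])
      qed
      show "(\<lambda>u. \<Prod>k\<in>UNIV. emeasure lborel ((\<lambda>t. (t, u k)) -` A k)) \<in> borel_measurable S_power"
        by (intro borel_measurable_prod_ennreal
            measurable_compose[OF measurable_component_singleton[of _ UNIV "\<lambda>_. S", OF UNIV_I] em1])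
    qed
    also have "\<dots> = (\<integral>\<^sup>+u. (\<Prod>k\<in>UNIV. ennreal (inverse V) * emeasure lborel ((\<lambda>t. (t, u k)) -` A k)) \<partial>S_power)"
      using V_pos by (intro nn_integral_cong) (simp add: prod.distrib ennreal_power)
    also have "\<dots> = (\<Prod>k\<in>UNIV. emeasure \<Lambda> (A k))"
      unfolding emA using emS by (intro PS.product_nn_integral_prod) auto
    finally show "emeasure Q (\<Pi>\<^sub>E k\<in>UNIV. A k) = (\<Prod>k\<in>UNIV. emeasure \<Lambda> (A k))" .
  qed simp
  then have "(\<integral>\<^sup>+x. g x \<partial>L_power) = (\<integral>\<^sup>+x. g x \<partial>Q)" by simp
  also have "\<dots> = ennreal (inverse V ^ CARD('n)) * (\<integral>\<^sup>+x. g x \<partial>distr (S_power \<Otimes>\<^sub>M W) L_power j)"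
    unfolding Q_def by (rule nn_integral_scale_measure) simp
  also have "(\<integral>\<^sup>+x. g x \<partial>distr (S_power \<Otimes>\<^sub>M W) L_power j) = (\<integral>\<^sup>+z. g (j z) \<partial>(S_power \<Otimes>\<^sub>M W))"
    by (rule nn_integral_distr) (auto intro: jm g)
  also have "\<dots> = (\<integral>\<^sup>+u. (\<integral>\<^sup>+t. g (j (u, t)) \<partial>W) \<partial>S_power)"
    by (rule W.nn_integral_fst[symmetric]) (rule measurable_compose[OF jm g])
  also have "\<dots> = (\<integral>\<^sup>+u. (\<integral>\<^sup>+t. g (\<lambda>k. (t $ k, u k)) * indicator positive_orthant t \<partial>lborel) \<partial>S_power)"
    unfolding W_def j_def by (intro nn_integral_cong, subst nn_integral_restrict_space) auto
  finally show ?thesis .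
qed

abbreviation dirs :: "('n \<Rightarrow> real ^ 'n) \<Rightarrow> real ^ 'n ^ 'n" where
  "dirs u \<equiv> (\<chi> i. u i)"

lemma S_power_unit: "u \<in> space S_power \<Longrightarrow> norm (u k) = 1"
  by (auto simp: space_PiM space_surface_area_measure PiE_UNIV_domain Pi_iff)

lemma S_power_component [measurable]: "(\<lambda>u. u k) \<in> borel_measurable S_power"
  by (rule measurable_compose[OF measurable_component_singleton[of k UNIV "\<lambda>_. S", OF UNIV_I] S_borel])

lemma vec_nth_borel: "(\<lambda>v :: real ^ 'n. v $ k) \<in> borel_measurable borel"
  by (intro borel_measurable_continuous_onI continuous_intros)

lemma det_dirs_measurable [measurable]: "(\<lambda>u. det (dirs u)) \<in> borel_measurable S_power"
  by (rule borel_measurable_det)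
    (simp only: vec_lambda_beta, rule measurable_compose[OF S_power_component vec_nth_borel])

lemma det_dirs_le: "u \<in> space S_power \<Longrightarrow> \<bar>det (dirs u)\<bar> \<le> fact CARD('n)"
proof (rule abs_det_le_fact)
  fix i j assume "u \<in> space S_power"
  then show "\<bar>dirs u $ i $ j\<bar> \<le> 1" using component_le_norm_cart[of "u i" j] S_power_unit by simp
qed

definition j_integrand :: "real ^ 'n \<Rightarrow> ('n \<Rightarrow> real ^ 'n) \<Rightarrow> real" where
  "j_integrand x u = \<bar>det (dirs u)\<bar> * indicator {u. \<forall>k. 0 \<le> u k \<bullet> x} u"

lemma J_eq: "J K x = (\<integral>u. j_integrand x u \<partial>S_power)"
  unfolding J_def j_integrand_def parallelepiped_volume_eq ..

lemma j_integrand_measurable [measurable]: "(\<lambda>(x, u). j_integrand x u) \<in> borel_measurable (borel \<Otimes>\<^sub>M S_power)"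
proof -
  have "(\<lambda>z. \<bar>det (dirs (snd z))\<bar> * (if \<forall>k. 0 \<le> snd z k \<bullet> fst z then 1 else 0)) \<in> borel_measurable (borel \<Otimes>\<^sub>M S_power)"
    by measurable
  then show ?thesis by (simp add: j_integrand_def indicator_def split_beta)
qed

lemma j_integrand_measurable2 [measurable]: "j_integrand x \<in> borel_measurable S_power"
  using measurable_compose[OF measurable_Pair1'[of x borel S_power] j_integrand_measurable] by simp

lemma j_integrand_bounds: "0 \<le> j_integrand x u" "u \<in> space S_power \<Longrightarrow> j_integrand x u \<le> fact CARD('n)"
  using det_dirs_le[of u] by (auto simp: j_integrand_def indicator_def)

lemma integrable_j_integrand: "integrable S_power (j_integrand x)"
proof -
  interpret finite_measure S_power by (rule finite_S_power)
  show ?thesis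
    using j_integrand_bounds by (intro integrable_const_bound[of _ "fact CARD('n)"] AE_I2) auto
qed

lemma nn_integral_j_integrand: "(\<integral>\<^sup>+u. ennreal (j_integrand x u) \<partial>S_power) = ennreal (J K x)"
  unfolding J_eq using integrable_j_integrand j_integrand_bounds by (intro nn_integral_eq_integral AE_I2) auto

lemma J_nonneg: "0 \<le> J K x"
  unfolding J_eq using j_integrand_bounds by (intro Bochner_Integration.integral_nonneg) auto

lemma J_le: "J K x \<le> fact CARD('n) * measure S_power (space S_power)"
proof -
  interpret finite_measure S_power by (rule finite_S_power)
  have "J K x \<le> (\<integral>u. fact CARD('n) \<partial>S_power)"
    unfolding J_eq using integrable_j_integrand j_integrand_bounds by (intro integral_mono_AE AE_I2) auto
  then show ?thesis by (simp add: mult.commute)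
qed

lemma J_scale: "0 < c \<Longrightarrow> J K (c *\<^sub>R x) = J K x"
  unfolding J_eq j_integrand_def by (simp add: zero_le_mult_iff indicator_def)

lemma J_measurable [measurable]: "J K \<in> borel_measurable borel"
proof -
  interpret finite_measure S_power by (rule finite_S_power)
  show ?thesis unfolding J_eq[abs_def] by measurable
qed

text \<open>If \<open>h y = 0\<close>, the surface area measure is concentrated on directions orthogonal to \<open>y\<close>, and
  such directions span no volume.\<close>

lemma J_eq_0:
  assumes y: "y \<noteq> 0" and hy: "h y = 0"
  shows "J K x = 0"
proof -
  interpret S: finite_measure S by (rule finite_S)
  interpret PS: product_sigma_finite "\<lambda>_::'n. S" by (rule product_sigma_finite_S)
  let ?Z = "{u \<in> space S. y \<bullet> u \<noteq> 0}"
  have Zm: "?Z \<in> sets S" by measurable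
  have "(\<integral>u. \<bar>y \<bullet> u\<bar> \<partial>S) = 0" using hy by (simp add: proj_body_support_def)
  then have "AE u in S. \<bar>y \<bullet> u\<bar> = 0"
    using integral_nonneg_eq_0_iff_AE[OF integrable_abs_inner[of y]] by simp
  then have Z0: "emeasure S ?Z = 0"
    by (subst (asm) AE_iff_measurable[OF Zm]) auto
  define C where "C k = (\<Pi>\<^sub>E i\<in>(UNIV :: 'n set). if i = k then ?Z else space S)" for k
  have C0: "C k \<in> null_sets S_power" for k
  proof (rule null_setsI)
    show "C k \<in> sets S_power" unfolding C_def using Zm by (intro sets_PiM_I_finite) auto
    have "emeasure S_power (C k) = (\<Prod>i\<in>(UNIV :: 'n set). emeasure S (if i = k then ?Z else space S))"
      unfolding C_def using Zm by (intro PS.emeasure_PiM) auto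
    also have "\<dots> = 0" using Z0 by (intro prod_zero bexI[of _ k]) auto
    finally show "emeasure S_power (C k) = 0" .
  qed
  then have "(\<Union>k. C k) \<in> null_sets S_power" by (intro null_sets.finite_UN) auto
  then have "AE u in S_power. j_integrand x u = 0"
  proof (rule AE_I')
    show "{u \<in> space S_power. j_integrand x u \<noteq> 0} \<subseteq> (\<Union>k. C k)"
    proof
      fix u assume "u \<in> {u \<in> space S_power. j_integrand x u \<noteq> 0}"
      then have u: "u \<in> space S_power" and d: "det (dirs u) \<noteq> 0" by (auto simp: j_integrand_def)
      have "inj ((*v) (dirs u))" using d by (simp add: inj_matrix_vector_mult invertible_det_nz)
      then have "dirs u *v y \<noteq> 0" using y by (metis injD matrix_vector_mult_0_right)
      then obtain k where "(dirs u *v y) $ k \<noteq> 0" by (auto simp: vec_eq_iff)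
      then have "y \<bullet> u k \<noteq> 0" by (simp add: matrix_vector_mult_def inner_vec_def mult.commute)
      then have "u \<in> C k"
        using u by (auto simp: C_def space_PiM PiE_UNIV_domain Pi_iff)
      then show "u \<in> (\<Union>k. C k)" by blast
    qed
  qed
  then have "J K x = (\<integral>u. 0 \<partial>S_power)"
    unfolding J_eq by (intro integral_cong_AE) auto
  then show ?thesis by simp
qed

definition independent_tuples :: "('n \<Rightarrow> real \<times> (real ^ 'n)) set" where
  "independent_tuples = {x \<in> space L_power. det (normals x) \<noteq> 0}"

lemma L_power_components [measurable]:
  "(\<lambda>x. fst (x k)) \<in> borel_measurable L_power" "(\<lambda>x. snd (x k)) \<in> borel_measurable L_power"
  by (rule measurable_compose[OF measurable_component_singleton[of k UNIV "\<lambda>_. \<Lambda>", OF UNIV_I] fst_Lambda],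
      rule measurable_compose[OF measurable_component_singleton[of k UNIV "\<lambda>_. \<Lambda>", OF UNIV_I] snd_Lambda])

lemma det_normals_measurable [measurable]: "(\<lambda>x. det (normals x)) \<in> borel_measurable L_power"
  unfolding normals_def by (rule borel_measurable_det)
    (simp only: vec_lambda_beta, rule measurable_compose[OF L_power_components(2) vec_nth_borel])

lemma independent_tuples_sets [measurable]: "independent_tuples \<in> sets L_power"
  unfolding independent_tuples_def by measurable

lemma meet_measurable [measurable]: "meet \<in> borel_measurable L_power"
proof (rule measurable_vec_components)
  fix k
  have "(\<lambda>x. det (\<chi> i j. if j = k then fst (x i) else snd (x i) $ j)) \<in> borel_measurable L_power"
  proof (rule borel_measurable_det)
    fix i j
    show "(\<lambda>x. (\<chi> i j. if j = k then fst (x i) else snd (x i) $ j) $ i $ j) \<in> borel_measurable L_power"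
      using measurable_compose[OF L_power_components(2)[of i] vec_nth_borel[of j]] by (cases "j = k") simp_all
  qed
  then show "(\<lambda>x. meet x $ k) \<in> borel_measurable L_power" unfolding meet_def by simp
qed

text \<open>The distances \<open>t\<close> of the hyperplanes with normals \<open>u\<close> are replaced by their common point \<open>p\<close>;
  the volume spanned by \<open>u\<close> is the Jacobian determinant. Positive distances mean that \<open>p\<close> has
  positive inner product with all normals, and equality is a null event.\<close>

lemma nn_integral_distances:
  assumes u: "u \<in> space S_power" and f [measurable]: "f \<in> borel_measurable borel"
  shows "(\<integral>\<^sup>+t. indicator independent_tuples (\<lambda>k. (t $ k, u k)) * f (meet (\<lambda>k. (t $ k, u k))) * indicator positive_orthant t \<partial>lborel)
      = (\<integral>\<^sup>+p. ennreal (j_integrand p u) * f p \<partial>lborel)"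
proof (cases "det (dirs u) = 0")
  case True
  then show ?thesis by (simp add: independent_tuples_def normals_def j_integrand_def)
next
  case False
  have nrm: "normals (\<lambda>k. (t $ k, u k)) = dirs u" for t :: "real ^ 'n" by (simp add: normals_def)
  have mv: "(dirs u *v p) $ k = u k \<bullet> p" for p k
    by (simp add: matrix_vector_mult_def inner_vec_def)
  have meet_mv: "meet (\<lambda>k. ((dirs u *v p) $ k, u k)) = p" for p
  proof -
    have "det (normals (\<lambda>k. ((dirs u *v p) $ k, u k))) \<noteq> 0" unfolding nrm by (rule False)
    from meet_iff[OF this, of p] show ?thesis by (simp add: mv inner_commute)
  qed
  define F where "F t = f (meet (\<lambda>k. (t $ k, u k))) * indicator positive_orthant t" for t :: "real ^ 'n"
  have "(\<lambda>t :: real ^ 'n. meet (\<lambda>k. (t $ k, u k))) \<in> borel_measurable borel"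
  proof (rule measurable_vec_components)
    fix k
    have "(\<lambda>t :: real ^ 'n. det (\<chi> i j. if j = k then fst (t $ i, u i) else snd (t $ i, u i) $ j)) \<in> borel_measurable borel"
      by (rule borel_measurable_det) (simp only: vec_lambda_beta fst_conv snd_conv, measurable)
    then show "(\<lambda>t :: real ^ 'n. meet (\<lambda>k. (t $ k, u k)) $ k) \<in> borel_measurable borel"
      unfolding meet_def nrm vec_lambda_beta by (rule borel_measurable_divide) simp
  qed
  from measurable_compose[OF this f] have Fm: "F \<in> borel_measurable borel" unfolding F_def by simp
  have "(\<integral>\<^sup>+t. indicator independent_tuples (\<lambda>k. (t $ k, u k)) * f (meet (\<lambda>k. (t $ k, u k))) * indicator positive_orthant t \<partial>lborel) = (\<integral>\<^sup>+t. F t \<partial>lborel)"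
  proof (intro nn_integral_cong)
    fix t :: "real ^ 'n"
    have "(\<lambda>k. (t $ k, u k)) \<in> independent_tuples" if "t \<in> positive_orthant"
      using that S_power_unit[OF u] False
      by (simp add: independent_tuples_def nrm space_PiM space_Lambda PiE_UNIV_domain Pi_iff)
    then show "indicator independent_tuples (\<lambda>k. (t $ k, u k)) * f (meet (\<lambda>k. (t $ k, u k))) * indicator positive_orthant t = F t"
      by (cases "t \<in> positive_orthant") (simp_all add: F_def)
  qed
  also have "\<dots> = ennreal \<bar>det (dirs u)\<bar> * (\<integral>\<^sup>+p. F (dirs u *v p) \<partial>lborel)"
    by (rule nn_integral_lborel_matrix[OF False Fm])
  also have "\<dots> = (\<integral>\<^sup>+p. ennreal \<bar>det (dirs u)\<bar> * F (dirs u *v p) \<partial>lborel)"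
  proof (rule nn_integral_cmult[symmetric])
    have "(*v) (dirs u) \<in> borel_measurable borel"
      by (intro borel_measurable_continuous_onI matrix_vector_mult_linear_continuous_on)
    from measurable_compose[OF this Fm] show "(\<lambda>p. F (dirs u *v p)) \<in> borel_measurable lborel" by simp
  qed
  also have "\<dots> = (\<integral>\<^sup>+p. ennreal (j_integrand p u) * f p \<partial>lborel)"
  proof (rule nn_integral_cong_AE)
    have "AE p in lborel. \<forall>k. u k \<bullet> p \<noteq> 0"
    proof -
      have "AE p in lborel. u k \<bullet> p \<noteq> 0" for k
      proof -
        have "u k \<noteq> 0" using S_power_unit[OF u, of k] by auto
        then have "negligible {p. u k \<bullet> p = 0}" by (intro negligible_hyperplane) simp
        moreover have "{p. u k \<bullet> p = 0} \<in> sets borel" by (intro borel_closed closed_hyperplane)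
        ultimately have "{p. u k \<bullet> p = 0} \<in> null_sets lborel"
          by (simp add: negligible_iff_null_sets null_sets_completion_iff)
        then show ?thesis by (rule AE_I') auto
      qed
      then show ?thesis by (simp add: AE_all_countable)
    qed
    then show "AE p in lborel. ennreal \<bar>det (dirs u)\<bar> * F (dirs u *v p) = ennreal (j_integrand p u) * f p"
    proof eventually_elim
      fix p assume p: "\<forall>k. u k \<bullet> p \<noteq> 0"
      have "dirs u *v p \<in> positive_orthant \<longleftrightarrow> (\<forall>k. 0 \<le> u k \<bullet> p)"
        using p by (auto simp: mv less_le)
      then show "ennreal \<bar>det (dirs u)\<bar> * F (dirs u *v p) = ennreal (j_integrand p u) * f p"
        unfolding F_def meet_mv j_integrand_def by (simp add: indicator_def)
    qed
  qed
  finally show ?thesis .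
qed

text \<open>For a given common point \<open>p\<close>, integration over the normals gives \<open>J K p\<close>. In the radial
  integral of \<open>h / V\<close> the powers of \<open>V\<close> cancel.\<close>

lemma nn_integral_independent_tuples:
  "(\<integral>\<^sup>+x. indicator independent_tuples x * ennreal (exp (- (h (meet x) / V))) \<partial>L_power)
    = ennreal (fact CARD('n)) * (ennreal (1 / real CARD('n)) * (\<integral>\<^sup>+x. ennreal (J K x / h x ^ CARD('n)) \<partial>sphere_measure))"
proof -
  let ?c = "ennreal (inverse V ^ CARD('n))"
  have fm [measurable]: "(\<lambda>p. ennreal (exp (- (h p / V)))) \<in> borel_measurable borel" by measurable
  interpret SP: finite_measure S_power by (rule finite_S_power)
  interpret P: pair_sigma_finite "lborel :: (real ^ 'n) measure" S_power ..
  have [measurable]: "cball 0 1 \<in> sets (borel :: (real ^ 'n) measure)" by simp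
  have "(\<integral>\<^sup>+x. indicator independent_tuples x * ennreal (exp (- (h (meet x) / V))) \<partial>L_power)
      = ?c * (\<integral>\<^sup>+u. (\<integral>\<^sup>+t. indicator independent_tuples (\<lambda>k. (t $ k, u k)) * ennreal (exp (- (h (meet (\<lambda>k. (t $ k, u k))) / V))) * indicator positive_orthant t \<partial>lborel) \<partial>S_power)"
    by (rule nn_integral_L_power) measurable
  also have "\<dots> = ?c * (\<integral>\<^sup>+u. (\<integral>\<^sup>+p. ennreal (j_integrand p u) * ennreal (exp (- (h p / V))) \<partial>lborel) \<partial>S_power)"
    by (intro arg_cong[where f = "\<lambda>z. ?c * z"] nn_integral_cong nn_integral_distances fm)
  also have "(\<integral>\<^sup>+u. (\<integral>\<^sup>+p. ennreal (j_integrand p u) * ennreal (exp (- (h p / V))) \<partial>lborel) \<partial>S_power)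
      = (\<integral>\<^sup>+p. (\<integral>\<^sup>+u. ennreal (j_integrand p u) * ennreal (exp (- (h p / V))) \<partial>S_power) \<partial>lborel)"
  proof (rule P.Fubini')
    have "(\<lambda>z. ennreal (case z of (p, u) \<Rightarrow> j_integrand p u) * ennreal (exp (- (h (fst z) / V)))) \<in> borel_measurable (borel \<Otimes>\<^sub>M S_power)"
      by measurable
    then show "(\<lambda>(p, u). ennreal (j_integrand p u) * ennreal (exp (- (h p / V)))) \<in> borel_measurable (lborel \<Otimes>\<^sub>M S_power)"
      by (simp add: split_beta)
  qed
  also have "\<dots> = (\<integral>\<^sup>+p. ennreal (J K p * exp (- (h p / V))) \<partial>lborel)"
    using J_nonneg by (simp add: nn_integral_multc nn_integral_j_integrand ennreal_mult)
  also have "\<dots> = ennreal (fact CARD('n)) * (\<integral>\<^sup>+x. indicator (cball 0 1) x * ennreal (J K (sgn x) / (h (sgn x) / V) ^ CARD('n)) \<partial>lborel)"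
    using V_pos by (intro nn_integral_homogeneous_exp)
      (auto simp: J_nonneg J_scale support_nonneg support_scale J_eq_0 divide_nonneg_pos)
  also have "?c * \<dots> = ennreal (fact CARD('n)) * (\<integral>\<^sup>+x. ?c * (indicator (cball 0 1) x * ennreal (J K (sgn x) / (h (sgn x) / V) ^ CARD('n))) \<partial>lborel)"
  proof -
    have [measurable]: "(\<lambda>x. J K (sgn x)) \<in> borel_measurable borel" "(\<lambda>x. h (sgn x)) \<in> borel_measurable borel"
      by (rule measurable_compose[OF sgn_measurable J_measurable], rule measurable_compose[OF sgn_measurable support_measurable])
    have "(\<lambda>x. indicator (cball 0 1) x * ennreal (J K (sgn x) / (h (sgn x) / V) ^ CARD('n))) \<in> borel_measurable borel"
      by measurable
    then have m: "(\<lambda>x. indicator (cball 0 1) x * ennreal (J K (sgn x) / (h (sgn x) / V) ^ CARD('n))) \<in> borel_measurable lborel"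
      by simp
    show ?thesis unfolding nn_integral_cmult[OF m] by (rule mult.left_commute)
  qed
  also have "(\<integral>\<^sup>+x. ?c * (indicator (cball 0 1) x * ennreal (J K (sgn x) / (h (sgn x) / V) ^ CARD('n))) \<partial>lborel) =
      (\<integral>\<^sup>+x. indicator (cball 0 1) x * ennreal (J K (sgn x) / h (sgn x) ^ CARD('n)) \<partial>lborel)"
  proof (intro nn_integral_cong)
    fix x :: "real ^ 'n"
    have "inverse V ^ CARD('n) * (J K (sgn x) / (h (sgn x) / V) ^ CARD('n)) = J K (sgn x) / h (sgn x) ^ CARD('n)"
      using V_pos by (simp add: field_simps power_divide power_inverse)
    then show "?c * (indicator (cball 0 1) x * ennreal (J K (sgn x) / (h (sgn x) / V) ^ CARD('n))) = indicator (cball 0 1) x * ennreal (J K (sgn x) / h (sgn x) ^ CARD('n))"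
      using V_pos by (simp add: ennreal_mult'[symmetric] mult.left_commute[of ?c])
  qed
  finally have 1: "(\<integral>\<^sup>+x. indicator independent_tuples x * ennreal (exp (- (h (meet x) / V))) \<partial>L_power) =
    ennreal (fact CARD('n)) * (\<integral>\<^sup>+x. indicator (cball 0 1) x * ennreal (J K (sgn x) / h (sgn x) ^ CARD('n)) \<partial>lborel)" .
  have 2: "ennreal (1 / real CARD('n)) * (\<integral>\<^sup>+x. ennreal (J K x / h x ^ CARD('n)) \<partial>sphere_measure)
      = (\<integral>\<^sup>+x. indicator (cball 0 1) x * ennreal (J K (sgn x) / h (sgn x) ^ CARD('n)) \<partial>lborel)"
  proof (subst nn_integral_sphere_measure)
    have "ennreal (1 / real CARD('n)) * ennreal (real CARD('n)) = 1"
      by (subst ennreal_mult'[symmetric]) auto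
    then show "ennreal (1 / real CARD('n)) * (ennreal (real CARD('n)) * (\<integral>\<^sup>+x. indicator (cball 0 1) x * ennreal (J K (sgn x) / h (sgn x) ^ CARD('n)) \<partial>lborel))
      = (\<integral>\<^sup>+x. indicator (cball 0 1) x * ennreal (J K (sgn x) / h (sgn x) ^ CARD('n)) \<partial>lborel)"
      by (simp add: mult.assoc[symmetric])
  qed measurable
  show ?thesis unfolding 1 2 ..
qed

text \<open>Either \<open>h\<close> is bounded away from \<open>0\<close> on the sphere or \<open>J K\<close> vanishes identically.\<close>

lemma integrable_sphere_quotient:
  "integrable sphere_measure (\<lambda>x. h x powi (- int CARD('n)) * J K x)"
proof (cases "\<exists>y. y \<noteq> 0 \<and> h y = 0")
  case True
  then have "J K x = 0" for x using J_eq_0 by blast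
  then show ?thesis by simp
next
  case False
  interpret SP: finite_measure S_power by (rule finite_S_power)
  interpret \<sigma>: finite_measure "sphere_measure :: (real ^ 'n) measure"
  proof
    have "emeasure sphere_measure (space (sphere_measure :: (real ^ 'n) measure)) = (\<integral>\<^sup>+x. 1 \<partial>(sphere_measure :: (real ^ 'n) measure))" by simp
    also have "\<dots> = ennreal (real CARD('n)) * emeasure lborel (cball (0 :: real ^ 'n) 1)"
      by (subst nn_integral_sphere_measure) auto
    also have "\<dots> < \<infinity>" using emeasure_bounded_finite[of "cball (0 :: real ^ 'n) 1"] by (simp add: ennreal_mult_less_top)
    finally show "emeasure sphere_measure (space (sphere_measure :: (real ^ 'n) measure)) \<noteq> \<infinity>" by simp
  qed
  have "sphere (0 :: real ^ 'n) 1 \<noteq> {}" by simp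
  then obtain y where y: "norm y = 1" "\<And>x. norm x = 1 \<Longrightarrow> h y \<le> h x"
    using continuous_attains_inf[of "sphere (0 :: real ^ 'n) 1" h] continuous_on_subset[OF support_continuous]
    by auto
  have hy: "0 < h y" using False y(1) support_nonneg[of y] by (metis less_le norm_zero zero_neq_one)
  let ?B = "fact CARD('n) * measure S_power (space S_power)"
  have sets: "sets (sphere_measure :: (real ^ 'n) measure) = sets (restrict_space borel (sphere 0 1))"
    unfolding sphere_measure_eq by (simp add: sets_restrict_space)
  have sp: "space (sphere_measure :: (real ^ 'n) measure) = sphere 0 1"
    using sets_eq_imp_space_eq[OF sets] by (simp add: space_restrict_space)
  show ?thesis
  proof (rule \<sigma>.integrable_const_bound[of _ "?B / h y ^ CARD('n)"])
    show "AE x in sphere_measure. norm (h x powi (- int CARD('n)) * J K x) \<le> ?B / h y ^ CARD('n)"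
    proof (rule AE_I2)
      fix x :: "real ^ 'n" assume "x \<in> space sphere_measure"
      then have "h y \<le> h x" using y sp by simp
      then have "h y ^ CARD('n) \<le> h x ^ CARD('n)" using hy by (intro power_mono) auto
      then have "J K x / h x ^ CARD('n) \<le> ?B / h y ^ CARD('n)"
        using hy J_le[of x] J_nonneg[of x] by (intro frac_le) auto
      then show "norm (h x powi (- int CARD('n)) * J K x) \<le> ?B / h y ^ CARD('n)"
        using J_nonneg[of x] support_nonneg[of x] by (simp add: power_int_minus field_simps)
    qed
    have "(\<lambda>x. h x powi (- int CARD('n)) * J K x) \<in> borel_measurable borel"
      unfolding power_int_minus power_int_of_nat by measurable
    then show "(\<lambda>x. h x powi (- int CARD('n)) * J K x) \<in> borel_measurable sphere_measure"
      unfolding measurable_cong_sets[OF sets refl] by (rule measurable_restrict_space1)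
  qed
qed

lemma nn_integral_sphere_quotient:
  "(\<integral>\<^sup>+x. ennreal (J K x / h x ^ CARD('n)) \<partial>sphere_measure) = ennreal (\<integral>x. h x powi (- int CARD('n)) * J K x \<partial>sphere_measure)"
proof -
  have eq: "J K x / h x ^ CARD('n) = h x powi (- int CARD('n)) * J K x" for x
    by (simp add: power_int_minus field_simps)
  show ?thesis unfolding eq
    using integrable_sphere_quotient J_nonneg support_nonneg by (intro nn_integral_eq_integral AE_I2) auto
qed

end

section \<open>The expected number of vertices\<close>

locale poisson_tessellation = tessellation_body K for K :: "(real ^ 'n) set" +
  fixes M :: "'w measure" and P :: "nat \<Rightarrow> 'w \<Rightarrow> real \<times> (real ^ 'n)"
  assumes process: "poisson_process M (tessellation_intensity K) P"
begin

lemma poisson_points: "poisson_points M \<Lambda> P fst (measure S (space S) / V)"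
proof -
  interpret prob_space M using process by (simp add: poisson_process_def)
  show ?thesis
  proof
    show "0 < fst x" if "x \<in> space \<Lambda>" for x using that by (auto simp: space_Lambda)
  qed (use process emeasure_slice_le V_pos in auto)
qed

sublocale PP: poisson_points M \<Lambda> P fst "measure S (space S) / V"
  by (rule poisson_points)

text \<open>Given \<open>d\<close> hyperplanes with common point \<open>m\<close>, the distance of a further hyperplane through \<open>m\<close>
  is determined by its direction, so that such hyperplanes have intensity \<open>0\<close>.\<close>

lemma AE_general_position:
  "AE \<omega> in M. \<forall>\<iota> :: 'n option \<Rightarrow> nat. inj \<iota> \<longrightarrow> det (normals (\<lambda>k. P (\<iota> (Some k)) \<omega>)) \<noteq> 0 \<longrightarrow>
     meet (\<lambda>k. P (\<iota> (Some k)) \<omega>) \<bullet> snd (P (\<iota> None) \<omega>) \<noteq> fst (P (\<iota> None) \<omega>)"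
proof -
  interpret PL: product_sigma_finite "\<lambda>_::'n option. \<Lambda>"
    using sigma_finite_Lambda by (simp add: product_sigma_finite_def)
  let ?\<Pi> = "\<Pi>\<^sub>M k\<in>(UNIV :: 'n option set). \<Lambda>"
  define m where "m x = meet (\<lambda>k. x (Some k) :: real \<times> (real ^ 'n))" for x :: "'n option \<Rightarrow> real \<times> (real ^ 'n)"
  have some: "(\<lambda>x k. x (Some k)) \<in> ?\<Pi> \<rightarrow>\<^sub>M L_power"
    by (rule measurable_PiM_single') (auto simp: space_PiM PiE_UNIV_domain Pi_iff)
  have mm [measurable]: "m \<in> borel_measurable ?\<Pi>"
    unfolding m_def using measurable_compose[OF some meet_measurable] .
  have none: "(\<lambda>x. x None) \<in> ?\<Pi> \<rightarrow>\<^sub>M \<Lambda>" by (rule measurable_component_singleton) simp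
  have [measurable]: "(\<lambda>x. fst (x None)) \<in> borel_measurable ?\<Pi>" "(\<lambda>x. snd (x None)) \<in> borel_measurable ?\<Pi>"
    using measurable_compose[OF none fst_Lambda] measurable_compose[OF none snd_Lambda] by auto
  define G where "G = {x \<in> space ?\<Pi>. m x \<bullet> snd (x None) = fst (x None)}"
  have Gm: "G \<in> sets ?\<Pi>" unfolding G_def by measurable
  have ins: "insert None (range Some) = (UNIV :: 'n option set)" by (auto simp: UNIV_option_conv)
  have "emeasure ?\<Pi> G = (\<integral>\<^sup>+x. indicator G x \<partial>(\<Pi>\<^sub>M k\<in>insert None (range (Some :: 'n \<Rightarrow> _)). \<Lambda>))"
    using Gm by (simp add: ins)
  also have "\<dots> = (\<integral>\<^sup>+x. (\<integral>\<^sup>+y. indicator G (x(None := y)) \<partial>\<Lambda>) \<partial>(\<Pi>\<^sub>M k\<in>range (Some :: 'n \<Rightarrow> _). \<Lambda>))"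
    by (rule PL.product_nn_integral_insert) (use Gm in \<open>auto simp: ins\<close>)
  also have "\<dots> = (\<integral>\<^sup>+x. 0 \<partial>(\<Pi>\<^sub>M k\<in>range (Some :: 'n \<Rightarrow> _). \<Lambda>))"
  proof (rule nn_integral_cong)
    fix x :: "'n option \<Rightarrow> real \<times> (real ^ 'n)"
    have mx: "m (x(None := y)) = m x" for y by (simp add: m_def)
    have "(\<integral>\<^sup>+y. indicator G (x(None := y)) \<partial>\<Lambda>) \<le> (\<integral>\<^sup>+y. indicator {y \<in> space \<Lambda>. m x \<bullet> snd y = fst y} y \<partial>\<Lambda>)"
      by (intro nn_integral_mono) (auto simp: indicator_def G_def mx)
    also have "\<dots> = 0"
    proof -
      have "{y \<in> space \<Lambda>. m x \<bullet> snd y = fst y} \<in> sets \<Lambda>" by measurable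
      then show ?thesis using emeasure_through_null[of "m x"] by simp
    qed
    finally show "(\<integral>\<^sup>+y. indicator G (x(None := y)) \<partial>\<Lambda>) = 0" by simp
  qed
  finally have "G \<in> null_sets ?\<Pi>" using Gm by (intro null_setsI) simp_all
  from PP.AE_tuples_avoid_null[OF this] AE_space show ?thesis
  proof eventually_elim
    fix \<omega> assume G: "\<forall>\<iota>. inj \<iota> \<longrightarrow> PP.tuple \<iota> \<omega> \<notin> G" and \<omega>: "\<omega> \<in> space M"
    show "\<forall>\<iota> :: 'n option \<Rightarrow> nat. inj \<iota> \<longrightarrow> det (normals (\<lambda>k. P (\<iota> (Some k)) \<omega>)) \<noteq> 0 \<longrightarrow>
       meet (\<lambda>k. P (\<iota> (Some k)) \<omega>) \<bullet> snd (P (\<iota> None) \<omega>) \<noteq> fst (P (\<iota> None) \<omega>)"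
    proof (intro allI impI)
      fix \<iota> :: "'n option \<Rightarrow> nat" assume "inj \<iota>"
      then have "PP.tuple \<iota> \<omega> \<notin> G" using G by blast
      moreover have "PP.tuple \<iota> \<omega> \<in> space ?\<Pi>"
        using PP.X_space[OF \<omega>] by (simp add: PP.tuple_def space_PiM PiE_UNIV_domain Pi_iff)
      ultimately show "meet (\<lambda>k. P (\<iota> (Some k)) \<omega>) \<bullet> snd (P (\<iota> None) \<omega>) \<noteq> fst (P (\<iota> None) \<omega>)"
        by (simp add: G_def m_def PP.tuple_def)
    qed
  qed
qed

lemma AE_simple_hyperplane_system: "AE \<omega> in M. simple_hyperplane_system (\<lambda>i. P i \<omega>)"
proof -
  let ?A = "\<lambda>n::nat. {y \<in> space \<Lambda>. 0 < fst y \<and> fst y \<le> real n}"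
  have "AE \<omega> in M. \<exists>k::nat. PP.N (?A n) \<omega> = of_nat k" for n
    by (rule PP.AE_N_nat) (use PP.tau_slice_finite[of 0 "real n"] in \<open>auto\<close>)
  then have fin: "AE \<omega> in M. \<forall>n. \<exists>k::nat. PP.N (?A n) \<omega> = of_nat k"
    by (simp add: AE_all_countable)
  from fin AE_general_position AE_space show ?thesis
  proof eventually_elim
    fix \<omega>
    assume fin: "\<forall>n. \<exists>k::nat. PP.N (?A n) \<omega> = of_nat k"
      and gp: "\<forall>\<iota> :: 'n option \<Rightarrow> nat. inj \<iota> \<longrightarrow> det (normals (\<lambda>k. P (\<iota> (Some k)) \<omega>)) \<noteq> 0 \<longrightarrow>
       meet (\<lambda>k. P (\<iota> (Some k)) \<omega>) \<bullet> snd (P (\<iota> None) \<omega>) \<noteq> fst (P (\<iota> None) \<omega>)"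
      and \<omega>: "\<omega> \<in> space M"
    have sp: "P i \<omega> \<in> space \<Lambda>" for i using PP.X_space[OF \<omega>] .
    show "simple_hyperplane_system (\<lambda>i. P i \<omega>)"
    proof
      fix R :: real
      obtain n :: nat where n: "R \<le> real n" using real_arch_simple by blast
      obtain k :: nat where k: "emeasure (count_space UNIV) {i. P i \<omega> \<in> ?A n} = of_nat k"
        using fin by (auto simp: point_count_def)
      have "finite {i. P i \<omega> \<in> ?A n}"
      proof (rule ccontr)
        assume "infinite {i. P i \<omega> \<in> ?A n}"
        then have "emeasure (count_space UNIV) {i. P i \<omega> \<in> ?A n} = \<infinity>"
          by (intro emeasure_count_space_infinite) simp_all
        then show False unfolding k using of_nat_less_top[of k] by simp
      qed
      moreover have "{i. fst (P i \<omega>) \<le> R} \<subseteq> {i. P i \<omega> \<in> ?A n}"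
      proof
        fix i assume "i \<in> {i. fst (P i \<omega>) \<le> R}"
        then show "i \<in> {i. P i \<omega> \<in> ?A n}" using sp[of i] PP.tau_pos[OF sp[of i]] n by simp
      qed
      ultimately show "finite {i. fst (P i \<omega>) \<le> R}" by (rule finite_subset[rotated])
    next
      fix i show "norm (snd (P i \<omega>)) = 1" using sp[of i] by (auto simp: space_Lambda)
    next
      fix \<iota> :: "'n option \<Rightarrow> nat" assume "inj \<iota>" "det (normals (\<lambda>k. P (\<iota> (Some k)) \<omega>)) \<noteq> 0"
      then show "meet (\<lambda>k. P (\<iota> (Some k)) \<omega>) \<bullet> snd (P (\<iota> None) \<omega>) \<noteq> fst (P (\<iota> None) \<omega>)"
        using gp by blast
    qed
  qed
qed

abbreviation separating :: "real ^ 'n \<Rightarrow> (real \<times> (real ^ 'n)) set" where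
  "separating q \<equiv> {y \<in> space \<Lambda>. 0 < q \<bullet> snd y - fst y}"

text \<open>Whether the hyperplanes with indices \<open>\<iota>\<close> have a single common point, which no hyperplane
  of the process separates from the origin.\<close>

definition vertex_indicator :: "('n \<Rightarrow> nat) \<Rightarrow> 'w \<Rightarrow> ennreal" where
  "vertex_indicator \<iota> \<omega> = indicator independent_tuples (PP.tuple \<iota> \<omega>) *
     (if PP.N (separating (meet (PP.tuple \<iota> \<omega>))) \<omega> = 0 then 1 else 0)"

lemma vertex_indicator_measurable [measurable]: "vertex_indicator \<iota> \<in> borel_measurable M"
proof -
  have [measurable]: "(\<lambda>\<omega>. meet (PP.tuple \<iota> \<omega>)) \<in> borel_measurable M"
    by (rule measurable_compose[OF PP.tuple_measurable meet_measurable])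
  have [measurable]: "(\<lambda>\<omega>. fst (P j \<omega>)) \<in> borel_measurable M" "(\<lambda>\<omega>. snd (P j \<omega>)) \<in> borel_measurable M" for j
    by (rule measurable_compose[OF PP.X_measurable fst_Lambda], rule measurable_compose[OF PP.X_measurable snd_Lambda])
  have [measurable]: "(\<lambda>\<omega>. indicator independent_tuples (PP.tuple \<iota> \<omega>) :: ennreal) \<in> borel_measurable M"
    by (rule measurable_compose[OF PP.tuple_measurable borel_measurable_indicator[OF independent_tuples_sets]])
  have "(\<lambda>\<omega>. indicator independent_tuples (PP.tuple \<iota> \<omega>) *
      (if \<forall>j. \<not> 0 < meet (PP.tuple \<iota> \<omega>) \<bullet> snd (P j \<omega>) - fst (P j \<omega>) then 1 else (0 :: ennreal))) \<in> borel_measurable M"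
    by measurable
  then show ?thesis
    by (rule measurable_cong[THEN iffD1, rotated]) (simp add: vertex_indicator_def PP.N_eq_0_iff PP.X_space)
qed

lemma AE_vertex_count:
  "AE \<omega> in M. (\<integral>\<^sup>+\<iota>. vertex_indicator \<iota> \<omega> \<partial>count_space PP.inj_tuples) =
     of_nat (fact CARD('n)) * num_vertices (zero_cell (\<lambda>i. P i \<omega>))"
  using AE_simple_hyperplane_system AE_space
proof eventually_elim
  fix \<omega> assume "simple_hyperplane_system (\<lambda>i. P i \<omega>)" and \<omega>: "\<omega> \<in> space M"
  then interpret H: simple_hyperplane_system "\<lambda>i. P i \<omega>" by simp
  have sub: "H.vertex_tuples \<subseteq> PP.inj_tuples" by (auto simp: H.vertex_tuples_def)
  have tup: "PP.tuple \<iota> \<omega> \<in> space L_power" for \<iota> :: "'n \<Rightarrow> nat"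
    using PP.X_space[OF \<omega>] by (simp add: PP.tuple_def space_PiM PiE_UNIV_domain Pi_iff)
  have "(\<integral>\<^sup>+\<iota>. vertex_indicator \<iota> \<omega> \<partial>count_space PP.inj_tuples) = (\<integral>\<^sup>+\<iota>. indicator H.vertex_tuples \<iota> \<partial>count_space PP.inj_tuples)"
  proof (rule nn_integral_cong)
    fix \<iota> :: "'n \<Rightarrow> nat" assume "\<iota> \<in> space (count_space PP.inj_tuples)"
    then have "\<iota> \<in> H.vertex_tuples \<longleftrightarrow> PP.tuple \<iota> \<omega> \<in> independent_tuples \<and> PP.N (separating (meet (PP.tuple \<iota> \<omega>))) \<omega> = 0"
      using tup[of \<iota>] PP.X_space[OF \<omega>]
      by (simp add: H.vertex_tuples_def independent_tuples_def PP.N_eq_0_iff PP.tuple_def not_less)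
    then show "vertex_indicator \<iota> \<omega> = indicator H.vertex_tuples \<iota>"
      by (simp add: vertex_indicator_def indicator_def)
  qed
  also have "\<dots> = emeasure (count_space PP.inj_tuples) H.vertex_tuples"
    using sub by (intro nn_integral_indicator) simp
  also have "\<dots> = emeasure (count_space UNIV) H.vertex_tuples"
    using sub by (cases "finite H.vertex_tuples") (simp_all add: emeasure_count_space)
  also have "\<dots> = of_nat (fact CARD('n)) * num_vertices (zero_cell (\<lambda>i. P i \<omega>))"
    by (rule H.card_vertex_tuples)
  finally show "(\<integral>\<^sup>+\<iota>. vertex_indicator \<iota> \<omega> \<partial>count_space PP.inj_tuples) =
     of_nat (fact CARD('n)) * num_vertices (zero_cell (\<lambda>i. P i \<omega>))" .
qed

lemma expected_vertex_count:
  "(\<integral>\<^sup>+\<omega>. (\<integral>\<^sup>+\<iota>. vertex_indicator \<iota> \<omega> \<partial>count_space PP.inj_tuples) \<partial>M) =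
    (\<integral>\<^sup>+x. indicator independent_tuples x * ennreal (exp (- (h (meet x) / V))) \<partial>L_power)"
  unfolding vertex_indicator_def
proof (rule PP.mecke_avoiding)
  show "meet \<in> borel_measurable L_power" by measurable
  show "(\<lambda>(y, q). q \<bullet> snd y - fst y) \<in> borel_measurable (\<Lambda> \<Otimes>\<^sub>M (borel :: (real ^ 'n) measure))"
    by measurable
  show "\<bar>(q \<bullet> snd y - fst y) - (q' \<bullet> snd y - fst y)\<bar> \<le> norm (q - q')" if "y \<in> space \<Lambda>" for y q q'
    using that abs_inner_unit_le[of "snd y" "q - q'"] by (auto simp: space_Lambda inner_diff_left)
  show "emeasure \<Lambda> (separating q) < \<infinity>" for q unfolding emeasure_separating by simp
  show "meet x \<bullet> snd (x k) - fst (x k) \<le> 0" if "x \<in> independent_tuples" for x k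
    using that meet_inner[of x k] by (simp add: independent_tuples_def)
  show "(\<lambda>x. ennreal (exp (- (h (meet x) / V)))) \<in> borel_measurable L_power" by measurable
  show "ennreal (exp (- (h (meet x) / V))) = ennreal (exp (- measure \<Lambda> (separating (meet x))))" for x
  proof -
    have "0 \<le> h (meet x) / V" using V_pos support_nonneg[of "meet x"] by simp
    then have "measure \<Lambda> (separating (meet x)) = h (meet x) / V"
      unfolding measure_def[of \<Lambda>] emeasure_separating by (rule enn2real_ennreal)
    then show ?thesis by simp
  qed
  show "(\<lambda>\<omega>. indicator independent_tuples (PP.tuple \<iota> \<omega>) * (if PP.N (separating (meet (PP.tuple \<iota> \<omega>))) \<omega> = 0 then 1 else (0 :: ennreal))) \<in> borel_measurable M" for \<iota>
    using vertex_indicator_measurable[of \<iota>] unfolding vertex_indicator_def[abs_def] .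
qed measurable

theorem expected_num_vertices:
  "(\<integral>\<^sup>+\<omega>. num_vertices (zero_cell (\<lambda>i. P i \<omega>)) \<partial>M) =
    ennreal (1 / real CARD('n) * (\<integral>x. h x powi (- int CARD('n)) * J K x \<partial>sphere_measure))"
proof -
  let ?f = "ennreal (fact CARD('n))" and ?g = "ennreal (1 / fact CARD('n))"
  let ?W = "\<lambda>\<omega>. \<integral>\<^sup>+\<iota>. vertex_indicator \<iota> \<omega> \<partial>count_space PP.inj_tuples"
  have gf: "?g * (?f * z) = z" for z
    by (simp add: mult.assoc[symmetric] ennreal_mult'[symmetric])
  have "(\<integral>\<^sup>+\<omega>. num_vertices (zero_cell (\<lambda>i. P i \<omega>)) \<partial>M) = (\<integral>\<^sup>+\<omega>. ?g * ?W \<omega> \<partial>M)"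
  proof (rule nn_integral_cong_AE)
    show "AE \<omega> in M. num_vertices (zero_cell (\<lambda>i. P i \<omega>)) = ?g * ?W \<omega>"
      using AE_vertex_count
    proof eventually_elim
      fix \<omega> assume "?W \<omega> = of_nat (fact CARD('n)) * num_vertices (zero_cell (\<lambda>i. P i \<omega>))"
      then have "?W \<omega> = ?f * num_vertices (zero_cell (\<lambda>i. P i \<omega>))"
        by (simp add: ennreal_of_nat_eq_real_of_nat)
      then show "num_vertices (zero_cell (\<lambda>i. P i \<omega>)) = ?g * ?W \<omega>" by (simp only: gf)
    qed
  qed
  also have "\<dots> = ?g * (\<integral>\<^sup>+\<omega>. ?W \<omega> \<partial>M)"
    by (intro nn_integral_cmult borel_measurable_sum_countable) auto
  also have "\<dots> = ennreal (1 / real CARD('n)) * ennreal (\<integral>x. h x powi (- int CARD('n)) * J K x \<partial>sphere_measure)"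
    unfolding expected_vertex_count nn_integral_independent_tuples gf nn_integral_sphere_quotient ..
  also have "\<dots> = ennreal (1 / real CARD('n) * (\<integral>x. h x powi (- int CARD('n)) * J K x \<partial>sphere_measure))"
    by (rule ennreal_mult'[symmetric]) simp
  finally show ?thesis .
qed

end

theorem theorem7p3:
  fixes K :: "(real ^ 'n) set"
    and M :: "'w measure"
    and P :: "nat \<Rightarrow> 'w \<Rightarrow> real \<times> (real ^ 'n)"
  assumes "compact K" and "convex K" and "0 \<in> interior K"
    and "poisson_process M (tessellation_intensity K) P"
  shows "(\<integral>\<^sup>+\<omega>. num_vertices (zero_cell (\<lambda>i. P i \<omega>)) \<partial>M) =
    ennreal (1 / real CARD('n) *
      (\<integral>x. proj_body_support K x powi (- int CARD('n)) * J K x \<partial>sphere_measure))"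
proof -
  have "K \<noteq> {}" using assms(3) by auto
  then interpret poisson_tessellation K M P
    by unfold_locales (use assms in auto)
  show ?thesis by (rule expected_num_vertices)
qed

end
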